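(* Let $A$ be a left Noetherian $R$-algebra which is $\pi$-adically separated and $\pi$-torsion free, and let $B$ be an $R$-subalgebra of $A_L=A\otimes_RL$ which contains $A$. Suppose $B$ is equipped with an exhaustive $R$-algebra filtration $(F_\cdot)$ satisfying $F_0B=A$ and such that $\operatorname{gr}^FB$ is a $q$-commutative $A$-algebra. Then $\widehat{A_L}$ and $\widehat{B_L}$ are left Noetherian and $\widehat{B_L}$ is right flat over $\widehat{A_L}$.
   Context: $L$ is a complete discrete valuation field of characteristic $0$ with valuation ring $R$ and uniformizer $\pi$. $d\ge1$ is a fixed integer and $q\in R^\times$ is not a root of unity, with a fixed $d$-th root $q^{1/d}\in R$, $q^{1/d}\equiv1\pmod\pi$. Filtrations are positive (indexed by integers $\ge0$). $\pi$-adically separated means $\bigcap_n\pi^nA=0$. For an $R$-module $M$, $\widehat M=\varprojlim_aM/\pi^aM$, and $\widehat{M_L}=\widehat M\otimes_RL$. Elements $x_1,\dots,x_m$ of an $R$-algebra $q$-commute if for all $i,j$ one has $x_ix_j=q^{n_{ij}}x_jx_i$ for some $n_{ij}\in\frac1d\mathbb Z$. If $S$ is an $R$-subalgebra of an $R$-algebra $C$, then $C$ is a $q$-commutative $S$-algebra if $C$ is finitely generated over $S$ (as an algebra) by elements $x_1,\dots,x_m$ which normalise $S$ (i.e. $x_iS=Sx_i$) and which $q$-commute. *)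

theory Defs
  imports "HOL-Algebra.Algebra"
begin

section \<open>Complete discretely valued fields\<close>

text \<open>The valuation is normalised, with values in the integers; its value at zero (morally infinity)
  is irrelevant, and \<open>val_ball L v k\<close> is the set of elements of valuation at least \<open>k\<close>.\<close>

definition val_ball :: "('l, 'x) ring_scheme \<Rightarrow> ('l \<Rightarrow> int) \<Rightarrow> int \<Rightarrow> 'l set" where
  "val_ball L v k = {x \<in> carrier L. x = \<zero>\<^bsub>L\<^esub> \<or> k \<le> v x}"

definition val_ring :: "'l ring \<Rightarrow> ('l \<Rightarrow> int) \<Rightarrow> 'l ring" where
  "val_ring L v = L\<lparr>carrier := val_ball L v 0\<rparr>"

definition uniformizer :: "'l ring \<Rightarrow> ('l \<Rightarrow> int) \<Rightarrow> 'l \<Rightarrow> bool" where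
  "uniformizer L v p \<longleftrightarrow> p \<in> carrier L - {\<zero>\<^bsub>L\<^esub>} \<and> v p = 1"

locale complete_discrete_valuation_field = field L for L (structure) +
  fixes v :: "'a \<Rightarrow> int"
  assumes char_0: "\<And>n::nat. n > 0 \<Longrightarrow> [n] \<cdot> \<one> \<noteq> \<zero>"
    and v_mult: "\<lbrakk>x \<in> carrier L - {\<zero>}; y \<in> carrier L - {\<zero>}\<rbrakk> \<Longrightarrow> v (x \<otimes> y) = v x + v y"
    and v_add: "\<lbrakk>x \<in> carrier L - {\<zero>}; y \<in> carrier L - {\<zero>}; x \<oplus> y \<noteq> \<zero>\<rbrakk>
                  \<Longrightarrow> min (v x) (v y) \<le> v (x \<oplus> y)"
    and v_surj: "v ` (carrier L - {\<zero>}) = UNIV"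
    and complete: "\<And>s :: nat \<Rightarrow> 'a.
      \<lbrakk>range s \<subseteq> carrier L; \<And>k. \<exists>N. \<forall>m\<ge>N. \<forall>n\<ge>N. s m \<ominus> s n \<in> val_ball L v k\<rbrakk>
      \<Longrightarrow> \<exists>l\<in>carrier L. \<forall>k. \<exists>N. \<forall>n\<ge>N. s n \<ominus> l \<in> val_ball L v k"


section \<open>Modules and algebras over possibly noncommutative rings\<close>

text \<open>The library's locales \<^locale>\<open>module\<close> and \<^locale>\<open>algebra\<close> presuppose commutativity; only
  the record type \<^typ>\<open>('a, 'b) module\<close> is reused here. For a right module,
  \<open>r \<odot>\<^bsub>M\<^esub> x\<close> stands for the right action \<open>x \<cdot> r\<close>.\<close>

locale left_module = R?: ring R + M?: abelian_group M
  for R :: "('r, 'x) ring_scheme" (structure) and M :: "('r, 'm, 'y) module_scheme" (structure) +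
  assumes lsmult_closed: "\<lbrakk>r \<in> carrier R; x \<in> carrier M\<rbrakk> \<Longrightarrow> r \<odot>\<^bsub>M\<^esub> x \<in> carrier M"
    and lsmult_l_distr: "\<lbrakk>r \<in> carrier R; s \<in> carrier R; x \<in> carrier M\<rbrakk>
          \<Longrightarrow> (r \<oplus>\<^bsub>R\<^esub> s) \<odot>\<^bsub>M\<^esub> x = r \<odot>\<^bsub>M\<^esub> x \<oplus>\<^bsub>M\<^esub> s \<odot>\<^bsub>M\<^esub> x"
    and lsmult_r_distr: "\<lbrakk>r \<in> carrier R; x \<in> carrier M; y \<in> carrier M\<rbrakk>
          \<Longrightarrow> r \<odot>\<^bsub>M\<^esub> (x \<oplus>\<^bsub>M\<^esub> y) = r \<odot>\<^bsub>M\<^esub> x \<oplus>\<^bsub>M\<^esub> r \<odot>\<^bsub>M\<^esub> y"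
    and lsmult_assoc: "\<lbrakk>r \<in> carrier R; s \<in> carrier R; x \<in> carrier M\<rbrakk>
          \<Longrightarrow> (r \<otimes>\<^bsub>R\<^esub> s) \<odot>\<^bsub>M\<^esub> x = r \<odot>\<^bsub>M\<^esub> (s \<odot>\<^bsub>M\<^esub> x)"
    and lsmult_one: "x \<in> carrier M \<Longrightarrow> \<one>\<^bsub>R\<^esub> \<odot>\<^bsub>M\<^esub> x = x"

locale right_module = R?: ring R + M?: abelian_group M
  for R :: "('r, 'x) ring_scheme" (structure) and M :: "('r, 'm, 'y) module_scheme" (structure) +
  assumes rsmult_closed: "\<lbrakk>r \<in> carrier R; x \<in> carrier M\<rbrakk> \<Longrightarrow> r \<odot>\<^bsub>M\<^esub> x \<in> carrier M"
    and rsmult_l_distr: "\<lbrakk>r \<in> carrier R; s \<in> carrier R; x \<in> carrier M\<rbrakk>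
          \<Longrightarrow> (r \<oplus>\<^bsub>R\<^esub> s) \<odot>\<^bsub>M\<^esub> x = r \<odot>\<^bsub>M\<^esub> x \<oplus>\<^bsub>M\<^esub> s \<odot>\<^bsub>M\<^esub> x"
    and rsmult_r_distr: "\<lbrakk>r \<in> carrier R; x \<in> carrier M; y \<in> carrier M\<rbrakk>
          \<Longrightarrow> r \<odot>\<^bsub>M\<^esub> (x \<oplus>\<^bsub>M\<^esub> y) = r \<odot>\<^bsub>M\<^esub> x \<oplus>\<^bsub>M\<^esub> r \<odot>\<^bsub>M\<^esub> y"
    and rsmult_assoc: "\<lbrakk>r \<in> carrier R; s \<in> carrier R; x \<in> carrier M\<rbrakk>
          \<Longrightarrow> (r \<otimes>\<^bsub>R\<^esub> s) \<odot>\<^bsub>M\<^esub> x = s \<odot>\<^bsub>M\<^esub> (r \<odot>\<^bsub>M\<^esub> x)"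
    and rsmult_one: "x \<in> carrier M \<Longrightarrow> \<one>\<^bsub>R\<^esub> \<odot>\<^bsub>M\<^esub> x = x"

definition left_module_hom ::
  "('r, 'x) ring_scheme \<Rightarrow> ('r, 'm) module \<Rightarrow> ('r, 'n) module \<Rightarrow> ('m \<Rightarrow> 'n) set" where
  "left_module_hom R M N = {f \<in> carrier M \<rightarrow> carrier N.
     (\<forall>x\<in>carrier M. \<forall>y\<in>carrier M. f (x \<oplus>\<^bsub>M\<^esub> y) = f x \<oplus>\<^bsub>N\<^esub> f y) \<and>
     (\<forall>r\<in>carrier R. \<forall>x\<in>carrier M. f (r \<odot>\<^bsub>M\<^esub> x) = r \<odot>\<^bsub>N\<^esub> f x)}"

locale assoc_algebra = R?: cring R + A?: ring A + left_module R A
  for R :: "('r, 'x) ring_scheme" (structure) and A :: "('r, 'a, 'y) module_scheme" (structure) +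
  assumes smult_mult_l: "\<lbrakk>r \<in> carrier R; x \<in> carrier A; y \<in> carrier A\<rbrakk>
          \<Longrightarrow> r \<odot>\<^bsub>A\<^esub> (x \<otimes>\<^bsub>A\<^esub> y) = (r \<odot>\<^bsub>A\<^esub> x) \<otimes>\<^bsub>A\<^esub> y"
    and smult_mult_r: "\<lbrakk>r \<in> carrier R; x \<in> carrier A; y \<in> carrier A\<rbrakk>
          \<Longrightarrow> r \<odot>\<^bsub>A\<^esub> (x \<otimes>\<^bsub>A\<^esub> y) = x \<otimes>\<^bsub>A\<^esub> (r \<odot>\<^bsub>A\<^esub> y)"

definition R_subalgebra :: "('r, 'x) ring_scheme \<Rightarrow> ('r, 'a) module \<Rightarrow> 'a set \<Rightarrow> bool" where
  "R_subalgebra R A S \<longleftrightarrow> subring S A \<and> (\<forall>r\<in>carrier R. \<forall>x\<in>S. r \<odot>\<^bsub>A\<^esub> x \<in> S)"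

definition R_submodule :: "('r, 'x) ring_scheme \<Rightarrow> ('r, 'm) module \<Rightarrow> 'm set \<Rightarrow> bool" where
  "R_submodule R M N \<longleftrightarrow> additive_subgroup N M \<and> (\<forall>r\<in>carrier R. \<forall>x\<in>N. r \<odot>\<^bsub>M\<^esub> x \<in> N)"

definition left_ideal :: "'a set \<Rightarrow> ('a, 'x) ring_scheme \<Rightarrow> bool" where
  "left_ideal I A \<longleftrightarrow> additive_subgroup I A \<and> (\<forall>a\<in>carrier A. \<forall>x\<in>I. a \<otimes>\<^bsub>A\<^esub> x \<in> I)"

definition gen_left_ideal :: "('a, 'x) ring_scheme \<Rightarrow> 'a set \<Rightarrow> 'a set" where
  "gen_left_ideal A U = \<Inter> {J. left_ideal J A \<and> U \<subseteq> J}"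

locale left_noetherian_ring = ring +
  assumes left_ideal_fin_gen:
    "left_ideal I R \<Longrightarrow> \<exists>U \<subseteq> carrier R. finite U \<and> I = gen_left_ideal R U"


section \<open>Tensor products and flatness\<close>

text \<open>For a right \<open>S\<close>-module \<open>M\<close> and a left \<open>S\<close>-module \<open>N\<close>, the elements of
  \<open>M \<otimes>\<^bsub>S\<^esub> N\<close> are the cosets of \<open>tensor_ker S M N\<close> in the free abelian group on
  \<open>carrier M \<times> carrier N\<close>. A module over a commutative ring can be used on either side.\<close>

definition tensor_rels ::
  "('s, 'x) ring_scheme \<Rightarrow> ('s, 'm) module \<Rightarrow> ('s, 'n) module \<Rightarrow> ('m \<times> 'n \<Rightarrow>\<^sub>0 int) set" where
  "tensor_rels S M N =
     {frag_of (x \<oplus>\<^bsub>M\<^esub> x', y) - frag_of (x, y) - frag_of (x', y) |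
        x x' y. x \<in> carrier M \<and> x' \<in> carrier M \<and> y \<in> carrier N} \<union>
     {frag_of (x, y \<oplus>\<^bsub>N\<^esub> y') - frag_of (x, y) - frag_of (x, y') |
        x y y'. x \<in> carrier M \<and> y \<in> carrier N \<and> y' \<in> carrier N} \<union>
     {frag_of (s \<odot>\<^bsub>M\<^esub> x, y) - frag_of (x, s \<odot>\<^bsub>N\<^esub> y) |
        s x y. s \<in> carrier S \<and> x \<in> carrier M \<and> y \<in> carrier N}"

definition tensor_ker ::
  "('s, 'x) ring_scheme \<Rightarrow> ('s, 'm) module \<Rightarrow> ('s, 'n) module \<Rightarrow> ('m \<times> 'n \<Rightarrow>\<^sub>0 int) set" where
  "tensor_ker S M N = generate (free_Abelian_group (carrier M \<times> carrier N)) (tensor_rels S M N)"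

definition tensor_class ::
  "('s, 'x) ring_scheme \<Rightarrow> ('s, 'm) module \<Rightarrow> ('s, 'n) module
    \<Rightarrow> ('m \<times> 'n \<Rightarrow>\<^sub>0 int) \<Rightarrow> ('m \<times> 'n \<Rightarrow>\<^sub>0 int) set" where
  "tensor_class S M N z = tensor_ker S M N #>\<^bsub>free_Abelian_group (carrier M \<times> carrier N)\<^esub> z"

definition pure_tensor ::
  "('s, 'x) ring_scheme \<Rightarrow> ('s, 'm) module \<Rightarrow> ('s, 'n) module
    \<Rightarrow> 'm \<Rightarrow> 'n \<Rightarrow> ('m \<times> 'n \<Rightarrow>\<^sub>0 int) set" where
  "pure_tensor S M N x y = tensor_class S M N (frag_of (x, y))"

definition tensor_group ::
  "('s, 'x) ring_scheme \<Rightarrow> ('s, 'm) module \<Rightarrow> ('s, 'n) module \<Rightarrow> ('m \<times> 'n \<Rightarrow>\<^sub>0 int) set monoid" where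
  "tensor_group S M N = free_Abelian_group (carrier M \<times> carrier N) Mod tensor_ker S M N"

text \<open>The map \<open>f \<otimes> g : M \<otimes>\<^bsub>S\<^esub> N \<rightarrow> M' \<otimes>\<^bsub>S'\<^esub> N'\<close>, given on
  representatives; here \<open>f\<close>, \<open>g\<close> are additive and compatible with the scalar actions. The image of
  a class is the union of the (equal) target classes of its representatives, in the style of
  \<^const>\<open>rcoset_mult\<close>.\<close>

definition tensor_map ::
  "('t, 'x) ring_scheme \<Rightarrow> ('t, 'm2) module \<Rightarrow> ('t, 'n2) module \<Rightarrow> ('m1 \<Rightarrow> 'm2) \<Rightarrow> ('n1 \<Rightarrow> 'n2)
    \<Rightarrow> ('m1 \<times> 'n1 \<Rightarrow>\<^sub>0 int) set \<Rightarrow> ('m2 \<times> 'n2 \<Rightarrow>\<^sub>0 int) set" where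
  "tensor_map S' M' N' f g U =
     (\<Union>z\<in>U. tensor_class S' M' N' (frag_extend (\<lambda>(x, y). frag_of (f x, g y)) z))"

text \<open>A right \<open>S\<close>-module \<open>M\<close> is flat if \<open>M \<otimes>\<^bsub>S\<^esub> -\<close> preserves injectivity of homomorphisms of
  left \<open>S\<close>-modules. A definition cannot quantify over types, so the type in which the test modules
  live is a parameter, left arbitrary in statements. One type suffices for both
  modules since an injective homomorphism identifies its source with a submodule of its target.\<close>

definition flat_right_module ::
  "'n itself \<Rightarrow> ('s, 'x) ring_scheme \<Rightarrow> ('s, 'm) module \<Rightarrow> bool" where
  "flat_right_module _ S M \<longleftrightarrow> right_module S M \<and>
     (\<forall>(N' :: ('s, 'n) module) (N :: ('s, 'n) module) g.
        left_module S N' \<longrightarrow> left_module S N \<longrightarrow> g \<in> left_module_hom S N' N \<longrightarrow>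
        inj_on g (carrier N') \<longrightarrow>
        inj_on (tensor_map S M N (\<lambda>x. x) g) (carrier (tensor_group S M N')))"

text \<open>The ring \<open>T\<close> as a right module over the source of a ring homomorphism \<open>h\<close> into \<open>T\<close>.\<close>

definition right_module_via :: "('s \<Rightarrow> 't) \<Rightarrow> ('t, 'x) ring_scheme \<Rightarrow> ('s, 't) module" where
  "right_module_via h T =
     \<lparr>carrier = carrier T, monoid.mult = monoid.mult T, one = one T,
      ring.zero = \<zero>\<^bsub>T\<^esub>, add = add T, smult = (\<lambda>s x. x \<otimes>\<^bsub>T\<^esub> h s)\<rparr>"

text \<open>The tensor product of two algebras over a commutative ring, with
  \<open>(a \<otimes> c)(a' \<otimes> c') = aa' \<otimes> cc'\<close> extended biadditively.\<close>

definition tensor_frag_mult ::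
  "('a, 'x) ring_scheme \<Rightarrow> ('c, 'y) ring_scheme
    \<Rightarrow> ('a \<times> 'c \<Rightarrow>\<^sub>0 int) \<Rightarrow> ('a \<times> 'c \<Rightarrow>\<^sub>0 int) \<Rightarrow> ('a \<times> 'c \<Rightarrow>\<^sub>0 int)" where
  "tensor_frag_mult A C z w =
     frag_extend (\<lambda>(a, c). frag_extend (\<lambda>(a', c'). frag_of (a \<otimes>\<^bsub>A\<^esub> a', c \<otimes>\<^bsub>C\<^esub> c')) w) z"

definition tensor_algebra ::
  "('r, 'x) ring_scheme \<Rightarrow> ('r, 'a) module \<Rightarrow> ('r, 'c) module
    \<Rightarrow> ('r, ('a \<times> 'c \<Rightarrow>\<^sub>0 int) set) module" where
  "tensor_algebra R A C =
     \<lparr>carrier = carrier (tensor_group R A C),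
      monoid.mult = (\<lambda>U V. \<Union>z\<in>U. \<Union>w\<in>V. tensor_class R A C (tensor_frag_mult A C z w)),
      one = pure_tensor R A C \<one>\<^bsub>A\<^esub> \<one>\<^bsub>C\<^esub>,
      ring.zero = \<one>\<^bsub>tensor_group R A C\<^esub>,
      add = monoid.mult (tensor_group R A C),
      smult = (\<lambda>r. tensor_map R A C (\<lambda>a. r \<odot>\<^bsub>A\<^esub> a) (\<lambda>c. c))\<rparr>"

definition self_module :: "('l, 'x) ring_scheme \<Rightarrow> ('l, 'l) module" where
  "self_module L =
     \<lparr>carrier = carrier L, monoid.mult = monoid.mult L, one = one L,
      ring.zero = \<zero>\<^bsub>L\<^esub>, add = add L, smult = monoid.mult L\<rparr>"

text \<open>\<open>A\<^sub>L = A \<otimes>\<^bsub>R\<^esub> L\<close> for a subring \<open>R\<close> of \<open>L\<close>, the structural map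
  \<open>A \<rightarrow> A\<^sub>L\<close>, and the map \<open>A\<^sub>L \<rightarrow> C\<^sub>L\<close> induced by an algebra map \<open>f : A \<rightarrow> C\<close>.\<close>

definition base_change ::
  "('l, 'x) ring_scheme \<Rightarrow> ('l, 'y) ring_scheme \<Rightarrow> ('l, 'a) module
    \<Rightarrow> ('l, ('a \<times> 'l \<Rightarrow>\<^sub>0 int) set) module" where
  "base_change R L A = tensor_algebra R A (self_module L)"

definition to_base_change ::
  "('l, 'x) ring_scheme \<Rightarrow> ('l, 'y) ring_scheme \<Rightarrow> ('l, 'a) module
    \<Rightarrow> 'a \<Rightarrow> ('a \<times> 'l \<Rightarrow>\<^sub>0 int) set" where
  "to_base_change R L A a = pure_tensor R A (self_module L) a \<one>\<^bsub>L\<^esub>"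

definition base_change_map ::
  "('l, 'x) ring_scheme \<Rightarrow> ('l, 'y) ring_scheme \<Rightarrow> ('l, 'c) module \<Rightarrow> ('a \<Rightarrow> 'c)
    \<Rightarrow> ('a \<times> 'l \<Rightarrow>\<^sub>0 int) set \<Rightarrow> ('c \<times> 'l \<Rightarrow>\<^sub>0 int) set" where
  "base_change_map R L C f = tensor_map R C (self_module L) f (\<lambda>l. l)"


section \<open>Adic completion\<close>

definition pow_sub :: "('r, 'x) ring_scheme \<Rightarrow> 'r \<Rightarrow> ('r, 'a) module \<Rightarrow> nat \<Rightarrow> 'a set" where
  "pow_sub R p A n = (\<lambda>x. (p [^]\<^bsub>R\<^esub> n) \<odot>\<^bsub>A\<^esub> x) ` carrier A"

definition adically_separated :: "('r, 'x) ring_scheme \<Rightarrow> 'r \<Rightarrow> ('r, 'a) module \<Rightarrow> bool" where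
  "adically_separated R p A \<longleftrightarrow> (\<Inter>n. pow_sub R p A n) = {\<zero>\<^bsub>A\<^esub>}"

definition torsion_free :: "'r \<Rightarrow> ('r, 'a) module \<Rightarrow> bool" where
  "torsion_free p A \<longleftrightarrow> (\<forall>x\<in>carrier A. p \<odot>\<^bsub>A\<^esub> x = \<zero>\<^bsub>A\<^esub> \<longrightarrow> x = \<zero>\<^bsub>A\<^esub>)"

text \<open>The inverse limit of the quotients \<open>A / p\<^sup>n A\<close>. Elements are sequences of cosets;
  compatibility with the projection \<open>A / p\<^sup>n\<^sup>+\<^sup>1 A \<rightarrow> A / p\<^sup>n A\<close> amounts to an inclusion of
  cosets.\<close>

definition completion ::
  "('r, 'x) ring_scheme \<Rightarrow> 'r \<Rightarrow> ('r, 'a) module \<Rightarrow> ('r, nat \<Rightarrow> 'a set) module" where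
  "completion R p A =
     \<lparr>carrier = {U. \<forall>n. U n \<in> carrier (A Quot pow_sub R p A n) \<and> U (Suc n) \<subseteq> U n},
      monoid.mult = (\<lambda>U V n. U n \<otimes>\<^bsub>A Quot pow_sub R p A n\<^esub> V n),
      one = (\<lambda>n. \<one>\<^bsub>A Quot pow_sub R p A n\<^esub>),
      ring.zero = (\<lambda>n. \<zero>\<^bsub>A Quot pow_sub R p A n\<^esub>),
      add = (\<lambda>U V n. U n \<oplus>\<^bsub>A Quot pow_sub R p A n\<^esub> V n),
      smult = (\<lambda>r U n. \<Union>x\<in>U n. pow_sub R p A n +>\<^bsub>A\<^esub> (r \<odot>\<^bsub>A\<^esub> x))\<rparr>"

definition completion_map ::
  "('r, 'x) ring_scheme \<Rightarrow> 'r \<Rightarrow> ('r, 'c) module \<Rightarrow> ('a \<Rightarrow> 'c) \<Rightarrow> (nat \<Rightarrow> 'a set) \<Rightarrow> (nat \<Rightarrow> 'c set)"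
  where "completion_map R p C f U = (\<lambda>n. \<Union>x\<in>U n. pow_sub R p C n +>\<^bsub>C\<^esub> f x)"


section \<open>Filtrations and associated graded algebras\<close>

definition algebra_filtration ::
  "('r, 'x) ring_scheme \<Rightarrow> ('r, 'b) module \<Rightarrow> (nat \<Rightarrow> 'b set) \<Rightarrow> bool" where
  "algebra_filtration R B F \<longleftrightarrow>
     (\<forall>n. R_submodule R B (F n)) \<and> (\<forall>n. F n \<subseteq> F (Suc n)) \<and> \<one>\<^bsub>B\<^esub> \<in> F 0 \<and>
     (\<forall>m n. \<forall>x\<in>F m. \<forall>y\<in>F n. x \<otimes>\<^bsub>B\<^esub> y \<in> F (m + n))"

definition exhaustive :: "('r, 'b) module \<Rightarrow> (nat \<Rightarrow> 'b set) \<Rightarrow> bool" where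
  "exhaustive B F \<longleftrightarrow> (\<Union>n. F n) = carrier B"

text \<open>\<open>F\<^bsub>n-1\<^esub>\<close>, with \<open>F\<^bsub>-1\<^esub> = 0\<close>.\<close>

definition filt_pred :: "('r, 'b) module \<Rightarrow> (nat \<Rightarrow> 'b set) \<Rightarrow> nat \<Rightarrow> 'b set" where
  "filt_pred B F n = (case n of 0 \<Rightarrow> {\<zero>\<^bsub>B\<^esub>} | Suc k \<Rightarrow> F k)"

text \<open>Elements of the direct sum of the \<open>F\<^bsub>n\<^esub> / F\<^bsub>n-1\<^esub>\<close> are finitely supported
  sequences of cosets; the product is the convolution product, computed on representatives.\<close>

definition gr ::
  "('r, 'b) module \<Rightarrow> (nat \<Rightarrow> 'b set) \<Rightarrow> ('r, nat \<Rightarrow> 'b set) module" where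
  "gr B F =
     \<lparr>carrier = {s. (\<forall>n. \<exists>x\<in>F n. s n = filt_pred B F n +>\<^bsub>B\<^esub> x) \<and>
                    finite {n. s n \<noteq> filt_pred B F n}},
      monoid.mult = (\<lambda>s t n. \<Union>{filt_pred B F n +>\<^bsub>B\<^esub> (\<Oplus>\<^bsub>B\<^esub>i\<in>{..n}. x i \<otimes>\<^bsub>B\<^esub> y (n - i)) |
                          x y. \<forall>i. x i \<in> s i \<and> y i \<in> t i}),
      one = (\<lambda>n. if n = 0 then filt_pred B F 0 +>\<^bsub>B\<^esub> \<one>\<^bsub>B\<^esub> else filt_pred B F n),
      ring.zero = filt_pred B F,
      add = (\<lambda>s t n. s n <+>\<^bsub>B\<^esub> t n),
      smult = (\<lambda>r s n. \<Union>x\<in>s n. filt_pred B F n +>\<^bsub>B\<^esub> (r \<odot>\<^bsub>B\<^esub> x))\<rparr>"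

text \<open>The degree zero part, canonically isomorphic to \<open>F\<^sub>0\<close>.\<close>

definition gr_zero :: "('r, 'b) module \<Rightarrow> (nat \<Rightarrow> 'b set) \<Rightarrow> (nat \<Rightarrow> 'b set) set" where
  "gr_zero B F = {s \<in> carrier (gr B F). \<forall>n>0. s n = filt_pred B F n}"


section \<open>q-commutative algebras\<close>

text \<open>Given the root \<open>qd = q\<^bsup>1/d\<^esup>\<close>, an exponent \<open>n\<^sub>i\<^sub>j\<close> in \<open>(1/d)\<int>\<close> is encoded by the integer
  \<open>k = d n\<^sub>i\<^sub>j\<close>, so that \<open>q\<^bsup>n\<^esup> = qd\<^bsup>k\<^esup>\<close>.\<close>

definition q_commute :: "('r, 'x) ring_scheme \<Rightarrow> 'r \<Rightarrow> ('r, 'c) module \<Rightarrow> 'c set \<Rightarrow> bool" where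
  "q_commute R qd C U \<longleftrightarrow>
     (\<forall>x\<in>U. \<forall>y\<in>U. \<exists>k::int. x \<otimes>\<^bsub>C\<^esub> y = (qd [^]\<^bsub>R\<^esub> k) \<odot>\<^bsub>C\<^esub> (y \<otimes>\<^bsub>C\<^esub> x))"

definition normalises :: "('c, 'x) ring_scheme \<Rightarrow> 'c \<Rightarrow> 'c set \<Rightarrow> bool" where
  "normalises C x S \<longleftrightarrow> x <#\<^bsub>C\<^esub> S = S #>\<^bsub>C\<^esub> x"

definition q_commutative_algebra ::
  "('r, 'x) ring_scheme \<Rightarrow> 'r \<Rightarrow> 'c set \<Rightarrow> ('r, 'c) module \<Rightarrow> bool" where
  "q_commutative_algebra R qd S C \<longleftrightarrow>
     assoc_algebra R C \<and> R_subalgebra R C S \<and>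
     (\<exists>U. finite U \<and> U \<subseteq> carrier C \<and>
          \<Inter> {D. R_subalgebra R C D \<and> S \<union> U \<subseteq> D} = carrier C \<and>
          (\<forall>x\<in>U. normalises C x S) \<and> q_commute R qd C U)"

end

(*
  Write A^ and B^ for the completions and let C = B + A^, a subring of A^_L. In positive degrees the
  graded pieces of the filtration F_n B + A^ of C are those of gr B, which is left Noetherian by a
  Hilbert basis argument for normalising elements; together with the Noetherianity of A^ this makes C
  left Noetherian. The map C -> B^ is bijective modulo every power of p, so successive approximation
  carries the Noetherian property from C to B^ (and in the same way from A to A^). Artin-Rees for the
  central element p, which amounts to the stabilisation of an ascending chain of quotients, shows that
  m s in B^ V implies m in B^ (C V : s) for finite V contained in C and s in C. Inverting p turns C
  into A^_L, so this colon condition holds for B^_L over A^_L, and it implies flatness: the finitely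
  many relations that make a tensor vanish can be removed one at a time.
*)
theory Submission
  imports Defs
begin

text \<open>\<open>B\<close> is only given inside the base change of \<open>A\<close>, so the ring
  that links it to the completion of \<open>A\<close> has to be formed inside the base change
  \<open>D\<close> of that completion. The sum \<open>C\<close> is closed under products because an
  element of the completion can be approximated from \<open>A\<close> to any precision, in
  particular to within the denominator of a given element of \<open>B\<close>. All Noetherian
  statements are kept as chain conditions. Each is reduced to a family of ideals with two indices,
  the position in the chain and a degree, and one bound in the first index has to serve for all
  degrees. Flatness is reached without Tor. For a right flat module, tensoring the injection of
  R/(RV : s) into R/RV by right multiplication with s gives the colon condition. That condition
  mentions finitely many elements at a time, which is why it can be transferred by clearing
  denominators and by passing to limits; it is then shown to imply flatness in the form of the
  equational criterion.\<close>

section \<open>Left ideals and the ascending chain condition\<close>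

text \<open>Left ideals of a subring \<^term>\<open>T\<close> of \<^term>\<open>R\<close>, without passing to the record with carrier \<^term>\<open>T\<close>.\<close>

definition left_ideal_in :: "('a, 'x) ring_scheme \<Rightarrow> 'a set \<Rightarrow> 'a set \<Rightarrow> bool" where
  "left_ideal_in R T I \<longleftrightarrow> I \<subseteq> T \<and> \<zero>\<^bsub>R\<^esub> \<in> I \<and> (\<forall>x\<in>I. \<forall>y\<in>I. x \<oplus>\<^bsub>R\<^esub> y \<in> I) \<and> (\<forall>a\<in>T. \<forall>x\<in>I. a \<otimes>\<^bsub>R\<^esub> x \<in> I)"

definition acc_in :: "('a, 'x) ring_scheme \<Rightarrow> 'a set \<Rightarrow> bool" where
  "acc_in R T \<longleftrightarrow> (\<forall>I :: nat \<Rightarrow> 'a set. (\<forall>n. left_ideal_in R T (I n)) \<longrightarrow> (\<forall>n. I n \<subseteq> I (Suc n))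
     \<longrightarrow> (\<exists>N. \<forall>n\<ge>N. I n = I N))"

lemma left_ideal_inI:
  assumes "I \<subseteq> T" "\<zero>\<^bsub>R\<^esub> \<in> I" "\<And>x y. x \<in> I \<Longrightarrow> y \<in> I \<Longrightarrow> x \<oplus>\<^bsub>R\<^esub> y \<in> I" "\<And>a x. a \<in> T \<Longrightarrow> x \<in> I \<Longrightarrow> a \<otimes>\<^bsub>R\<^esub> x \<in> I"
  shows "left_ideal_in R T I"
  using assms unfolding left_ideal_in_def by blast

lemma left_ideal_inD:
  assumes "left_ideal_in R T I"
  shows "x \<in> I \<Longrightarrow> x \<in> T" "\<zero>\<^bsub>R\<^esub> \<in> I" "x \<in> I \<Longrightarrow> y \<in> I \<Longrightarrow> x \<oplus>\<^bsub>R\<^esub> y \<in> I" "a \<in> T \<Longrightarrow> x \<in> I \<Longrightarrow> a \<otimes>\<^bsub>R\<^esub> x \<in> I"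
  using assms unfolding left_ideal_in_def by blast+

lemma acc_inD:
  assumes "acc_in R T" "\<And>n. left_ideal_in R T (I n)" "\<And>n. I n \<subseteq> I (Suc n)"
  obtains N where "\<And>n. n \<ge> N \<Longrightarrow> I n = I N"
  using assms unfolding acc_in_def by metis

context ring
begin

lemma left_ideal_in_minus:
  assumes "subring T R" "left_ideal_in R T I" "x \<in> I" shows "\<ominus> x \<in> I"
proof -
  have "\<ominus> \<one> \<in> T" using assms(1) by (simp add: subringE)
  moreover have "x \<in> carrier R" using subringE(1)[OF assms(1)] left_ideal_inD(1)[OF assms(2,3)] by auto
  ultimately show ?thesis using left_ideal_inD(4)[OF assms(2) _ assms(3), of "\<ominus> \<one>"] by (simp add: l_minus)
qed

lemma left_ideal_in_diff:
  assumes "subring T R" "left_ideal_in R T I" "x \<in> I" "y \<in> I" shows "x \<ominus> y \<in> I"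
  unfolding minus_eq by (rule left_ideal_inD(3)[OF assms(2,3) left_ideal_in_minus[OF assms(1,2,4)]])

lemma subring_carrier: "subring (carrier R) R"
  by (rule subringI) auto

lemma left_ideal_iff: "left_ideal I R \<longleftrightarrow> left_ideal_in R (carrier R) I"
proof
  assume "left_ideal I R"
  then have "additive_subgroup I R" and m: "\<forall>a\<in>carrier R. \<forall>x\<in>I. a \<otimes> x \<in> I" unfolding left_ideal_def by auto
  then interpret additive_subgroup I R by simp
  show "left_ideal_in R (carrier R) I" using m by (intro left_ideal_inI) auto
next
  assume l: "left_ideal_in R (carrier R) I"
  have "subgroup I (add_monoid R)"
    using l left_ideal_in_minus[OF subring_carrier l]
    by (intro group.subgroupI) (auto simp: a_inv_def[symmetric] a_group dest: left_ideal_inD)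
  then show "left_ideal I R" using l by (auto simp: left_ideal_def additive_subgroup_def dest: left_ideal_inD)
qed

lemma left_ideal_in_Inter:
  assumes "\<And>J. J \<in> S \<Longrightarrow> left_ideal_in R T J" "S \<noteq> {}" shows "left_ideal_in R T (\<Inter>S)"
  using assms by (intro left_ideal_inI) (fastforce dest: left_ideal_inD)+

lemma left_ideal_in_gen:
  assumes "U \<subseteq> carrier R" shows "left_ideal_in R (carrier R) (gen_left_ideal R U)"
proof -
  have "left_ideal_in R (carrier R) (carrier R)" by (intro left_ideal_inI) auto
  then show ?thesis unfolding gen_left_ideal_def using assms
    by (intro left_ideal_in_Inter) (auto simp: left_ideal_iff)
qed

lemma gen_left_ideal_incl: "U \<subseteq> gen_left_ideal R U"
  unfolding gen_left_ideal_def by blast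

lemma gen_left_ideal_minimal:
  "left_ideal_in R (carrier R) J \<Longrightarrow> U \<subseteq> J \<Longrightarrow> gen_left_ideal R U \<subseteq> J"
  unfolding gen_left_ideal_def left_ideal_iff by blast

lemma gen_left_ideal_mono:
  "U \<subseteq> V \<Longrightarrow> gen_left_ideal R U \<subseteq> gen_left_ideal R V"
  unfolding gen_left_ideal_def by blast

lemma gen_left_ideal_empty: "gen_left_ideal R {} = {\<zero>}"
proof -
  have "left_ideal_in R (carrier R) {\<zero>}" by (intro left_ideal_inI) auto
  from gen_left_ideal_minimal[OF this] left_ideal_inD(2)[OF left_ideal_in_gen[of "{}"]] show ?thesis by blast
qed

text \<open>The generated ideal is defined as an intersection. This description, one generator at a
  time, is what the inductions over finite generating sets use.\<close>

lemma gen_left_ideal_insert: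
  assumes u: "u \<in> carrier R" and U: "U \<subseteq> carrier R"
  shows "gen_left_ideal R (insert u U) = {a \<otimes> u \<oplus> g | a g. a \<in> carrier R \<and> g \<in> gen_left_ideal R U}" (is "?G = ?S")
proof
  note G = left_ideal_in_gen[OF U]
  have gc: "g \<in> carrier R" if "g \<in> gen_left_ideal R U" for g using left_ideal_inD(1)[OF G that] .
  have "left_ideal_in R (carrier R) ?S"
  proof (intro left_ideal_inI)
    show "?S \<subseteq> carrier R" using u gc by auto
    show "\<zero> \<in> ?S" using u left_ideal_inD(2)[OF G] by (auto intro!: exI[of _ \<zero>])
  next
    fix x y assume "x \<in> ?S" "y \<in> ?S"
    then obtain a g b h where x: "x = a \<otimes> u \<oplus> g" "y = b \<otimes> u \<oplus> h" "a \<in> carrier R" "b \<in> carrier R"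
      "g \<in> gen_left_ideal R U" "h \<in> gen_left_ideal R U" by auto
    then have "x \<oplus> y = (a \<oplus> b) \<otimes> u \<oplus> (g \<oplus> h)" using u gc
      by (simp add: l_distr a_ac)
    then show "x \<oplus> y \<in> ?S" using x left_ideal_inD(3)[OF G] by blast
  next
    fix c x assume c: "c \<in> carrier R" and "x \<in> ?S"
    then obtain a g where x: "x = a \<otimes> u \<oplus> g" "a \<in> carrier R" "g \<in> gen_left_ideal R U" by auto
    then have "c \<otimes> x = (c \<otimes> a) \<otimes> u \<oplus> c \<otimes> g" using u c gc by (simp add: r_distr m_assoc)
    then show "c \<otimes> x \<in> ?S" using x c left_ideal_inD(4)[OF G] by blast
  qed
  moreover have "insert u U \<subseteq> ?S"
  proof -
    have "u = \<one> \<otimes> u \<oplus> \<zero>" using u by simp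
    then have "u \<in> ?S" using left_ideal_inD(2)[OF G] by blast
    moreover have "x = \<zero> \<otimes> u \<oplus> x" if "x \<in> U" for x using u U that by auto
    then have "U \<subseteq> ?S" using gen_left_ideal_incl[of U] by blast
    ultimately show ?thesis by blast
  qed
  ultimately show "?G \<subseteq> ?S" by (rule gen_left_ideal_minimal)
  have U': "insert u U \<subseteq> carrier R" using u U by simp
  note G' = left_ideal_in_gen[OF U']
  show "?S \<subseteq> ?G" using left_ideal_inD(3,4)[OF G'] gen_left_ideal_incl[of "insert u U"]
      gen_left_ideal_mono[of U "insert u U"] by blast
qed

lemma left_noetherian_iff_acc: "left_noetherian_ring R \<longleftrightarrow> acc_in R (carrier R)"
proof
  assume "left_noetherian_ring R"
  then interpret left_noetherian_ring R .
  show "acc_in R (carrier R)" unfolding acc_in_def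
  proof (intro allI impI)
    fix I :: "nat \<Rightarrow> 'a set"
    assume I: "\<forall>n. left_ideal_in R (carrier R) (I n)" and inc: "\<forall>n. I n \<subseteq> I (Suc n)"
    have mono: "I m \<subseteq> I n" if "m \<le> n" for m n using lift_Suc_mono_le[of I] inc that by blast
    have "left_ideal_in R (carrier R) (\<Union>n. I n)"
    proof (intro left_ideal_inI)
      fix x y assume "x \<in> (\<Union>n. I n)" "y \<in> (\<Union>n. I n)"
      then obtain m n where "x \<in> I m" "y \<in> I n" by auto
      then have "x \<in> I (max m n)" "y \<in> I (max m n)" using mono[of m "max m n"] mono[of n "max m n"] by auto
      then show "x \<oplus> y \<in> (\<Union>n. I n)" using left_ideal_inD(3)[OF I[rule_format]] by blast
    qed (use left_ideal_inD[OF I[rule_format]] in \<open>auto, blast\<close>)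
    then obtain U where U: "U \<subseteq> carrier R" "finite U" "(\<Union>n. I n) = gen_left_ideal R U"
      using left_ideal_fin_gen unfolding left_ideal_iff by metis
    have "\<forall>u\<in>U. \<exists>n. u \<in> I n" using U(3) gen_left_ideal_incl by blast
    then obtain n where n: "\<forall>u\<in>U. u \<in> I (n u)" by metis
    define N where "N = Max (insert 0 (n ` U))"
    have "n u \<le> N" if "u \<in> U" for u unfolding N_def using U(2) that by (intro Max_ge) auto
    then have "U \<subseteq> I N" using n mono by blast
    then have le: "(\<Union>n. I n) \<subseteq> I N" unfolding U(3) using gen_left_ideal_minimal I by simp
    have "I n = I N" if "n \<ge> N" for n
    proof
      show "I n \<subseteq> I N" using le by auto
    qed (rule mono[OF that])
    then show "\<exists>N. \<forall>n\<ge>N. I n = I N" by (intro exI[of _ N] allI impI)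
  qed
next
  assume acc: "acc_in R (carrier R)"
  show "left_noetherian_ring R"
  proof
    fix I assume "left_ideal I R"
    then have I: "left_ideal_in R (carrier R) I" using left_ideal_iff by blast
    then have Ic: "I \<subseteq> carrier R" by (auto dest: left_ideal_inD)
    show "\<exists>U \<subseteq> carrier R. finite U \<and> I = gen_left_ideal R U"
    proof (rule ccontr)
      assume no: "\<not> ?thesis"
      have ex: "\<exists>u. u \<in> I - gen_left_ideal R U" if U: "finite U" "U \<subseteq> I" for U
      proof -
        have "I \<noteq> gen_left_ideal R U" using no U(1) subset_trans[OF U(2) Ic] by blast
        then show ?thesis using gen_left_ideal_minimal[OF I U(2)] by auto
      qed
      \<comment> \<open>\<open>c U\<close> is a member of \<open>I\<close> outside the ideal
        generated by \<open>U\<close>. Adjoining it again and again gives a chain that grows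
        strictly at every step.\<close>
      define c where "c U = (SOME u. u \<in> I - gen_left_ideal R U)" for U
      define V where "V n = ((\<lambda>U. insert (c U) U) ^^ n) {}" for n :: nat
      have V: "finite (V n) \<and> V n \<subseteq> I" for n
      proof (induction n)
        case (Suc n)
        then have "c (V n) \<in> I" using someI_ex[OF ex[of "V n"]] unfolding c_def by blast
        then show ?case using Suc by (simp add: V_def)
      qed (simp add: V_def)
      have VS: "V (Suc n) = insert (c (V n)) (V n)" for n by (simp add: V_def)
      obtain N where N: "\<And>n. n \<ge> N \<Longrightarrow> gen_left_ideal R (V n) = gen_left_ideal R (V N)"
        using acc_inD[OF acc, of "\<lambda>n. gen_left_ideal R (V n)"] left_ideal_in_gen V Ic
          gen_left_ideal_mono VS by (metis subset_insertI subset_trans)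
      have "c (V N) \<in> gen_left_ideal R (V (Suc N))" using VS gen_left_ideal_incl by blast
      moreover have "c (V N) \<notin> gen_left_ideal R (V N)"
        using someI_ex[OF ex[of "V N"]] V unfolding c_def by blast
      ultimately show False using N[of "Suc N"] by simp
    qed
  qed
qed

end

text \<open>The diagonal stabilises at some \<open>N\<close>, which settles all pairs beyond
  \<open>N\<close>. Only the finitely many rows up to \<open>N\<close> remain, each with a bound of
  its own, and the maximum of all these bounds is uniform in \<open>n\<close>.\<close>

lemma acc_in_double:
  assumes acc: "acc_in R T" and I: "\<And>n k. left_ideal_in R T (I n k)"
    and n: "\<And>n k. I n k \<subseteq> I (Suc n) k" and k: "\<And>n k. I n k \<subseteq> I n (Suc k)"
  obtains K :: nat where "\<And>n k. k \<ge> K \<Longrightarrow> I n k = I n K"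
proof -
  have mn: "I a k \<subseteq> I b k" if "a \<le> b" for a b k :: nat using lift_Suc_mono_le[of "\<lambda>n. I n k"] n that by blast
  have mk: "I n a \<subseteq> I n b" if "a \<le> b" for a b n :: nat using lift_Suc_mono_le[of "I n"] k that by blast
  obtain N where N: "\<And>n. n \<ge> N \<Longrightarrow> I n n = I N N"
    using acc_inD[OF acc, of "\<lambda>n. I n n"] I n k by (metis subset_trans)
  have big: "I n k = I N N" if "n \<ge> N" "k \<ge> N" for n k
  proof
    show "I n k \<subseteq> I N N" using N[of "max n k"] mn[of n "max n k" k] mk[of k "max n k" "max n k"] that by fastforce
    show "I N N \<subseteq> I n k" using mn[of N n N] mk[of N k n] that by blast
  qed
  have "\<forall>n. \<exists>K. \<forall>k\<ge>K. I n k = I n K" using acc_inD[OF acc, of "I _"] I k by metis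
  then obtain K where K: "\<And>n k. k \<ge> K n \<Longrightarrow> I n k = I n (K n)" by metis
  define M where "M = Max (insert N (K ` {..N}))"
  have M: "M \<ge> N" unfolding M_def by simp
  have M2: "M \<ge> K n" if "n \<le> N" for n unfolding M_def using that by (intro Max_ge) auto
  have "I n k = I n M" if "k \<ge> M" for n k
  proof (cases "n \<le> N")
    case True
    then have "k \<ge> K n" "M \<ge> K n" using M2[OF True] that by linarith+
    then show ?thesis using K[of n k] K[of n M] by (simp only:)
  next
    case False
    then have "n \<ge> N" "k \<ge> N" using M that by linarith+
    then show ?thesis using big[of n k] big[of n M] M by (simp only:)
  qed
  then show thesis using that by blast
qed

text \<open>The preimages of the ideals of a chain form a chain in \<open>T\<close>, and each ideal
  is the image of its preimage. The conditions on \<open>f\<close> are local to \<open>T\<close>, so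
  the lemma also serves for the symbol map into a graded algebra whose ring axioms are not yet at
  hand.\<close>

lemma acc_in_hom_image:
  assumes acc: "acc_in R T"
    and zero: "f \<zero>\<^bsub>R\<^esub> = \<zero>\<^bsub>R'\<^esub>" "\<zero>\<^bsub>R\<^esub> \<in> T"
    and closed: "\<And>x y. x \<in> T \<Longrightarrow> y \<in> T \<Longrightarrow> x \<oplus>\<^bsub>R\<^esub> y \<in> T \<and> x \<otimes>\<^bsub>R\<^esub> y \<in> T"
    and hom: "\<And>x y. x \<in> T \<Longrightarrow> y \<in> T \<Longrightarrow> f (x \<oplus>\<^bsub>R\<^esub> y) = f x \<oplus>\<^bsub>R'\<^esub> f y \<and> f (x \<otimes>\<^bsub>R\<^esub> y) = f x \<otimes>\<^bsub>R'\<^esub> f y"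
  shows "acc_in R' (f ` T)"
  unfolding acc_in_def
proof (intro allI impI)
  fix I assume I: "\<forall>n. left_ideal_in R' (f ` T) (I n)" and inc: "\<forall>n. I n \<subseteq> I (Suc n)"
  define J where "J n = {x \<in> T. f x \<in> I n}" for n :: nat
  have "left_ideal_in R T (J n)" for n
    using I[rule_format, of n] zero closed hom unfolding left_ideal_in_def J_def by auto
  moreover have "J n \<subseteq> J (Suc n)" for n using inc unfolding J_def by blast
  ultimately obtain N where N: "\<And>n. n \<ge> N \<Longrightarrow> J n = J N" using acc_inD[OF acc, of J] by metis
  have eq: "I n = f ` J n" for n using I[rule_format, of n] unfolding J_def left_ideal_in_def by blast
  have "I n = I N" if "n \<ge> N" for n
    unfolding eq[of n] eq[of N] N[OF that] ..
  then show "\<exists>N. \<forall>n\<ge>N. I n = I N" by (intro exI[of _ N] allI impI)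
qed

section \<open>A Hilbert basis theorem for normalising extensions\<close>

context ring
begin

text \<open>The equation xS = Sx in elementwise form, split into its two inclusions because they are
  applied separately.\<close>

definition normalising :: "'a \<Rightarrow> 'a set \<Rightarrow> bool" where
  "normalising x S \<longleftrightarrow> (\<forall>s\<in>S. \<exists>t\<in>S. x \<otimes> s = t \<otimes> x) \<and> (\<forall>s\<in>S. \<exists>t\<in>S. s \<otimes> x = x \<otimes> t)"

lemma normalises_imp_normalising:
  assumes "normalises R x S" shows "normalising x S"
proof -
  have e: "(\<Union>s\<in>S. {x \<otimes> s}) = (\<Union>s\<in>S. {s \<otimes> x})"
    using assms unfolding normalises_def l_coset_def r_coset_def by simp
  have "x \<otimes> s \<in> (\<Union>s\<in>S. {s \<otimes> x})" "s \<otimes> x \<in> (\<Union>s\<in>S. {x \<otimes> s})" if "s \<in> S" for s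
    unfolding e[symmetric] using that apply blast unfolding e using that by blast
  then show ?thesis unfolding normalising_def by auto
qed

text \<open>Polynomials in \<open>x\<close> of degree below the index, with coefficients on the
  right. On this side left multiplication by \<open>x\<close> leaves the leading coefficient
  unchanged, which makes the ideals of leading coefficients increase with the degree. An element may
  have several such expressions.\<close>

primrec skew_poly :: "'a set \<Rightarrow> 'a \<Rightarrow> nat \<Rightarrow> 'a set" where
  "skew_poly S x 0 = {\<zero>}"
| "skew_poly S x (Suc n) = {x [^] n \<otimes> s \<oplus> g | s g. s \<in> S \<and> g \<in> skew_poly S x n}"

definition skew_ext :: "'a set \<Rightarrow> 'a \<Rightarrow> 'a set" where
  "skew_ext S x = (\<Union>n. skew_poly S x n)"

end

locale normalising_ext = ring C for C (structure) +
  fixes S x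
  assumes sub: "subring S C" and x: "x \<in> carrier C" and nrm: "normalising x S"
begin

abbreviation "P \<equiv> skew_poly S x"
abbreviation "T \<equiv> skew_ext S x"

lemma S_carrier: "s \<in> S \<Longrightarrow> s \<in> carrier C"
  using subringE(1)[OF sub] by blast

lemma nrm_l: assumes "s \<in> S" obtains t where "t \<in> S" "x \<otimes> s = t \<otimes> x"
  using nrm assms unfolding normalising_def by blast

lemma nrm_r: assumes "s \<in> S" obtains t where "t \<in> S" "s \<otimes> x = x \<otimes> t"
  using nrm assms unfolding normalising_def by blast

lemma P_SucE:
  assumes "f \<in> P (Suc n)" obtains s g where "s \<in> S" "g \<in> P n" "f = x [^] n \<otimes> s \<oplus> g"
  using assms by auto

lemma P_SucI: "s \<in> S \<Longrightarrow> g \<in> P n \<Longrightarrow> x [^] n \<otimes> s \<oplus> g \<in> P (Suc n)"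
  by auto

lemma P_carrier: "f \<in> P n \<Longrightarrow> f \<in> carrier C"
proof (induction n arbitrary: f)
  case (Suc n)
  from Suc.prems obtain s g where "s \<in> S" "g \<in> P n" "f = x [^] n \<otimes> s \<oplus> g" by (rule P_SucE)
  then show ?case using Suc.IH S_carrier x by simp
qed simp

lemma P_zero: "\<zero> \<in> P n"
proof (induction n)
  case (Suc n)
  then show ?case using P_SucI[OF subringE(2)[OF sub] Suc] x by simp
qed simp

lemma P_Suc: "f \<in> P n \<Longrightarrow> f \<in> P (Suc n)"
  using P_SucI[OF subringE(2)[OF sub], of f n] x P_carrier[of f n] by simp

lemma P_mono: "n \<le> m \<Longrightarrow> f \<in> P n \<Longrightarrow> f \<in> P m"
  by (induction rule: dec_induct) (simp_all only: P_Suc)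

lemma P_add: "f \<in> P n \<Longrightarrow> h \<in> P n \<Longrightarrow> f \<oplus> h \<in> P n"
proof (induction n arbitrary: f h)
  case (Suc n)
  from Suc.prems(1) obtain s g where 1: "s \<in> S" "g \<in> P n" "f = x [^] n \<otimes> s \<oplus> g" by (rule P_SucE)
  from Suc.prems(2) obtain t k where 2: "t \<in> S" "k \<in> P n" "h = x [^] n \<otimes> t \<oplus> k" by (rule P_SucE)
  have "f \<oplus> h = x [^] n \<otimes> (s \<oplus> t) \<oplus> (g \<oplus> k)"
    using 1 2 S_carrier P_carrier x by (simp add: r_distr a_ac)
  then show ?case using P_SucI[OF subringE(7)[OF sub 1(1) 2(1)] Suc.IH[OF 1(2) 2(2)]] by simp
qed simp

lemma S_pow: assumes "s \<in> S" obtains t where "t \<in> S" "s \<otimes> x [^] (n::nat) = x [^] n \<otimes> t"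
proof -
  have "\<exists>t\<in>S. s \<otimes> x [^] n = x [^] n \<otimes> t"
  proof (induction n)
    case 0 then show ?case using assms S_carrier by auto
  next
    case (Suc n)
    then obtain t where t: "t \<in> S" "s \<otimes> x [^] n = x [^] n \<otimes> t" by blast
    obtain u where u: "u \<in> S" "t \<otimes> x = x \<otimes> u" using nrm_r[OF t(1)] .
    have "s \<otimes> x [^] Suc n = (s \<otimes> x [^] n) \<otimes> x" using assms S_carrier x by (simp add: m_assoc)
    also have "\<dots> = x [^] n \<otimes> (t \<otimes> x)" using t S_carrier x by (simp add: m_assoc)
    also have "\<dots> = x [^] Suc n \<otimes> u" using u S_carrier x by (simp add: m_assoc)
    finally show ?case using u(1) by blast
  qed
  then show thesis using that by blast
qed

lemma pow_S: assumes "s \<in> S" obtains t where "t \<in> S" "x [^] (n::nat) \<otimes> s = t \<otimes> x [^] n"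
proof -
  have "\<exists>t\<in>S. x [^] n \<otimes> s = t \<otimes> x [^] n"
    using assms
  proof (induction n arbitrary: s)
    case 0 then show ?case using S_carrier by auto
  next
    case (Suc n)
    obtain t where t: "t \<in> S" "x \<otimes> s = t \<otimes> x" using nrm_l[OF Suc.prems] .
    obtain u where u: "u \<in> S" "x [^] n \<otimes> t = u \<otimes> x [^] n" using Suc.IH[OF t(1)] by blast
    have "x [^] Suc n \<otimes> s = x [^] n \<otimes> (x \<otimes> s)" using Suc.prems S_carrier x by (simp add: m_assoc)
    also have "\<dots> = (x [^] n \<otimes> t) \<otimes> x" using t S_carrier x by (simp add: m_assoc)
    also have "\<dots> = u \<otimes> x [^] Suc n" using u S_carrier x by (simp add: m_assoc)
    finally show ?case using u(1) by blast
  qed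
  then show thesis using that by blast
qed

lemma P_S_mult: "a \<in> S \<Longrightarrow> f \<in> P n \<Longrightarrow> a \<otimes> f \<in> P n"
proof (induction n arbitrary: f)
  case 0 then show ?case using S_carrier by simp
next
  case (Suc n)
  from Suc.prems(2) obtain s g where 1: "s \<in> S" "g \<in> P n" "f = x [^] n \<otimes> s \<oplus> g" by (rule P_SucE)
  obtain b where b: "b \<in> S" "a \<otimes> x [^] n = x [^] n \<otimes> b" using S_pow[OF Suc.prems(1)] .
  have "a \<otimes> f = (a \<otimes> x [^] n) \<otimes> s \<oplus> a \<otimes> g"
    using 1 Suc.prems S_carrier P_carrier x by (simp add: r_distr m_assoc)
  also have "\<dots> = x [^] n \<otimes> (b \<otimes> s) \<oplus> a \<otimes> g" using b 1 S_carrier x by (simp add: m_assoc)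
  finally show ?case using P_SucI[OF subringE(6)[OF sub b(1) 1(1)] Suc.IH[OF Suc.prems(1) 1(2)]] by simp
qed

lemma P_x_mult: "f \<in> P n \<Longrightarrow> x \<otimes> f \<in> P (Suc n)"
proof (induction n arbitrary: f)
  case 0 then show ?case using x P_zero[of "Suc 0"] by simp
next
  case (Suc n)
  from Suc.prems obtain s g where 1: "s \<in> S" "g \<in> P n" "f = x [^] n \<otimes> s \<oplus> g" by (rule P_SucE)
  have "x \<otimes> f = x [^] Suc n \<otimes> s \<oplus> x \<otimes> g"
    unfolding nat_pow_Suc2[OF x] using 1 S_carrier P_carrier x by (simp add: r_distr m_assoc)
  then show ?case using P_SucI[OF 1(1) Suc.IH[OF 1(2)]] by (simp only:)
qed

lemma P_pow_mult: "f \<in> P n \<Longrightarrow> x [^] (m::nat) \<otimes> f \<in> P (m + n)"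
proof (induction m)
  case 0 then show ?case using P_carrier by simp
next
  case (Suc m)
  have "x [^] Suc m \<otimes> f = x \<otimes> (x [^] m \<otimes> f)" unfolding nat_pow_Suc2[OF x]
    using P_carrier[OF Suc.prems] x by (simp add: m_assoc)
  then show ?case using P_x_mult[OF Suc.IH[OF Suc.prems]] by (simp only: add_Suc)
qed

lemma P_mult: "f \<in> P m \<Longrightarrow> h \<in> P n \<Longrightarrow> f \<otimes> h \<in> P (m + n)"
proof (induction m arbitrary: f)
  case 0 then show ?case using P_carrier[of h] P_zero by simp
next
  case (Suc m)
  from Suc.prems(1) obtain s g where 1: "s \<in> S" "g \<in> P m" "f = x [^] m \<otimes> s \<oplus> g" by (rule P_SucE)
  have "f \<otimes> h = x [^] m \<otimes> (s \<otimes> h) \<oplus> g \<otimes> h"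
    using 1 Suc.prems S_carrier P_carrier x by (simp add: l_distr m_assoc)
  moreover have "x [^] m \<otimes> (s \<otimes> h) \<in> P (m + n)" using P_pow_mult P_S_mult 1 Suc.prems by blast
  ultimately have "f \<otimes> h \<in> P (m + n)" using Suc.IH[OF 1(2) Suc.prems(2)] P_add by simp
  then show ?case using P_Suc by (simp only: add_Suc)
qed

lemma T_iff: "f \<in> T \<longleftrightarrow> (\<exists>n. f \<in> P n)"
  unfolding skew_ext_def by simp

lemma S_in_P: "s \<in> S \<Longrightarrow> s \<in> P (Suc 0)"
  using P_SucI[of s \<zero> 0] S_carrier x by simp

lemma x_in_P: "x \<in> P (Suc (Suc 0))"
  using P_SucI[OF subringE(3)[OF sub] P_zero, of "Suc 0"] x by simp

lemma T_subring: "subring T C"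
proof (rule subringI)
  show "T \<subseteq> carrier C" using T_iff P_carrier by blast
  show "\<one> \<in> T" using S_in_P[OF subringE(3)[OF sub]] T_iff by blast
next
  fix f assume "f \<in> T"
  then obtain n where f: "f \<in> P n" using T_iff by blast
  have "\<ominus> \<one> \<in> S" using sub by (simp add: subringE)
  from P_S_mult[OF this f] have "\<ominus> f \<in> P n" using P_carrier[OF f] by (simp add: l_minus)
  then show "\<ominus> f \<in> T" using T_iff by blast
next
  fix f h assume "f \<in> T" "h \<in> T"
  then obtain m n where f: "f \<in> P m" "h \<in> P n" using T_iff by blast
  then show "f \<otimes> h \<in> T" using P_mult T_iff by blast
  have "f \<in> P (max m n)" "h \<in> P (max m n)" using f P_mono[of m "max m n"] P_mono[of n "max m n"] by auto
  then show "f \<oplus> h \<in> T" using P_add T_iff by blast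
qed

lemma S_subset_T: "S \<subseteq> T" and x_in_T: "x \<in> T"
  using S_in_P x_in_P T_iff by blast+

text \<open>As expressions are not unique, this collects the coefficients of x^n in all expressions
  of degree at most \<open>n\<close> of members of \<open>I\<close>.\<close>

definition lead :: "nat \<Rightarrow> 'a set \<Rightarrow> 'a set" where
  "lead n I = {s \<in> S. \<exists>g\<in>P n. x [^] n \<otimes> s \<oplus> g \<in> I}"

lemma lead_ideal:
  assumes I: "left_ideal_in C T I" shows "left_ideal_in C S (lead n I)"
proof (intro left_ideal_inI)
  show "lead n I \<subseteq> S" unfolding lead_def by blast
  show "\<zero> \<in> lead n I" unfolding lead_def using P_zero[of n] left_ideal_inD(2)[OF I] x sub
    by (auto simp: subringE(2) intro!: bexI[of _ \<zero>])
next
  fix s t assume "s \<in> lead n I" "t \<in> lead n I"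
  then obtain g h where 1: "s \<in> S" "g \<in> P n" "x [^] n \<otimes> s \<oplus> g \<in> I" "t \<in> S" "h \<in> P n" "x [^] n \<otimes> t \<oplus> h \<in> I"
    unfolding lead_def by blast
  have "(x [^] n \<otimes> s \<oplus> g) \<oplus> (x [^] n \<otimes> t \<oplus> h) = x [^] n \<otimes> (s \<oplus> t) \<oplus> (g \<oplus> h)"
    using 1 S_carrier P_carrier x by (simp add: r_distr a_ac)
  then have "x [^] n \<otimes> (s \<oplus> t) \<oplus> (g \<oplus> h) \<in> I" using left_ideal_inD(3)[OF I 1(3) 1(6)] by simp
  then show "s \<oplus> t \<in> lead n I" unfolding lead_def
    using P_add[OF 1(2) 1(5)] subringE(7)[OF sub 1(1) 1(4)] by blast
next
  fix a s assume a: "a \<in> S" and "s \<in> lead n I"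
  then obtain g where 1: "s \<in> S" "g \<in> P n" "x [^] n \<otimes> s \<oplus> g \<in> I"
    unfolding lead_def by blast
  \<comment> \<open>Multiplying the leading coefficient by \<open>a\<close> requires multiplying the
    whole element by the twisted factor \<open>b\<close> with x^n a = b x^n.\<close>
  obtain b where b: "b \<in> S" "x [^] n \<otimes> a = b \<otimes> x [^] n" using pow_S[OF a] .
  have "b \<otimes> (x [^] n \<otimes> s \<oplus> g) = (b \<otimes> x [^] n) \<otimes> s \<oplus> b \<otimes> g"
    using b 1 S_carrier P_carrier x by (simp add: r_distr m_assoc)
  also have "\<dots> = x [^] n \<otimes> (a \<otimes> s) \<oplus> b \<otimes> g" unfolding b(2)[symmetric]
    using a 1 S_carrier x by (simp add: m_assoc)
  finally have "x [^] n \<otimes> (a \<otimes> s) \<oplus> b \<otimes> g \<in> I"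
    using left_ideal_inD(4)[OF I _ 1(3), of b] b(1) S_subset_T by auto
  then show "a \<otimes> s \<in> lead n I" unfolding lead_def
    using P_S_mult[OF b(1) 1(2)] subringE(6)[OF sub a 1(1)] by blast
qed

lemma lead_Suc:
  assumes I: "left_ideal_in C T I" shows "lead n I \<subseteq> lead (Suc n) I"
proof
  fix s assume "s \<in> lead n I"
  then obtain g where 1: "s \<in> S" "g \<in> P n" "x [^] n \<otimes> s \<oplus> g \<in> I" unfolding lead_def by blast
  have "x \<otimes> (x [^] n \<otimes> s \<oplus> g) = x [^] Suc n \<otimes> s \<oplus> x \<otimes> g"
    unfolding nat_pow_Suc2[OF x] using 1 S_carrier P_carrier x by (simp add: r_distr m_assoc)
  then have "x [^] Suc n \<otimes> s \<oplus> x \<otimes> g \<in> I" using left_ideal_inD(4)[OF I x_in_T 1(3)] by (simp only:)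
  then show "s \<in> lead (Suc n) I" unfolding lead_def using 1(1) P_x_mult[OF 1(2)] by blast
qed

text \<open>Induction on the degree: an element of \<open>J\<close> is corrected by an element of
  \<open>I\<close> with the same leading coefficient, and the difference is again in
  \<open>J\<close> and has smaller degree.\<close>

lemma eq_if_lead_eq:
  assumes I: "left_ideal_in C T I" and J: "left_ideal_in C T J" and le: "I \<subseteq> J"
    and lead: "\<And>n. lead n J \<subseteq> lead n I"
  shows "J \<subseteq> I"
proof -
  have "f \<in> I" if "f \<in> P n" "f \<in> J" for f n
    using that
  proof (induction n arbitrary: f)
    case 0 then show ?case using left_ideal_inD(2)[OF I] by simp
  next
    case (Suc n)
    from Suc.prems(1) obtain s g where 1: "s \<in> S" "g \<in> P n" "f = x [^] n \<otimes> s \<oplus> g" by (rule P_SucE)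
    then have "s \<in> lead n J" unfolding lead_def using Suc.prems(2) by blast
    then have "s \<in> lead n I" using lead by blast
    then obtain h where h: "h \<in> P n" "x [^] n \<otimes> s \<oplus> h \<in> I" unfolding lead_def by blast
    have "\<ominus> \<one> \<in> S" using sub by (simp add: subringE)
    from P_S_mult[OF this h(1)] have "\<ominus> h \<in> P n" using P_carrier[OF h(1)] by (simp add: l_minus)
    then have gh: "g \<ominus> h \<in> P n" unfolding minus_eq using P_add 1(2) by blast
    have c: "x [^] n \<otimes> s \<in> carrier C" "g \<in> carrier C" "h \<in> carrier C"
      using 1 h P_carrier S_carrier x by auto
    have e: "f \<ominus> (x [^] n \<otimes> s \<oplus> h) = g \<ominus> h" unfolding 1(3) using c by algebra
    have "f \<ominus> (x [^] n \<otimes> s \<oplus> h) \<in> J"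
      using left_ideal_in_diff[OF T_subring J Suc.prems(2)] le h(2) by blast
    then have "g \<ominus> h \<in> I" using Suc.IH[OF gh] e by simp
    moreover have "x [^] n \<otimes> s \<oplus> g = (x [^] n \<otimes> s \<oplus> h) \<oplus> (g \<ominus> h)" using c by algebra
    ultimately show ?case unfolding 1(3) using left_ideal_inD(3)[OF I h(2)] by simp
  qed
  then show ?thesis using left_ideal_inD(1)[OF J] T_iff by blast
qed

text \<open>The ideals \<open>lead n (I k)\<close> increase in both \<open>n\<close> and
  \<open>k\<close>, so \<open>acc_in_double\<close> gives one \<open>K\<close> for all degrees, and
  equality of all leading ideals forces equality of the ideals themselves.\<close>

theorem acc_in_skew_ext:
  assumes acc: "acc_in C S" shows "acc_in C T"
  unfolding acc_in_def
proof (intro allI impI)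
  fix I :: "nat \<Rightarrow> 'a set" assume I: "\<forall>k. left_ideal_in C T (I k)" and inc: "\<forall>k. I k \<subseteq> I (Suc k)"
  have mono: "I m \<subseteq> I n" if "m \<le> n" for m n using lift_Suc_mono_le[of I] inc that by blast
  have "lead n (I k) \<subseteq> lead n (I (Suc k))" for n k using inc unfolding lead_def by blast
  then obtain K where K: "\<And>n k. k \<ge> K \<Longrightarrow> lead n (I k) = lead n (I K)"
    using acc_in_double[OF acc, of "\<lambda>n k. lead n (I k)"] lead_ideal lead_Suc I by metis
  have "I k = I K" if "k \<ge> K" for k
  proof
    show "I k \<subseteq> I K" using eq_if_lead_eq[OF I[rule_format] I[rule_format] mono[OF that]]
      equalityD1[OF K[OF that]] by blast
  qed (rule mono[OF that])
  then show "\<exists>N. \<forall>n\<ge>N. I n = I N" by (intro exI[of _ K] allI impI)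
qed

text \<open>This keeps the induction over the generators alive: those still to be adjoined also
  normalise the enlarged ring. In the application \<open>e\<close> and \<open>e'\<close> are powers
  of \<open>qd\<close> times the unit element, hence central and already in
  \<open>S\<close>.\<close>

lemma normalising_skew_ext:
  assumes y: "y \<in> carrier C" "normalising y S"
    and e: "e \<in> S" "\<And>c. c \<in> carrier C \<Longrightarrow> e \<otimes> c = c \<otimes> e" "y \<otimes> x = x \<otimes> y \<otimes> e"
    and e': "e' \<in> S" "\<And>c. c \<in> carrier C \<Longrightarrow> e' \<otimes> c = c \<otimes> e'" "x \<otimes> y = y \<otimes> x \<otimes> e'"
  shows "normalising y T"
proof -
  \<comment> \<open>Each passage of \<open>y\<close> across one factor \<open>x\<close> costs a
    central element of \<open>S\<close>; these elements are multiplied up.\<close>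
  have pow: "\<exists>e\<in>S. (\<forall>c\<in>carrier C. e \<otimes> c = c \<otimes> e) \<and> y \<otimes> x [^] n = x [^] n \<otimes> y \<otimes> e" for n :: nat
  proof (induction n)
    case 0 then show ?case using y subringE(3)[OF sub] by (auto intro!: bexI[of _ \<one>])
  next
    case (Suc n)
    then obtain d where d: "d \<in> S" "\<forall>c\<in>carrier C. d \<otimes> c = c \<otimes> d" "y \<otimes> x [^] n = x [^] n \<otimes> y \<otimes> d" by blast
    note c = S_carrier[OF d(1)] S_carrier[OF e(1)] x y(1)
    have "y \<otimes> x [^] Suc n = (x [^] n \<otimes> y \<otimes> d) \<otimes> x" using c d(3) by (simp add: m_assoc[symmetric])
    also have "\<dots> = x [^] n \<otimes> (y \<otimes> x) \<otimes> d" using c d(2) by (simp add: m_assoc)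
    also have "\<dots> = x [^] Suc n \<otimes> y \<otimes> (e \<otimes> d)" unfolding e(3) using c by (simp add: m_assoc)
    finally have "y \<otimes> x [^] Suc n = x [^] Suc n \<otimes> y \<otimes> (e \<otimes> d)" .
    moreover have "e \<otimes> d \<otimes> z = z \<otimes> (e \<otimes> d)" if "z \<in> carrier C" for z
    proof -
      have "e \<otimes> d \<otimes> z = e \<otimes> (z \<otimes> d)" using c d(2) that by (simp add: m_assoc)
      also have "\<dots> = (e \<otimes> z) \<otimes> d" using c that by (simp add: m_assoc)
      also have "\<dots> = z \<otimes> (e \<otimes> d)" using c e(2)[OF that] that by (simp add: m_assoc)
      finally show ?thesis .
    qed
    ultimately show ?case using subringE(6)[OF sub e(1) d(1)] by blast
  qed
  \<comment> \<open>The reverse passage is driven by \<open>e'\<close>, since \<open>e\<close> is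
    not assumed to be invertible.\<close>
  have pow': "\<exists>e\<in>S. (\<forall>c\<in>carrier C. e \<otimes> c = c \<otimes> e) \<and> x [^] n \<otimes> y = y \<otimes> x [^] n \<otimes> e" for n :: nat
  proof (induction n)
    case 0 then show ?case using y subringE(3)[OF sub] by (auto intro!: bexI[of _ \<one>])
  next
    case (Suc n)
    then obtain d where d: "d \<in> S" "\<forall>c\<in>carrier C. d \<otimes> c = c \<otimes> d" "x [^] n \<otimes> y = y \<otimes> x [^] n \<otimes> d" by blast
    note c = S_carrier[OF d(1)] S_carrier[OF e'(1)] x y(1)
    have "x [^] Suc n \<otimes> y = x [^] n \<otimes> (y \<otimes> x \<otimes> e')" using c e'(3) by (simp add: m_assoc)
    also have "\<dots> = (x [^] n \<otimes> y) \<otimes> x \<otimes> e'" using c by (simp add: m_assoc)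
    also have "\<dots> = y \<otimes> x [^] n \<otimes> (d \<otimes> x) \<otimes> e'" unfolding d(3) using c by (simp add: m_assoc)
    also have "\<dots> = y \<otimes> x [^] Suc n \<otimes> (d \<otimes> e')" using c d(2) by (simp add: m_assoc)
    finally have "x [^] Suc n \<otimes> y = y \<otimes> x [^] Suc n \<otimes> (d \<otimes> e')" .
    moreover have "d \<otimes> e' \<otimes> z = z \<otimes> (d \<otimes> e')" if "z \<in> carrier C" for z
    proof -
      have "d \<otimes> e' \<otimes> z = d \<otimes> (z \<otimes> e')" using c e'(2) that by (simp add: m_assoc)
      also have "\<dots> = (d \<otimes> z) \<otimes> e'" using c that by (simp add: m_assoc)
      also have "\<dots> = z \<otimes> (d \<otimes> e')" using c bspec[OF d(2) that] that by (simp add: m_assoc)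
      finally show ?thesis .
    qed
    ultimately show ?case using subringE(6)[OF sub d(1) e'(1)] by blast
  qed
  have l: "\<exists>h\<in>P n. y \<otimes> f = h \<otimes> y" if "f \<in> P n" for f n
    using that
  proof (induction n arbitrary: f)
    case 0 then show ?case using y by simp
  next
    case (Suc n)
    from Suc.prems obtain s g where 1: "s \<in> S" "g \<in> P n" "f = x [^] n \<otimes> s \<oplus> g" by (rule P_SucE)
    obtain h where h: "h \<in> P n" "y \<otimes> g = h \<otimes> y" using Suc.IH[OF 1(2)] by blast
    obtain d where d: "d \<in> S" "y \<otimes> x [^] n = x [^] n \<otimes> y \<otimes> d" using pow by blast
    \<comment> \<open>The factor \<open>d\<close> produced by the passage is absorbed into the
      coefficient before \<open>y\<close> is moved across it.\<close>
    obtain t where t: "t \<in> S" "y \<otimes> (d \<otimes> s) = t \<otimes> y"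
      using y(2) subringE(6)[OF sub d(1) 1(1)] unfolding normalising_def by blast
    note c = S_carrier[OF d(1)] S_carrier[OF 1(1)] S_carrier[OF t(1)] P_carrier[OF 1(2)] P_carrier[OF h(1)] x y(1)
    have "y \<otimes> f = (y \<otimes> x [^] n) \<otimes> s \<oplus> y \<otimes> g" unfolding 1(3) using c by (simp add: r_distr m_assoc)
    also have "\<dots> = x [^] n \<otimes> (y \<otimes> (d \<otimes> s)) \<oplus> h \<otimes> y" unfolding d(2) h(2) using c by (simp add: m_assoc)
    also have "\<dots> = (x [^] n \<otimes> t \<oplus> h) \<otimes> y" unfolding t(2) using c by (simp add: l_distr m_assoc)
    finally show ?case using P_SucI[OF t(1) h(1)] by blast
  qed
  have r: "\<exists>h\<in>P n. f \<otimes> y = y \<otimes> h" if "f \<in> P n" for f n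
    using that
  proof (induction n arbitrary: f)
    case 0 then show ?case using y by simp
  next
    case (Suc n)
    from Suc.prems obtain s g where 1: "s \<in> S" "g \<in> P n" "f = x [^] n \<otimes> s \<oplus> g" by (rule P_SucE)
    obtain h where h: "h \<in> P n" "g \<otimes> y = y \<otimes> h" using Suc.IH[OF 1(2)] by blast
    obtain d where d: "d \<in> S" "x [^] n \<otimes> y = y \<otimes> x [^] n \<otimes> d" using pow' by blast
    obtain t where t: "t \<in> S" "s \<otimes> y = y \<otimes> t" using y(2) 1(1) unfolding normalising_def by blast
    note c = S_carrier[OF d(1)] S_carrier[OF 1(1)] S_carrier[OF t(1)] P_carrier[OF 1(2)] P_carrier[OF h(1)] x y(1)
    have "f \<otimes> y = x [^] n \<otimes> (s \<otimes> y) \<oplus> g \<otimes> y" unfolding 1(3) using c by (simp add: l_distr m_assoc)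
    also have "\<dots> = (x [^] n \<otimes> y) \<otimes> t \<oplus> y \<otimes> h" unfolding t(2) h(2) using c by (simp add: m_assoc)
    also have "\<dots> = y \<otimes> (x [^] n \<otimes> (d \<otimes> t) \<oplus> h)" unfolding d(2) using c by (simp add: r_distr m_assoc)
    finally show ?case using P_SucI[OF subringE(6)[OF sub d(1) t(1)] h(1)] by blast
  qed
  have "\<exists>h\<in>T. y \<otimes> f = h \<otimes> y" "\<exists>h\<in>T. f \<otimes> y = y \<otimes> h" if f: "f \<in> T" for f
  proof -
    obtain n where n: "f \<in> P n" using f T_iff by blast
    show "\<exists>h\<in>T. y \<otimes> f = h \<otimes> y" using l[OF n] T_iff by blast
    show "\<exists>h\<in>T. f \<otimes> y = y \<otimes> h" using r[OF n] T_iff by blast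
  qed
  then show ?thesis unfolding normalising_def by blast
qed

end

text \<open>The generators are adjoined one at a time. The induction varies \<open>S\<close>,
  because the ring obtained from one generator is the coefficient ring for the next; the commutation
  factors remain available since this ring contains \<open>S\<close>.\<close>

lemma (in ring) acc_in_normalising_generators:
  assumes "finite U" "U \<subseteq> carrier R" "subring S R" "acc_in R S" "\<And>x. x \<in> U \<Longrightarrow> normalising x S"
    "\<And>x y. x \<in> U \<Longrightarrow> y \<in> U \<Longrightarrow> \<exists>e\<in>S. (\<forall>c\<in>carrier R. e \<otimes> c = c \<otimes> e) \<and> y \<otimes> x = x \<otimes> y \<otimes> e"
  shows "\<exists>T. subring T R \<and> acc_in R T \<and> S \<union> U \<subseteq> T"
  using assms
proof (induction U arbitrary: S)
  case empty then show ?case by auto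
next
  case (insert x U)
  interpret normalising_ext R S x
    by (intro normalising_ext.intro ring_axioms normalising_ext_axioms.intro)
      (use insert.prems in auto)
  have "\<exists>T'. subring T' R \<and> acc_in R T' \<and> T \<union> U \<subseteq> T'"
  proof (rule insert.IH)
    show "U \<subseteq> carrier R" "subring T R" "acc_in R T"
      using insert.prems T_subring acc_in_skew_ext by auto
    show "\<exists>e\<in>T. (\<forall>c\<in>carrier R. e \<otimes> c = c \<otimes> e) \<and> z \<otimes> y = y \<otimes> z \<otimes> e" if "y \<in> U" "z \<in> U" for y z
      using insert.prems(5)[of y z] that S_subset_T by blast
  next
    fix y assume y: "y \<in> U"
    obtain e e' where "e\<in>S" "\<And>c. c\<in>carrier R \<Longrightarrow> e \<otimes> c = c \<otimes> e" "y \<otimes> x = x \<otimes> y \<otimes> e"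
       "e'\<in>S" "\<And>c. c\<in>carrier R \<Longrightarrow> e' \<otimes> c = c \<otimes> e'" "x \<otimes> y = y \<otimes> x \<otimes> e'"
      using insert.prems(5)[of x y] insert.prems(5)[of y x] y by blast
    then show "normalising y T" using normalising_skew_ext[of y] insert.prems(1) insert.prems(4)[of y] y by auto
  qed
  then show ?case using S_subset_T x_in_T by blast
qed

text \<open>A scalar r acts as multiplication by r times the unit element, which is central and lies
  in \<open>S\<close>. Thus q-commutation is commutation up to a central factor from the coefficient
  ring.\<close>

theorem q_commutative_algebra_acc:
  assumes q: "q_commutative_algebra R qd S C" and qd: "qd \<in> Units R" and acc: "acc_in C S"
  shows "acc_in C (carrier C)"
proof -
  interpret assoc_algebra R C using q unfolding q_commutative_algebra_def by blast
  from q obtain U where U: "finite U" "U \<subseteq> carrier C" "\<Inter> {D. R_subalgebra R C D \<and> S \<union> U \<subseteq> D} = carrier C"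
      "\<forall>x\<in>U. normalises C x S" "q_commute R qd C U" and S: "R_subalgebra R C S"
    unfolding q_commutative_algebra_def by blast
  have S1: "subring S C" and S2: "\<And>r x. r \<in> carrier R \<Longrightarrow> x \<in> S \<Longrightarrow> r \<odot>\<^bsub>C\<^esub> x \<in> S"
    using S unfolding R_subalgebra_def by blast+
  have Sc: "r \<odot>\<^bsub>C\<^esub> \<one>\<^bsub>C\<^esub> \<in> S" if "r \<in> carrier R" for r using S2[OF that subringE(3)[OF S1]] .
  have cent: "(r \<odot>\<^bsub>C\<^esub> \<one>\<^bsub>C\<^esub>) \<otimes>\<^bsub>C\<^esub> c = r \<odot>\<^bsub>C\<^esub> c" "c \<otimes>\<^bsub>C\<^esub> (r \<odot>\<^bsub>C\<^esub> \<one>\<^bsub>C\<^esub>) = r \<odot>\<^bsub>C\<^esub> c"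
    if "r \<in> carrier R" "c \<in> carrier C" for r c
    using that smult_mult_l[of r "\<one>\<^bsub>C\<^esub>" c] smult_mult_r[of r c "\<one>\<^bsub>C\<^esub>"] by simp_all
  have "\<exists>T. subring T C \<and> acc_in C T \<and> S \<union> U \<subseteq> T"
  proof (rule A.acc_in_normalising_generators[OF U(1,2) S1 acc])
    show "A.normalising x S" if "x \<in> U" for x using U(4) that A.normalises_imp_normalising by blast
  next
    fix x y assume xy: "x \<in> U" "y \<in> U"
    then obtain k :: int where k: "y \<otimes>\<^bsub>C\<^esub> x = (qd [^]\<^bsub>R\<^esub> k) \<odot>\<^bsub>C\<^esub> (x \<otimes>\<^bsub>C\<^esub> y)"
      using U(5) unfolding q_commute_def by metis
    have c: "x \<in> carrier C" "y \<in> carrier C" using xy U(2) by auto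
    have r: "qd [^]\<^bsub>R\<^esub> k \<in> carrier R"
    \<comment> \<open>The exponent may be negative; this is where \<open>qd\<close> has to be a
      unit.\<close>
    proof (cases "k < 0")
      case True
      have "inv\<^bsub>R\<^esub> (qd [^]\<^bsub>R\<^esub> nat (- k)) \<in> carrier R"
        using monoid.Units_pow_closed[OF R.monoid_axioms qd] by (intro monoid.Units_inv_closed[OF R.monoid_axioms])
      then show ?thesis unfolding int_pow_def2 using True by (simp only: if_True)
    next
      case False
      have "qd [^]\<^bsub>R\<^esub> nat k \<in> carrier R"
        using monoid.nat_pow_closed[OF R.monoid_axioms monoid.Units_closed[OF R.monoid_axioms qd]] .
      then show ?thesis unfolding int_pow_def2 using False by (simp only: if_False)
    qed
    show "\<exists>e\<in>S. (\<forall>c\<in>carrier C. e \<otimes>\<^bsub>C\<^esub> c = c \<otimes>\<^bsub>C\<^esub> e) \<and> y \<otimes>\<^bsub>C\<^esub> x = x \<otimes>\<^bsub>C\<^esub> y \<otimes>\<^bsub>C\<^esub> e"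
      using Sc[OF r] cent[OF r] k c by (intro bexI[of _ "(qd [^]\<^bsub>R\<^esub> k) \<odot>\<^bsub>C\<^esub> \<one>\<^bsub>C\<^esub>"]) auto
  qed
  then obtain T where T: "subring T C" "acc_in C T" "S \<union> U \<subseteq> T" by blast
  \<comment> \<open>A subring that contains all scalar multiples of the unit element is a
    subalgebra, so the generation hypothesis applies to \<open>T\<close>.\<close>
  have "R_subalgebra R C T" unfolding R_subalgebra_def
  proof (intro conjI ballI T(1))
    fix r x assume rx: "r \<in> carrier R" "x \<in> T"
    then have "x \<in> carrier C" using subringE(1)[OF T(1)] by blast
    then have "r \<odot>\<^bsub>C\<^esub> x = (r \<odot>\<^bsub>C\<^esub> \<one>\<^bsub>C\<^esub>) \<otimes>\<^bsub>C\<^esub> x" using cent rx by simp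
    then show "r \<odot>\<^bsub>C\<^esub> x \<in> T" using subringE(6)[OF T(1) _ rx(2), of "r \<odot>\<^bsub>C\<^esub> \<one>\<^bsub>C\<^esub>"] Sc[OF rx(1)] T(3) by auto
  qed
  then have "carrier C \<subseteq> T" using U(3) T(3) by blast
  then have "T = carrier C" using subringE(1)[OF T(1)] by blast
  then show ?thesis using T(2) by simp
qed

section \<open>Tensor products\<close>

text \<open>The additive extension of \<open>f\<close> to the free abelian group on
  \<open>S\<close>, chosen from the universal property. Its values on elements with support outside
  \<open>S\<close> are unspecified.\<close>

definition frag_lift :: "('b, 'm) ring_scheme \<Rightarrow> 'c set \<Rightarrow> ('c \<Rightarrow> 'b) \<Rightarrow> ('c \<Rightarrow>\<^sub>0 int) \<Rightarrow> 'b" where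
  "frag_lift G S f = (SOME k. k \<in> hom (free_Abelian_group S) (add_monoid G) \<and> (\<forall>x\<in>S. k (frag_of x) = f x))"

context abelian_group
begin

context
  fixes S :: "'c set" and f :: "'c \<Rightarrow> 'a"
  assumes f: "\<And>x. x \<in> S \<Longrightarrow> f x \<in> carrier G"
begin

lemma frag_lift_hom: "frag_lift G S f \<in> hom (free_Abelian_group S) (add_monoid G)"
  and frag_lift_of: "x \<in> S \<Longrightarrow> frag_lift G S f (frag_of x) = f x"
proof -
  have "\<exists>k. k \<in> hom (free_Abelian_group S) (add_monoid G) \<and> (\<forall>x\<in>S. k (frag_of x) = f x)"
  proof -
    have "f ` S \<subseteq> carrier (add_monoid G)" using f by auto
    from comm_group.free_Abelian_group_universal[OF a_comm_group this] show ?thesis by metis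
  qed
  from someI_ex[OF this] show "frag_lift G S f \<in> hom (free_Abelian_group S) (add_monoid G)"
    "x \<in> S \<Longrightarrow> frag_lift G S f (frag_of x) = f x" unfolding frag_lift_def by auto
qed

lemma frag_lift_closed: "Poly_Mapping.keys z \<subseteq> S \<Longrightarrow> frag_lift G S f z \<in> carrier G"
  using hom_in_carrier[OF frag_lift_hom, of z] by simp

lemma frag_lift_add:
  "Poly_Mapping.keys z \<subseteq> S \<Longrightarrow> Poly_Mapping.keys w \<subseteq> S
    \<Longrightarrow> frag_lift G S f (z + w) = frag_lift G S f z \<oplus> frag_lift G S f w"
  using hom_mult[OF frag_lift_hom, of z w] by simp

lemma frag_lift_0: "frag_lift G S f 0 = \<zero>"
  using frag_lift_add[of 0 0] frag_lift_closed[of 0] add.l_cancel_one[of "frag_lift G S f 0" "frag_lift G S f 0"]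
  by simp

lemma frag_lift_diff:
  assumes "Poly_Mapping.keys z \<subseteq> S" "Poly_Mapping.keys w \<subseteq> S"
  shows "frag_lift G S f (z - w) = frag_lift G S f z \<ominus> frag_lift G S f w"
proof -
  have k: "Poly_Mapping.keys (z - w) \<subseteq> S" using keys_diff[of z w] assms by blast
  have "frag_lift G S f z = frag_lift G S f (z - w) \<oplus> frag_lift G S f w"
    using frag_lift_add[OF k assms(2)] by simp
  then show ?thesis using frag_lift_closed[OF k] frag_lift_closed[OF assms(2)]
    by (simp add: minus_eq a_assoc r_neg)
qed

end

end

definition tensor_push :: "('m1 \<Rightarrow> 'm2) \<Rightarrow> ('n1 \<Rightarrow> 'n2) \<Rightarrow> ('m1 \<times> 'n1 \<Rightarrow>\<^sub>0 int) \<Rightarrow> ('m2 \<times> 'n2 \<Rightarrow>\<^sub>0 int)" where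
  "tensor_push f g = frag_extend (\<lambda>(x, y). frag_of (f x, g y))"

lemma tensor_push_simps [simp]:
  "tensor_push f g 0 = 0" "tensor_push f g (frag_of (x, y)) = frag_of (f x, g y)"
  "tensor_push f g (z + w) = tensor_push f g z + tensor_push f g w"
  "tensor_push f g (z - w) = tensor_push f g z - tensor_push f g w"
  by (simp_all add: tensor_push_def frag_extend_add frag_extend_diff)

lemma tensor_push_keys:
  assumes "Poly_Mapping.keys z \<subseteq> M \<times> N" "f ` M \<subseteq> M'" "g ` N \<subseteq> N'"
  shows "Poly_Mapping.keys (tensor_push f g z) \<subseteq> M' \<times> N'"
  unfolding tensor_push_def by (rule order_trans[OF keys_frag_extend]) (use assms in \<open>fastforce simp: keys_frag_of\<close>)

text \<open>Additive groups that are closed under the scalars suffice for computing with classes. In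
  this form the locale covers right modules, left modules, algebras and the field \<open>L\<close>,
  on either side of the tensor product.\<close>

locale tensor_factors =
  fixes S :: "('s, 'x) ring_scheme" and M :: "('s, 'm) module" and N :: "('s, 'n) module"
  assumes ab_M: "abelian_group M" and ab_N: "abelian_group N"
    and smult_M: "\<And>s x. s \<in> carrier S \<Longrightarrow> x \<in> carrier M \<Longrightarrow> s \<odot>\<^bsub>M\<^esub> x \<in> carrier M"
    and smult_N: "\<And>s x. s \<in> carrier S \<Longrightarrow> x \<in> carrier N \<Longrightarrow> s \<odot>\<^bsub>N\<^esub> x \<in> carrier N"
begin

sublocale M: abelian_group M by (rule ab_M)
sublocale N: abelian_group N by (rule ab_N)

abbreviation "Fr \<equiv> {z. Poly_Mapping.keys z \<subseteq> carrier M \<times> carrier N}"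
abbreviation "Ker \<equiv> tensor_ker S M N"
abbreviation "cls \<equiv> tensor_class S M N"

lemma Fr_diff: "z \<in> Fr \<Longrightarrow> w \<in> Fr \<Longrightarrow> z - w \<in> Fr"
  using keys_diff[of z w] by blast

lemma Fr_add: "z \<in> Fr \<Longrightarrow> w \<in> Fr \<Longrightarrow> z + w \<in> Fr"
  using Poly_Mapping.keys_add[of z w] by blast

lemma Fr_of: "x \<in> carrier M \<Longrightarrow> y \<in> carrier N \<Longrightarrow> frag_of (x, y) \<in> Fr"
  by (simp add: keys_frag_of)

lemma Fr_induct [consumes 1, case_names zero diff of]:
  assumes "z \<in> Fr" "P 0" "\<And>z w. z \<in> Fr \<Longrightarrow> w \<in> Fr \<Longrightarrow> P z \<Longrightarrow> P w \<Longrightarrow> P (z - w)"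
    "\<And>x y. x \<in> carrier M \<Longrightarrow> y \<in> carrier N \<Longrightarrow> P (frag_of (x, y))"
  shows "P z"
  using free_Abelian_group_induct[of z "carrier M \<times> carrier N" P] assms by auto

lemma rels_Fr: "tensor_rels S M N \<subseteq> Fr"
proof
  fix z assume "z \<in> tensor_rels S M N"
  from this[unfolded tensor_rels_def Un_iff mem_Collect_eq] show "z \<in> Fr"
    by - (elim disjE exE conjE; hypsubst; intro Fr_diff Fr_of; simp add: smult_M smult_N)
qed

lemma Ker_subgroup: "subgroup Ker (free_Abelian_group (carrier M \<times> carrier N))"
  unfolding tensor_ker_def using rels_Fr by (intro group.generate_is_subgroup) auto

lemma Ker_Fr: "Ker \<subseteq> Fr"
  using subgroup.subset[OF Ker_subgroup] unfolding free_Abelian_group_def by simp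

lemma Ker_0: "0 \<in> Ker"
  using subgroup.one_closed[OF Ker_subgroup] by simp

lemma Ker_add: "z \<in> Ker \<Longrightarrow> w \<in> Ker \<Longrightarrow> z + w \<in> Ker"
  using subgroup.m_closed[OF Ker_subgroup, of z w] by simp

lemma Ker_minus: "z \<in> Ker \<Longrightarrow> - z \<in> Ker"
  using subgroup.m_inv_closed[OF Ker_subgroup, of z] Ker_Fr inv_free_Abelian_group[of z] by fastforce

lemma Ker_diff: "z \<in> Ker \<Longrightarrow> w \<in> Ker \<Longrightarrow> z - w \<in> Ker"
  using Ker_add[of z "- w"] Ker_minus[of w] by simp

lemma Ker_rel: "z \<in> tensor_rels S M N \<Longrightarrow> z \<in> Ker"
  unfolding tensor_ker_def by (rule generate.incl)

lemma Ker_add_l: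
  "x \<in> carrier M \<Longrightarrow> x' \<in> carrier M \<Longrightarrow> y \<in> carrier N
    \<Longrightarrow> frag_of (x \<oplus>\<^bsub>M\<^esub> x', y) - frag_of (x, y) - frag_of (x', y) \<in> Ker"
  by (rule Ker_rel, unfold tensor_rels_def, rule UnI1, rule UnI1, intro CollectI exI conjI) (rule refl)

lemma Ker_add_r:
  "x \<in> carrier M \<Longrightarrow> y \<in> carrier N \<Longrightarrow> y' \<in> carrier N
    \<Longrightarrow> frag_of (x, y \<oplus>\<^bsub>N\<^esub> y') - frag_of (x, y) - frag_of (x, y') \<in> Ker"
  by (rule Ker_rel, unfold tensor_rels_def, rule UnI1, rule UnI2, intro CollectI exI conjI) (rule refl)

lemma Ker_smult:
  "s \<in> carrier S \<Longrightarrow> x \<in> carrier M \<Longrightarrow> y \<in> carrier N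
    \<Longrightarrow> frag_of (s \<odot>\<^bsub>M\<^esub> x, y) - frag_of (x, s \<odot>\<^bsub>N\<^esub> y) \<in> Ker"
  by (rule Ker_rel, unfold tensor_rels_def, rule UnI2, intro CollectI exI conjI) (rule refl)

lemma Ker_zero_l: "y \<in> carrier N \<Longrightarrow> frag_of (\<zero>\<^bsub>M\<^esub>, y) \<in> Ker"
  using Ker_minus[OF Ker_add_l[of "\<zero>\<^bsub>M\<^esub>" "\<zero>\<^bsub>M\<^esub>" y]] by simp

lemma Ker_zero_r: "x \<in> carrier M \<Longrightarrow> frag_of (x, \<zero>\<^bsub>N\<^esub>) \<in> Ker"
  using Ker_minus[OF Ker_add_r[of x "\<zero>\<^bsub>N\<^esub>" "\<zero>\<^bsub>N\<^esub>"]] by simp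

text \<open>Well-definedness of maps on tensor products is always reduced to this: a property that
  is stable under differences has to be tested on the three kinds of defining relations
  only.\<close>

lemma Ker_induct [consumes 1, case_names zero diff add_l add_r smult]:
  assumes z: "z \<in> Ker" and 0: "P 0"
    and diff: "\<And>z w. z \<in> Ker \<Longrightarrow> w \<in> Ker \<Longrightarrow> P z \<Longrightarrow> P w \<Longrightarrow> P (z - w)"
    and l: "\<And>x x' y. x \<in> carrier M \<Longrightarrow> x' \<in> carrier M \<Longrightarrow> y \<in> carrier N
      \<Longrightarrow> P (frag_of (x \<oplus>\<^bsub>M\<^esub> x', y) - frag_of (x, y) - frag_of (x', y))"
    and r: "\<And>x y y'. x \<in> carrier M \<Longrightarrow> y \<in> carrier N \<Longrightarrow> y' \<in> carrier N
      \<Longrightarrow> P (frag_of (x, y \<oplus>\<^bsub>N\<^esub> y') - frag_of (x, y) - frag_of (x, y'))"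
    and s: "\<And>s x y. s \<in> carrier S \<Longrightarrow> x \<in> carrier M \<Longrightarrow> y \<in> carrier N
      \<Longrightarrow> P (frag_of (s \<odot>\<^bsub>M\<^esub> x, y) - frag_of (x, s \<odot>\<^bsub>N\<^esub> y))"
  shows "P z"
proof -
  have rel: "P w" if "w \<in> tensor_rels S M N" for w
    using that unfolding tensor_rels_def Un_iff mem_Collect_eq
    by - (elim disjE exE conjE; hypsubst; (rule l r s; assumption))
  have "P z \<and> z \<in> Ker" using z unfolding tensor_ker_def
  proof (induction rule: generate.induct)
    case one then show ?case using 0 Ker_0 unfolding tensor_ker_def by simp
  next
    case (incl h) then show ?case using rel[OF incl] generate.incl[OF incl] by simp
  next
    case (inv h)
    then have "h \<in> Ker" by (rule Ker_rel)
    then have "P (0 - h)" "inv\<^bsub>free_Abelian_group (carrier M \<times> carrier N)\<^esub> h = 0 - h"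
      using diff[OF Ker_0 _ 0 rel[OF inv]] subsetD[OF Ker_Fr] inv_free_Abelian_group[of h] by simp_all
    then show ?case using generate.inv[OF inv, of "free_Abelian_group (carrier M \<times> carrier N)"] by simp
  next
    case (eng h k)
    then have hk: "h \<in> Ker" "k \<in> Ker" "P h" "P k" unfolding tensor_ker_def by auto
    have "P (0 - k)" using diff[OF Ker_0 hk(2) 0 hk(4)] .
    moreover have "0 - k \<in> Ker" using Ker_minus[OF hk(2)] by simp
    ultimately have "P (h - (0 - k))" using diff[OF hk(1) _ hk(3)] by blast
    then show ?case using Ker_add[OF hk(1,2)] unfolding tensor_ker_def by simp
  qed
  then show ?thesis ..
qed

lemma cls_iff: "w \<in> cls z \<longleftrightarrow> w - z \<in> Ker"
proof
  assume "w \<in> cls z" then show "w - z \<in> Ker" unfolding tensor_class_def r_coset_def by auto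
next
  assume "w - z \<in> Ker"
  moreover have "w = (w - z) + z" by simp
  ultimately show "w \<in> cls z" unfolding tensor_class_def r_coset_def by fastforce
qed

lemma cls_self: "z \<in> cls z"
  using Ker_0 cls_iff by simp

lemma cls_eq_iff: "cls z = cls w \<longleftrightarrow> z - w \<in> Ker"
proof
  assume "cls z = cls w" then show "z - w \<in> Ker" using cls_self cls_iff by blast
next
  assume zw: "z - w \<in> Ker"
  have "u - z \<in> Ker \<longleftrightarrow> u - w \<in> Ker" for u
    using Ker_add[OF _ zw, of "u - z"] Ker_diff[OF _ zw, of "u - w"] by auto
  then show "cls z = cls w" using cls_iff by blast
qed

lemma cls_eqI: "z - w \<in> Ker \<Longrightarrow> cls z = cls w"
  using cls_eq_iff by blast

lemma tensor_group_carrier: "carrier (tensor_group S M N) = cls ` Fr"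
  unfolding tensor_group_def FactGroup_def RCOSETS_def tensor_class_def by auto

lemma tensor_group_mult:
  assumes "z \<in> Fr" "w \<in> Fr" shows "cls z \<otimes>\<^bsub>tensor_group S M N\<^esub> cls w = cls (z + w)"
proof -
  have "cls z \<otimes>\<^bsub>tensor_group S M N\<^esub> cls w = (\<Union>a\<in>cls z. \<Union>b\<in>cls w. {a + b})"
    unfolding tensor_group_def FactGroup_def set_mult_def by simp
  also have "\<dots> = cls (z + w)"
  proof
    show "(\<Union>a\<in>cls z. \<Union>b\<in>cls w. {a + b}) \<subseteq> cls (z + w)"
    proof clarsimp
      fix a b assume "a \<in> cls z" "b \<in> cls w"
      then have "(a - z) + (b - w) \<in> Ker" using cls_iff Ker_add by blast
      then show "a + b \<in> cls (z + w)" using cls_iff by (simp add: algebra_simps)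
    qed
    show "cls (z + w) \<subseteq> (\<Union>a\<in>cls z. \<Union>b\<in>cls w. {a + b})"
    proof
      fix u assume "u \<in> cls (z + w)"
      then have "u - w \<in> cls z" using cls_iff by (simp add: algebra_simps)
      moreover have "u = (u - w) + w" by simp
      ultimately show "u \<in> (\<Union>a\<in>cls z. \<Union>b\<in>cls w. {a + b})" using cls_self by blast
    qed
  qed
  finally show ?thesis .
qed

lemma tensor_group_one: "\<one>\<^bsub>tensor_group S M N\<^esub> = cls 0"
  unfolding tensor_group_def FactGroup_def tensor_class_def r_coset_def by simp

end

text \<open>\<open>tensor_map\<close> is a union over all representatives. It collapses to a single
  class as soon as the map on representatives sends relations to relations.\<close>

lemma tensor_map_cls:
  assumes "tensor_factors S M N" "tensor_factors S' M' N'" and z: "z \<in> U" and U: "U = tensor_class S M N z"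
    and push: "\<And>w. w \<in> tensor_ker S M N \<Longrightarrow> tensor_push f g w \<in> tensor_ker S' M' N'"
  shows "tensor_map S' M' N' f g U = tensor_class S' M' N' (tensor_push f g z)"
proof -
  interpret X: tensor_factors S M N by fact
  interpret Y: tensor_factors S' M' N' by fact
  have "tensor_class S' M' N' (tensor_push f g w) = tensor_class S' M' N' (tensor_push f g z)" if "w \<in> U" for w
    using push[of "w - z"] that X.cls_iff U by (intro Y.cls_eqI) simp
  then show ?thesis unfolding tensor_map_def tensor_push_def[symmetric] using z by blast
qed

section \<open>A colon ideal criterion for flatness\<close>

text \<open>In ideal notation the condition reads (SV : s) = S (RV : s), with \<open>h\<close>
  suppressed; only the nontrivial inclusion is assumed. It is the injectivity of the map obtained by
  tensoring right multiplication by \<open>s\<close>, from R/(RV : s) to R/RV, with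
  \<open>S\<close>.\<close>

locale colon_flat = ring_hom_ring R S h for R :: "('d, 'x) ring_scheme" and S :: "('e, 'y) ring_scheme" and h +
  assumes colon: "\<lbrakk>finite V; V \<subseteq> carrier R; s \<in> carrier R; m \<in> carrier S;
      m \<otimes>\<^bsub>S\<^esub> h s \<in> gen_left_ideal S (h ` V)\<rbrakk>
    \<Longrightarrow> m \<in> gen_left_ideal S (h ` {c \<in> carrier R. c \<otimes>\<^bsub>R\<^esub> s \<in> gen_left_ideal R V})"
begin

text \<open>Left \<open>S\<close>-combinations of functions with values in \<open>R\<close>. Lists
  instead of sets allow an induction that strips one function at a time. The index type carries no
  structure here; in the proof of flatness the indices are elements of \<open>S\<close>.\<close>

primrec mspan :: "('i \<Rightarrow> 'd) list \<Rightarrow> ('i \<Rightarrow> 'e) set" where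
  "mspan [] = {\<lambda>_. \<zero>\<^bsub>S\<^esub>}"
| "mspan (w # ws) = {\<lambda>x. e \<otimes>\<^bsub>S\<^esub> h (w x) \<oplus>\<^bsub>S\<^esub> \<phi> x | e \<phi>. e \<in> carrier S \<and> \<phi> \<in> mspan ws}"

primrec dspan :: "('i \<Rightarrow> 'd) list \<Rightarrow> ('i \<Rightarrow> 'd) set" where
  "dspan [] = {\<lambda>_. \<zero>\<^bsub>R\<^esub>}"
| "dspan (w # ws) = {\<lambda>x. a \<otimes>\<^bsub>R\<^esub> w x \<oplus>\<^bsub>R\<^esub> c x | a c. a \<in> carrier R \<and> c \<in> dspan ws}"

definition valued :: "('i \<Rightarrow> 'd) set \<Rightarrow> bool" where
  "valued K \<longleftrightarrow> (\<forall>w\<in>K. \<forall>x. w x \<in> carrier R)"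

lemma valuedD: "valued K \<Longrightarrow> w \<in> K \<Longrightarrow> w x \<in> carrier R"
  unfolding valued_def by blast

lemma valued_Cons: "valued (set (w # ws)) \<Longrightarrow> valued (set ws)"
  unfolding valued_def by simp

lemma mspan_ConsE:
  assumes "\<phi> \<in> mspan (w # ws)"
  obtains e \<phi>' where "e \<in> carrier S" "\<phi>' \<in> mspan ws" "\<phi> = (\<lambda>x. e \<otimes>\<^bsub>S\<^esub> h (w x) \<oplus>\<^bsub>S\<^esub> \<phi>' x)"
  using assms by auto

lemma mspan_ConsI:
  "e \<in> carrier S \<Longrightarrow> \<phi> \<in> mspan ws \<Longrightarrow> (\<lambda>x. e \<otimes>\<^bsub>S\<^esub> h (w x) \<oplus>\<^bsub>S\<^esub> \<phi> x) \<in> mspan (w # ws)"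
  by auto

lemma dspan_ConsE:
  assumes "c \<in> dspan (w # ws)"
  obtains a c' where "a \<in> carrier R" "c' \<in> dspan ws" "c = (\<lambda>x. a \<otimes>\<^bsub>R\<^esub> w x \<oplus>\<^bsub>R\<^esub> c' x)"
  using assms by auto

lemma dspan_ConsI:
  "a \<in> carrier R \<Longrightarrow> c \<in> dspan ws \<Longrightarrow> (\<lambda>x. a \<otimes>\<^bsub>R\<^esub> w x \<oplus>\<^bsub>R\<^esub> c x) \<in> dspan (w # ws)"
  by auto

lemma mspan_closed: "valued (set ws) \<Longrightarrow> \<phi> \<in> mspan ws \<Longrightarrow> \<phi> x \<in> carrier S"
proof (induction ws arbitrary: \<phi>)
  case (Cons w ws)
  from Cons.prems(2) obtain e \<phi>' where 1: "e \<in> carrier S" "\<phi>' \<in> mspan ws" "\<phi> = (\<lambda>x. e \<otimes>\<^bsub>S\<^esub> h (w x) \<oplus>\<^bsub>S\<^esub> \<phi>' x)"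
    by (rule mspan_ConsE)
  then show ?case using Cons.IH[OF valued_Cons[OF Cons.prems(1)] 1(2)] valuedD[OF Cons.prems(1), of w x] by simp
qed simp

lemma dspan_closed: "valued (set ws) \<Longrightarrow> c \<in> dspan ws \<Longrightarrow> c x \<in> carrier R"
proof (induction ws arbitrary: c)
  case (Cons w ws)
  from Cons.prems(2) obtain a c' where 1: "a \<in> carrier R" "c' \<in> dspan ws" "c = (\<lambda>x. a \<otimes>\<^bsub>R\<^esub> w x \<oplus>\<^bsub>R\<^esub> c' x)"
    by (rule dspan_ConsE)
  then show ?case using Cons.IH[OF valued_Cons[OF Cons.prems(1)] 1(2)] valuedD[OF Cons.prems(1), of w x] by simp
qed simp

lemma valued_dspan: "valued (set ws) \<Longrightarrow> valued (dspan ws)"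
  unfolding valued_def[of "dspan ws"] by (intro ballI allI dspan_closed)

lemma mspan_Cons_incl:
  assumes v: "valued (set (w # ws))" and \<phi>: "\<phi> \<in> mspan ws" shows "\<phi> \<in> mspan (w # ws)"
proof -
  have "(\<lambda>x. \<zero>\<^bsub>S\<^esub> \<otimes>\<^bsub>S\<^esub> h (w x) \<oplus>\<^bsub>S\<^esub> \<phi> x) = \<phi>"
    using mspan_closed[OF valued_Cons[OF v] \<phi>] valuedD[OF v, of w] by (intro ext) simp
  then show ?thesis using mspan_ConsI[OF S.zero_closed \<phi>, of w] by simp
qed

lemma dspan_Cons_incl:
  assumes v: "valued (set (w # ws))" and c: "c \<in> dspan ws" shows "c \<in> dspan (w # ws)"
proof -
  have "(\<lambda>x. \<zero>\<^bsub>R\<^esub> \<otimes>\<^bsub>R\<^esub> w x \<oplus>\<^bsub>R\<^esub> c x) = c"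
    using dspan_closed[OF valued_Cons[OF v] c] valuedD[OF v, of w] by (intro ext) simp
  then show ?thesis using dspan_ConsI[OF R.zero_closed c, of w] by simp
qed

lemma mspan_zero: "valued (set ws) \<Longrightarrow> (\<lambda>_. \<zero>\<^bsub>S\<^esub>) \<in> mspan ws"
proof (induction ws)
  case (Cons w ws)
  then show ?case using mspan_Cons_incl[OF Cons.prems Cons.IH[OF valued_Cons[OF Cons.prems]]] by simp
qed simp

lemma mspan_add: "valued (set ws) \<Longrightarrow> \<phi> \<in> mspan ws \<Longrightarrow> \<psi> \<in> mspan ws \<Longrightarrow> (\<lambda>x. \<phi> x \<oplus>\<^bsub>S\<^esub> \<psi> x) \<in> mspan ws"
proof (induction ws arbitrary: \<phi> \<psi>)
  case (Cons w ws)
  from Cons.prems(2) obtain e \<phi>' where 1: "e \<in> carrier S" "\<phi>' \<in> mspan ws" "\<phi> = (\<lambda>x. e \<otimes>\<^bsub>S\<^esub> h (w x) \<oplus>\<^bsub>S\<^esub> \<phi>' x)"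
    by (rule mspan_ConsE)
  from Cons.prems(3) obtain f \<psi>' where 2: "f \<in> carrier S" "\<psi>' \<in> mspan ws" "\<psi> = (\<lambda>x. f \<otimes>\<^bsub>S\<^esub> h (w x) \<oplus>\<^bsub>S\<^esub> \<psi>' x)"
    by (rule mspan_ConsE)
  note v = valued_Cons[OF Cons.prems(1)]
  have "(\<lambda>x. \<phi> x \<oplus>\<^bsub>S\<^esub> \<psi> x) = (\<lambda>x. (e \<oplus>\<^bsub>S\<^esub> f) \<otimes>\<^bsub>S\<^esub> h (w x) \<oplus>\<^bsub>S\<^esub> (\<phi>' x \<oplus>\<^bsub>S\<^esub> \<psi>' x))"
    unfolding 1(3) 2(3) using 1 2 mspan_closed[OF v 1(2)] mspan_closed[OF v 2(2)] valuedD[OF Cons.prems(1), of w]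
    by (intro ext) (simp add: S.l_distr S.a_ac)
  then show ?case using mspan_ConsI[OF _ Cons.IH[OF v 1(2) 2(2)], of "e \<oplus>\<^bsub>S\<^esub> f" w] 1(1) 2(1) by simp
qed simp

lemma mspan_smult: "valued (set ws) \<Longrightarrow> f \<in> carrier S \<Longrightarrow> \<phi> \<in> mspan ws \<Longrightarrow> (\<lambda>x. f \<otimes>\<^bsub>S\<^esub> \<phi> x) \<in> mspan ws"
proof (induction ws arbitrary: \<phi>)
  case (Cons w ws)
  from Cons.prems(3) obtain e \<phi>' where 1: "e \<in> carrier S" "\<phi>' \<in> mspan ws" "\<phi> = (\<lambda>x. e \<otimes>\<^bsub>S\<^esub> h (w x) \<oplus>\<^bsub>S\<^esub> \<phi>' x)"
    by (rule mspan_ConsE)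
  note v = valued_Cons[OF Cons.prems(1)]
  have "(\<lambda>x. f \<otimes>\<^bsub>S\<^esub> \<phi> x) = (\<lambda>x. (f \<otimes>\<^bsub>S\<^esub> e) \<otimes>\<^bsub>S\<^esub> h (w x) \<oplus>\<^bsub>S\<^esub> (f \<otimes>\<^bsub>S\<^esub> \<phi>' x))"
    unfolding 1(3) using 1 Cons.prems mspan_closed[OF v 1(2)] valuedD[OF Cons.prems(1), of w]
    by (intro ext) (simp add: S.r_distr S.m_assoc)
  then show ?case using mspan_ConsI[OF _ Cons.IH[OF v Cons.prems(2) 1(2)], of "f \<otimes>\<^bsub>S\<^esub> e" w] 1(1) Cons.prems(2) by simp
qed simp

lemma hom_dspan: "valued (set ws) \<Longrightarrow> c \<in> dspan ws \<Longrightarrow> (\<lambda>x. h (c x)) \<in> mspan ws"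
proof (induction ws arbitrary: c)
  case (Cons w ws)
  from Cons.prems(2) obtain a c' where 1: "a \<in> carrier R" "c' \<in> dspan ws" "c = (\<lambda>x. a \<otimes>\<^bsub>R\<^esub> w x \<oplus>\<^bsub>R\<^esub> c' x)"
    by (rule dspan_ConsE)
  note v = valued_Cons[OF Cons.prems(1)]
  have "(\<lambda>x. h (c x)) = (\<lambda>x. h a \<otimes>\<^bsub>S\<^esub> h (w x) \<oplus>\<^bsub>S\<^esub> h (c' x))"
    unfolding 1(3) using 1 dspan_closed[OF v 1(2)] valuedD[OF Cons.prems(1), of w]
    by (intro ext) simp
  then show ?case using mspan_ConsI[OF _ Cons.IH[OF v 1(2)], of "h a" w] 1(1) by simp
qed simp

lemma mspan_append:
  "valued (set (us @ ws)) \<Longrightarrow> \<phi> \<in> mspan us \<Longrightarrow> \<psi> \<in> mspan ws \<Longrightarrow> (\<lambda>x. \<phi> x \<oplus>\<^bsub>S\<^esub> \<psi> x) \<in> mspan (us @ ws)"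
proof (induction us arbitrary: \<phi>)
  case Nil
  then have "(\<lambda>x. \<phi> x \<oplus>\<^bsub>S\<^esub> \<psi> x) = \<psi>" using mspan_closed[of ws \<psi>] by (intro ext) simp
  then show ?case using Nil by simp
next
  case (Cons w us)
  from Cons.prems(2) obtain e \<phi>' where 1: "e \<in> carrier S" "\<phi>' \<in> mspan us" "\<phi> = (\<lambda>x. e \<otimes>\<^bsub>S\<^esub> h (w x) \<oplus>\<^bsub>S\<^esub> \<phi>' x)"
    by (rule mspan_ConsE)
  have v: "valued (set (us @ ws))" "valued (set us)" "valued (set ws)" using Cons.prems(1) unfolding valued_def by auto
  have "(\<lambda>x. \<phi> x \<oplus>\<^bsub>S\<^esub> \<psi> x) = (\<lambda>x. e \<otimes>\<^bsub>S\<^esub> h (w x) \<oplus>\<^bsub>S\<^esub> (\<phi>' x \<oplus>\<^bsub>S\<^esub> \<psi> x))"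
    unfolding 1(3) using 1 mspan_closed[OF v(2) 1(2)] mspan_closed[OF v(3) Cons.prems(3)] valuedD[OF Cons.prems(1), of w]
    by (intro ext) (simp add: S.a_assoc)
  then show ?case using mspan_ConsI[OF 1(1) Cons.IH[OF v(1) 1(2) Cons.prems(3)], of w] by simp
qed

text \<open>The left \<open>S\<close>-span of a possibly infinite set of \<open>R\<close>-valued
  functions, each combination involving finitely many of them.\<close>

definition trace :: "('i \<Rightarrow> 'd) set \<Rightarrow> ('i \<Rightarrow> 'e) set" where
  "trace K = (\<Union>ws\<in>{ws. set ws \<subseteq> K}. mspan ws)"

lemma traceI: "set ws \<subseteq> K \<Longrightarrow> \<phi> \<in> mspan ws \<Longrightarrow> \<phi> \<in> trace K"
  unfolding trace_def by blast

lemma traceE: assumes "\<phi> \<in> trace K" obtains ws where "set ws \<subseteq> K" "\<phi> \<in> mspan ws"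
  using assms unfolding trace_def by blast

lemma trace_mono: "K \<subseteq> K' \<Longrightarrow> \<phi> \<in> trace K \<Longrightarrow> \<phi> \<in> trace K'"
  unfolding trace_def by blast

lemma valued_subset: "valued K \<Longrightarrow> K' \<subseteq> K \<Longrightarrow> valued K'"
  unfolding valued_def by blast

lemma trace_closed: "valued K \<Longrightarrow> \<phi> \<in> trace K \<Longrightarrow> \<phi> x \<in> carrier S"
  by (erule traceE) (rule mspan_closed[OF valued_subset])

lemma trace_zero: "(\<lambda>_. \<zero>\<^bsub>S\<^esub>) \<in> trace K"
  by (rule traceI[of "[]"]) auto

lemma trace_add:
  assumes "valued K" "\<phi> \<in> trace K" "\<psi> \<in> trace K" shows "(\<lambda>x. \<phi> x \<oplus>\<^bsub>S\<^esub> \<psi> x) \<in> trace K"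
proof -
  obtain us where us: "set us \<subseteq> K" "\<phi> \<in> mspan us" using assms(2) by (rule traceE)
  obtain ws where ws: "set ws \<subseteq> K" "\<psi> \<in> mspan ws" using assms(3) by (rule traceE)
  have s: "set (us @ ws) \<subseteq> K" using us ws by simp
  show ?thesis by (rule traceI[OF s mspan_append[OF valued_subset[OF assms(1) s] us(2) ws(2)]])
qed

lemma trace_smult:
  assumes "valued K" "f \<in> carrier S" "\<phi> \<in> trace K" shows "(\<lambda>x. f \<otimes>\<^bsub>S\<^esub> \<phi> x) \<in> trace K"
proof -
  obtain us where us: "set us \<subseteq> K" "\<phi> \<in> mspan us" using assms(3) by (rule traceE)
  show ?thesis by (rule traceI[OF us(1) mspan_smult[OF valued_subset[OF assms(1) us(1)] assms(2) us(2)]])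
qed

lemma trace_hom:
  assumes "valued K" "c \<in> K" shows "(\<lambda>x. h (c x)) \<in> trace K"
proof -
  have v: "valued (set [c])" using assms unfolding valued_def by simp
  have "(\<lambda>x. \<one>\<^bsub>R\<^esub> \<otimes>\<^bsub>R\<^esub> c x \<oplus>\<^bsub>R\<^esub> \<zero>\<^bsub>R\<^esub>) = c" using valuedD[OF assms] by (intro ext) simp
  then have "c \<in> dspan [c]" using dspan_ConsI[OF R.one_closed, of "\<lambda>_. \<zero>\<^bsub>R\<^esub>" "[]" c] by simp
  then show ?thesis using traceI[OF _ hom_dspan[OF v]] assms by simp
qed

end

text \<open>A linear relation with three terms covers both the additivity relations and the balancing
  relations of a tensor product.\<close>

locale colon_flat_relation = colon_flat R S h
  for R :: "('d, 'x) ring_scheme" and S :: "('e, 'y) ring_scheme" and h +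
  fixes x1 x2 x3 :: 'i and k1 k2 k3 :: 'd
  assumes k: "k1 \<in> carrier R" "k2 \<in> carrier R" "k3 \<in> carrier R"
begin

text \<open>The coefficients stand on the right, which makes \<open>form\<close> left linear in the
  function.\<close>

definition form :: "('i \<Rightarrow> 'd) \<Rightarrow> 'd" where
  "form c = c x1 \<otimes>\<^bsub>R\<^esub> k1 \<oplus>\<^bsub>R\<^esub> c x2 \<otimes>\<^bsub>R\<^esub> k2 \<oplus>\<^bsub>R\<^esub> c x3 \<otimes>\<^bsub>R\<^esub> k3"

definition mform :: "('i \<Rightarrow> 'e) \<Rightarrow> 'e" where
  "mform \<phi> = \<phi> x1 \<otimes>\<^bsub>S\<^esub> h k1 \<oplus>\<^bsub>S\<^esub> \<phi> x2 \<otimes>\<^bsub>S\<^esub> h k2 \<oplus>\<^bsub>S\<^esub> \<phi> x3 \<otimes>\<^bsub>S\<^esub> h k3"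

lemma form_closed: "(\<And>x. c x \<in> carrier R) \<Longrightarrow> form c \<in> carrier R"
  unfolding form_def using k by simp

lemma mform_closed: "(\<And>x. \<phi> x \<in> carrier S) \<Longrightarrow> mform \<phi> \<in> carrier S"
  unfolding mform_def using k by simp

lemma form_linear:
  assumes "a \<in> carrier R" "\<And>x. w x \<in> carrier R" "\<And>x. c x \<in> carrier R"
  shows "form (\<lambda>x. a \<otimes>\<^bsub>R\<^esub> w x \<oplus>\<^bsub>R\<^esub> c x) = a \<otimes>\<^bsub>R\<^esub> form w \<oplus>\<^bsub>R\<^esub> form c"
  unfolding form_def using assms k by (simp add: R.l_distr R.r_distr R.m_assoc R.a_ac)

lemma mform_add:
  assumes "\<And>x. \<phi> x \<in> carrier S" "\<And>x. \<psi> x \<in> carrier S"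
  shows "mform (\<lambda>x. \<phi> x \<oplus>\<^bsub>S\<^esub> \<psi> x) = mform \<phi> \<oplus>\<^bsub>S\<^esub> mform \<psi>"
  unfolding mform_def using assms k by (simp add: S.l_distr S.a_ac)

lemma mform_smult_hom:
  assumes "e \<in> carrier S" "\<And>x. w x \<in> carrier R"
  shows "mform (\<lambda>x. e \<otimes>\<^bsub>S\<^esub> h (w x)) = e \<otimes>\<^bsub>S\<^esub> h (form w)"
  unfolding form_def mform_def using assms k by (simp add: S.r_distr S.m_assoc)

lemma form_dspan:
  "valued (set ws) \<Longrightarrow> b \<in> gen_left_ideal R (form ` set ws) \<Longrightarrow> \<exists>g\<in>dspan ws. form g = b"
proof (induction ws arbitrary: b)
  case Nil
  then show ?case using k by (simp add: R.gen_left_ideal_empty form_def)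
next
  case (Cons w ws)
  note v = valued_Cons[OF Cons.prems(1)]
  have 1: "form w \<in> carrier R" "form ` set ws \<subseteq> carrier R"
    using form_closed valuedD[OF Cons.prems(1)] by auto
  have "b \<in> gen_left_ideal R (insert (form w) (form ` set ws))" using Cons.prems(2) by simp
  then obtain a g where a: "b = a \<otimes>\<^bsub>R\<^esub> form w \<oplus>\<^bsub>R\<^esub> g" "a \<in> carrier R" "g \<in> gen_left_ideal R (form ` set ws)"
    unfolding R.gen_left_ideal_insert[OF 1] by blast
  obtain d where d: "d \<in> dspan ws" "form d = g" using Cons.IH[OF v a(3)] by blast
  have "form (\<lambda>x. a \<otimes>\<^bsub>R\<^esub> w x \<oplus>\<^bsub>R\<^esub> d x) = b"
    using form_linear[OF a(2), of w d] valuedD[OF Cons.prems(1), of w] dspan_closed[OF v d(1)] a(1) d(2) by simp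
  then show ?case using dspan_ConsI[OF a(2) d(1), of w] by blast
qed

lemma mform_mspan:
  "valued (set ws) \<Longrightarrow> \<phi> \<in> mspan ws \<Longrightarrow> mform \<phi> \<in> gen_left_ideal S (h ` form ` set ws)"
proof (induction ws arbitrary: \<phi>)
  case Nil
  then show ?case using k by (simp add: S.gen_left_ideal_empty mform_def)
next
  case (Cons w ws)
  note v = valued_Cons[OF Cons.prems(1)]
  from Cons.prems(2) obtain e \<phi>' where 1: "e \<in> carrier S" "\<phi>' \<in> mspan ws" "\<phi> = (\<lambda>x. e \<otimes>\<^bsub>S\<^esub> h (w x) \<oplus>\<^bsub>S\<^esub> \<phi>' x)"
    by (rule mspan_ConsE)
  have w: "w x \<in> carrier R" for x using valuedD[OF Cons.prems(1)] by simp
  have 2: "h (form w) \<in> carrier S" "h ` form ` set ws \<subseteq> carrier S"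
    using form_closed valuedD[OF Cons.prems(1)] by auto
  have "mform \<phi> = e \<otimes>\<^bsub>S\<^esub> h (form w) \<oplus>\<^bsub>S\<^esub> mform \<phi>'"
    unfolding 1(3) using 1 w mspan_closed[OF v 1(2)] mform_smult_hom[OF 1(1) w]
    by (subst mform_add) simp_all
  moreover have "h ` form ` set (w # ws) = insert (h (form w)) (h ` form ` set ws)" by simp
  ultimately show ?case using Cons.IH[OF v 1(2)] 1(1) S.gen_left_ideal_insert[OF 2] by auto
qed

text \<open>Let e h(w) be the contribution of the first function. The vanishing of the form puts e
  h(form w) into the ideal generated by the values of the form at the other functions. The colon
  condition then expresses \<open>e\<close> through elements b with b (form w) = form g, where g is
  in the span of the other functions. Each b w - g is a solution over \<open>R\<close>, and what
  remains involves a shorter list.\<close>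

theorem mspan_kernel:
  "valued (set ws) \<Longrightarrow> \<phi> \<in> mspan ws \<Longrightarrow> mform \<phi> = \<zero>\<^bsub>S\<^esub> \<Longrightarrow> \<phi> \<in> trace {c \<in> dspan ws. form c = \<zero>\<^bsub>R\<^esub>}"
proof (induction ws arbitrary: \<phi>)
  case Nil then show ?case using trace_zero by simp
next
  case (Cons w ws)
  let ?P = "{c \<in> dspan (w # ws). form c = \<zero>\<^bsub>R\<^esub>}"
  note vv = Cons.prems(1)
  note v = valued_Cons[OF vv]
  have vP: "valued ?P" by (rule valued_subset[OF valued_dspan[OF vv]]) auto
  have w: "w x \<in> carrier R" for x using valuedD[OF vv] by simp
  from Cons.prems(2) obtain e \<phi>' where 1: "e \<in> carrier S" "\<phi>' \<in> mspan ws" "\<phi> = (\<lambda>x. e \<otimes>\<^bsub>S\<^esub> h (w x) \<oplus>\<^bsub>S\<^esub> \<phi>' x)"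
    by (rule mspan_ConsE)
  have \<phi>'c: "\<phi>' x \<in> carrier S" for x using mspan_closed[OF v 1(2)] .
  let ?V = "form ` set ws"
  have V: "finite ?V" "?V \<subseteq> carrier R" "h ` ?V \<subseteq> carrier S"
    using form_closed valuedD[OF v] by auto
  have fw: "form w \<in> carrier R" using form_closed w by blast
  note G = S.left_ideal_in_gen[OF V(3)]
  have "mform \<phi> = e \<otimes>\<^bsub>S\<^esub> h (form w) \<oplus>\<^bsub>S\<^esub> mform \<phi>'"
    unfolding 1(3) using 1 w \<phi>'c mform_smult_hom[OF 1(1) w] by (subst mform_add) simp_all
  then have "e \<otimes>\<^bsub>S\<^esub> h (form w) \<oplus>\<^bsub>S\<^esub> mform \<phi>' = \<zero>\<^bsub>S\<^esub>" using Cons.prems(3) by simp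
  then have "e \<otimes>\<^bsub>S\<^esub> h (form w) = \<ominus>\<^bsub>S\<^esub> mform \<phi>'"
    using 1(1) fw mform_closed[OF \<phi>'c] S.minus_equality[of "e \<otimes>\<^bsub>S\<^esub> h (form w)" "mform \<phi>'"] by simp
  then have "e \<otimes>\<^bsub>S\<^esub> h (form w) \<in> gen_left_ideal S (h ` ?V)"
    using S.left_ideal_in_minus[OF S.subring_carrier G mform_mspan[OF v 1(2)]] by simp
  from colon[OF V(1,2) fw 1(1) this]
  have e: "e \<in> gen_left_ideal S (h ` {b \<in> carrier R. b \<otimes>\<^bsub>R\<^esub> form w \<in> gen_left_ideal R ?V})" .
  \<comment> \<open>The elements \<open>e\<close> for which e h(w) is a combination of solutions up
    to the span of the remaining functions. This is a left ideal, so only the generators supplied by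
    the colon condition have to be tested.\<close>
  let ?J = "{e \<in> carrier S. \<exists>\<phi>1\<in>trace ?P. \<exists>\<phi>2\<in>mspan ws. \<forall>x. e \<otimes>\<^bsub>S\<^esub> h (w x) = \<phi>1 x \<oplus>\<^bsub>S\<^esub> \<phi>2 x}"
  have "left_ideal_in S (carrier S) ?J"
  proof (intro left_ideal_inI)
    have eqx: "\<zero>\<^bsub>S\<^esub> \<otimes>\<^bsub>S\<^esub> h (w x) = \<zero>\<^bsub>S\<^esub> \<oplus>\<^bsub>S\<^esub> \<zero>\<^bsub>S\<^esub>" for x using w by simp
    show "\<zero>\<^bsub>S\<^esub> \<in> ?J"
      by (intro CollectI conjI S.zero_closed allI eqx bexI[OF _ trace_zero] bexI[OF _ mspan_zero[OF v]])
  next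
    fix a b assume "a \<in> ?J" "b \<in> ?J"
    then obtain \<phi>1 \<phi>2 \<psi>1 \<psi>2 where a: "a \<in> carrier S" "\<phi>1 \<in> trace ?P" "\<phi>2 \<in> mspan ws" "\<And>x. a \<otimes>\<^bsub>S\<^esub> h (w x) = \<phi>1 x \<oplus>\<^bsub>S\<^esub> \<phi>2 x"
      and b: "b \<in> carrier S" "\<psi>1 \<in> trace ?P" "\<psi>2 \<in> mspan ws" "\<And>x. b \<otimes>\<^bsub>S\<^esub> h (w x) = \<psi>1 x \<oplus>\<^bsub>S\<^esub> \<psi>2 x" by auto
    note c = trace_closed[OF vP a(2)] trace_closed[OF vP b(2)] mspan_closed[OF v a(3)] mspan_closed[OF v b(3)]
    have eqx: "(a \<oplus>\<^bsub>S\<^esub> b) \<otimes>\<^bsub>S\<^esub> h (w x) = (\<phi>1 x \<oplus>\<^bsub>S\<^esub> \<psi>1 x) \<oplus>\<^bsub>S\<^esub> (\<phi>2 x \<oplus>\<^bsub>S\<^esub> \<psi>2 x)" for x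
      using a(1) b(1) w c by (simp add: S.l_distr a(4) b(4) S.a_ac)
    show "a \<oplus>\<^bsub>S\<^esub> b \<in> ?J"
      by (intro CollectI conjI S.a_closed[OF a(1) b(1)] allI eqx
          bexI[OF _ trace_add[OF vP a(2) b(2)]] bexI[OF _ mspan_add[OF v a(3) b(3)]])
  next
    fix f a assume f: "f \<in> carrier S" and "a \<in> ?J"
    then obtain \<phi>1 \<phi>2 where a: "a \<in> carrier S" "\<phi>1 \<in> trace ?P" "\<phi>2 \<in> mspan ws" "\<And>x. a \<otimes>\<^bsub>S\<^esub> h (w x) = \<phi>1 x \<oplus>\<^bsub>S\<^esub> \<phi>2 x"
      by auto
    note c = trace_closed[OF vP a(2)] mspan_closed[OF v a(3)]
    have eqx: "(f \<otimes>\<^bsub>S\<^esub> a) \<otimes>\<^bsub>S\<^esub> h (w x) = (f \<otimes>\<^bsub>S\<^esub> \<phi>1 x) \<oplus>\<^bsub>S\<^esub> (f \<otimes>\<^bsub>S\<^esub> \<phi>2 x)" for x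
      using a(1) f w c by (simp add: S.m_assoc a(4) S.r_distr)
    show "f \<otimes>\<^bsub>S\<^esub> a \<in> ?J"
      by (intro CollectI conjI S.m_closed[OF f a(1)] allI eqx
          bexI[OF _ trace_smult[OF vP f a(2)]] bexI[OF _ mspan_smult[OF v f a(3)]])
  qed auto
  moreover have "h ` {b \<in> carrier R. b \<otimes>\<^bsub>R\<^esub> form w \<in> gen_left_ideal R ?V} \<subseteq> ?J"
  proof (rule image_subsetI)
    fix b assume "b \<in> {b \<in> carrier R. b \<otimes>\<^bsub>R\<^esub> form w \<in> gen_left_ideal R ?V}"
    then have b: "b \<in> carrier R" "b \<otimes>\<^bsub>R\<^esub> form w \<in> gen_left_ideal R ?V" by auto
    obtain g where g: "g \<in> dspan ws" "form g = b \<otimes>\<^bsub>R\<^esub> form w" using form_dspan[OF v b(2)] by blast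
    have gc: "g x \<in> carrier R" for x using dspan_closed[OF v g(1)] .
    have ng: "(\<lambda>x. \<ominus>\<^bsub>R\<^esub> g x) \<in> dspan ws"
    proof -
      have "(\<lambda>x. a \<otimes>\<^bsub>R\<^esub> g x) \<in> dspan ws" if "a \<in> carrier R" "valued (set ws)" "g \<in> dspan ws" for a ws g
        using that(2,3)
      proof (induction ws arbitrary: g)
        case (Cons u us)
        from Cons.prems(2) obtain a' c' where 1: "a' \<in> carrier R" "c' \<in> dspan us" "g = (\<lambda>x. a' \<otimes>\<^bsub>R\<^esub> u x \<oplus>\<^bsub>R\<^esub> c' x)"
          by (rule dspan_ConsE)
        note v = valued_Cons[OF Cons.prems(1)]
        have "(\<lambda>x. a \<otimes>\<^bsub>R\<^esub> g x) = (\<lambda>x. (a \<otimes>\<^bsub>R\<^esub> a') \<otimes>\<^bsub>R\<^esub> u x \<oplus>\<^bsub>R\<^esub> a \<otimes>\<^bsub>R\<^esub> c' x)"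
          unfolding 1(3) using 1 that(1) dspan_closed[OF v 1(2)] valuedD[OF Cons.prems(1), of u]
          by (intro ext) (simp add: R.r_distr R.m_assoc)
        then show ?case using dspan_ConsI[OF _ Cons.IH[OF v 1(2)], of "a \<otimes>\<^bsub>R\<^esub> a'" u] 1(1) that(1) by simp
      qed (use that(1) in simp)
      from this[OF _ v g(1), of "\<ominus>\<^bsub>R\<^esub> \<one>\<^bsub>R\<^esub>"] show ?thesis using gc by (simp add: R.l_minus)
    qed
    \<comment> \<open>Subtracting \<open>g\<close> from b w yields a function with values in
      \<open>R\<close> on which the form vanishes.\<close>
    have cd: "(\<lambda>x. b \<otimes>\<^bsub>R\<^esub> w x \<oplus>\<^bsub>R\<^esub> \<ominus>\<^bsub>R\<^esub> g x) \<in> dspan (w # ws)" by (rule dspan_ConsI[OF b(1) ng])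
    have "form (\<lambda>x. \<ominus>\<^bsub>R\<^esub> g x) = \<ominus>\<^bsub>R\<^esub> form g"
      unfolding form_def using gc k by (simp add: R.l_minus R.minus_add)
    then have "form (\<lambda>x. b \<otimes>\<^bsub>R\<^esub> w x \<oplus>\<^bsub>R\<^esub> \<ominus>\<^bsub>R\<^esub> g x) = \<zero>\<^bsub>R\<^esub>"
      using form_linear[OF b(1), of w "\<lambda>x. \<ominus>\<^bsub>R\<^esub> g x"] w gc g(2) b(1) fw by (simp add: R.r_neg)
    with cd have c: "(\<lambda>x. b \<otimes>\<^bsub>R\<^esub> w x \<oplus>\<^bsub>R\<^esub> \<ominus>\<^bsub>R\<^esub> g x) \<in> ?P" by simp
    have eqx: "h b \<otimes>\<^bsub>S\<^esub> h (w x) = h (b \<otimes>\<^bsub>R\<^esub> w x \<oplus>\<^bsub>R\<^esub> \<ominus>\<^bsub>R\<^esub> g x) \<oplus>\<^bsub>S\<^esub> h (g x)" for x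
      using b(1) w gc by (simp add: S.a_assoc S.l_neg)
    show "h b \<in> ?J"
      by (intro CollectI conjI hom_closed[OF b(1)] allI eqx
          bexI[OF _ trace_hom[OF vP c]] bexI[OF _ hom_dspan[OF v g(1)]])
  qed
  ultimately have "e \<in> ?J" by (rule subsetD[OF S.gen_left_ideal_minimal e])
  then obtain \<phi>1 \<phi>2 where \<phi>: "\<phi>1 \<in> trace ?P" "\<phi>2 \<in> mspan ws" "\<And>x. e \<otimes>\<^bsub>S\<^esub> h (w x) = \<phi>1 x \<oplus>\<^bsub>S\<^esub> \<phi>2 x" by auto
  note c = trace_closed[OF vP \<phi>(1)] mspan_closed[OF v \<phi>(2)]
  \<comment> \<open>Everything that lies in the span of the shorter list is gathered in \<psi>; the
    induction hypothesis applies once its form is seen to vanish.\<close>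
  define \<psi> where "\<psi> = (\<lambda>x. \<phi>2 x \<oplus>\<^bsub>S\<^esub> \<phi>' x)"
  have \<psi>: "\<psi> \<in> mspan ws" unfolding \<psi>_def by (rule mspan_add[OF v \<phi>(2) 1(2)])
  have eq: "\<phi> = (\<lambda>x. \<phi>1 x \<oplus>\<^bsub>S\<^esub> \<psi> x)"
    unfolding 1(3) \<psi>_def \<phi>(3) using c \<phi>'c by (intro ext) (simp add: S.a_assoc)
  obtain us where us: "set us \<subseteq> ?P" "\<phi>1 \<in> mspan us" using \<phi>(1) by (rule traceE)
  have z: "mform \<phi>1 = \<zero>\<^bsub>S\<^esub>" if "set us \<subseteq> ?P" "\<phi>1 \<in> mspan us" for us \<phi>1
    using that
  proof (induction us arbitrary: \<phi>1)
    case Nil then show ?case using k by (simp add: mform_def)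
  next
    case (Cons u us)
    from Cons.prems(2) obtain e \<phi>' where 1: "e \<in> carrier S" "\<phi>' \<in> mspan us" "\<phi>1 = (\<lambda>x. e \<otimes>\<^bsub>S\<^esub> h (u x) \<oplus>\<^bsub>S\<^esub> \<phi>' x)"
      by (rule mspan_ConsE)
    have u: "u x \<in> carrier R" for x using valuedD[OF vP] Cons.prems(1) by auto
    have "\<phi>' x \<in> carrier S" for x using mspan_closed[OF valued_subset[OF vP] 1(2)] Cons.prems(1) by auto
    then have "mform \<phi>1 = e \<otimes>\<^bsub>S\<^esub> h (form u) \<oplus>\<^bsub>S\<^esub> mform \<phi>'"
      unfolding 1(3) using 1 u mform_smult_hom[OF 1(1) u] by (subst mform_add) simp_all
    then show ?case using Cons.IH[OF _ 1(2)] Cons.prems(1) 1(1) by simp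
  qed
  have "mform \<phi> = mform \<phi>1 \<oplus>\<^bsub>S\<^esub> mform \<psi>"
    unfolding eq using c mspan_closed[OF v \<psi>] by (intro mform_add)
  then have "mform \<psi> = \<zero>\<^bsub>S\<^esub>" using z[OF us] Cons.prems(3) mform_closed[OF mspan_closed[OF v \<psi>]] by simp
  from Cons.IH[OF v \<psi> this] have "\<psi> \<in> trace {c \<in> dspan ws. form c = \<zero>\<^bsub>R\<^esub>}" .
  then have "\<psi> \<in> trace ?P" using dspan_Cons_incl[OF vv]
    by (elim trace_mono[rotated]) blast
  then show ?case unfolding eq by (rule trace_add[OF vP \<phi>(1)])
qed

end

context colon_flat
begin

definition good :: "('i \<Rightarrow> 'd) set \<Rightarrow> bool" where
  "good K \<longleftrightarrow> valued K \<and> (\<lambda>_. \<zero>\<^bsub>R\<^esub>) \<in> K \<and>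
     (\<forall>a\<in>carrier R. \<forall>w\<in>K. \<forall>c\<in>K. (\<lambda>x. a \<otimes>\<^bsub>R\<^esub> w x \<oplus>\<^bsub>R\<^esub> c x) \<in> K)"

text \<open>Every finite part of the identity of \<^term>\<open>S\<close> factors through the functions in \<^term>\<open>K\<close>.\<close>

definition resolving :: "('e \<Rightarrow> 'd) set \<Rightarrow> bool" where
  "resolving K \<longleftrightarrow> good K \<and> (\<forall>Y. finite Y \<longrightarrow> Y \<subseteq> carrier S \<longrightarrow> (\<exists>\<phi>\<in>trace K. \<forall>x\<in>Y. \<phi> x = x))"

text \<open>Kronecker deltas interpolate the identity at finitely many points. The set of all
  functions is the starting point that is afterwards cut down relation by relation.\<close>

lemma resolving_all: "resolving {c. \<forall>x. c x \<in> carrier R}" (is "resolving ?K")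
proof -
  have g: "good ?K" unfolding good_def valued_def by simp
  then have v: "valued ?K" unfolding good_def by blast
  have "\<exists>\<phi>\<in>trace ?K. \<forall>x\<in>Y. \<phi> x = x" if "finite Y" "Y \<subseteq> carrier S" for Y
    using that
  proof (induction Y)
    case empty then show ?case using trace_zero by blast
  next
    case (insert y Y)
    then obtain \<phi> where \<phi>: "\<phi> \<in> trace ?K" "\<forall>x\<in>Y. \<phi> x = x" by auto
    define \<delta> where "\<delta> x = (if x = y then \<one>\<^bsub>R\<^esub> else \<zero>\<^bsub>R\<^esub>)" for x
    have \<delta>: "\<delta> \<in> ?K" unfolding \<delta>_def by simp
    have c: "\<phi> x \<in> carrier S" for x using trace_closed[OF v \<phi>(1)] .
    have y: "y \<in> carrier S" using insert.prems by simp
    let ?\<psi> = "\<lambda>x. (y \<ominus>\<^bsub>S\<^esub> \<phi> y) \<otimes>\<^bsub>S\<^esub> h (\<delta> x) \<oplus>\<^bsub>S\<^esub> \<phi> x"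
    have "?\<psi> \<in> trace ?K"
      using trace_add[OF v trace_smult[OF v _ trace_hom[OF v \<delta>]] \<phi>(1)] y c by simp
    moreover have "?\<psi> y = y" unfolding \<delta>_def using y c by (simp add: S.minus_eq S.a_assoc S.l_neg)
    moreover have "?\<psi> x = \<phi> x" if "x \<noteq> y" for x unfolding \<delta>_def using that y c by simp
    ultimately have "?\<psi> \<in> trace ?K \<and> (\<forall>x\<in>insert y Y. ?\<psi> x = x)" using \<phi>(2) by (metis insert_iff)
    then show ?case by (intro bexI[where x = ?\<psi>]) auto
  qed
  then show ?thesis unfolding resolving_def using g by blast
qed

text \<open>A combination \<phi> that fixes the three elements turns the relation in
  \<open>S\<close> into the vanishing of \<open>mform\<close> at \<phi>. By
  \<open>mspan_kernel\<close>, \<phi> is then a combination of functions that satisfy the same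
  relation in \<open>R\<close>, so one more relation may be imposed on the functions.\<close>

lemma resolving_relation:
  assumes K: "resolving K" and x: "x1 \<in> carrier S" "x2 \<in> carrier S" "x3 \<in> carrier S"
    and k: "k1 \<in> carrier R" "k2 \<in> carrier R" "k3 \<in> carrier R"
    and rel: "x1 \<otimes>\<^bsub>S\<^esub> h k1 \<oplus>\<^bsub>S\<^esub> x2 \<otimes>\<^bsub>S\<^esub> h k2 \<oplus>\<^bsub>S\<^esub> x3 \<otimes>\<^bsub>S\<^esub> h k3 = \<zero>\<^bsub>S\<^esub>"
  shows "resolving {c \<in> K. c x1 \<otimes>\<^bsub>R\<^esub> k1 \<oplus>\<^bsub>R\<^esub> c x2 \<otimes>\<^bsub>R\<^esub> k2 \<oplus>\<^bsub>R\<^esub> c x3 \<otimes>\<^bsub>R\<^esub> k3 = \<zero>\<^bsub>R\<^esub>}" (is "resolving ?K'")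
proof -
  interpret f: colon_flat_relation R S h x1 x2 x3 k1 k2 k3
    by unfold_locales (use k in auto)
  have K': "?K' = {c \<in> K. f.form c = \<zero>\<^bsub>R\<^esub>}" unfolding f.form_def by simp
  have g: "good K" using K unfolding resolving_def by blast
  have v: "valued K" and lin: "\<And>a w c. a \<in> carrier R \<Longrightarrow> w \<in> K \<Longrightarrow> c \<in> K \<Longrightarrow> (\<lambda>x. a \<otimes>\<^bsub>R\<^esub> w x \<oplus>\<^bsub>R\<^esub> c x) \<in> K"
    and z: "(\<lambda>_. \<zero>\<^bsub>R\<^esub>) \<in> K"
    using g unfolding good_def by blast+
  have span: "dspan ws \<subseteq> K" if "set ws \<subseteq> K" for ws
    using that
  proof (induction ws)
    case (Cons w ws)
    show ?case
    proof
      fix c assume "c \<in> dspan (w # ws)"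
      then obtain a c' where "a \<in> carrier R" "c' \<in> dspan ws" "c = (\<lambda>x. a \<otimes>\<^bsub>R\<^esub> w x \<oplus>\<^bsub>R\<^esub> c' x)"
        by (rule dspan_ConsE)
      then show "c \<in> K" using Cons lin by auto
    qed
  qed (use z in simp)
  have "good ?K'" unfolding good_def
  proof (intro conjI ballI)
    show "valued ?K'" by (rule valued_subset[OF v]) auto
    show "(\<lambda>_. \<zero>\<^bsub>R\<^esub>) \<in> ?K'" using z k by simp
  next
    fix a w c assume a: "a \<in> carrier R" and w: "w \<in> ?K'" and c: "c \<in> ?K'"
    have wc: "w x \<in> carrier R" "c x \<in> carrier R" for x using valuedD[OF v] w c by auto
    have "f.form (\<lambda>x. a \<otimes>\<^bsub>R\<^esub> w x \<oplus>\<^bsub>R\<^esub> c x) = \<zero>\<^bsub>R\<^esub>"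
      using f.form_linear[of a w c] a wc w c unfolding K' by simp
    then show "(\<lambda>x. a \<otimes>\<^bsub>R\<^esub> w x \<oplus>\<^bsub>R\<^esub> c x) \<in> ?K'" unfolding K' using lin[OF a] w c by simp
  qed
  moreover have "\<exists>\<phi>\<in>trace ?K'. \<forall>x\<in>Y. \<phi> x = x" if Y: "finite Y" "Y \<subseteq> carrier S" for Y
  proof -
    \<comment> \<open>The three elements of the relation join \<open>Y\<close>, so that \<phi> fixes
      them as well.\<close>
    have "finite (Y \<union> {x1, x2, x3})" "Y \<union> {x1, x2, x3} \<subseteq> carrier S" using Y x by auto
    then obtain \<phi> where \<phi>: "\<phi> \<in> trace K" "\<forall>y\<in>Y \<union> {x1, x2, x3}. \<phi> y = y"
      using K unfolding resolving_def by meson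
    obtain ws where ws: "set ws \<subseteq> K" "\<phi> \<in> mspan ws" using \<phi>(1) by (rule traceE)
    have "f.mform \<phi> = \<zero>\<^bsub>S\<^esub>" unfolding f.mform_def using \<phi>(2) rel by simp
    then have "\<phi> \<in> trace {c \<in> dspan ws. f.form c = \<zero>\<^bsub>R\<^esub>}"
      by (rule f.mspan_kernel[OF valued_subset[OF v ws(1)] ws(2)])
    then have "\<phi> \<in> trace ?K'" unfolding K' using span[OF ws(1)] by (elim trace_mono[rotated]) blast
    then show ?thesis using \<phi>(2) by blast
  qed
  ultimately show ?thesis unfolding resolving_def by blast
qed

section \<open>Contraction of tensors along coordinate functions\<close>

abbreviation "M \<equiv> right_module_via h S"

lemma M_simps: "carrier M = carrier S" "add M = add S" "\<zero>\<^bsub>M\<^esub> = \<zero>\<^bsub>S\<^esub>" "s \<odot>\<^bsub>M\<^esub> x = x \<otimes>\<^bsub>S\<^esub> h s"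
  by (simp_all add: right_module_via_def)

lemma M_abelian_group: "abelian_group M"
  by (rule abelian_groupI) (simp_all add: M_simps S.a_ac S.add.l_inv_ex)

lemma M_right_module: "right_module R M"
  by (intro right_module.intro R.ring_axioms M_abelian_group right_module_axioms.intro)
    (simp_all add: M_simps S.l_distr S.r_distr S.m_assoc)

lemma tensor_factors_M:
  assumes "left_module R N" shows "tensor_factors R M N"
proof -
  interpret N: left_module R N by fact
  show ?thesis
    by (intro tensor_factors.intro M_abelian_group N.abelian_group_axioms N.lsmult_closed)
      (auto simp: M_simps)
qed

context
  fixes N :: "('d, 'n) module"
  assumes N: "left_module R N"
begin

interpretation N: left_module R N by (rule N)
interpretation T: tensor_factors R M N by (rule tensor_factors_M[OF N])

text \<open>The pair (x, y) is sent to c(x) y. The function \<open>c\<close> need not be additive or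
  linear, so the contraction lives on the free abelian group and may fail to respect the relations
  of the tensor product.\<close>

definition contract :: "('e \<Rightarrow> 'd) \<Rightarrow> ('e \<times> 'n \<Rightarrow>\<^sub>0 int) \<Rightarrow> 'n" where
  "contract c = frag_lift N (carrier M \<times> carrier N) (\<lambda>(x, y). c x \<odot>\<^bsub>N\<^esub> y)"

lemma contract:
  assumes c: "\<And>x. c x \<in> carrier R"
  shows "contract c 0 = \<zero>\<^bsub>N\<^esub>"
    "z \<in> T.Fr \<Longrightarrow> contract c z \<in> carrier N"
    "z \<in> T.Fr \<Longrightarrow> w \<in> T.Fr \<Longrightarrow> contract c (z - w) = contract c z \<ominus>\<^bsub>N\<^esub> contract c w"
    "x \<in> carrier S \<Longrightarrow> y \<in> carrier N \<Longrightarrow> contract c (frag_of (x, y)) = c x \<odot>\<^bsub>N\<^esub> y"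
proof -
  have f: "(case p of (x, y) \<Rightarrow> c x \<odot>\<^bsub>N\<^esub> y) \<in> carrier N" if "p \<in> carrier M \<times> carrier N" for p
    using that c N.lsmult_closed by auto
  note L = N.frag_lift_0[OF f] N.frag_lift_closed[OF f] N.frag_lift_diff[OF f] N.frag_lift_of[OF f]
  show "contract c 0 = \<zero>\<^bsub>N\<^esub>" unfolding contract_def by (rule L(1))
  show "z \<in> T.Fr \<Longrightarrow> contract c z \<in> carrier N"
    "z \<in> T.Fr \<Longrightarrow> w \<in> T.Fr \<Longrightarrow> contract c (z - w) = contract c z \<ominus>\<^bsub>N\<^esub> contract c w"
    unfolding contract_def using L(2,3) by simp_all
  show "x \<in> carrier S \<Longrightarrow> y \<in> carrier N \<Longrightarrow> contract c (frag_of (x, y)) = c x \<odot>\<^bsub>N\<^esub> y"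
    unfolding contract_def by (subst L(4)) (auto simp: M_simps)
qed

lemma contract_diff2:
  assumes c: "\<And>x. c x \<in> carrier R" and xy: "x \<in> carrier S" "y \<in> carrier N" "x' \<in> carrier S" "y' \<in> carrier N"
  shows "contract c (frag_of (x, y) - frag_of (x', y')) = c x \<odot>\<^bsub>N\<^esub> y \<ominus>\<^bsub>N\<^esub> c x' \<odot>\<^bsub>N\<^esub> y'"
proof -
  have F: "frag_of (x, y) \<in> T.Fr" "frag_of (x', y') \<in> T.Fr" using xy by (auto simp: keys_frag_of M_simps)
  show ?thesis unfolding contract(3)[OF c F] contract(4)[OF c xy(1,2)] contract(4)[OF c xy(3,4)] ..
qed

lemma contract_diff3:
  assumes c: "\<And>x. c x \<in> carrier R" and xy: "x \<in> carrier S" "y \<in> carrier N" "x' \<in> carrier S" "y' \<in> carrier N"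
    "x'' \<in> carrier S" "y'' \<in> carrier N"
  shows "contract c (frag_of (x, y) - frag_of (x', y') - frag_of (x'', y''))
    = c x \<odot>\<^bsub>N\<^esub> y \<ominus>\<^bsub>N\<^esub> c x' \<odot>\<^bsub>N\<^esub> y' \<ominus>\<^bsub>N\<^esub> c x'' \<odot>\<^bsub>N\<^esub> y''"
proof -
  have F: "frag_of (x, y) \<in> T.Fr" "frag_of (x', y') \<in> T.Fr" "frag_of (x'', y'') \<in> T.Fr"
    using xy by (auto simp: keys_frag_of M_simps)
  show ?thesis
    unfolding contract(3)[OF c T.Fr_diff[OF F(1,2)] F(3)] contract_diff2[OF c xy(1-4)] contract(4)[OF c xy(5,6)] ..
qed

text \<open>Each relation that occurs in \<open>z\<close> costs at most one application of
  \<open>resolving_relation\<close>: when all functions of the smaller set respect it, their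
  contractions annihilate it. As finitely many relations occur, a resolving set is left at the
  end.\<close>

lemma contract_Ker:
  "z \<in> T.Ker \<Longrightarrow> resolving K \<Longrightarrow> \<exists>K'\<subseteq>K. resolving K' \<and> (\<forall>c\<in>K'. contract c z = \<zero>\<^bsub>N\<^esub>)"
proof (induction z arbitrary: K rule: T.Ker_induct)
  case zero
  have "contract c 0 = \<zero>\<^bsub>N\<^esub>" if c: "c \<in> K" for c
  proof -
    have "c x \<in> carrier R" for x using zero c unfolding resolving_def good_def valued_def by simp
    then show ?thesis by (rule contract(1))
  qed
  then show ?case using zero by (intro exI[of _ K] conjI subset_refl ballI)
next
  case (diff z w)
  obtain K' where K': "K' \<subseteq> K" "resolving K'" "\<forall>c\<in>K'. contract c z = \<zero>\<^bsub>N\<^esub>" using diff.IH(1) diff.prems by blast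
  obtain K'' where K'': "K'' \<subseteq> K'" "resolving K''" "\<forall>c\<in>K''. contract c w = \<zero>\<^bsub>N\<^esub>" using diff.IH(2)[OF K'(2)] by blast
  have "contract c (z - w) = \<zero>\<^bsub>N\<^esub>" if c: "c \<in> K''" for c
  proof -
    have "c x \<in> carrier R" for x using K''(2) c unfolding resolving_def good_def valued_def by simp
    then show ?thesis
      using contract(3)[of c z w] subsetD[OF T.Ker_Fr diff.hyps(1)] subsetD[OF T.Ker_Fr diff.hyps(2)]
        bspec[OF K'(3) subsetD[OF K''(1) c]] bspec[OF K''(3) c]
      by (simp add: N.minus_eq)
  qed
  then show ?case using K''(2) subset_trans[OF K''(1) K'(1)] by (intro exI[of _ K''] conjI ballI)
next
  case (add_l x x' y)
  \<comment> \<open>Additivity of \<open>c\<close> at \<open>x\<close> and \<open>x'\<close>,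
    written as a three-term relation with coefficients 1, -1, -1.\<close>
  let ?K' = "{c \<in> K. c (x \<oplus>\<^bsub>S\<^esub> x') \<otimes>\<^bsub>R\<^esub> \<one>\<^bsub>R\<^esub> \<oplus>\<^bsub>R\<^esub> c x \<otimes>\<^bsub>R\<^esub> (\<ominus>\<^bsub>R\<^esub> \<one>\<^bsub>R\<^esub>) \<oplus>\<^bsub>R\<^esub> c x' \<otimes>\<^bsub>R\<^esub> (\<ominus>\<^bsub>R\<^esub> \<one>\<^bsub>R\<^esub>) = \<zero>\<^bsub>R\<^esub>}"
  have x: "x \<in> carrier S" "x' \<in> carrier S" using add_l by (simp_all add: M_simps)
  have "(x \<oplus>\<^bsub>S\<^esub> x') \<otimes>\<^bsub>S\<^esub> h \<one>\<^bsub>R\<^esub> \<oplus>\<^bsub>S\<^esub> x \<otimes>\<^bsub>S\<^esub> h (\<ominus>\<^bsub>R\<^esub> \<one>\<^bsub>R\<^esub>) \<oplus>\<^bsub>S\<^esub> x' \<otimes>\<^bsub>S\<^esub> h (\<ominus>\<^bsub>R\<^esub> \<one>\<^bsub>R\<^esub>) = \<zero>\<^bsub>S\<^esub>"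
    using x by (simp add: S.r_minus) (simp add: S.a_ac S.r_neg S.r_neg1 S.r_neg2)
  then have "resolving ?K'" using x by (intro resolving_relation[OF add_l.prems]) auto
  moreover have "contract c (frag_of (x \<oplus>\<^bsub>M\<^esub> x', y) - frag_of (x, y) - frag_of (x', y)) = \<zero>\<^bsub>N\<^esub>" if c: "c \<in> ?K'" for c
  proof -
    have cR: "c x \<in> carrier R" for x using add_l.prems c unfolding resolving_def good_def valued_def by simp
    have "c (x \<oplus>\<^bsub>S\<^esub> x') \<ominus>\<^bsub>R\<^esub> c x \<ominus>\<^bsub>R\<^esub> c x' = \<zero>\<^bsub>R\<^esub>" using c cR by (simp add: R.r_minus R.minus_eq)
    then have e: "c (x \<oplus>\<^bsub>S\<^esub> x') = c x \<oplus>\<^bsub>R\<^esub> c x'"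
      using cR[of x] cR[of x'] cR[of "x \<oplus>\<^bsub>S\<^esub> x'"]
      by (metis R.add.inv_solve_right R.a_comm R.minus_eq R.r_zero R.zero_closed R.minus_closed R.r_right_minus_eq R.add.m_assoc R.minus_add R.a_inv_closed)
    have "contract c (frag_of (x \<oplus>\<^bsub>M\<^esub> x', y) - frag_of (x, y) - frag_of (x', y))
      = c (x \<oplus>\<^bsub>S\<^esub> x') \<odot>\<^bsub>N\<^esub> y \<ominus>\<^bsub>N\<^esub> c x \<odot>\<^bsub>N\<^esub> y \<ominus>\<^bsub>N\<^esub> c x' \<odot>\<^bsub>N\<^esub> y"
      unfolding M_simps(2) using cR x add_l.hyps by (intro contract_diff3) auto
    also have "\<dots> = \<zero>\<^bsub>N\<^esub>" unfolding e using cR add_l.hyps N.lsmult_closed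
      by (simp add: N.lsmult_l_distr N.minus_eq N.a_ac N.r_neg N.r_neg1 N.r_neg2)
    finally show ?thesis .
  qed
  ultimately show ?case by (intro exI[of _ ?K'] conjI ballI) auto
next
  case (add_r x y y')
  have x: "x \<in> carrier S" using add_r by (simp add: M_simps)
  \<comment> \<open>Contraction is additive in the second factor for every \<open>c\<close>, so the
    set \<open>K\<close> is kept.\<close>
  have "contract c (frag_of (x, y \<oplus>\<^bsub>N\<^esub> y') - frag_of (x, y) - frag_of (x, y')) = \<zero>\<^bsub>N\<^esub>" if c: "c \<in> K" for c
  proof -
    have cR: "c x \<in> carrier R" for x using add_r.prems c unfolding resolving_def good_def valued_def by simp
    have "contract c (frag_of (x, y \<oplus>\<^bsub>N\<^esub> y') - frag_of (x, y) - frag_of (x, y'))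
      = c x \<odot>\<^bsub>N\<^esub> (y \<oplus>\<^bsub>N\<^esub> y') \<ominus>\<^bsub>N\<^esub> c x \<odot>\<^bsub>N\<^esub> y \<ominus>\<^bsub>N\<^esub> c x \<odot>\<^bsub>N\<^esub> y'"
      using cR x add_r.hyps by (intro contract_diff3) auto
    also have "\<dots> = \<zero>\<^bsub>N\<^esub>" using cR add_r.hyps N.lsmult_closed
      by (simp add: N.lsmult_r_distr N.minus_eq N.a_ac N.r_neg N.r_neg1 N.r_neg2)
    finally show ?thesis .
  qed
  then show ?case using add_r.prems by (intro exI[of _ K] conjI ballI subset_refl)
next
  case (smult s x y)
  \<comment> \<open>The balancing relation has two terms and is padded by a third one with
    coefficient zero.\<close>
  let ?K' = "{c \<in> K. c (x \<otimes>\<^bsub>S\<^esub> h s) \<otimes>\<^bsub>R\<^esub> \<one>\<^bsub>R\<^esub> \<oplus>\<^bsub>R\<^esub> c x \<otimes>\<^bsub>R\<^esub> (\<ominus>\<^bsub>R\<^esub> s) \<oplus>\<^bsub>R\<^esub> c x \<otimes>\<^bsub>R\<^esub> \<zero>\<^bsub>R\<^esub> = \<zero>\<^bsub>R\<^esub>}"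
  have x: "x \<in> carrier S" using smult by (simp add: M_simps)
  have "(x \<otimes>\<^bsub>S\<^esub> h s) \<otimes>\<^bsub>S\<^esub> h \<one>\<^bsub>R\<^esub> \<oplus>\<^bsub>S\<^esub> x \<otimes>\<^bsub>S\<^esub> h (\<ominus>\<^bsub>R\<^esub> s) \<oplus>\<^bsub>S\<^esub> x \<otimes>\<^bsub>S\<^esub> h \<zero>\<^bsub>R\<^esub> = \<zero>\<^bsub>S\<^esub>"
    using x smult by (simp add: S.r_minus S.r_neg)
  then have "resolving ?K'" using x smult by (intro resolving_relation[OF smult.prems]) auto
  moreover have "contract c (frag_of (s \<odot>\<^bsub>M\<^esub> x, y) - frag_of (x, s \<odot>\<^bsub>N\<^esub> y)) = \<zero>\<^bsub>N\<^esub>" if c: "c \<in> ?K'" for c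
  proof -
    have cR: "c x \<in> carrier R" for x using smult.prems c unfolding resolving_def good_def valued_def by simp
    have "c (x \<otimes>\<^bsub>S\<^esub> h s) \<oplus>\<^bsub>R\<^esub> \<ominus>\<^bsub>R\<^esub> (c x \<otimes>\<^bsub>R\<^esub> s) = \<zero>\<^bsub>R\<^esub>" using c cR smult by (simp add: R.r_minus)
    then have e: "c (x \<otimes>\<^bsub>S\<^esub> h s) = c x \<otimes>\<^bsub>R\<^esub> s"
      using cR smult.hyps(1) R.r_right_minus_eq[of "c (x \<otimes>\<^bsub>S\<^esub> h s)" "c x \<otimes>\<^bsub>R\<^esub> s"] by (simp add: R.minus_eq)
    have "contract c (frag_of (s \<odot>\<^bsub>M\<^esub> x, y) - frag_of (x, s \<odot>\<^bsub>N\<^esub> y))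
      = c (x \<otimes>\<^bsub>S\<^esub> h s) \<odot>\<^bsub>N\<^esub> y \<ominus>\<^bsub>N\<^esub> c x \<odot>\<^bsub>N\<^esub> (s \<odot>\<^bsub>N\<^esub> y)"
      unfolding M_simps(4) using cR x smult.hyps N.lsmult_closed by (intro contract_diff2) auto
    also have "\<dots> = \<zero>\<^bsub>N\<^esub>" unfolding e using cR smult.hyps N.lsmult_closed
      by (simp add: N.lsmult_assoc N.minus_eq N.r_neg)
    finally show ?thesis .
  qed
  ultimately show ?case by (intro exI[of _ ?K'] conjI ballI) auto
qed

text \<open>Modulo relations, e h(c(x)) tensor y equals e tensor c(x) y. Summed up, the push along a
  single function factors through the contraction along that function.\<close>

lemma push_contract:
  assumes c: "\<And>x. c x \<in> carrier R" and e: "e \<in> carrier S" and z: "z \<in> T.Fr"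
  shows "tensor_push (\<lambda>x. e \<otimes>\<^bsub>S\<^esub> h (c x)) (\<lambda>y. y) z - frag_of (e, contract c z) \<in> T.Ker"
  using z
proof (induction z rule: T.Fr_induct)
  case zero
  then show ?case using T.Ker_minus[OF T.Ker_zero_r[of e]] e contract(1)[OF c] by (simp add: M_simps)
next
  case (diff z w)
  have cl: "contract c z \<in> carrier N" "contract c w \<in> carrier N" "e \<in> carrier M"
    using contract(2)[OF c] diff.hyps e by (simp_all add: M_simps)
  then have "contract c (z - w) \<in> carrier N" "contract c z = contract c (z - w) \<oplus>\<^bsub>N\<^esub> contract c w"
    using contract(3)[OF c diff.hyps] by (simp_all add: N.minus_eq N.a_assoc N.l_neg)
  then have "frag_of (e, contract c z) - frag_of (e, contract c (z - w)) - frag_of (e, contract c w) \<in> T.Ker"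
    using T.Ker_add_r[OF cl(3), of "contract c (z - w)" "contract c w"] cl by simp
  from T.Ker_add[OF this T.Ker_diff[OF diff.IH]] show ?case by (simp add: algebra_simps)
next
  case (of x y)
  have "frag_of (c x \<odot>\<^bsub>M\<^esub> e, y) - frag_of (e, c x \<odot>\<^bsub>N\<^esub> y) \<in> T.Ker"
    using c e of by (intro T.Ker_smult) (simp_all add: M_simps)
  then show ?case using contract(4)[OF c] of by (simp add: M_simps)
qed

lemma push_add:
  assumes \<phi>: "\<And>x. \<phi> x \<in> carrier S" and \<psi>: "\<And>x. \<psi> x \<in> carrier S" and z: "z \<in> T.Fr"
  shows "tensor_push (\<lambda>x. \<phi> x \<oplus>\<^bsub>S\<^esub> \<psi> x) (\<lambda>y. y) z - tensor_push \<phi> (\<lambda>y. y) z - tensor_push \<psi> (\<lambda>y. y) z \<in> T.Ker"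
  using z
proof (induction z rule: T.Fr_induct)
  case zero then show ?case using T.Ker_0 by simp
next
  case (diff z w)
  from T.Ker_diff[OF diff.IH] show ?case by (simp add: algebra_simps)
next
  case (of x y)
  then show ?case using T.Ker_add_l[of "\<phi> x" "\<psi> x" y] \<phi> \<psi> by (simp add: M_simps)
qed

text \<open>\<phi> is a finite combination of functions from \<open>K\<close>, and by
  \<open>push_contract\<close> each of them contributes a tensor whose second factor is a
  contraction of \<open>z\<close>, that is, zero.\<close>

lemma push_trace:
  assumes K: "valued K" and \<phi>: "\<phi> \<in> trace K" and z: "z \<in> T.Fr" "\<And>c. c \<in> K \<Longrightarrow> contract c z = \<zero>\<^bsub>N\<^esub>"
  shows "tensor_push \<phi> (\<lambda>y. y) z \<in> T.Ker"
proof -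
  obtain ws where "set ws \<subseteq> K" "\<phi> \<in> mspan ws" using \<phi> by (rule traceE)
  then show ?thesis
  proof (induction ws arbitrary: \<phi>)
    case Nil
    have "tensor_push (\<lambda>_. \<zero>\<^bsub>M\<^esub>) (\<lambda>y. y) z \<in> T.Ker"
      using z(1)
    proof (induction z rule: T.Fr_induct)
      case (diff z w)
      then show ?case using T.Ker_diff by simp
    qed (use T.Ker_0 T.Ker_zero_l in simp_all)
    then show ?case using Nil by (simp add: M_simps)
  next
    case (Cons w ws)
    from Cons.prems(2) obtain e \<phi>' where 1: "e \<in> carrier S" "\<phi>' \<in> mspan ws" "\<phi> = (\<lambda>x. e \<otimes>\<^bsub>S\<^esub> h (w x) \<oplus>\<^bsub>S\<^esub> \<phi>' x)"
      by (rule mspan_ConsE)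
    have w: "w \<in> K" "set ws \<subseteq> K" using Cons.prems(1) by auto
    have wc: "w x \<in> carrier R" for x using valuedD[OF K w(1)] .
    have \<phi>'c: "\<phi>' x \<in> carrier S" for x using mspan_closed[OF valued_subset[OF K w(2)] 1(2)] .
    have "tensor_push (\<lambda>x. e \<otimes>\<^bsub>S\<^esub> h (w x)) (\<lambda>y. y) z - frag_of (e, \<zero>\<^bsub>N\<^esub>) \<in> T.Ker"
      using push_contract[of w e z] wc 1(1) z(1) z(2)[OF w(1)] by simp
    from T.Ker_add[OF this T.Ker_zero_r[of e]]
    have a: "tensor_push (\<lambda>x. e \<otimes>\<^bsub>S\<^esub> h (w x)) (\<lambda>y. y) z \<in> T.Ker" using 1(1) by (simp add: M_simps)
    have "tensor_push \<phi> (\<lambda>y. y) z - tensor_push (\<lambda>x. e \<otimes>\<^bsub>S\<^esub> h (w x)) (\<lambda>y. y) z - tensor_push \<phi>' (\<lambda>y. y) z \<in> T.Ker"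
      unfolding 1(3) using wc \<phi>'c 1(1) z(1) by (intro push_add) auto
    from T.Ker_add[OF T.Ker_add[OF this a] Cons.IH[OF w(2) 1(2)]] show ?case by simp
  qed
qed

end

text \<open>Naturality of contraction in the module; the linearity of \<open>g\<close> enters
  here.\<close>

lemma contract_push:
  assumes N: "left_module R N" "left_module R N'" and g: "g \<in> left_module_hom R N' N"
    and c: "\<And>x. c x \<in> carrier R" and z: "Poly_Mapping.keys z \<subseteq> carrier M \<times> carrier N'"
  shows "contract N c (tensor_push (\<lambda>x. x) g z) = g (contract N' c z)"
proof -
  interpret N: left_module R N by fact
  interpret N': left_module R N' by fact
  interpret T: tensor_factors R M N by (rule tensor_factors_M[OF N(1)])
  interpret T': tensor_factors R M N' by (rule tensor_factors_M[OF N(2)])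
  have g1: "\<And>x. x \<in> carrier N' \<Longrightarrow> g x \<in> carrier N"
    and g2: "\<And>x y. x \<in> carrier N' \<Longrightarrow> y \<in> carrier N' \<Longrightarrow> g (x \<oplus>\<^bsub>N'\<^esub> y) = g x \<oplus>\<^bsub>N\<^esub> g y"
    and g3: "\<And>r x. r \<in> carrier R \<Longrightarrow> x \<in> carrier N' \<Longrightarrow> g (r \<odot>\<^bsub>N'\<^esub> x) = r \<odot>\<^bsub>N\<^esub> g x"
    using g unfolding left_module_hom_def by auto
  have g0: "g \<zero>\<^bsub>N'\<^esub> = \<zero>\<^bsub>N\<^esub>"
    using g2[of "\<zero>\<^bsub>N'\<^esub>" "\<zero>\<^bsub>N'\<^esub>"] g1[of "\<zero>\<^bsub>N'\<^esub>"] N.add.l_cancel_one[of "g \<zero>\<^bsub>N'\<^esub>" "g \<zero>\<^bsub>N'\<^esub>"] by simp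
  have Fr: "tensor_push (\<lambda>x. x) g z \<in> T.Fr" if "z \<in> T'.Fr" for z
    using tensor_push_keys[of z "carrier M" "carrier N'" "\<lambda>x. x" "carrier M" g "carrier N"] that g1 by auto
  have "z \<in> T'.Fr" using z by simp
  then show ?thesis
  proof (induction z rule: T'.Fr_induct)
    case zero
    then show ?case using contract(1)[OF N(1) c] contract(1)[OF N(2) c] g0 by simp
  next
    case (diff z w)
    have cl: "contract N' c z \<in> carrier N'" "contract N' c w \<in> carrier N'"
      using contract(2)[OF N(2) c] diff.hyps by simp_all
    then have d: "g (contract N' c z \<ominus>\<^bsub>N'\<^esub> contract N' c w) = g (contract N' c z) \<ominus>\<^bsub>N\<^esub> g (contract N' c w)"
    proof -
      have "g (contract N' c z \<ominus>\<^bsub>N'\<^esub> contract N' c w) \<oplus>\<^bsub>N\<^esub> g (contract N' c w) = g (contract N' c z)"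
        using cl g2[of "contract N' c z \<ominus>\<^bsub>N'\<^esub> contract N' c w" "contract N' c w"]
        by (simp add: N'.minus_eq N'.a_assoc N'.l_neg)
      then show ?thesis using cl g1[of "contract N' c w"] g1[of "contract N' c z \<ominus>\<^bsub>N'\<^esub> contract N' c w"]
        by (metis N.add.inv_solve_right N.minus_eq N'.minus_closed g1)
    qed
    show ?case
      using contract(3)[OF N(1) c Fr[OF diff.hyps(1)] Fr[OF diff.hyps(2)]] contract(3)[OF N(2) c diff.hyps] diff.IH d
      by simp
  next
    case (of x y)
    then show ?case using contract(4)[OF N(1) c, of x "g y"] contract(4)[OF N(2) c, of x y] g1 g3[OF c]
      by (simp add: M_simps)
  qed
qed

text \<open>If the image of \<open>z\<close> is a relation, its contractions vanish on a resolving
  set. By injectivity of \<open>g\<close> the contractions of \<open>z\<close> vanish there too. A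
  combination of these functions that fixes the first components of \<open>z\<close> then shows that
  \<open>z\<close> itself is a relation.\<close>

theorem flat: "flat_right_module TYPE('n) R M"
  unfolding flat_right_module_def
proof (intro conjI allI impI M_right_module)
  fix N' N :: "('d, 'n) module" and g
  assume N': "left_module R N'" and N: "left_module R N" and g: "g \<in> left_module_hom R N' N"
    and inj: "inj_on g (carrier N')"
  interpret N: left_module R N by fact
  interpret N': left_module R N' by fact
  interpret T: tensor_factors R M N by (rule tensor_factors_M[OF N])
  interpret T': tensor_factors R M N' by (rule tensor_factors_M[OF N'])
  have g1: "\<And>x. x \<in> carrier N' \<Longrightarrow> g x \<in> carrier N"
    and g2: "\<And>x y. x \<in> carrier N' \<Longrightarrow> y \<in> carrier N' \<Longrightarrow> g (x \<oplus>\<^bsub>N'\<^esub> y) = g x \<oplus>\<^bsub>N\<^esub> g y"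
    and g3: "\<And>r x. r \<in> carrier R \<Longrightarrow> x \<in> carrier N' \<Longrightarrow> g (r \<odot>\<^bsub>N'\<^esub> x) = r \<odot>\<^bsub>N\<^esub> g x"
    using g unfolding left_module_hom_def by auto
  have g0: "g \<zero>\<^bsub>N'\<^esub> = \<zero>\<^bsub>N\<^esub>"
    using g2[of "\<zero>\<^bsub>N'\<^esub>" "\<zero>\<^bsub>N'\<^esub>"] g1[of "\<zero>\<^bsub>N'\<^esub>"] N.add.l_cancel_one[of "g \<zero>\<^bsub>N'\<^esub>" "g \<zero>\<^bsub>N'\<^esub>"] by simp
  have push: "tensor_push (\<lambda>x. x) g w \<in> T.Ker" if "w \<in> T'.Ker" for w
    using that
  proof (induction w rule: T'.Ker_induct)
    case (smult s x y)
    then show ?case using T.Ker_smult[of s x "g y"] g1 g3 by simp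
  qed (use T.Ker_0 T.Ker_diff T.Ker_add_l T.Ker_add_r g1 g2 in simp_all)
  have map: "tensor_map R M N (\<lambda>x. x) g (T'.cls z) = T.cls (tensor_push (\<lambda>x. x) g z)" if "z \<in> T'.Fr" for z
    by (rule tensor_map_cls[OF T'.tensor_factors_axioms T.tensor_factors_axioms T'.cls_self refl push])
  show "inj_on (tensor_map R M N (\<lambda>x. x) g) (carrier (tensor_group R M N'))"
    unfolding T'.tensor_group_carrier
  proof (rule inj_onI)
    fix U V assume "U \<in> T'.cls ` T'.Fr" "V \<in> T'.cls ` T'.Fr"
      and eq: "tensor_map R M N (\<lambda>x. x) g U = tensor_map R M N (\<lambda>x. x) g V"
    then obtain u v where uv: "u \<in> T'.Fr" "v \<in> T'.Fr" "U = T'.cls u" "V = T'.cls v" by blast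
    define z where "z = u - v"
    have z: "z \<in> T'.Fr" unfolding z_def using T'.Fr_diff uv(1,2) by blast
    have "tensor_push (\<lambda>x. x) g z \<in> T.Ker"
      using eq map[OF uv(1)] map[OF uv(2)] T.cls_eq_iff unfolding uv(3,4) z_def by simp
    from contract_Ker[OF N this resolving_all] obtain K where
      K: "resolving K" "\<forall>c\<in>K. contract N c (tensor_push (\<lambda>x. x) g z) = \<zero>\<^bsub>N\<^esub>" by blast
    have v: "valued K" using K(1) unfolding resolving_def good_def by blast
    have c0: "contract N' c z = \<zero>\<^bsub>N'\<^esub>" if c: "c \<in> K" for c
    proof -
      have cR: "\<And>x. c x \<in> carrier R" using valuedD[OF v c] .
      have "g (contract N' c z) = g \<zero>\<^bsub>N'\<^esub>"
        using contract_push[OF N N' g cR] z bspec[OF K(2) c] g0 by simp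
      then show ?thesis using inj contract(2)[OF N' cR z] by (auto dest: inj_onD)
    qed
    have "fst ` Poly_Mapping.keys z \<subseteq> carrier S" using z by (auto simp: M_simps)
    then obtain \<phi> where \<phi>: "\<phi> \<in> trace K" "\<forall>x\<in>fst ` Poly_Mapping.keys z. \<phi> x = x"
      using K(1) unfolding resolving_def by (meson finite_imageI finite_keys)
    \<comment> \<open>\<phi> fixes each of the finitely many first components of \<open>z\<close>,
      so the push reproduces \<open>z\<close>.\<close>
    have "tensor_push \<phi> (\<lambda>y. y) z = frag_extend frag_of z"
      unfolding tensor_push_def by (rule frag_extend_eq) (use \<phi>(2) in force)
    then have "z \<in> T'.Ker"
      using push_trace[OF N' v \<phi>(1) z c0] frag_expansion[of z] by simp
    then show "U = V" unfolding uv(3,4) z_def by (rule T'.cls_eqI)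
  qed
qed

end

section \<open>Base change along inverting an element\<close>

text \<open>\<open>L\<close> is the localisation of \<open>K\<close> at the powers of
  \<open>p\<close>. The intended case is a valuation ring in its discretely valued field, with
  \<open>p\<close> a uniformizer.\<close>

locale denominators = field L for L :: "('a, 'l) ring_scheme" (structure) +
  fixes K :: "'a set" and p :: 'a
  assumes K: "subring K L" and p: "p \<in> K" "p \<noteq> \<zero>"
    and denom: "\<And>l. l \<in> carrier L \<Longrightarrow> \<exists>n::nat. p [^] n \<otimes> l \<in> K"
begin

abbreviation "Rg \<equiv> L\<lparr>carrier := K\<rparr>"

lemma K_carrier: "k \<in> K \<Longrightarrow> k \<in> carrier L"
  using subringE(1)[OF K] by blast

lemma p_pow_K: "p [^] (n::nat) \<in> K"
  by (induction n) (use p K in \<open>auto simp: subringE\<close>)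

lemma p_pow_nz: "p [^] (n::nat) \<noteq> \<zero>"
  by (induction n) (use p K_carrier in \<open>auto simp: integral_iff\<close>)

definition dn :: "nat \<Rightarrow> 'a" where "dn n = inv (p [^] n)"

lemma dn: "dn n \<in> carrier L" "p [^] n \<otimes> dn n = \<one>"
  using p_pow_nz[of n] K_carrier[OF p_pow_K[of n]] field_Units unfolding dn_def by auto

lemma dn_add: "dn (n + m) = dn n \<otimes> dn m"
proof -
  have c: "p [^] n \<in> carrier L" "p [^] m \<in> carrier L" using K_carrier[OF p_pow_K] by auto
  have "p [^] (n + m) \<otimes> (dn n \<otimes> dn m) = (p [^] n \<otimes> dn n) \<otimes> (p [^] m \<otimes> dn m)"
    using c dn(1) K_carrier[OF p(1)] by (simp add: nat_pow_mult[symmetric] m_ac)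
  also have "\<dots> = p [^] (n + m) \<otimes> dn (n + m)" using dn by simp
  finally show ?thesis
    using dn(1) p_pow_nz[of "n + m"] K_carrier[OF p_pow_K[of "n + m"]] by (simp add: m_lcancel)
qed

lemma dn_0: "dn 0 = \<one>"
  unfolding dn_def by simp

lemma denom_mono: "p [^] (n::nat) \<otimes> l \<in> K \<Longrightarrow> n \<le> m \<Longrightarrow> l \<in> carrier L \<Longrightarrow> p [^] m \<otimes> l \<in> K"
proof -
  assume l: "p [^] n \<otimes> l \<in> K" "l \<in> carrier L" and "n \<le> m"
  show "p [^] m \<otimes> l \<in> K"
    using \<open>n \<le> m\<close>
  proof (induction rule: dec_induct)
    case (step m)
    have "p \<otimes> (p [^] m \<otimes> l) \<in> K" using subringE(6)[OF K p(1) step.IH] .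
    then show ?case using l(2) K_carrier[OF p(1)] by (simp add: m_ac)
  qed (rule l(1))
qed

lemma K_pow: "x [^]\<^bsub>Rg\<^esub> (n::nat) = x [^] n"
  by (simp add: nat_pow_def)

end

text \<open>Torsion-freeness is built in because it makes the structural map from \<open>A\<close>
  to its base change injective.\<close>

locale base_change_algebra = L?: denominators L K p + assoc_algebra "L\<lparr>carrier := K\<rparr>" A
  for L :: "('a, 'l) ring_scheme" (structure) and K p and A :: "('a, 'b) module" +
  assumes tf: "torsion_free p A"
begin

abbreviation "BC \<equiv> base_change Rg L A"
abbreviation "LL \<equiv> self_module L"

lemma LL_simps: "carrier LL = carrier L" "add LL = add L" "\<zero>\<^bsub>LL\<^esub> = \<zero>" "r \<odot>\<^bsub>LL\<^esub> l = r \<otimes> l"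
  "x \<otimes>\<^bsub>LL\<^esub> y = x \<otimes> y" "\<one>\<^bsub>LL\<^esub> = \<one>"
  by (simp_all add: self_module_def)

lemma LL_abelian: "abelian_group LL"
  by (rule abelian_groupI) (simp_all add: LL_simps L.a_ac L.add.l_inv_ex)

lemma smult_closed: "r \<in> K \<Longrightarrow> a \<in> carrier A \<Longrightarrow> r \<odot>\<^bsub>A\<^esub> a \<in> carrier A"
  using lsmult_closed by simp

lemma tensor_factors_A: "tensor_factors Rg A LL"
  by (intro tensor_factors.intro A.abelian_group_axioms LL_abelian)
    (use smult_closed K_carrier in \<open>auto simp: LL_simps\<close>)

sublocale T: tensor_factors Rg A LL by (rule tensor_factors_A)

lemma p_pow_tf:
  assumes "a \<in> carrier A" "p [^] (n::nat) \<odot>\<^bsub>A\<^esub> a = \<zero>\<^bsub>A\<^esub>" shows "a = \<zero>\<^bsub>A\<^esub>"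
  using assms(2)
proof (induction n)
  case 0 then show ?case using assms(1) lsmult_one[of a] by simp
next
  case (Suc n)
  have "p [^] Suc n \<odot>\<^bsub>A\<^esub> a = p \<odot>\<^bsub>A\<^esub> (p [^] n \<odot>\<^bsub>A\<^esub> a)"
    using lsmult_assoc[of p "p [^] n" a] p p_pow_K assms(1) K_carrier by (simp add: L.m_comm)
  then have "p [^] n \<odot>\<^bsub>A\<^esub> a = \<zero>\<^bsub>A\<^esub>"
    using Suc.prems tf smult_closed[OF p_pow_K assms(1)] unfolding torsion_free_def by simp
  then show ?case by (rule Suc.IH)
qed

lemma smult_diff:
  assumes "r \<in> K" "a \<in> carrier A" "b \<in> carrier A" shows "r \<odot>\<^bsub>A\<^esub> (a \<ominus>\<^bsub>A\<^esub> b) = r \<odot>\<^bsub>A\<^esub> a \<ominus>\<^bsub>A\<^esub> r \<odot>\<^bsub>A\<^esub> b"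
proof -
  have "r \<odot>\<^bsub>A\<^esub> (a \<ominus>\<^bsub>A\<^esub> b) \<oplus>\<^bsub>A\<^esub> r \<odot>\<^bsub>A\<^esub> b = r \<odot>\<^bsub>A\<^esub> a"
    using lsmult_r_distr[of r "a \<ominus>\<^bsub>A\<^esub> b" b] assms by (simp add: A.minus_eq A.a_assoc A.l_neg)
  then show ?thesis using assms smult_closed
    by (metis A.add.inv_solve_right A.minus_eq A.minus_closed)
qed

lemma smult_zero: "r \<in> K \<Longrightarrow> r \<odot>\<^bsub>A\<^esub> \<zero>\<^bsub>A\<^esub> = \<zero>\<^bsub>A\<^esub>"
  using smult_diff[of r "\<zero>\<^bsub>A\<^esub>" "\<zero>\<^bsub>A\<^esub>"] smult_closed[of r "\<zero>\<^bsub>A\<^esub>"] by (simp add: A.minus_eq A.r_neg)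

lemma p_pow_inj:
  assumes "a \<in> carrier A" "b \<in> carrier A" "p [^] (n::nat) \<odot>\<^bsub>A\<^esub> a = p [^] n \<odot>\<^bsub>A\<^esub> b" shows "a = b"
proof -
  have "p [^] n \<odot>\<^bsub>A\<^esub> (a \<ominus>\<^bsub>A\<^esub> b) = \<zero>\<^bsub>A\<^esub>"
    using assms smult_diff[OF p_pow_K] smult_closed[OF p_pow_K] by (simp add: A.minus_eq A.r_neg)
  then have "a \<ominus>\<^bsub>A\<^esub> b = \<zero>\<^bsub>A\<^esub>" using p_pow_tf assms by simp
  then show ?thesis using assms by simp
qed

text \<open>Clearing the denominator \<^term>\<open>p [^] n\<close>; the value is junk on terms whose denominator is larger.\<close>

definition clear :: "nat \<Rightarrow> ('b \<times> 'a \<Rightarrow>\<^sub>0 int) \<Rightarrow> 'b" where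
  "clear n = frag_lift A (carrier A \<times> carrier LL)
     (\<lambda>(a, l). if p [^] n \<otimes> l \<in> K then (p [^] n \<otimes> l) \<odot>\<^bsub>A\<^esub> a else \<zero>\<^bsub>A\<^esub>)"

lemma clear:
  "clear n 0 = \<zero>\<^bsub>A\<^esub>"
  "z \<in> T.Fr \<Longrightarrow> clear n z \<in> carrier A"
  "z \<in> T.Fr \<Longrightarrow> w \<in> T.Fr \<Longrightarrow> clear n (z - w) = clear n z \<ominus>\<^bsub>A\<^esub> clear n w"
  "a \<in> carrier A \<Longrightarrow> l \<in> carrier L \<Longrightarrow> p [^] n \<otimes> l \<in> K \<Longrightarrow> clear n (frag_of (a, l)) = (p [^] n \<otimes> l) \<odot>\<^bsub>A\<^esub> a"
proof -
  let ?f = "\<lambda>(a, l). if p [^] n \<otimes> l \<in> K then (p [^] n \<otimes> l) \<odot>\<^bsub>A\<^esub> a else \<zero>\<^bsub>A\<^esub>"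
  have f: "?f x \<in> carrier A" if "x \<in> carrier A \<times> carrier LL" for x
    using that smult_closed by (auto simp: LL_simps)
  note L = A.frag_lift_0[OF f] A.frag_lift_closed[OF f] A.frag_lift_diff[OF f] A.frag_lift_of[OF f]
  show "clear n 0 = \<zero>\<^bsub>A\<^esub>" unfolding clear_def by (rule L(1))
  show "z \<in> T.Fr \<Longrightarrow> clear n z \<in> carrier A"
    "z \<in> T.Fr \<Longrightarrow> w \<in> T.Fr \<Longrightarrow> clear n (z - w) = clear n z \<ominus>\<^bsub>A\<^esub> clear n w"
    unfolding clear_def using L(2,3) by simp_all
  show "a \<in> carrier A \<Longrightarrow> l \<in> carrier L \<Longrightarrow> p [^] n \<otimes> l \<in> K \<Longrightarrow> clear n (frag_of (a, l)) = (p [^] n \<otimes> l) \<odot>\<^bsub>A\<^esub> a"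
    unfolding clear_def by (subst L(4)) (auto simp: LL_simps)
qed

lemma clear_diff2:
  assumes "a \<in> carrier A" "l \<in> carrier L" "p [^] n \<otimes> l \<in> K" "a' \<in> carrier A" "l' \<in> carrier L" "p [^] n \<otimes> l' \<in> K"
  shows "clear n (frag_of (a, l) - frag_of (a', l')) = (p [^] n \<otimes> l) \<odot>\<^bsub>A\<^esub> a \<ominus>\<^bsub>A\<^esub> (p [^] n \<otimes> l') \<odot>\<^bsub>A\<^esub> a'"
proof -
  have F: "frag_of (a, l) \<in> T.Fr" "frag_of (a', l') \<in> T.Fr" using assms by (auto simp: keys_frag_of LL_simps)
  show ?thesis unfolding clear(3)[OF F] clear(4)[OF assms(1-3)] clear(4)[OF assms(4-6)] ..
qed

lemma clear_diff3:
  assumes "a \<in> carrier A" "l \<in> carrier L" "p [^] n \<otimes> l \<in> K" "a' \<in> carrier A" "l' \<in> carrier L" "p [^] n \<otimes> l' \<in> K"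
    "a'' \<in> carrier A" "l'' \<in> carrier L" "p [^] n \<otimes> l'' \<in> K"
  shows "clear n (frag_of (a, l) - frag_of (a', l') - frag_of (a'', l''))
    = (p [^] n \<otimes> l) \<odot>\<^bsub>A\<^esub> a \<ominus>\<^bsub>A\<^esub> (p [^] n \<otimes> l') \<odot>\<^bsub>A\<^esub> a' \<ominus>\<^bsub>A\<^esub> (p [^] n \<otimes> l'') \<odot>\<^bsub>A\<^esub> a''"
proof -
  have F: "frag_of (a, l) \<in> T.Fr" "frag_of (a', l') \<in> T.Fr" "frag_of (a'', l'') \<in> T.Fr"
    using assms by (auto simp: keys_frag_of LL_simps)
  show ?thesis unfolding clear(3)[OF T.Fr_diff[OF F(1,2)] F(3)] clear_diff2[OF assms(1-6)] clear(4)[OF assms(7-9)] ..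
qed

text \<open>\<open>clear n\<close> respects a relation only if p^n clears all scalars occurring in
  it. The bound therefore depends on \<open>z\<close>, and the vanishing is merely eventual.\<close>

lemma clear_Ker: "z \<in> T.Ker \<Longrightarrow> \<exists>N. \<forall>n\<ge>N. clear n z = \<zero>\<^bsub>A\<^esub>"
proof (induction z rule: T.Ker_induct)
  case zero then show ?case using clear(1) by blast
next
  case (diff z w)
  then obtain N N' where N: "\<forall>n\<ge>N. clear n z = \<zero>\<^bsub>A\<^esub>" "\<forall>n\<ge>N'. clear n w = \<zero>\<^bsub>A\<^esub>" by blast
  have F: "z \<in> T.Fr" "w \<in> T.Fr" using diff.hyps subsetD[OF T.Ker_Fr] by auto
  have "clear n (z - w) = \<zero>\<^bsub>A\<^esub>" if "n \<ge> max N N'" for n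
    using N that clear(3)[OF F, of n] by (simp add: A.minus_eq)
  then show ?case by blast
next
  case (add_l a a' l)
  have l: "l \<in> carrier L" using add_l by (simp add: LL_simps)
  obtain N where N: "p [^] (N::nat) \<otimes> l \<in> K" using denom[OF l] by blast
  have "clear n (frag_of (a \<oplus>\<^bsub>A\<^esub> a', l) - frag_of (a, l) - frag_of (a', l)) = \<zero>\<^bsub>A\<^esub>" if "n \<ge> N" for n
  proof -
    have k: "p [^] n \<otimes> l \<in> K" using denom_mono[OF N that l] .
    have "clear n (frag_of (a \<oplus>\<^bsub>A\<^esub> a', l) - frag_of (a, l) - frag_of (a', l))
      = (p [^] n \<otimes> l) \<odot>\<^bsub>A\<^esub> (a \<oplus>\<^bsub>A\<^esub> a') \<ominus>\<^bsub>A\<^esub> (p [^] n \<otimes> l) \<odot>\<^bsub>A\<^esub> a \<ominus>\<^bsub>A\<^esub> (p [^] n \<otimes> l) \<odot>\<^bsub>A\<^esub> a'"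
      using add_l k l by (intro clear_diff3) auto
    also have "\<dots> = \<zero>\<^bsub>A\<^esub>" using add_l k smult_closed[OF k] lsmult_r_distr[of "p [^] n \<otimes> l" a a']
      by (simp add: A.minus_eq A.a_ac A.r_neg A.r_neg1 A.r_neg2)
    finally show ?thesis .
  qed
  then show ?case by blast
next
  case (add_r a l l')
  have l: "l \<in> carrier L" "l' \<in> carrier L" using add_r by (simp_all add: LL_simps)
  obtain N N' where N: "p [^] (N::nat) \<otimes> l \<in> K" "p [^] (N'::nat) \<otimes> l' \<in> K" using denom l by meson
  have "clear n (frag_of (a, l \<oplus>\<^bsub>LL\<^esub> l') - frag_of (a, l) - frag_of (a, l')) = \<zero>\<^bsub>A\<^esub>" if "n \<ge> max N N'" for n
  proof -
    have k: "p [^] n \<otimes> l \<in> K" "p [^] n \<otimes> l' \<in> K" using denom_mono N that l by simp_all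
    have e: "p [^] n \<otimes> (l \<oplus> l') = p [^] n \<otimes> l \<oplus> p [^] n \<otimes> l'" using l K_carrier[OF p_pow_K] by (simp add: L.r_distr)
    have k': "p [^] n \<otimes> (l \<oplus> l') \<in> K" unfolding e using subringE(7)[OF K] k by blast
    have "clear n (frag_of (a, l \<oplus>\<^bsub>LL\<^esub> l') - frag_of (a, l) - frag_of (a, l'))
      = (p [^] n \<otimes> (l \<oplus> l')) \<odot>\<^bsub>A\<^esub> a \<ominus>\<^bsub>A\<^esub> (p [^] n \<otimes> l) \<odot>\<^bsub>A\<^esub> a \<ominus>\<^bsub>A\<^esub> (p [^] n \<otimes> l') \<odot>\<^bsub>A\<^esub> a"
      unfolding LL_simps(2) using add_r k k' l by (intro clear_diff3) auto
    also have "\<dots> = \<zero>\<^bsub>A\<^esub>" unfolding e using add_r k smult_closed[OF k(1)] smult_closed[OF k(2)]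
        lsmult_l_distr[of "p [^] n \<otimes> l" "p [^] n \<otimes> l'" a]
      by (simp add: A.minus_eq A.a_ac A.r_neg A.r_neg1 A.r_neg2)
    finally show ?thesis .
  qed
  then show ?case by blast
next
  case (smult s a l)
  have l: "l \<in> carrier L" "s \<in> K" "s \<in> carrier L" using smult K_carrier by (simp_all add: LL_simps)
  obtain N where N: "p [^] (N::nat) \<otimes> l \<in> K" using denom[OF l(1)] by blast
  have "clear n (frag_of (s \<odot>\<^bsub>A\<^esub> a, l) - frag_of (a, s \<odot>\<^bsub>LL\<^esub> l)) = \<zero>\<^bsub>A\<^esub>" if "n \<ge> N" for n
  proof -
    have k: "p [^] n \<otimes> l \<in> K" using denom_mono[OF N that l(1)] .
    have e: "p [^] n \<otimes> (s \<otimes> l) = (p [^] n \<otimes> l) \<otimes> s" using l K_carrier[OF p_pow_K] by (simp add: L.m_ac)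
    have k': "p [^] n \<otimes> (s \<otimes> l) \<in> K" unfolding e using subringE(6)[OF K k l(2)] .
    have "clear n (frag_of (s \<odot>\<^bsub>A\<^esub> a, l) - frag_of (a, s \<odot>\<^bsub>LL\<^esub> l))
      = (p [^] n \<otimes> l) \<odot>\<^bsub>A\<^esub> (s \<odot>\<^bsub>A\<^esub> a) \<ominus>\<^bsub>A\<^esub> (p [^] n \<otimes> (s \<otimes> l)) \<odot>\<^bsub>A\<^esub> a"
      unfolding LL_simps(4) using smult k k' l smult_closed by (intro clear_diff2) auto
    also have "\<dots> = \<zero>\<^bsub>A\<^esub>" unfolding e using smult k l smult_closed lsmult_assoc[of "p [^] n \<otimes> l" s a]
      by (simp add: A.minus_eq A.r_neg)
    finally show ?thesis .
  qed
  then show ?case by blast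
qed

text \<open>The fraction a/p^n. Every element of the base change has this form, and computing with
  fractions replaces computing with cosets from here on.\<close>

definition fr :: "'b \<Rightarrow> nat \<Rightarrow> ('b \<times> 'a \<Rightarrow>\<^sub>0 int) set" where
  "fr a n = T.cls (frag_of (a, dn n))"

lemma fr_Fr: "a \<in> carrier A \<Longrightarrow> l \<in> carrier L \<Longrightarrow> frag_of (a, l) \<in> T.Fr"
  by (rule T.Fr_of) (auto simp: LL_simps)

lemma to_base_change_eq: "to_base_change Rg L A a = fr a 0"
  unfolding to_base_change_def pure_tensor_def fr_def dn_0 ..

lemma frag_shift:
  assumes "a \<in> carrier A" shows "frag_of (p [^] (m::nat) \<odot>\<^bsub>A\<^esub> a, dn (n + m)) - frag_of (a, dn n) \<in> T.Ker"
proof -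
  have "p [^] m \<otimes> dn (n + m) = dn n" unfolding dn_add
    using dn[of n] dn[of m] K_carrier[OF p_pow_K[of m]] L.m_lcomm[of "p [^] m" "dn n" "dn m"] by simp
  then show ?thesis using T.Ker_smult[of "p [^] m" a "dn (n + m)"] p_pow_K assms dn(1) by (simp add: LL_simps)
qed

lemma fr_shift: "a \<in> carrier A \<Longrightarrow> fr (p [^] (m::nat) \<odot>\<^bsub>A\<^esub> a) (n + m) = fr a n"
  unfolding fr_def by (rule T.cls_eqI[OF frag_shift])

text \<open>A difference of two fractions is brought to the denominator p^(n+m). In a generator (a,
  l) the scalar is written as (p^n l)/p^n, and its numerator is moved to the left factor.\<close>

lemma frag_fr: "z \<in> T.Fr \<Longrightarrow> \<exists>a\<in>carrier A. \<exists>n. z - frag_of (a, dn n) \<in> T.Ker"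
proof (induction z rule: T.Fr_induct)
  case zero
  have "0 - frag_of (\<zero>\<^bsub>A\<^esub>, dn 0) \<in> T.Ker" using T.Ker_diff[OF T.Ker_0 T.Ker_zero_l[of "dn 0"]] dn(1) by (simp add: LL_simps)
  then show ?case by blast
next
  case (diff z w)
  then obtain a n b m where a: "a \<in> carrier A" "z - frag_of (a, dn n) \<in> T.Ker"
    and b: "b \<in> carrier A" "w - frag_of (b, dn m) \<in> T.Ker" by blast
  let ?a = "p [^] m \<odot>\<^bsub>A\<^esub> a" and ?b = "p [^] n \<odot>\<^bsub>A\<^esub> b" and ?d = "dn (n + m)"
  have c: "?a \<in> carrier A" "?b \<in> carrier A" using smult_closed[OF p_pow_K] a b by auto
  have 1: "z - frag_of (?a, ?d) \<in> T.Ker" using T.Ker_diff[OF a(2) frag_shift[OF a(1), of m n]] by simp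
  have 2: "w - frag_of (?b, ?d) \<in> T.Ker"
    using T.Ker_diff[OF b(2) frag_shift[OF b(1), of n m]] by (simp add: add.commute)
  have "frag_of (?a, ?d) - frag_of (?a \<ominus>\<^bsub>A\<^esub> ?b, ?d) - frag_of (?b, ?d) \<in> T.Ker"
    using T.Ker_add_l[of "?a \<ominus>\<^bsub>A\<^esub> ?b" ?b ?d] c dn(1) by (simp add: LL_simps A.minus_eq A.a_assoc A.l_neg)
  from T.Ker_add[OF this T.Ker_diff[OF 1 2]]
  have "z - w - frag_of (?a \<ominus>\<^bsub>A\<^esub> ?b, ?d) \<in> T.Ker" by (simp add: algebra_simps)
  then show ?case using c A.minus_closed by blast
next
  case (of a l)
  have l: "l \<in> carrier L" using of by (simp add: LL_simps)
  obtain n where n: "p [^] (n::nat) \<otimes> l \<in> K" using denom[OF l] by blast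
  have "(p [^] n \<otimes> l) \<otimes> dn n = l \<otimes> (p [^] n \<otimes> dn n)" using l dn(1) K_carrier[OF p_pow_K[of n]] by (simp add: L.m_ac)
  then have "(p [^] n \<otimes> l) \<otimes> dn n = l" using l dn by simp
  then have "frag_of ((p [^] n \<otimes> l) \<odot>\<^bsub>A\<^esub> a, dn n) - frag_of (a, l) \<in> T.Ker"
    using T.Ker_smult[of "p [^] n \<otimes> l" a "dn n"] n of dn(1) by (simp add: LL_simps)
  from T.Ker_minus[OF this] have "frag_of (a, l) - frag_of ((p [^] n \<otimes> l) \<odot>\<^bsub>A\<^esub> a, dn n) \<in> T.Ker" by simp
  then show ?case using smult_closed[OF n of(1)] by blast
qed

lemma BC_carrier: "carrier BC = T.cls ` T.Fr"
  unfolding base_change_def tensor_algebra_def by (simp add: T.tensor_group_carrier)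

lemma fr_closed: "a \<in> carrier A \<Longrightarrow> fr a n \<in> carrier BC"
  unfolding BC_carrier fr_def using fr_Fr[OF _ dn(1)] by blast

lemma frE: assumes "U \<in> carrier BC" obtains a n where "a \<in> carrier A" "U = fr a n"
proof -
  obtain z where z: "z \<in> T.Fr" "U = T.cls z" using assms unfolding BC_carrier by blast
  obtain a n where "a \<in> carrier A" "z - frag_of (a, dn n) \<in> T.Ker" using frag_fr[OF z(1)] by blast
  then show thesis using that z(2) unfolding fr_def by (metis T.cls_eqI)
qed

lemma frE2:
  assumes "U \<in> carrier BC" "V \<in> carrier BC"
  obtains a b n where "a \<in> carrier A" "b \<in> carrier A" "U = fr a n" "V = fr b n"
proof -
  obtain a n where a: "a \<in> carrier A" "U = fr a n" using frE[OF assms(1)] .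
  obtain b m where b: "b \<in> carrier A" "V = fr b m" using frE[OF assms(2)] .
  have "U = fr (p [^] m \<odot>\<^bsub>A\<^esub> a) (n + m)" "V = fr (p [^] n \<odot>\<^bsub>A\<^esub> b) (n + m)"
    using a b fr_shift[OF a(1), of m n] fr_shift[OF b(1), of n m] by (simp_all add: add.commute)
  then show thesis using that[OF smult_closed[OF p_pow_K a(1)] smult_closed[OF p_pow_K b(1)]] by simp
qed

lemma frE3:
  assumes "U \<in> carrier BC" "V \<in> carrier BC" "W \<in> carrier BC"
  obtains a b c n where "a \<in> carrier A" "b \<in> carrier A" "c \<in> carrier A" "U = fr a n" "V = fr b n" "W = fr c n"
proof -
  obtain a b n where a: "a \<in> carrier A" "b \<in> carrier A" "U = fr a n" "V = fr b n" using frE2[OF assms(1,2)] .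
  obtain c m where c: "c \<in> carrier A" "W = fr c m" using frE[OF assms(3)] .
  have "U = fr (p [^] m \<odot>\<^bsub>A\<^esub> a) (n + m)" "V = fr (p [^] m \<odot>\<^bsub>A\<^esub> b) (n + m)" "W = fr (p [^] n \<odot>\<^bsub>A\<^esub> c) (n + m)"
    using a c fr_shift[OF a(1), of m n] fr_shift[OF a(2), of m n] fr_shift[OF c(1), of n m] by (simp_all add: add.commute)
  then show thesis
    using that[OF smult_closed[OF p_pow_K a(1)] smult_closed[OF p_pow_K a(2)] smult_closed[OF p_pow_K c(1)]] by simp
qed

text \<open>Equality of classes is turned by \<open>clear_Ker\<close> into an equality in
  \<open>A\<close> after multiplication by a large power of \<open>p\<close>, and this power can be
  cancelled because \<open>A\<close> is torsion free.\<close>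

lemma fr_eq_iff: assumes "a \<in> carrier A" "b \<in> carrier A" shows "fr a n = fr b n \<longleftrightarrow> a = b"
proof
  assume "fr a n = fr b n"
  then have "frag_of (a, dn n) - frag_of (b, dn n) \<in> T.Ker" unfolding fr_def T.cls_eq_iff .
  from clear_Ker[OF this] obtain N where
    N: "\<And>m. m \<ge> N \<Longrightarrow> clear m (frag_of (a, dn n) - frag_of (b, dn n)) = \<zero>\<^bsub>A\<^esub>" by blast
  \<comment> \<open>The exponent \<open>N + n\<close> reaches the bound \<open>N\<close> and also
    clears the denominator p^n, leaving p^N.\<close>
  have e: "p [^] (N + n) \<otimes> dn n = p [^] N"
    using dn[of n] K_carrier[OF p_pow_K] K_carrier[OF p(1)] by (simp add: L.nat_pow_mult[symmetric] L.m_assoc)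
  have "p [^] N \<odot>\<^bsub>A\<^esub> a \<ominus>\<^bsub>A\<^esub> p [^] N \<odot>\<^bsub>A\<^esub> b = \<zero>\<^bsub>A\<^esub>"
    using clear_diff2[of a "dn n" "N + n" b "dn n"] N[of "N + n"] assms dn(1) p_pow_K unfolding e by simp
  then have "p [^] N \<odot>\<^bsub>A\<^esub> a = p [^] N \<odot>\<^bsub>A\<^esub> b" using assms smult_closed[OF p_pow_K] by simp
  then show "a = b" by (rule p_pow_inj[OF assms])
qed simp

lemma BC_add: "z \<in> T.Fr \<Longrightarrow> w \<in> T.Fr \<Longrightarrow> T.cls z \<oplus>\<^bsub>BC\<^esub> T.cls w = T.cls (z + w)"
  unfolding base_change_def tensor_algebra_def by (simp add: T.tensor_group_mult)

lemma fr_add: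
  assumes "a \<in> carrier A" "b \<in> carrier A" shows "fr a n \<oplus>\<^bsub>BC\<^esub> fr b n = fr (a \<oplus>\<^bsub>A\<^esub> b) n"
proof -
  have "fr a n \<oplus>\<^bsub>BC\<^esub> fr b n = T.cls (frag_of (a, dn n) + frag_of (b, dn n))"
    unfolding fr_def by (rule BC_add[OF fr_Fr[OF assms(1) dn(1)] fr_Fr[OF assms(2) dn(1)]])
  also have "\<dots> = fr (a \<oplus>\<^bsub>A\<^esub> b) n" unfolding fr_def
    using T.Ker_minus[OF T.Ker_add_l[OF assms, of "dn n"]] dn(1) by (intro T.cls_eqI) (simp add: LL_simps algebra_simps)
  finally show ?thesis .
qed

lemma BC_zero: "\<zero>\<^bsub>BC\<^esub> = fr \<zero>\<^bsub>A\<^esub> n"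
proof -
  have "T.cls 0 = T.cls (frag_of (\<zero>\<^bsub>A\<^esub>, dn n))"
    using T.Ker_diff[OF T.Ker_0 T.Ker_zero_l[of "dn n"]] dn(1) by (intro T.cls_eqI) (simp add: LL_simps)
  then show ?thesis unfolding fr_def base_change_def tensor_algebra_def by (simp add: T.tensor_group_one)
qed

lemma BC_one: "\<one>\<^bsub>BC\<^esub> = fr \<one>\<^bsub>A\<^esub> 0"
  unfolding base_change_def tensor_algebra_def fr_def dn_0 pure_tensor_def by (simp add: LL_simps)

abbreviation "fm \<equiv> tensor_frag_mult A LL"

lemma frag_extend_fun_diff:
  fixes f g :: "'f \<Rightarrow> 'g \<Rightarrow>\<^sub>0 int"
  shows "frag_extend (\<lambda>x. f x - g x) z = frag_extend f z - frag_extend g z"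
proof -
  have "frag_cmul k (a - b) = frag_cmul k a - frag_cmul k b" for k and a b :: "'g \<Rightarrow>\<^sub>0 int"
    using frag_cmul_distrib2[of k "a - b" b] by (simp add: algebra_simps)
  then show ?thesis unfolding frag_extend_def by (simp add: sum_subtractf)
qed

lemma fm_simps:
  "fm 0 w = 0" "fm z 0 = 0" "fm (z - z') w = fm z w - fm z' w" "fm z (w - w') = fm z w - fm z w'"
  "fm (frag_of (a, l)) (frag_of (b, k)) = frag_of (a \<otimes>\<^bsub>A\<^esub> b, l \<otimes> k)"
proof -
  show "fm 0 w = 0" "fm (z - z') w = fm z w - fm z' w" unfolding tensor_frag_mult_def
    by (simp_all add: frag_extend_diff)
  have "(\<lambda>(a, c). frag_extend (\<lambda>(a', c'). frag_of (a \<otimes>\<^bsub>A\<^esub> a', c \<otimes>\<^bsub>LL\<^esub> c')) (w - w'))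
    = (\<lambda>x. (case x of (a, c) \<Rightarrow> frag_extend (\<lambda>(a', c'). frag_of (a \<otimes>\<^bsub>A\<^esub> a', c \<otimes>\<^bsub>LL\<^esub> c')) w)
       - (case x of (a, c) \<Rightarrow> frag_extend (\<lambda>(a', c'). frag_of (a \<otimes>\<^bsub>A\<^esub> a', c \<otimes>\<^bsub>LL\<^esub> c')) w'))" for w w'
    by (auto simp: frag_extend_diff)
  then show d: "fm z (w - w') = fm z w - fm z w'" for w w' unfolding tensor_frag_mult_def
    by (simp add: frag_extend_fun_diff)
  show "fm z 0 = 0" using d[of 0 0] by simp
  show "fm (frag_of (a, l)) (frag_of (b, k)) = frag_of (a \<otimes>\<^bsub>A\<^esub> b, l \<otimes> k)"
    unfolding tensor_frag_mult_def by (simp add: LL_simps)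
qed

text \<open>Together with the right-hand version this says that the relations form a two-sided ideal
  for the product of representatives, so that the product of classes is well defined.\<close>

lemma fm_Ker_l: assumes z: "z \<in> T.Ker" and w: "w \<in> T.Fr" shows "fm z w \<in> T.Ker"
  using w
proof (induction w rule: T.Fr_induct)
  case zero then show ?case using T.Ker_0 by (simp add: fm_simps)
next
  case (diff u w) then show ?case using T.Ker_diff by (simp add: fm_simps)
next
  case (of b k)
  have k: "k \<in> carrier L" using of by (simp add: LL_simps)
  show ?case using z
  proof (induction z rule: T.Ker_induct)
    case zero then show ?case using T.Ker_0 by (simp add: fm_simps)
  next
    case (diff z w) then show ?case using T.Ker_diff by (simp add: fm_simps)
  next
    case (add_l x x' y)
    then show ?case using T.Ker_add_l[of "x \<otimes>\<^bsub>A\<^esub> b" "x' \<otimes>\<^bsub>A\<^esub> b" "y \<otimes> k"] of k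
      by (simp add: fm_simps LL_simps A.l_distr)
  next
    case (add_r x y y')
    then show ?case using T.Ker_add_r[of "x \<otimes>\<^bsub>A\<^esub> b" "y \<otimes> k" "y' \<otimes> k"] of k
      by (simp add: fm_simps LL_simps L.l_distr)
  next
    case (smult s x y)
    then have "s \<in> K" "s \<in> carrier L" "y \<in> carrier L" using K_carrier by (auto simp: LL_simps)
    then show ?case using T.Ker_smult[of s "x \<otimes>\<^bsub>A\<^esub> b" "y \<otimes> k"] of k smult
      by (simp add: fm_simps LL_simps L.m_assoc smult_mult_l)
  qed
qed

lemma fm_Ker_r: assumes z: "z \<in> T.Ker" and w: "w \<in> T.Fr" shows "fm w z \<in> T.Ker"
  using w
proof (induction w rule: T.Fr_induct)
  case zero then show ?case using T.Ker_0 by (simp add: fm_simps)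
next
  case (diff u w) then show ?case using T.Ker_diff by (simp add: fm_simps)
next
  case (of b k)
  have k: "k \<in> carrier L" using of by (simp add: LL_simps)
  show ?case using z
  proof (induction z rule: T.Ker_induct)
    case zero then show ?case using T.Ker_0 by (simp add: fm_simps)
  next
    case (diff z w) then show ?case using T.Ker_diff by (simp add: fm_simps)
  next
    case (add_l x x' y)
    then show ?case using T.Ker_add_l[of "b \<otimes>\<^bsub>A\<^esub> x" "b \<otimes>\<^bsub>A\<^esub> x'" "k \<otimes> y"] of k
      by (simp add: fm_simps LL_simps A.r_distr)
  next
    case (add_r x y y')
    then show ?case using T.Ker_add_r[of "b \<otimes>\<^bsub>A\<^esub> x" "k \<otimes> y" "k \<otimes> y'"] of k
      by (simp add: fm_simps LL_simps L.r_distr)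
  next
    case (smult s x y)
    then have s: "s \<in> K" "s \<in> carrier L" "y \<in> carrier L" using K_carrier by (auto simp: LL_simps)
    then have "k \<otimes> (s \<otimes> y) = s \<otimes> (k \<otimes> y)" using k by (simp add: L.m_lcomm)
    then show ?case using T.Ker_smult[of s "b \<otimes>\<^bsub>A\<^esub> x" "k \<otimes> y"] of k smult s
      by (simp add: fm_simps LL_simps smult_mult_r)
  qed
qed

lemma cls_mult:
  assumes z: "z \<in> T.Fr" and w: "w \<in> T.Fr" shows "T.cls z \<otimes>\<^bsub>BC\<^esub> T.cls w = T.cls (fm z w)"
proof -
  have "T.cls (fm z' w') = T.cls (fm z w)" if "z' \<in> T.cls z" "w' \<in> T.cls w" for z' w'
  proof (rule T.cls_eqI)
    have d: "z' - z \<in> T.Ker" "w' - w \<in> T.Ker" using that T.cls_iff by blast+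
    have "w' \<in> T.Fr" using T.Fr_add[OF subsetD[OF T.Ker_Fr d(2)] w] by simp
    from T.Ker_add[OF fm_Ker_l[OF d(1) this] fm_Ker_r[OF d(2) z]]
    show "fm z' w' - fm z w \<in> T.Ker" by (simp add: fm_simps)
  qed
  then have "(\<Union>z'\<in>T.cls z. \<Union>w'\<in>T.cls w. T.cls (fm z' w')) = (\<Union>z'\<in>T.cls z. \<Union>w'\<in>T.cls w. T.cls (fm z w))"
    by simp
  also have "\<dots> = T.cls (fm z w)" using T.cls_self by blast
  finally show ?thesis unfolding base_change_def tensor_algebra_def by simp
qed

lemma fr_mult:
  assumes "a \<in> carrier A" "b \<in> carrier A" shows "fr a n \<otimes>\<^bsub>BC\<^esub> fr b m = fr (a \<otimes>\<^bsub>A\<^esub> b) (n + m)"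
  unfolding fr_def cls_mult[OF fr_Fr[OF assms(1) dn(1)] fr_Fr[OF assms(2) dn(1)]] fm_simps dn_add ..

lemma fr_smult:
  assumes r: "r \<in> K" and a: "a \<in> carrier A" shows "r \<odot>\<^bsub>BC\<^esub> fr a n = fr (r \<odot>\<^bsub>A\<^esub> a) n"
proof -
  have "r \<odot>\<^bsub>BC\<^esub> fr a n = tensor_map Rg A LL (\<lambda>a. r \<odot>\<^bsub>A\<^esub> a) (\<lambda>c. c) (fr a n)"
    unfolding base_change_def tensor_algebra_def by simp
  also have "\<dots> = T.cls (tensor_push (\<lambda>a. r \<odot>\<^bsub>A\<^esub> a) (\<lambda>c. c) (frag_of (a, dn n)))"
  proof (rule tensor_map_cls[OF tensor_factors_A tensor_factors_A])
    show "frag_of (a, dn n) \<in> fr a n" "fr a n = T.cls (frag_of (a, dn n))" unfolding fr_def using T.cls_self by auto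
    fix w assume "w \<in> T.Ker"
    then show "tensor_push (\<lambda>a. r \<odot>\<^bsub>A\<^esub> a) (\<lambda>c. c) w \<in> T.Ker"
    proof (induction w rule: T.Ker_induct)
      case zero then show ?case using T.Ker_0 by simp
    next
      case (diff z w) then show ?case using T.Ker_diff by simp
    next
      case (add_l x x' y)
      then show ?case using T.Ker_add_l[of "r \<odot>\<^bsub>A\<^esub> x" "r \<odot>\<^bsub>A\<^esub> x'" y] r smult_closed lsmult_r_distr[of r x x'] by simp
    next
      case (add_r x y y')
      then show ?case using T.Ker_add_r[of "r \<odot>\<^bsub>A\<^esub> x" y y'] r smult_closed by simp
    next
      case (smult s x y)
      then have s: "s \<in> K" "s \<in> carrier L" "r \<in> carrier L" using K_carrier r by auto
      then have "r \<odot>\<^bsub>A\<^esub> (s \<odot>\<^bsub>A\<^esub> x) = s \<odot>\<^bsub>A\<^esub> (r \<odot>\<^bsub>A\<^esub> x)"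
        using lsmult_assoc[of r s x] lsmult_assoc[of s r x] r smult L.m_comm[of r s] by simp
      then show ?case using T.Ker_smult[of s "r \<odot>\<^bsub>A\<^esub> x" y] r smult smult_closed by simp
    qed
  qed
  finally show ?thesis unfolding fr_def by simp
qed

text \<open>Any two or three elements have a common denominator, after which each ring axiom becomes
  the corresponding axiom of \<open>A\<close>.\<close>

lemma BC_ring: "ring BC"
proof (rule ringI)
  show "abelian_group BC"
  proof (rule abelian_groupI)
    fix U V assume "U \<in> carrier BC" "V \<in> carrier BC"
    then obtain a b n where "a \<in> carrier A" "b \<in> carrier A" "U = fr a n" "V = fr b n" by (rule frE2)
    then show "U \<oplus>\<^bsub>BC\<^esub> V \<in> carrier BC" "U \<oplus>\<^bsub>BC\<^esub> V = V \<oplus>\<^bsub>BC\<^esub> U" by (simp_all add: fr_add fr_closed A.a_comm)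
  next
    fix U V W assume "U \<in> carrier BC" "V \<in> carrier BC" "W \<in> carrier BC"
    then obtain a b c n where "a \<in> carrier A" "b \<in> carrier A" "c \<in> carrier A" "U = fr a n" "V = fr b n" "W = fr c n"
      by (rule frE3)
    then show "U \<oplus>\<^bsub>BC\<^esub> V \<oplus>\<^bsub>BC\<^esub> W = U \<oplus>\<^bsub>BC\<^esub> (V \<oplus>\<^bsub>BC\<^esub> W)" by (simp add: fr_add A.a_assoc)
  next
    show "\<zero>\<^bsub>BC\<^esub> \<in> carrier BC" unfolding BC_zero[of 0] by (simp add: fr_closed)
    fix U assume "U \<in> carrier BC"
    then obtain a n where a: "a \<in> carrier A" "U = fr a n" by (rule frE)
    then show "\<zero>\<^bsub>BC\<^esub> \<oplus>\<^bsub>BC\<^esub> U = U" unfolding BC_zero[of n] by (simp add: fr_add)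
    have "fr (\<ominus>\<^bsub>A\<^esub> a) n \<oplus>\<^bsub>BC\<^esub> U = \<zero>\<^bsub>BC\<^esub>" unfolding BC_zero[of n] using a by (simp add: fr_add A.l_neg)
    then show "\<exists>V\<in>carrier BC. V \<oplus>\<^bsub>BC\<^esub> U = \<zero>\<^bsub>BC\<^esub>" using a fr_closed A.a_inv_closed by blast
  qed
  show "Group.monoid BC"
  proof (rule Group.monoidI)
    fix U V assume "U \<in> carrier BC" "V \<in> carrier BC"
    then obtain a b n where "a \<in> carrier A" "b \<in> carrier A" "U = fr a n" "V = fr b n" by (rule frE2)
    then show "U \<otimes>\<^bsub>BC\<^esub> V \<in> carrier BC" by (simp add: fr_mult fr_closed)
  next
    fix U V W assume "U \<in> carrier BC" "V \<in> carrier BC" "W \<in> carrier BC"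
    then obtain a b c n where "a \<in> carrier A" "b \<in> carrier A" "c \<in> carrier A" "U = fr a n" "V = fr b n" "W = fr c n"
      by (rule frE3)
    then show "U \<otimes>\<^bsub>BC\<^esub> V \<otimes>\<^bsub>BC\<^esub> W = U \<otimes>\<^bsub>BC\<^esub> (V \<otimes>\<^bsub>BC\<^esub> W)" by (simp add: fr_mult A.m_assoc add.assoc)
  next
    show "\<one>\<^bsub>BC\<^esub> \<in> carrier BC" unfolding BC_one by (simp add: fr_closed)
    fix U assume "U \<in> carrier BC"
    then obtain a n where "a \<in> carrier A" "U = fr a n" by (rule frE)
    then show "\<one>\<^bsub>BC\<^esub> \<otimes>\<^bsub>BC\<^esub> U = U" "U \<otimes>\<^bsub>BC\<^esub> \<one>\<^bsub>BC\<^esub> = U" unfolding BC_one by (simp_all add: fr_mult)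
  qed
next
  fix U V W assume "U \<in> carrier BC" "V \<in> carrier BC" "W \<in> carrier BC"
  then obtain a b c n where "a \<in> carrier A" "b \<in> carrier A" "c \<in> carrier A" "U = fr a n" "V = fr b n" "W = fr c n"
    by (rule frE3)
  then show "(U \<oplus>\<^bsub>BC\<^esub> V) \<otimes>\<^bsub>BC\<^esub> W = U \<otimes>\<^bsub>BC\<^esub> W \<oplus>\<^bsub>BC\<^esub> V \<otimes>\<^bsub>BC\<^esub> W" "W \<otimes>\<^bsub>BC\<^esub> (U \<oplus>\<^bsub>BC\<^esub> V) = W \<otimes>\<^bsub>BC\<^esub> U \<oplus>\<^bsub>BC\<^esub> W \<otimes>\<^bsub>BC\<^esub> V"
    by (simp_all add: fr_mult fr_add A.l_distr A.r_distr)
qed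

sublocale BC: ring BC by (rule BC_ring)

lemma BC_assoc_algebra: "assoc_algebra Rg BC"
proof (intro assoc_algebra.intro R.cring_axioms BC_ring left_module.intro BC.abelian_group_axioms
    left_module_axioms.intro assoc_algebra_axioms.intro)
  show "ring Rg" by (rule R.ring_axioms)
next
  fix r U assume "r \<in> carrier Rg" "U \<in> carrier BC"
  moreover from this obtain a n where "a \<in> carrier A" "U = fr a n" by (auto elim: frE)
  ultimately show "r \<odot>\<^bsub>BC\<^esub> U \<in> carrier BC" by (simp add: fr_smult fr_closed smult_closed)
next
  fix r s U assume r: "r \<in> carrier Rg" "s \<in> carrier Rg" and "U \<in> carrier BC"
  then obtain a n where a: "a \<in> carrier A" "U = fr a n" by (auto elim: frE)
  have k: "r \<oplus> s \<in> K" "r \<otimes> s \<in> K" using r K by (auto simp: subringE)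
  show "(r \<oplus>\<^bsub>Rg\<^esub> s) \<odot>\<^bsub>BC\<^esub> U = r \<odot>\<^bsub>BC\<^esub> U \<oplus>\<^bsub>BC\<^esub> s \<odot>\<^bsub>BC\<^esub> U"
    using r a k lsmult_l_distr[of r s a] by (simp add: fr_smult fr_add smult_closed)
  show "(r \<otimes>\<^bsub>Rg\<^esub> s) \<odot>\<^bsub>BC\<^esub> U = r \<odot>\<^bsub>BC\<^esub> (s \<odot>\<^bsub>BC\<^esub> U)"
    using r a k lsmult_assoc[of r s a] by (simp add: fr_smult smult_closed)
next
  fix r U V assume r: "r \<in> carrier Rg" and U: "U \<in> carrier BC" "V \<in> carrier BC"
  obtain a b n where a: "a \<in> carrier A" "b \<in> carrier A" "U = fr a n" "V = fr b n" using U by (rule frE2)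
  show "r \<odot>\<^bsub>BC\<^esub> (U \<oplus>\<^bsub>BC\<^esub> V) = r \<odot>\<^bsub>BC\<^esub> U \<oplus>\<^bsub>BC\<^esub> r \<odot>\<^bsub>BC\<^esub> V"
    using r a lsmult_r_distr[of r a b] by (simp add: fr_smult fr_add smult_closed)
  show "r \<odot>\<^bsub>BC\<^esub> (U \<otimes>\<^bsub>BC\<^esub> V) = (r \<odot>\<^bsub>BC\<^esub> U) \<otimes>\<^bsub>BC\<^esub> V"
    using r a smult_mult_l[of r a b] by (simp add: fr_smult fr_mult smult_closed)
  show "r \<odot>\<^bsub>BC\<^esub> (U \<otimes>\<^bsub>BC\<^esub> V) = U \<otimes>\<^bsub>BC\<^esub> (r \<odot>\<^bsub>BC\<^esub> V)"
    using r a smult_mult_r[of r a b] by (simp add: fr_smult fr_mult smult_closed)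
next
  fix U assume "U \<in> carrier BC"
  then obtain a n where "a \<in> carrier A" "U = fr a n" by (rule frE)
  moreover have "\<one> \<in> K" using K subringE(3) by blast
  ultimately show "\<one>\<^bsub>Rg\<^esub> \<odot>\<^bsub>BC\<^esub> U = U" using lsmult_one[of a] by (simp add: fr_smult)
qed

end

locale base_change_hom = A: base_change_algebra L K p A + C: base_change_algebra L K p C
  for L :: "('a, 'l) ring_scheme" (structure) and K p and A :: "('a, 'b) module" and C :: "('a, 'c) module" +
  fixes f :: "'b \<Rightarrow> 'c"
  assumes f_hom: "f \<in> ring_hom A C"
    and f_smult: "\<And>r a. r \<in> K \<Longrightarrow> a \<in> carrier A \<Longrightarrow> f (r \<odot>\<^bsub>A\<^esub> a) = r \<odot>\<^bsub>C\<^esub> f a"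
begin

abbreviation "bcm \<equiv> base_change_map A.Rg L C f"

lemma f_simps: "a \<in> carrier A \<Longrightarrow> f a \<in> carrier C"
  "a \<in> carrier A \<Longrightarrow> b \<in> carrier A \<Longrightarrow> f (a \<oplus>\<^bsub>A\<^esub> b) = f a \<oplus>\<^bsub>C\<^esub> f b"
  "a \<in> carrier A \<Longrightarrow> b \<in> carrier A \<Longrightarrow> f (a \<otimes>\<^bsub>A\<^esub> b) = f a \<otimes>\<^bsub>C\<^esub> f b"
  "f \<one>\<^bsub>A\<^esub> = \<one>\<^bsub>C\<^esub>"
  using f_hom unfolding ring_hom_def by auto

lemma bcm_fr:
  assumes a: "a \<in> carrier A" shows "bcm (A.fr a n) = C.fr (f a) n"
proof -
  have "bcm (A.fr a n) = C.T.cls (tensor_push f (\<lambda>l. l) (frag_of (a, A.dn n)))"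
    unfolding base_change_map_def
  proof (rule tensor_map_cls[OF A.tensor_factors_A C.tensor_factors_A])
    show "frag_of (a, A.dn n) \<in> A.fr a n" "A.fr a n = A.T.cls (frag_of (a, A.dn n))"
      unfolding A.fr_def using A.T.cls_self by auto
    fix w assume "w \<in> A.T.Ker"
    then show "tensor_push f (\<lambda>l. l) w \<in> C.T.Ker"
    proof (induction w rule: A.T.Ker_induct)
      case zero then show ?case using C.T.Ker_0 by simp
    next
      case (diff z w) then show ?case using C.T.Ker_diff by simp
    next
      case (add_l x x' y)
      then show ?case using C.T.Ker_add_l[of "f x" "f x'" y] f_simps by simp
    next
      case (add_r x y y')
      then show ?case using C.T.Ker_add_r[of "f x" y y'] f_simps by simp
    next
      case (smult s x y)
      then show ?case using C.T.Ker_smult[of s "f x" y] f_simps f_smult by simp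
    qed
  qed
  then show ?thesis unfolding C.fr_def by simp
qed

lemma bcm_ring_hom: "bcm \<in> ring_hom A.BC C.BC"
proof (rule ring_hom_memI)
  fix U assume "U \<in> carrier A.BC"
  then obtain a n where "a \<in> carrier A" "U = A.fr a n" by (rule A.frE)
  then show "bcm U \<in> carrier C.BC" by (simp add: bcm_fr C.fr_closed f_simps)
next
  fix U V assume "U \<in> carrier A.BC" "V \<in> carrier A.BC"
  then obtain a b n where "a \<in> carrier A" "b \<in> carrier A" "U = A.fr a n" "V = A.fr b n" by (rule A.frE2)
  then show "bcm (U \<otimes>\<^bsub>A.BC\<^esub> V) = bcm U \<otimes>\<^bsub>C.BC\<^esub> bcm V" "bcm (U \<oplus>\<^bsub>A.BC\<^esub> V) = bcm U \<oplus>\<^bsub>C.BC\<^esub> bcm V"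
    by (simp_all add: bcm_fr A.fr_mult A.fr_add C.fr_mult C.fr_add f_simps)
next
  show "bcm \<one>\<^bsub>A.BC\<^esub> = \<one>\<^bsub>C.BC\<^esub>" unfolding A.BC_one C.BC_one by (simp add: bcm_fr f_simps)
qed

end

section \<open>Adic completion of a torsion free algebra\<close>

locale adic_algebra = assoc_algebra R A
  for R :: "('r, 'x) ring_scheme" (structure) and A :: "('r, 'a) module" +
  fixes p :: 'r
  assumes p: "p \<in> carrier R" and tf: "torsion_free p A"
begin

abbreviation "P \<equiv> pow_sub R p A"
abbreviation "pw \<equiv> \<lambda>n::nat. p [^]\<^bsub>R\<^esub> n"
abbreviation "cst \<equiv> \<lambda>n x. P n +>\<^bsub>A\<^esub> x"
abbreviation "Ac \<equiv> completion R p A"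

lemma pw_closed: "pw n \<in> carrier R"
  using p by simp

lemma pw_add: "pw (m + n) = pw m \<otimes>\<^bsub>R\<^esub> pw n"
  using p by (simp add: R.nat_pow_mult)

lemma sm: "r \<in> carrier R \<Longrightarrow> a \<in> carrier A \<Longrightarrow> r \<odot>\<^bsub>A\<^esub> a \<in> carrier A"
  by (rule lsmult_closed)

lemma smult_diff:
  assumes "r \<in> carrier R" "a \<in> carrier A" "b \<in> carrier A" shows "r \<odot>\<^bsub>A\<^esub> (a \<ominus>\<^bsub>A\<^esub> b) = r \<odot>\<^bsub>A\<^esub> a \<ominus>\<^bsub>A\<^esub> r \<odot>\<^bsub>A\<^esub> b"
proof -
  have "r \<odot>\<^bsub>A\<^esub> (a \<ominus>\<^bsub>A\<^esub> b) \<oplus>\<^bsub>A\<^esub> r \<odot>\<^bsub>A\<^esub> b = r \<odot>\<^bsub>A\<^esub> a"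
    using lsmult_r_distr[of r "a \<ominus>\<^bsub>A\<^esub> b" b] assms by (simp add: A.minus_eq A.a_assoc A.l_neg)
  then show ?thesis using assms sm by (metis A.add.inv_solve_right A.minus_eq A.minus_closed)
qed

lemma smult_zero: "r \<in> carrier R \<Longrightarrow> r \<odot>\<^bsub>A\<^esub> \<zero>\<^bsub>A\<^esub> = \<zero>\<^bsub>A\<^esub>"
  using smult_diff[of r "\<zero>\<^bsub>A\<^esub>" "\<zero>\<^bsub>A\<^esub>"] sm[of r "\<zero>\<^bsub>A\<^esub>"] by (simp add: A.minus_eq A.r_neg)

lemma smult_minus: "r \<in> carrier R \<Longrightarrow> a \<in> carrier A \<Longrightarrow> r \<odot>\<^bsub>A\<^esub> (\<ominus>\<^bsub>A\<^esub> a) = \<ominus>\<^bsub>A\<^esub> (r \<odot>\<^bsub>A\<^esub> a)"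
  using smult_diff[of r "\<zero>\<^bsub>A\<^esub>" a] smult_zero[of r] sm[of r a] by (simp add: A.minus_eq)

lemma pw_inj:
  assumes "a \<in> carrier A" "b \<in> carrier A" "pw n \<odot>\<^bsub>A\<^esub> a = pw n \<odot>\<^bsub>A\<^esub> b" shows "a = b"
proof -
  have *: "x = \<zero>\<^bsub>A\<^esub>" if "x \<in> carrier A" "pw n \<odot>\<^bsub>A\<^esub> x = \<zero>\<^bsub>A\<^esub>" for x n
    using that(2)
  proof (induction n)
    case 0 then show ?case using that(1) lsmult_one[of x] by simp
  next
    case (Suc n)
    have "pw (Suc n) \<odot>\<^bsub>A\<^esub> x = p \<odot>\<^bsub>A\<^esub> (pw n \<odot>\<^bsub>A\<^esub> x)"
      using lsmult_assoc[of p "pw n" x] p that(1) by (simp add: R.m_comm)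
    then have "pw n \<odot>\<^bsub>A\<^esub> x = \<zero>\<^bsub>A\<^esub>"
      using Suc.prems tf sm[OF pw_closed that(1)] unfolding torsion_free_def by simp
    then show ?case by (rule Suc.IH)
  qed
  have "pw n \<odot>\<^bsub>A\<^esub> (a \<ominus>\<^bsub>A\<^esub> b) = \<zero>\<^bsub>A\<^esub>"
    using assms smult_diff[OF pw_closed] sm[OF pw_closed] by (simp add: A.minus_eq A.r_neg)
  then have "a \<ominus>\<^bsub>A\<^esub> b = \<zero>\<^bsub>A\<^esub>" using * assms by simp
  then show ?thesis using assms by simp
qed

lemma P_iff: "x \<in> P n \<longleftrightarrow> (\<exists>y\<in>carrier A. x = pw n \<odot>\<^bsub>A\<^esub> y)"
  unfolding pow_sub_def by blast

lemma P_carrier: "x \<in> P n \<Longrightarrow> x \<in> carrier A"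
  unfolding P_iff using sm pw_closed by blast

lemma PI: "y \<in> carrier A \<Longrightarrow> pw n \<odot>\<^bsub>A\<^esub> y \<in> P n"
  unfolding P_iff by blast

lemma P_ideal: "ideal (P n) A"
proof (rule idealI[OF A.ring_axioms])
  show "subgroup (P n) (add_monoid A)"
  proof (rule A.add.subgroupI)
    show "P n \<subseteq> carrier A" using P_carrier by blast
    show "P n \<noteq> {}" using PI A.zero_closed by blast
  next
    fix a assume "a \<in> P n"
    then obtain x where "x \<in> carrier A" "a = pw n \<odot>\<^bsub>A\<^esub> x" unfolding P_iff by blast
    then show "\<ominus>\<^bsub>A\<^esub> a \<in> P n" using PI[of "\<ominus>\<^bsub>A\<^esub> x" n] smult_minus[OF pw_closed] by simp
  next
    fix a b assume "a \<in> P n" "b \<in> P n"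
    then obtain x y where "x \<in> carrier A" "a = pw n \<odot>\<^bsub>A\<^esub> x" "y \<in> carrier A" "b = pw n \<odot>\<^bsub>A\<^esub> y" unfolding P_iff by blast
    then show "a \<oplus>\<^bsub>A\<^esub> b \<in> P n" using PI[of "x \<oplus>\<^bsub>A\<^esub> y" n] lsmult_r_distr[OF pw_closed] by simp
  qed
next
  fix a x assume "a \<in> P n" and x: "x \<in> carrier A"
  then obtain y where "y \<in> carrier A" "a = pw n \<odot>\<^bsub>A\<^esub> y" unfolding P_iff by blast
  then show "x \<otimes>\<^bsub>A\<^esub> a \<in> P n" "a \<otimes>\<^bsub>A\<^esub> x \<in> P n"
    using PI[of "x \<otimes>\<^bsub>A\<^esub> y" n] PI[of "y \<otimes>\<^bsub>A\<^esub> x" n] smult_mult_l[OF pw_closed, of y x n] smult_mult_r[OF pw_closed, of x y n] x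
    by simp_all
qed

lemma P_sg: "additive_subgroup (P n) A"
  using P_ideal by (rule ideal.axioms)

lemma P_zero: "\<zero>\<^bsub>A\<^esub> \<in> P n"
  using additive_subgroup.zero_closed[OF P_sg] .

lemma P_add: "x \<in> P n \<Longrightarrow> y \<in> P n \<Longrightarrow> x \<oplus>\<^bsub>A\<^esub> y \<in> P n"
  using additive_subgroup.a_closed[OF P_sg] .

lemma P_minus: "x \<in> P n \<Longrightarrow> \<ominus>\<^bsub>A\<^esub> x \<in> P n"
  using additive_subgroup.a_inv_closed[OF P_sg] .

lemma P_smult: "r \<in> carrier R \<Longrightarrow> x \<in> P n \<Longrightarrow> r \<odot>\<^bsub>A\<^esub> x \<in> P n"
proof -
  assume r: "r \<in> carrier R" and "x \<in> P n"
  then obtain y where y: "y \<in> carrier A" "x = pw n \<odot>\<^bsub>A\<^esub> y" unfolding P_iff by blast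
  have "r \<odot>\<^bsub>A\<^esub> x = pw n \<odot>\<^bsub>A\<^esub> (r \<odot>\<^bsub>A\<^esub> y)"
    using lsmult_assoc[of r "pw n" y] lsmult_assoc[of "pw n" r y] y r pw_closed R.m_comm[of r "pw n"] by simp
  then show ?thesis using PI[OF sm[OF r y(1)]] by simp
qed

lemma P_mult: "x \<in> P n \<Longrightarrow> y \<in> carrier A \<Longrightarrow> x \<otimes>\<^bsub>A\<^esub> y \<in> P n \<and> y \<otimes>\<^bsub>A\<^esub> x \<in> P n"
  using ideal.I_l_closed[OF P_ideal] ideal.I_r_closed[OF P_ideal] by blast

lemma P_Suc: "x \<in> P (Suc n) \<Longrightarrow> x \<in> P n"
proof -
  assume "x \<in> P (Suc n)"
  then obtain y where y: "y \<in> carrier A" "x = pw (Suc n) \<odot>\<^bsub>A\<^esub> y" unfolding P_iff by blast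
  then have "x = pw n \<odot>\<^bsub>A\<^esub> (p \<odot>\<^bsub>A\<^esub> y)" using lsmult_assoc[of "pw n" p y] p by simp
  then show "x \<in> P n" using PI sm p y by blast
qed

lemma cst_eq_iff:
  assumes "x \<in> carrier A" "y \<in> carrier A" shows "cst n x = cst n y \<longleftrightarrow> x \<ominus>\<^bsub>A\<^esub> y \<in> P n"
  using A.quotient_eq_iff_same_a_r_cos[OF P_ideal assms] by blast

lemma cst_mem_iff:
  assumes "x \<in> carrier A" shows "y \<in> cst n x \<longleftrightarrow> y \<in> carrier A \<and> y \<ominus>\<^bsub>A\<^esub> x \<in> P n"
proof
  assume "y \<in> cst n x"
  then obtain z where z: "z \<in> P n" "y = z \<oplus>\<^bsub>A\<^esub> x" unfolding a_r_coset_def' by blast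
  then show "y \<in> carrier A \<and> y \<ominus>\<^bsub>A\<^esub> x \<in> P n" using assms P_carrier[OF z(1)]
    by (simp add: A.minus_eq A.a_assoc A.r_neg)
next
  assume y: "y \<in> carrier A \<and> y \<ominus>\<^bsub>A\<^esub> x \<in> P n"
  then have "y = (y \<ominus>\<^bsub>A\<^esub> x) \<oplus>\<^bsub>A\<^esub> x" using assms by (simp add: A.minus_eq A.a_assoc A.l_neg)
  then show "y \<in> cst n x" using y unfolding a_r_coset_def' by blast
qed

lemma cst_hom: "cst n \<in> ring_hom A (A Quot P n)"
  by (rule ideal.rcos_ring_hom[OF P_ideal])

lemma cst_ops:
  assumes "x \<in> carrier A" "y \<in> carrier A"
  shows "cst n x \<otimes>\<^bsub>A Quot P n\<^esub> cst n y = cst n (x \<otimes>\<^bsub>A\<^esub> y)" "cst n x \<oplus>\<^bsub>A Quot P n\<^esub> cst n y = cst n (x \<oplus>\<^bsub>A\<^esub> y)"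
  using ring_hom_mult[OF cst_hom assms] ring_hom_add[OF cst_hom assms] by simp_all

lemma cst_one: "\<one>\<^bsub>A Quot P n\<^esub> = cst n \<one>\<^bsub>A\<^esub>"
  using ring_hom_one[OF cst_hom] by simp

lemma cst_zero: "\<zero>\<^bsub>A Quot P n\<^esub> = cst n \<zero>\<^bsub>A\<^esub>"
  using ring_hom_zero[OF cst_hom A.ring_axioms ideal.quotient_is_ring[OF P_ideal]] by simp

lemma Quot_carrier: "carrier (A Quot P n) = cst n ` carrier A"
  unfolding FactRing_def A_RCOSETS_def' by auto

lemma cst_smult:
  assumes r: "r \<in> carrier R" and a: "a \<in> carrier A"
  shows "(\<Union>x\<in>cst n a. cst n (r \<odot>\<^bsub>A\<^esub> x)) = cst n (r \<odot>\<^bsub>A\<^esub> a)"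
proof -
  have "cst n (r \<odot>\<^bsub>A\<^esub> x) = cst n (r \<odot>\<^bsub>A\<^esub> a)" if x: "x \<in> cst n a" for x
  proof -
    have "x \<in> carrier A" "x \<ominus>\<^bsub>A\<^esub> a \<in> P n" using x unfolding cst_mem_iff[OF a] by auto
    then show ?thesis using P_smult[OF r, of "x \<ominus>\<^bsub>A\<^esub> a" n] r a sm by (simp add: cst_eq_iff smult_diff)
  qed
  moreover have "a \<in> cst n a" unfolding cst_mem_iff[OF a] using a P_zero by (simp add: A.minus_eq A.r_neg)
  ultimately show ?thesis by blast
qed

text \<open>A choice of representatives for an element of the inverse limit: x(n) for the quotient
  by p^n, with x(n+1) congruent to x(n) modulo p^n. Two choices represent the same element when
  their n-th terms agree modulo p^n for all n.\<close>

definition coherent :: "(nat \<Rightarrow> 'a) \<Rightarrow> bool" where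
  "coherent x \<longleftrightarrow> (\<forall>n. x n \<in> carrier A \<and> x (Suc n) \<ominus>\<^bsub>A\<^esub> x n \<in> P n)"

definition sq :: "(nat \<Rightarrow> 'a) \<Rightarrow> nat \<Rightarrow> 'a set" where
  "sq x = (\<lambda>n. cst n (x n))"

lemma coherentD: "coherent x \<Longrightarrow> x n \<in> carrier A" "coherent x \<Longrightarrow> x (Suc n) \<ominus>\<^bsub>A\<^esub> x n \<in> P n"
  unfolding coherent_def by auto

lemma cst_mono:
  assumes "x \<in> carrier A" "y \<in> carrier A" shows "cst (Suc n) y \<subseteq> cst n x \<longleftrightarrow> y \<ominus>\<^bsub>A\<^esub> x \<in> P n"
proof
  assume "cst (Suc n) y \<subseteq> cst n x"
  moreover have "y \<in> cst (Suc n) y" unfolding cst_mem_iff[OF assms(2)] using assms P_zero by (simp add: A.minus_eq A.r_neg)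
  ultimately show "y \<ominus>\<^bsub>A\<^esub> x \<in> P n" using cst_mem_iff[OF assms(1)] by blast
next
  assume yx: "y \<ominus>\<^bsub>A\<^esub> x \<in> P n"
  show "cst (Suc n) y \<subseteq> cst n x"
  proof
    fix z assume "z \<in> cst (Suc n) y"
    then have z: "z \<in> carrier A" "z \<ominus>\<^bsub>A\<^esub> y \<in> P n" unfolding cst_mem_iff[OF assms(2)] using P_Suc by auto
    have "z \<ominus>\<^bsub>A\<^esub> x = (z \<ominus>\<^bsub>A\<^esub> y) \<oplus>\<^bsub>A\<^esub> (y \<ominus>\<^bsub>A\<^esub> x)" using z(1) assms
      by (simp add: A.minus_eq A.a_assoc[symmetric]) (simp add: A.a_assoc A.l_neg)
    then show "z \<in> cst n x" unfolding cst_mem_iff[OF assms(1)] using z(1) P_add[OF z(2) yx] by simp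
  qed
qed

lemma Ac_carrier: "carrier Ac = sq ` {x. coherent x}"
proof
  show "sq ` {x. coherent x} \<subseteq> carrier Ac"
    unfolding completion_def sq_def using cst_mono coherentD Quot_carrier by fastforce
  show "carrier Ac \<subseteq> sq ` {x. coherent x}"
  proof
    fix U assume "U \<in> carrier Ac"
    then have U: "\<And>n. U n \<in> cst n ` carrier A" "\<And>n. U (Suc n) \<subseteq> U n"
      unfolding completion_def Quot_carrier by auto
    have "\<forall>n. \<exists>a. a \<in> carrier A \<and> U n = cst n a" using U(1) by blast
    then obtain x where x: "\<And>n. x n \<in> carrier A" "\<And>n. U n = cst n (x n)" by metis
    have "coherent x" unfolding coherent_def using x U(2) cst_mono by metis
    moreover have "U = sq x" unfolding sq_def using x(2) by auto
    ultimately show "U \<in> sq ` {x. coherent x}" by blast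
  qed
qed

lemma sqE: assumes "U \<in> carrier Ac" obtains x where "coherent x" "U = sq x"
  using assms unfolding Ac_carrier by blast

lemma sq_closed: "coherent x \<Longrightarrow> sq x \<in> carrier Ac"
  unfolding Ac_carrier by blast

lemma sq_eq_iff: "coherent x \<Longrightarrow> coherent y \<Longrightarrow> sq x = sq y \<longleftrightarrow> (\<forall>n. x n \<ominus>\<^bsub>A\<^esub> y n \<in> P n)"
  unfolding sq_def fun_eq_iff by (simp add: cst_eq_iff coherentD)

lemma sq_ops:
  assumes "coherent x" "coherent y"
  shows "sq x \<oplus>\<^bsub>Ac\<^esub> sq y = sq (\<lambda>n. x n \<oplus>\<^bsub>A\<^esub> y n)" "sq x \<otimes>\<^bsub>Ac\<^esub> sq y = sq (\<lambda>n. x n \<otimes>\<^bsub>A\<^esub> y n)"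
  using assms unfolding completion_def sq_def by (auto simp: cst_ops coherentD)

lemma sq_const: "\<zero>\<^bsub>Ac\<^esub> = sq (\<lambda>_. \<zero>\<^bsub>A\<^esub>)" "\<one>\<^bsub>Ac\<^esub> = sq (\<lambda>_. \<one>\<^bsub>A\<^esub>)"
  unfolding completion_def sq_def by (auto simp: cst_zero cst_one)

lemma sq_smult: "r \<in> carrier R \<Longrightarrow> coherent x \<Longrightarrow> r \<odot>\<^bsub>Ac\<^esub> sq x = sq (\<lambda>n. r \<odot>\<^bsub>A\<^esub> x n)"
  unfolding completion_def sq_def by (auto simp: cst_smult coherentD)

lemma coherent_const: "a \<in> carrier A \<Longrightarrow> coherent (\<lambda>_. a)"
  unfolding coherent_def using P_zero by (simp add: A.minus_eq A.r_neg)

lemma coherent_add: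
  assumes "coherent x" "coherent y" shows "coherent (\<lambda>n. x n \<oplus>\<^bsub>A\<^esub> y n)"
proof -
  have "(x (Suc n) \<oplus>\<^bsub>A\<^esub> y (Suc n)) \<ominus>\<^bsub>A\<^esub> (x n \<oplus>\<^bsub>A\<^esub> y n) = (x (Suc n) \<ominus>\<^bsub>A\<^esub> x n) \<oplus>\<^bsub>A\<^esub> (y (Suc n) \<ominus>\<^bsub>A\<^esub> y n)" for n
    using coherentD(1)[OF assms(1)] coherentD(1)[OF assms(2)] by (simp add: A.minus_eq A.minus_add A.a_ac)
  then show ?thesis unfolding coherent_def using assms P_add coherentD by simp
qed

lemma coherent_mult:
  assumes "coherent x" "coherent y" shows "coherent (\<lambda>n. x n \<otimes>\<^bsub>A\<^esub> y n)"
proof -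
  have c: "x n \<in> carrier A" "y n \<in> carrier A" for n using assms coherentD by auto
  have "(x (Suc n) \<otimes>\<^bsub>A\<^esub> y (Suc n)) \<ominus>\<^bsub>A\<^esub> (x n \<otimes>\<^bsub>A\<^esub> y n)
     = (x (Suc n) \<ominus>\<^bsub>A\<^esub> x n) \<otimes>\<^bsub>A\<^esub> y (Suc n) \<oplus>\<^bsub>A\<^esub> x n \<otimes>\<^bsub>A\<^esub> (y (Suc n) \<ominus>\<^bsub>A\<^esub> y n)" for n
    using c by (simp add: A.minus_eq A.l_distr A.r_distr A.l_minus A.r_minus A.a_assoc A.r_neg2 A.r_neg1)
  then show ?thesis unfolding coherent_def
    using c P_add P_mult coherentD(2)[OF assms(1)] coherentD(2)[OF assms(2)] by simp
qed

lemma coherent_smult: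
  assumes "r \<in> carrier R" "coherent x" shows "coherent (\<lambda>n. r \<odot>\<^bsub>A\<^esub> x n)"
  unfolding coherent_def using assms sm coherentD P_smult[OF assms(1) coherentD(2)[OF assms(2)]] by (simp add: smult_diff)

lemma Ac_ring: "ring Ac"
proof (rule ringI)
  show "abelian_group Ac"
  proof (rule abelian_groupI)
    fix U V assume "U \<in> carrier Ac" "V \<in> carrier Ac"
    then obtain x y where "coherent x" "coherent y" "U = sq x" "V = sq y" by (metis sqE)
    then show "U \<oplus>\<^bsub>Ac\<^esub> V \<in> carrier Ac" "U \<oplus>\<^bsub>Ac\<^esub> V = V \<oplus>\<^bsub>Ac\<^esub> U"
      by (simp_all add: sq_ops sq_closed coherent_add A.a_comm coherentD)
  next
    fix U V W assume "U \<in> carrier Ac" "V \<in> carrier Ac" "W \<in> carrier Ac"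
    then obtain x y z where "coherent x" "coherent y" "coherent z" "U = sq x" "V = sq y" "W = sq z" by (metis sqE)
    then show "U \<oplus>\<^bsub>Ac\<^esub> V \<oplus>\<^bsub>Ac\<^esub> W = U \<oplus>\<^bsub>Ac\<^esub> (V \<oplus>\<^bsub>Ac\<^esub> W)"
      by (simp add: sq_ops coherent_add A.a_assoc coherentD)
  next
    show "\<zero>\<^bsub>Ac\<^esub> \<in> carrier Ac" unfolding sq_const by (simp add: sq_closed coherent_const)
    fix U assume "U \<in> carrier Ac"
    then obtain x where x: "coherent x" "U = sq x" by (metis sqE)
    then show "\<zero>\<^bsub>Ac\<^esub> \<oplus>\<^bsub>Ac\<^esub> U = U" unfolding sq_const by (simp add: sq_ops coherent_const coherentD)
    \<comment> \<open>The negative is built as the multiple by -1, for which coherence is already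
      known.\<close>
    have e: "(\<lambda>n. (\<ominus>\<^bsub>R\<^esub> \<one>\<^bsub>R\<^esub>) \<odot>\<^bsub>A\<^esub> x n \<oplus>\<^bsub>A\<^esub> x n) = (\<lambda>_. \<zero>\<^bsub>A\<^esub>)"
    proof
      fix n
      have xn: "x n \<in> carrier A" using x coherentD by blast
      have "(\<ominus>\<^bsub>R\<^esub> \<one>\<^bsub>R\<^esub>) \<odot>\<^bsub>A\<^esub> x n \<oplus>\<^bsub>A\<^esub> x n = (\<ominus>\<^bsub>R\<^esub> \<one>\<^bsub>R\<^esub> \<oplus>\<^bsub>R\<^esub> \<one>\<^bsub>R\<^esub>) \<odot>\<^bsub>A\<^esub> x n"
        using lsmult_l_distr[of "\<ominus>\<^bsub>R\<^esub> \<one>\<^bsub>R\<^esub>" "\<one>\<^bsub>R\<^esub>" "x n"] lsmult_one xn by simp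
      also have "\<dots> = \<zero>\<^bsub>R\<^esub> \<odot>\<^bsub>A\<^esub> x n" by (simp add: R.l_neg)
      also have "\<dots> = \<zero>\<^bsub>A\<^esub>"
        using lsmult_l_distr[of "\<zero>\<^bsub>R\<^esub>" "\<zero>\<^bsub>R\<^esub>" "x n"] sm[of "\<zero>\<^bsub>R\<^esub>" "x n"] xn
          A.add.l_cancel_one[of "\<zero>\<^bsub>R\<^esub> \<odot>\<^bsub>A\<^esub> x n" "\<zero>\<^bsub>R\<^esub> \<odot>\<^bsub>A\<^esub> x n"] by simp
      finally show "(\<ominus>\<^bsub>R\<^esub> \<one>\<^bsub>R\<^esub>) \<odot>\<^bsub>A\<^esub> x n \<oplus>\<^bsub>A\<^esub> x n = \<zero>\<^bsub>A\<^esub>" .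
    qed
    have c: "coherent (\<lambda>n. (\<ominus>\<^bsub>R\<^esub> \<one>\<^bsub>R\<^esub>) \<odot>\<^bsub>A\<^esub> x n)" using x coherent_smult by simp
    show "\<exists>V\<in>carrier Ac. V \<oplus>\<^bsub>Ac\<^esub> U = \<zero>\<^bsub>Ac\<^esub>" unfolding sq_const
      by (rule bexI[OF _ sq_closed[OF c]]) (simp add: x(2) sq_ops[OF c x(1)] e)
  qed
  show "Group.monoid Ac"
  proof (rule Group.monoidI)
    fix U V assume "U \<in> carrier Ac" "V \<in> carrier Ac"
    then obtain x y where "coherent x" "coherent y" "U = sq x" "V = sq y" by (metis sqE)
    then show "U \<otimes>\<^bsub>Ac\<^esub> V \<in> carrier Ac" by (simp add: sq_ops sq_closed coherent_mult)
  next
    fix U V W assume "U \<in> carrier Ac" "V \<in> carrier Ac" "W \<in> carrier Ac"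
    then obtain x y z where "coherent x" "coherent y" "coherent z" "U = sq x" "V = sq y" "W = sq z" by (metis sqE)
    then show "U \<otimes>\<^bsub>Ac\<^esub> V \<otimes>\<^bsub>Ac\<^esub> W = U \<otimes>\<^bsub>Ac\<^esub> (V \<otimes>\<^bsub>Ac\<^esub> W)"
      by (simp add: sq_ops coherent_mult A.m_assoc coherentD)
  next
    show "\<one>\<^bsub>Ac\<^esub> \<in> carrier Ac" unfolding sq_const by (simp add: sq_closed coherent_const)
    fix U assume "U \<in> carrier Ac"
    then obtain x where x: "coherent x" "U = sq x" by (metis sqE)
    then show "\<one>\<^bsub>Ac\<^esub> \<otimes>\<^bsub>Ac\<^esub> U = U" "U \<otimes>\<^bsub>Ac\<^esub> \<one>\<^bsub>Ac\<^esub> = U" unfolding sq_const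
      by (simp_all add: sq_ops coherent_const coherentD)
  qed
next
  fix U V W assume "U \<in> carrier Ac" "V \<in> carrier Ac" "W \<in> carrier Ac"
  then obtain x y z where "coherent x" "coherent y" "coherent z" "U = sq x" "V = sq y" "W = sq z" by (metis sqE)
  then show "(U \<oplus>\<^bsub>Ac\<^esub> V) \<otimes>\<^bsub>Ac\<^esub> W = U \<otimes>\<^bsub>Ac\<^esub> W \<oplus>\<^bsub>Ac\<^esub> V \<otimes>\<^bsub>Ac\<^esub> W" "W \<otimes>\<^bsub>Ac\<^esub> (U \<oplus>\<^bsub>Ac\<^esub> V) = W \<otimes>\<^bsub>Ac\<^esub> U \<oplus>\<^bsub>Ac\<^esub> W \<otimes>\<^bsub>Ac\<^esub> V"
    by (simp_all add: sq_ops coherent_mult coherent_add A.l_distr A.r_distr coherentD)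
qed

sublocale Ac: ring Ac by (rule Ac_ring)

lemma Ac_assoc_algebra: "assoc_algebra R Ac"
proof (intro assoc_algebra.intro R.cring_axioms Ac_ring left_module.intro Ac.abelian_group_axioms
    left_module_axioms.intro assoc_algebra_axioms.intro R.ring_axioms)
  fix r U assume "r \<in> carrier R" "U \<in> carrier Ac"
  moreover from this obtain x where "coherent x" "U = sq x" by (metis sqE)
  ultimately show "r \<odot>\<^bsub>Ac\<^esub> U \<in> carrier Ac" by (simp add: sq_smult sq_closed coherent_smult)
next
  fix r s U assume r: "r \<in> carrier R" "s \<in> carrier R" and "U \<in> carrier Ac"
  then obtain x where x: "coherent x" "U = sq x" by (metis sqE)
  show "(r \<oplus>\<^bsub>R\<^esub> s) \<odot>\<^bsub>Ac\<^esub> U = r \<odot>\<^bsub>Ac\<^esub> U \<oplus>\<^bsub>Ac\<^esub> s \<odot>\<^bsub>Ac\<^esub> U" "(r \<otimes>\<^bsub>R\<^esub> s) \<odot>\<^bsub>Ac\<^esub> U = r \<odot>\<^bsub>Ac\<^esub> (s \<odot>\<^bsub>Ac\<^esub> U)"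
    using r x lsmult_l_distr lsmult_assoc by (simp_all add: sq_smult sq_ops coherent_smult coherentD)
next
  fix r U V assume r: "r \<in> carrier R" and "U \<in> carrier Ac" "V \<in> carrier Ac"
  then obtain x y where x: "coherent x" "coherent y" "U = sq x" "V = sq y" by (metis sqE)
  show "r \<odot>\<^bsub>Ac\<^esub> (U \<oplus>\<^bsub>Ac\<^esub> V) = r \<odot>\<^bsub>Ac\<^esub> U \<oplus>\<^bsub>Ac\<^esub> r \<odot>\<^bsub>Ac\<^esub> V"
    using r x lsmult_r_distr by (simp add: sq_smult sq_ops coherent_smult coherent_add coherentD)
  show "r \<odot>\<^bsub>Ac\<^esub> (U \<otimes>\<^bsub>Ac\<^esub> V) = (r \<odot>\<^bsub>Ac\<^esub> U) \<otimes>\<^bsub>Ac\<^esub> V"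
    using r x smult_mult_l by (simp add: sq_smult sq_ops coherent_smult coherent_mult coherentD)
  show "r \<odot>\<^bsub>Ac\<^esub> (U \<otimes>\<^bsub>Ac\<^esub> V) = U \<otimes>\<^bsub>Ac\<^esub> (r \<odot>\<^bsub>Ac\<^esub> V)"
    using r x smult_mult_r by (simp add: sq_smult sq_ops coherent_smult coherent_mult coherentD)
next
  fix U assume "U \<in> carrier Ac"
  then obtain x where "coherent x" "U = sq x" by (metis sqE)
  then show "\<one>\<^bsub>R\<^esub> \<odot>\<^bsub>Ac\<^esub> U = U" using lsmult_one by (simp add: sq_smult coherentD)
qed

text \<open>The canonical map from \<open>A\<close> to its completion.\<close>

definition kap :: "'a \<Rightarrow> nat \<Rightarrow> 'a set" where
  "kap a = sq (\<lambda>_. a)"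

lemma kap_hom: "kap \<in> ring_hom A Ac"
  unfolding kap_def by (rule ring_hom_memI) (simp_all add: sq_closed coherent_const sq_ops sq_const)

lemma kap_smult: "r \<in> carrier R \<Longrightarrow> a \<in> carrier A \<Longrightarrow> kap (r \<odot>\<^bsub>A\<^esub> a) = r \<odot>\<^bsub>Ac\<^esub> kap a"
  unfolding kap_def by (simp add: sq_smult coherent_const)

text \<open>Torsion freeness allows one to divide a coherent sequence by \<^term>\<open>pw n\<close> term by term.\<close>

lemma divisible_iff:
  assumes x: "coherent x" shows "(\<exists>h\<in>carrier Ac. sq x = pw n \<odot>\<^bsub>Ac\<^esub> h) \<longleftrightarrow> x n \<in> P n"
proof
  assume "\<exists>h\<in>carrier Ac. sq x = pw n \<odot>\<^bsub>Ac\<^esub> h"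
  then obtain y where y: "coherent y" "sq x = sq (\<lambda>m. pw n \<odot>\<^bsub>A\<^esub> y m)" by (metis sqE sq_smult pw_closed)
  have "x n \<ominus>\<^bsub>A\<^esub> pw n \<odot>\<^bsub>A\<^esub> y n \<in> P n"
    using y sq_eq_iff[OF x coherent_smult[OF pw_closed y(1)]] by blast
  from P_add[OF this PI[OF coherentD(1)[OF y(1), of n]]] show "x n \<in> P n"
    using coherentD(1)[OF x, of n] sm[OF pw_closed coherentD(1)[OF y(1)]]
    by (simp add: A.minus_eq A.a_assoc A.l_neg)
next
  assume xn: "x n \<in> P n"
  \<comment> \<open>From index \<open>n\<close> on all terms agree modulo p^n, so all of them are
    divisible by p^n.\<close>
  have xm: "x (n + m) \<in> P n" for m
  proof (induction m)
    case 0 then show ?case using xn by simp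
  next
    case (Suc m)
    have "z \<in> P n" if "z \<in> P (n + m)" for z m using that by (induction m) (auto dest: P_Suc)
    then have "x (Suc (n + m)) \<ominus>\<^bsub>A\<^esub> x (n + m) \<in> P n" using coherentD(2)[OF x] by blast
    from P_add[OF this Suc.IH] show ?case using coherentD(1)[OF x]
      by (simp add: A.minus_eq A.a_assoc A.l_neg)
  qed
  then have "\<forall>m. \<exists>y. y \<in> carrier A \<and> x (n + m) = pw n \<odot>\<^bsub>A\<^esub> y" unfolding P_iff by blast
  \<comment> \<open>The sequence of quotients is shifted by \<open>n\<close>, since division by p^n
    costs \<open>n\<close> steps of precision.\<close>
  then obtain y where y: "\<And>m. y m \<in> carrier A" "\<And>m. x (n + m) = pw n \<odot>\<^bsub>A\<^esub> y m" by metis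
  have "y (Suc m) \<ominus>\<^bsub>A\<^esub> y m \<in> P m" for m
  proof -
    have "x (n + Suc m) \<ominus>\<^bsub>A\<^esub> x (n + m) \<in> P (n + m)" using coherentD(2)[OF x, of "n + m"] by simp
    then obtain z where z: "z \<in> carrier A" "x (n + Suc m) \<ominus>\<^bsub>A\<^esub> x (n + m) = pw (n + m) \<odot>\<^bsub>A\<^esub> z" unfolding P_iff by blast
    then have "pw n \<odot>\<^bsub>A\<^esub> (y (Suc m) \<ominus>\<^bsub>A\<^esub> y m) = pw n \<odot>\<^bsub>A\<^esub> (pw m \<odot>\<^bsub>A\<^esub> z)"
      using y y(2)[of "Suc m"] lsmult_assoc[OF pw_closed pw_closed z(1), of n m] by (simp add: smult_diff[OF pw_closed] pw_add)
    then have "y (Suc m) \<ominus>\<^bsub>A\<^esub> y m = pw m \<odot>\<^bsub>A\<^esub> z"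
      using pw_inj[of "y (Suc m) \<ominus>\<^bsub>A\<^esub> y m" "pw m \<odot>\<^bsub>A\<^esub> z" n] y(1) sm[OF pw_closed z(1)] by simp
    then show ?thesis using PI[OF z(1)] by simp
  qed
  then have c: "coherent y" unfolding coherent_def using y(1) by blast
  \<comment> \<open>The shift does no harm: p^n y(m) is x(n+m), which agrees with x(m) modulo
    p^m.\<close>
  have "x m \<ominus>\<^bsub>A\<^esub> pw n \<odot>\<^bsub>A\<^esub> y m \<in> P m" for m
  proof -
    have *: "x (m + k) \<ominus>\<^bsub>A\<^esub> x m \<in> P m" for k
    proof (induction k)
      case 0 then show ?case using coherentD(1)[OF x] P_zero by (simp add: A.minus_eq A.r_neg)
    next
      case (Suc k)
      have "z \<in> P m" if "z \<in> P (m + k)" for z k using that by (induction k) (auto dest: P_Suc)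
      then have "x (Suc (m + k)) \<ominus>\<^bsub>A\<^esub> x (m + k) \<in> P m" using coherentD(2)[OF x] by blast
      from P_add[OF this Suc.IH] show ?case using coherentD(1)[OF x]
        by (simp add: A.minus_eq A.a_assoc[symmetric]) (simp add: A.a_assoc A.l_neg)
    qed
    have "\<ominus>\<^bsub>A\<^esub> (x (m + n) \<ominus>\<^bsub>A\<^esub> x m) = x m \<ominus>\<^bsub>A\<^esub> pw n \<odot>\<^bsub>A\<^esub> y m"
      using coherentD(1)[OF x] y(2)[of m] sm[OF pw_closed y(1)] by (simp add: A.minus_eq A.minus_add add.commute A.a_comm)
    then show ?thesis using P_minus[OF *[of n]] by simp
  qed
  then have "sq x = pw n \<odot>\<^bsub>Ac\<^esub> sq y"
    using sq_smult[OF pw_closed c] sq_eq_iff[OF x coherent_smult[OF pw_closed c]] by simp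
  then show "\<exists>h\<in>carrier Ac. sq x = pw n \<odot>\<^bsub>Ac\<^esub> h" using sq_closed[OF c] by blast
qed

lemma Ac_torsion_free: "torsion_free p Ac"
  unfolding torsion_free_def
proof (intro ballI impI)
  fix U assume "U \<in> carrier Ac" "p \<odot>\<^bsub>Ac\<^esub> U = \<zero>\<^bsub>Ac\<^esub>"
  moreover from this obtain x where x: "coherent x" "U = sq x" by (metis sqE)
  ultimately have e: "sq (\<lambda>n. p \<odot>\<^bsub>A\<^esub> x n) = sq (\<lambda>_. \<zero>\<^bsub>A\<^esub>)" by (simp add: sq_smult p sq_const)
  have d: "p \<odot>\<^bsub>A\<^esub> x n \<in> P n" for n
    using sq_eq_iff[OF coherent_smult[OF p x(1)] coherent_const[OF A.zero_closed]] e sm[OF p coherentD(1)[OF x(1)]]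
    by (simp add: A.minus_eq)
  have "x n \<in> P n" for n
  proof -
    \<comment> \<open>Division by \<open>p\<close> loses one step of precision. Hence the term of
      index n+1 is divided, and coherence leads back to x(n).\<close>
    obtain z where z: "z \<in> carrier A" "p \<odot>\<^bsub>A\<^esub> x (Suc n) = pw (Suc n) \<odot>\<^bsub>A\<^esub> z" using d unfolding P_iff by blast
    have "pw (Suc n) \<odot>\<^bsub>A\<^esub> z = p \<odot>\<^bsub>A\<^esub> (pw n \<odot>\<^bsub>A\<^esub> z)"
      using lsmult_assoc[of p "pw n" z] p z(1) by (simp add: R.m_comm)
    then have "x (Suc n) = pw n \<odot>\<^bsub>A\<^esub> z"
      using pw_inj[of "x (Suc n)" "pw n \<odot>\<^bsub>A\<^esub> z" 1] z coherentD(1)[OF x(1)] sm[OF pw_closed z(1)] p by simp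
    then have "x (Suc n) \<in> P n" using PI[OF z(1)] by simp
    from P_add[OF P_minus[OF coherentD(2)[OF x(1)]] this] show "x n \<in> P n"
      using coherentD(1)[OF x(1)] by (simp add: A.minus_eq A.minus_add A.a_ac A.r_neg)
  qed
  then show "U = \<zero>\<^bsub>Ac\<^esub>" unfolding x(2) sq_const
    using sq_eq_iff[OF x(1) coherent_const[OF A.zero_closed]] coherentD(1)[OF x(1)] by (simp add: A.minus_eq)
qed

text \<open>Divisibility by p^n in the completion is detected by the n-th term of a representing
  sequence, which is \<open>a\<close> itself for the constant sequence.\<close>

lemma kap_divisible:
  assumes a: "a \<in> carrier A" and h: "h \<in> carrier Ac" "kap a = pw n \<odot>\<^bsub>Ac\<^esub> h" shows "a \<in> P n"
proof -
  have "\<exists>h\<in>carrier Ac. sq (\<lambda>_. a) = pw n \<odot>\<^bsub>Ac\<^esub> h" using h unfolding kap_def by blast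
  then show ?thesis using divisible_iff[OF coherent_const[OF a], of n] by simp
qed

lemma Ac_diff:
  assumes "coherent x" "coherent y"
  shows "sq x \<ominus>\<^bsub>Ac\<^esub> sq y = sq (\<lambda>n. x n \<ominus>\<^bsub>A\<^esub> y n)" "coherent (\<lambda>n. x n \<ominus>\<^bsub>A\<^esub> y n)"
proof -
  note c = coherentD(1)[OF assms(1)] coherentD(1)[OF assms(2)]
  have "(x (Suc n) \<ominus>\<^bsub>A\<^esub> y (Suc n)) \<ominus>\<^bsub>A\<^esub> (x n \<ominus>\<^bsub>A\<^esub> y n) = (x (Suc n) \<ominus>\<^bsub>A\<^esub> x n) \<oplus>\<^bsub>A\<^esub> \<ominus>\<^bsub>A\<^esub> (y (Suc n) \<ominus>\<^bsub>A\<^esub> y n)" for n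
    using c by (simp add: A.minus_eq A.minus_add A.a_ac)
  then show d: "coherent (\<lambda>n. x n \<ominus>\<^bsub>A\<^esub> y n)"
    unfolding coherent_def using c P_add P_minus coherentD(2)[OF assms(1)] coherentD(2)[OF assms(2)] by simp
  have e: "sq (\<lambda>n. x n \<ominus>\<^bsub>A\<^esub> y n) \<oplus>\<^bsub>Ac\<^esub> sq y = sq x"
    unfolding sq_ops[OF d assms(2)] using c by (simp add: A.minus_eq A.a_assoc A.l_neg)
  show "sq x \<ominus>\<^bsub>Ac\<^esub> sq y = sq (\<lambda>n. x n \<ominus>\<^bsub>A\<^esub> y n)"
    using sq_closed[OF d] sq_closed[OF assms(2)]
    by (simp only: e[symmetric] Ac.minus_eq Ac.a_assoc Ac.r_neg Ac.r_zero Ac.a_inv_closed)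
qed

text \<open>The n-th term of a representing sequence serves as the approximation modulo p^n.\<close>

lemma kap_dense:
  assumes "h \<in> carrier Ac" shows "\<exists>a\<in>carrier A. \<exists>h'\<in>carrier Ac. h \<ominus>\<^bsub>Ac\<^esub> kap a = pw n \<odot>\<^bsub>Ac\<^esub> h'"
proof -
  obtain x where x: "coherent x" "h = sq x" using assms by (metis sqE)
  have xn: "x n \<in> carrier A" using coherentD x(1) by blast
  have "\<exists>h'\<in>carrier Ac. sq (\<lambda>m. x m \<ominus>\<^bsub>A\<^esub> x n) = pw n \<odot>\<^bsub>Ac\<^esub> h'"
    using divisible_iff[OF Ac_diff(2)[OF x(1) coherent_const[OF xn]], of n] xn P_zero by (simp add: A.minus_eq A.r_neg)
  then show ?thesis
    unfolding kap_def x(2) using Ac_diff(1)[OF x(1) coherent_const[OF xn]] by (intro bexI[OF _ xn]) simp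
qed

lemma Ac_separated:
  assumes h: "h \<in> carrier Ac" and d: "\<And>n. \<exists>h'\<in>carrier Ac. h = pw n \<odot>\<^bsub>Ac\<^esub> h'" shows "h = \<zero>\<^bsub>Ac\<^esub>"
proof -
  obtain x where x: "coherent x" "h = sq x" using h by (metis sqE)
  have "x n \<in> P n" for n using divisible_iff[OF x(1)] d x(2) by blast
  then show ?thesis unfolding x(2) sq_const
    using sq_eq_iff[OF x(1) coherent_const[OF A.zero_closed]] coherentD(1)[OF x(1)] by (simp add: A.minus_eq)
qed

text \<open>The diagonal of the representing sequences is coherent, and it represents the
  limit.\<close>

lemma Ac_complete:
  assumes t: "\<And>n. t n \<in> carrier Ac" and cauchy: "\<And>n. \<exists>h\<in>carrier Ac. t (Suc n) \<ominus>\<^bsub>Ac\<^esub> t n = pw n \<odot>\<^bsub>Ac\<^esub> h"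
  shows "\<exists>s\<in>carrier Ac. \<forall>n. \<exists>h\<in>carrier Ac. s \<ominus>\<^bsub>Ac\<^esub> t n = pw n \<odot>\<^bsub>Ac\<^esub> h"
proof -
  have "\<forall>n. \<exists>x. coherent x \<and> t n = sq x" using t by (metis sqE)
  then obtain x where x: "\<And>n. coherent (x n)" "\<And>n. t n = sq (x n)" by metis
  note c = coherentD(1)[OF x(1)]
  have "x (Suc n) n \<ominus>\<^bsub>A\<^esub> x n n \<in> P n" for n
    using cauchy[of n] divisible_iff[OF Ac_diff(2)[OF x(1) x(1)], of "Suc n" n n]
    unfolding x(2) Ac_diff(1)[OF x(1) x(1)] by simp
  then have "(x (Suc n) (Suc n) \<ominus>\<^bsub>A\<^esub> x (Suc n) n) \<oplus>\<^bsub>A\<^esub> (x (Suc n) n \<ominus>\<^bsub>A\<^esub> x n n) \<in> P n" for n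
    using P_add coherentD(2)[OF x(1)] by simp
  moreover have "(x (Suc n) (Suc n) \<ominus>\<^bsub>A\<^esub> x (Suc n) n) \<oplus>\<^bsub>A\<^esub> (x (Suc n) n \<ominus>\<^bsub>A\<^esub> x n n)
    = x (Suc n) (Suc n) \<ominus>\<^bsub>A\<^esub> x n n" for n
    using c by (simp add: A.minus_eq A.a_assoc[symmetric]) (simp add: A.a_assoc A.l_neg)
  ultimately have s: "coherent (\<lambda>n. x n n)" unfolding coherent_def using c by simp
  have "\<exists>h\<in>carrier Ac. sq (\<lambda>n. x n n) \<ominus>\<^bsub>Ac\<^esub> t n = pw n \<odot>\<^bsub>Ac\<^esub> h" for n
    unfolding x(2) Ac_diff(1)[OF s x(1)] divisible_iff[OF Ac_diff(2)[OF s x(1)]]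
    using c P_zero by (simp add: A.minus_eq A.r_neg)
  then show ?thesis using sq_closed[OF s] by blast
qed

end

locale adic_hom = A: adic_algebra R A p + C: adic_algebra R C p
  for R :: "('r, 'x) ring_scheme" (structure) and A :: "('r, 'a) module" and C :: "('r, 'c) module" and p +
  fixes f :: "'a \<Rightarrow> 'c"
  assumes f_hom: "f \<in> ring_hom A C"
    and f_smult: "\<And>r a. r \<in> carrier R \<Longrightarrow> a \<in> carrier A \<Longrightarrow> f (r \<odot>\<^bsub>A\<^esub> a) = r \<odot>\<^bsub>C\<^esub> f a"
begin

abbreviation "cm \<equiv> completion_map R p C f"

lemma f_simps: "a \<in> carrier A \<Longrightarrow> f a \<in> carrier C"
  "a \<in> carrier A \<Longrightarrow> b \<in> carrier A \<Longrightarrow> f (a \<oplus>\<^bsub>A\<^esub> b) = f a \<oplus>\<^bsub>C\<^esub> f b"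
  "a \<in> carrier A \<Longrightarrow> b \<in> carrier A \<Longrightarrow> f (a \<otimes>\<^bsub>A\<^esub> b) = f a \<otimes>\<^bsub>C\<^esub> f b"
  "f \<one>\<^bsub>A\<^esub> = \<one>\<^bsub>C\<^esub>"
  using f_hom unfolding ring_hom_def by auto

lemma f_diff:
  assumes "a \<in> carrier A" "b \<in> carrier A" shows "f (a \<ominus>\<^bsub>A\<^esub> b) = f a \<ominus>\<^bsub>C\<^esub> f b"
proof -
  have "f (a \<ominus>\<^bsub>A\<^esub> b) \<oplus>\<^bsub>C\<^esub> f b = f a"
    using assms f_simps(2)[of "a \<ominus>\<^bsub>A\<^esub> b" b, symmetric] by (simp add: A.A.minus_eq A.A.a_assoc A.A.l_neg)
  then show ?thesis using assms f_simps(1)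
    by (metis C.A.add.inv_solve_right C.A.minus_eq A.A.minus_closed)
qed

lemma f_P: "x \<in> A.P n \<Longrightarrow> f x \<in> C.P n"
  unfolding A.P_iff C.P_iff using f_smult[OF A.pw_closed] f_simps(1) by metis

lemma f_coherent: "A.coherent x \<Longrightarrow> C.coherent (\<lambda>n. f (x n))"
  unfolding A.coherent_def C.coherent_def using f_simps(1) f_P by (simp add: f_diff[symmetric])

text \<open>\<open>completion_map\<close> is a union over representatives; all of them give the same
  coset because \<open>f\<close> respects divisibility by p^n.\<close>

lemma cm_sq:
  assumes x: "A.coherent x" shows "cm (A.sq x) = C.sq (\<lambda>n. f (x n))"
proof
  fix n
  have xn: "x n \<in> carrier A" using x A.coherentD by blast
  have "C.cst n (f y) = C.cst n (f (x n))" if y: "y \<in> A.cst n (x n)" for y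
  proof -
    have "y \<in> carrier A" "y \<ominus>\<^bsub>A\<^esub> x n \<in> A.P n" using y unfolding A.cst_mem_iff[OF xn] by auto
    then show ?thesis using f_P[of "y \<ominus>\<^bsub>A\<^esub> x n" n] xn f_simps(1) by (simp add: C.cst_eq_iff f_diff)
  qed
  moreover have "x n \<in> A.cst n (x n)" unfolding A.cst_mem_iff[OF xn] using xn A.P_zero by (simp add: A.A.minus_eq A.A.r_neg)
  ultimately have "(\<Union>y\<in>A.cst n (x n). C.cst n (f y)) = C.cst n (f (x n))" by blast
  then show "cm (A.sq x) n = C.sq (\<lambda>n. f (x n)) n" unfolding completion_map_def A.sq_def C.sq_def by simp
qed

lemma cm_kap: "a \<in> carrier A \<Longrightarrow> cm (A.kap a) = C.kap (f a)"
  unfolding A.kap_def C.kap_def by (simp add: cm_sq A.coherent_const)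

lemma cm_hom: "cm \<in> ring_hom A.Ac C.Ac"
proof (rule ring_hom_memI)
  fix U assume "U \<in> carrier A.Ac"
  then obtain x where "A.coherent x" "U = A.sq x" by (rule A.sqE)
  then show "cm U \<in> carrier C.Ac" by (simp add: cm_sq C.sq_closed f_coherent)
next
  fix U V assume "U \<in> carrier A.Ac" "V \<in> carrier A.Ac"
  then obtain x y where "A.coherent x" "A.coherent y" "U = A.sq x" "V = A.sq y" by (metis A.sqE)
  then show "cm (U \<otimes>\<^bsub>A.Ac\<^esub> V) = cm U \<otimes>\<^bsub>C.Ac\<^esub> cm V" "cm (U \<oplus>\<^bsub>A.Ac\<^esub> V) = cm U \<oplus>\<^bsub>C.Ac\<^esub> cm V"
    by (simp_all add: cm_sq A.sq_ops C.sq_ops f_coherent A.coherent_add A.coherent_mult f_simps A.coherentD)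
next
  show "cm \<one>\<^bsub>A.Ac\<^esub> = \<one>\<^bsub>C.Ac\<^esub>" unfolding A.sq_const C.sq_const by (simp add: cm_sq A.coherent_const f_simps)
qed

lemma cm_smult:
  assumes "r \<in> carrier R" "U \<in> carrier A.Ac" shows "cm (r \<odot>\<^bsub>A.Ac\<^esub> U) = r \<odot>\<^bsub>C.Ac\<^esub> cm U"
proof -
  obtain x where "A.coherent x" "U = A.sq x" using assms(2) by (rule A.sqE)
  then show ?thesis using assms(1)
    by (simp add: cm_sq A.sq_smult C.sq_smult f_coherent A.coherent_smult f_smult A.coherentD)
qed

end

section \<open>Complete rings approximated by Noetherian rings\<close>

lemma (in ring_hom_ring) hom_gen_left_ideal:
  assumes V: "V \<subseteq> carrier R" and c: "c \<in> gen_left_ideal R V" shows "h c \<in> gen_left_ideal S (h ` V)"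
proof -
  have hV: "h ` V \<subseteq> carrier S" using V by auto
  note G = S.left_ideal_in_gen[OF hV]
  have "left_ideal_in R (carrier R) {c \<in> carrier R. h c \<in> gen_left_ideal S (h ` V)}"
    by (rule left_ideal_inI) (auto simp: left_ideal_inD[OF G])
  moreover have "V \<subseteq> {c \<in> carrier R. h c \<in> gen_left_ideal S (h ` V)}"
    using V S.gen_left_ideal_incl[of "h ` V"] by auto
  ultimately show ?thesis using subsetD[OF R.gen_left_ideal_minimal c] by blast
qed

text \<open>\<open>S\<close> is torsion free, separated and complete for the central element h(w),
  and \<open>h\<close> induces an isomorphism from R/wR to S/h(w)S, with \<open>dense\<close> for
  surjectivity and \<open>reflect\<close> for injectivity. Two instances occur: \<open>A\<close>
  with its completion, and \<open>C\<close> with the completion of \<open>B\<close>.\<close>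

locale adic_approximation = ring_hom_ring R S h
  for R :: "('c, 'x) ring_scheme" and S :: "('s, 'y) ring_scheme" and h +
  fixes w :: 'c
  assumes w: "w \<in> carrier R" and w_central: "\<And>c. c \<in> carrier R \<Longrightarrow> c \<otimes>\<^bsub>R\<^esub> w = w \<otimes>\<^bsub>R\<^esub> c"
    and hw_central: "\<And>x. x \<in> carrier S \<Longrightarrow> x \<otimes>\<^bsub>S\<^esub> h w = h w \<otimes>\<^bsub>S\<^esub> x"
    and hw_cancel: "\<And>x. x \<in> carrier S \<Longrightarrow> h w \<otimes>\<^bsub>S\<^esub> x = \<zero>\<^bsub>S\<^esub> \<Longrightarrow> x = \<zero>\<^bsub>S\<^esub>"
    and separated: "\<And>x. x \<in> carrier S \<Longrightarrow> (\<And>n::nat. \<exists>y\<in>carrier S. x = h w [^]\<^bsub>S\<^esub> n \<otimes>\<^bsub>S\<^esub> y) \<Longrightarrow> x = \<zero>\<^bsub>S\<^esub>"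
    and complete: "\<And>t. (\<And>n. t n \<in> carrier S) \<Longrightarrow>
      (\<And>n::nat. \<exists>y\<in>carrier S. t (Suc n) \<ominus>\<^bsub>S\<^esub> t n = h w [^]\<^bsub>S\<^esub> n \<otimes>\<^bsub>S\<^esub> y)
      \<Longrightarrow> \<exists>s\<in>carrier S. \<forall>n. \<exists>y\<in>carrier S. s \<ominus>\<^bsub>S\<^esub> t n = h w [^]\<^bsub>S\<^esub> n \<otimes>\<^bsub>S\<^esub> y"
    and dense: "\<And>x. x \<in> carrier S \<Longrightarrow> \<exists>c\<in>carrier R. \<exists>y\<in>carrier S. x = h c \<oplus>\<^bsub>S\<^esub> h w \<otimes>\<^bsub>S\<^esub> y"
    and reflect: "\<And>c y. c \<in> carrier R \<Longrightarrow> y \<in> carrier S \<Longrightarrow> h c = h w \<otimes>\<^bsub>S\<^esub> y \<Longrightarrow> \<exists>c'\<in>carrier R. c = w \<otimes>\<^bsub>R\<^esub> c'"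
    and noeth: "acc_in R (carrier R)"
begin

abbreviation "u n \<equiv> w [^]\<^bsub>R\<^esub> (n::nat)"
abbreviation "v n \<equiv> h w [^]\<^bsub>S\<^esub> (n::nat)"

lemma u_closed: "u n \<in> carrier R" and v_closed: "v n \<in> carrier S"
  using w by simp_all

lemma hu: "h (u n) = v n"
  by (induction n) (use w in simp_all)

lemma v_central: "x \<in> carrier S \<Longrightarrow> x \<otimes>\<^bsub>S\<^esub> v n = v n \<otimes>\<^bsub>S\<^esub> x"
proof (induction n)
  case (Suc n)
  have "x \<otimes>\<^bsub>S\<^esub> v (Suc n) = (x \<otimes>\<^bsub>S\<^esub> v n) \<otimes>\<^bsub>S\<^esub> h w" using Suc.prems w by (simp add: S.m_assoc)
  also have "\<dots> = v n \<otimes>\<^bsub>S\<^esub> (x \<otimes>\<^bsub>S\<^esub> h w)" unfolding Suc.IH[OF Suc.prems] using Suc.prems w by (simp add: S.m_assoc)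
  also have "\<dots> = v (Suc n) \<otimes>\<^bsub>S\<^esub> x" unfolding hw_central[OF Suc.prems] using Suc.prems w by (simp add: S.m_assoc)
  finally show ?case .
qed simp

lemma u_central: "x \<in> carrier R \<Longrightarrow> x \<otimes>\<^bsub>R\<^esub> u n = u n \<otimes>\<^bsub>R\<^esub> x"
proof (induction n)
  case (Suc n)
  have "x \<otimes>\<^bsub>R\<^esub> u (Suc n) = (x \<otimes>\<^bsub>R\<^esub> u n) \<otimes>\<^bsub>R\<^esub> w" using Suc.prems w by (simp add: R.m_assoc)
  also have "\<dots> = u n \<otimes>\<^bsub>R\<^esub> (x \<otimes>\<^bsub>R\<^esub> w)" unfolding Suc.IH[OF Suc.prems] using Suc.prems w by (simp add: R.m_assoc)
  also have "\<dots> = u (Suc n) \<otimes>\<^bsub>R\<^esub> x" unfolding w_central[OF Suc.prems] using Suc.prems w by (simp add: R.m_assoc)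
  finally show ?case .
qed simp

lemma v_move: "x \<in> carrier S \<Longrightarrow> y \<in> carrier S \<Longrightarrow> x \<otimes>\<^bsub>S\<^esub> (v n \<otimes>\<^bsub>S\<^esub> y) = v n \<otimes>\<^bsub>S\<^esub> (x \<otimes>\<^bsub>S\<^esub> y)"
  using v_central[of x n] v_closed[of n] by (simp add: S.m_assoc[symmetric])

lemma u_move: "x \<in> carrier R \<Longrightarrow> y \<in> carrier R \<Longrightarrow> x \<otimes>\<^bsub>R\<^esub> (u n \<otimes>\<^bsub>R\<^esub> y) = u n \<otimes>\<^bsub>R\<^esub> (x \<otimes>\<^bsub>R\<^esub> y)"
  using u_central[of x n] u_closed[of n] by (simp add: R.m_assoc[symmetric])

lemma v_add: "x \<in> carrier S \<Longrightarrow> v (m + n) \<otimes>\<^bsub>S\<^esub> x = v m \<otimes>\<^bsub>S\<^esub> (v n \<otimes>\<^bsub>S\<^esub> x)"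
  using w by (simp add: S.nat_pow_mult[symmetric] S.m_assoc)

lemma u_add: "x \<in> carrier R \<Longrightarrow> u (m + n) \<otimes>\<^bsub>R\<^esub> x = u m \<otimes>\<^bsub>R\<^esub> (u n \<otimes>\<^bsub>R\<^esub> x)"
  using w by (simp add: R.nat_pow_mult[symmetric] R.m_assoc)

lemma v_Suc: "x \<in> carrier S \<Longrightarrow> v (Suc n) \<otimes>\<^bsub>S\<^esub> x = v n \<otimes>\<^bsub>S\<^esub> (h w \<otimes>\<^bsub>S\<^esub> x)"
  using w by (simp add: S.m_assoc)

lemma v_Suc': "x \<in> carrier S \<Longrightarrow> v (Suc n) \<otimes>\<^bsub>S\<^esub> x = h w \<otimes>\<^bsub>S\<^esub> (v n \<otimes>\<^bsub>S\<^esub> x)"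
  using v_add[of x 1 n] w by simp

lemma u_Suc': "x \<in> carrier R \<Longrightarrow> u (Suc n) \<otimes>\<^bsub>R\<^esub> x = w \<otimes>\<^bsub>R\<^esub> (u n \<otimes>\<^bsub>R\<^esub> x)"
  using u_add[of x 1 n] w by simp

lemma v_cancel:
  assumes "x \<in> carrier S" "y \<in> carrier S" "v n \<otimes>\<^bsub>S\<^esub> x = v n \<otimes>\<^bsub>S\<^esub> y" shows "x = y"
proof -
  have *: "z = \<zero>\<^bsub>S\<^esub>" if "z \<in> carrier S" "v n \<otimes>\<^bsub>S\<^esub> z = \<zero>\<^bsub>S\<^esub>" for z n
    using that(2)
  proof (induction n)
    case (Suc n)
    then show ?case using hw_cancel[of "v n \<otimes>\<^bsub>S\<^esub> z"] v_Suc'[OF that(1)] that(1) v_closed by simp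
  qed (use that(1) in simp)
  have "v n \<otimes>\<^bsub>S\<^esub> (x \<ominus>\<^bsub>S\<^esub> y) = \<zero>\<^bsub>S\<^esub>"
    using assms v_closed[of n] by (simp add: S.minus_eq S.r_distr S.r_minus S.r_neg)
  then have "x \<ominus>\<^bsub>S\<^esub> y = \<zero>\<^bsub>S\<^esub>" using * assms by simp
  then show ?thesis using assms by simp
qed

lemma dense_pow: "x \<in> carrier S \<Longrightarrow> \<exists>c\<in>carrier R. \<exists>y\<in>carrier S. x = h c \<oplus>\<^bsub>S\<^esub> v n \<otimes>\<^bsub>S\<^esub> y"
proof (induction n)
  case 0
  then have "x = h \<zero>\<^bsub>R\<^esub> \<oplus>\<^bsub>S\<^esub> v 0 \<otimes>\<^bsub>S\<^esub> x" by simp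
  then show ?case using 0 R.zero_closed by blast
next
  case (Suc n)
  then obtain c y where c: "c \<in> carrier R" "y \<in> carrier S" "x = h c \<oplus>\<^bsub>S\<^esub> v n \<otimes>\<^bsub>S\<^esub> y" by blast
  obtain d z where d: "d \<in> carrier R" "z \<in> carrier S" "y = h d \<oplus>\<^bsub>S\<^esub> h w \<otimes>\<^bsub>S\<^esub> z" using dense[OF c(2)] by blast
  have "x = h (c \<oplus>\<^bsub>R\<^esub> u n \<otimes>\<^bsub>R\<^esub> d) \<oplus>\<^bsub>S\<^esub> v (Suc n) \<otimes>\<^bsub>S\<^esub> z"
    unfolding c(3) d(3) v_Suc[OF d(2)] using c d w v_closed[of n] u_closed[of n] hu[of n]
    by (simp add: S.r_distr S.a_assoc del: hom_nat_pow)
  then show ?case using c(1) d(1,2) u_closed[of n] by blast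
qed

text \<open>Injectivity modulo \<open>w\<close> propagates to powers because h(w) can be cancelled
  in \<open>S\<close>.\<close>

lemma reflect_pow:
  "c \<in> carrier R \<Longrightarrow> y \<in> carrier S \<Longrightarrow> h c = v n \<otimes>\<^bsub>S\<^esub> y \<Longrightarrow> \<exists>c'\<in>carrier R. c = u n \<otimes>\<^bsub>R\<^esub> c'"
proof (induction n arbitrary: c)
  case 0 then show ?case by (intro bexI[of _ c]) simp_all
next
  case (Suc n)
  have y: "v n \<otimes>\<^bsub>S\<^esub> y \<in> carrier S" using Suc.prems v_closed by simp
  have "h c = h w \<otimes>\<^bsub>S\<^esub> (v n \<otimes>\<^bsub>S\<^esub> y)" using Suc.prems v_Suc' by simp
  from reflect[OF Suc.prems(1) y this] obtain c' where c': "c' \<in> carrier R" "c = w \<otimes>\<^bsub>R\<^esub> c'" by blast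
  have "v 1 \<otimes>\<^bsub>S\<^esub> h c' = v 1 \<otimes>\<^bsub>S\<^esub> (v n \<otimes>\<^bsub>S\<^esub> y)"
    using \<open>h c = h w \<otimes>\<^bsub>S\<^esub> (v n \<otimes>\<^bsub>S\<^esub> y)\<close> c' w by simp
  then have "h c' = v n \<otimes>\<^bsub>S\<^esub> y" using v_cancel[of "h c'" "v n \<otimes>\<^bsub>S\<^esub> y" 1] c'(1) y by simp
  from Suc.IH[OF c'(1) Suc.prems(2) this] obtain d where "d \<in> carrier R" "c' = u n \<otimes>\<^bsub>R\<^esub> d" by blast
  then show ?case using c' u_Suc' by auto
qed

text \<open>Partial sums of the series with terms h(w)^n g(n). The n-th one has exactly n terms, so
  the next one differs from it by a multiple of h(w)^n.\<close>

primrec psum :: "(nat \<Rightarrow> 's) \<Rightarrow> nat \<Rightarrow> 's" where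
  "psum g 0 = \<zero>\<^bsub>S\<^esub>"
| "psum g (Suc n) = psum g n \<oplus>\<^bsub>S\<^esub> v n \<otimes>\<^bsub>S\<^esub> g n"

lemma add_eq_diff_eq:
  assumes c: "a \<in> carrier S" "b \<in> carrier S" "c \<in> carrier S" "d \<in> carrier S"
    and e: "a \<oplus>\<^bsub>S\<^esub> b = c \<oplus>\<^bsub>S\<^esub> d"
  shows "a \<ominus>\<^bsub>S\<^esub> c = d \<ominus>\<^bsub>S\<^esub> b"
proof -
  have "a \<ominus>\<^bsub>S\<^esub> c = (a \<oplus>\<^bsub>S\<^esub> b) \<ominus>\<^bsub>S\<^esub> b \<ominus>\<^bsub>S\<^esub> c"
    using c by algebra
  also have "\<dots> = d \<ominus>\<^bsub>S\<^esub> b"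
    unfolding e using c by algebra
  finally show ?thesis .
qed

lemma add_diff_cancel: "a \<in> carrier S \<Longrightarrow> b \<in> carrier S \<Longrightarrow> b \<oplus>\<^bsub>S\<^esub> (a \<ominus>\<^bsub>S\<^esub> b) = a"
  by algebra

lemma psum_closed: "(\<And>n::nat. g n \<in> carrier S) \<Longrightarrow> psum g n \<in> carrier S"
  by (induction n) (use v_closed in auto)

text \<open>The coefficients of the series are required to lie in \<open>G\<close>. This is weaker
  than being closed in the adic topology, and for finitely generated ideals it follows from
  completeness without a chain condition.\<close>

definition series_closed :: "'s set \<Rightarrow> bool" where
  "series_closed G \<longleftrightarrow> (\<forall>g. (\<forall>n. g n \<in> G) \<longrightarrow> (\<exists>s\<in>G. \<forall>n. \<exists>y\<in>carrier S. s \<ominus>\<^bsub>S\<^esub> psum g n = v n \<otimes>\<^bsub>S\<^esub> y))"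

lemma series_closed_carrier: "series_closed (carrier S)"
  unfolding series_closed_def
proof (intro allI impI complete)
  fix g assume g: "\<forall>n::nat. g n \<in> carrier S"
  show c: "psum g n \<in> carrier S" for n using psum_closed g by blast
  show "\<exists>y\<in>carrier S. psum g (Suc n) \<ominus>\<^bsub>S\<^esub> psum g n = v n \<otimes>\<^bsub>S\<^esub> y" for n
    using g c[of n] v_closed[of n] by (intro bexI[of _ "g n"]) (simp_all add: S.minus_eq S.a_ac S.r_neg1 S.r_neg2 S.r_neg)
qed

text \<open>Each generator has its own series of coefficients: completeness sums the b(n) in front
  of \<open>a\<close>, and the induction hypothesis sums the d(n) in the remaining ideal.\<close>

lemma series_closed_gen:
  assumes "finite U" "U \<subseteq> carrier S" shows "series_closed (gen_left_ideal S U)"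
  using assms
proof (induction U)
  case empty
  have "psum (\<lambda>_. \<zero>\<^bsub>S\<^esub>) n = \<zero>\<^bsub>S\<^esub>" for n by (induction n) (use v_closed in simp_all)
  then have "psum g n = \<zero>\<^bsub>S\<^esub>" if "\<forall>n. g n = \<zero>\<^bsub>S\<^esub>" for g n using that by (metis ext)
  then show ?case unfolding S.gen_left_ideal_empty series_closed_def
    using v_closed by (auto intro!: bexI[of _ "\<zero>\<^bsub>S\<^esub>"] simp: S.minus_eq)
next
  case (insert a U)
  have a: "a \<in> carrier S" and U: "U \<subseteq> carrier S" using insert.prems by auto
  have Gc: "x \<in> carrier S" if "x \<in> gen_left_ideal S U" for x using left_ideal_inD(1)[OF S.left_ideal_in_gen[OF U] that] .
  show ?case unfolding series_closed_def
  proof (intro allI impI)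
    fix g assume "\<forall>n::nat. g n \<in> gen_left_ideal S (insert a U)"
    then have "\<forall>n. \<exists>b d. b \<in> carrier S \<and> d \<in> gen_left_ideal S U \<and> g n = b \<otimes>\<^bsub>S\<^esub> a \<oplus>\<^bsub>S\<^esub> d"
      unfolding S.gen_left_ideal_insert[OF a U] by blast
    then obtain b d where bd: "\<And>n::nat. b n \<in> carrier S" "\<And>n. d n \<in> gen_left_ideal S U" "\<And>n. g n = b n \<otimes>\<^bsub>S\<^esub> a \<oplus>\<^bsub>S\<^esub> d n"
      by metis
    have dc: "d n \<in> carrier S" for n using Gc bd(2) .
    obtain s where s: "s \<in> carrier S" "\<And>n. \<exists>y\<in>carrier S. s \<ominus>\<^bsub>S\<^esub> psum b n = v n \<otimes>\<^bsub>S\<^esub> y"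
      using series_closed_carrier bd(1) unfolding series_closed_def by blast
    obtain t where t: "t \<in> gen_left_ideal S U" "\<And>n. \<exists>y\<in>carrier S. t \<ominus>\<^bsub>S\<^esub> psum d n = v n \<otimes>\<^bsub>S\<^esub> y"
      using insert.IH[OF U] bd(2) unfolding series_closed_def by blast
    have c: "psum b n \<in> carrier S" "psum d n \<in> carrier S" for n :: nat using psum_closed bd(1) dc by auto
    have p: "psum g n = psum b n \<otimes>\<^bsub>S\<^esub> a \<oplus>\<^bsub>S\<^esub> psum d n" for n :: nat
    proof (induction n)
      case (Suc n)
      then show ?case using c[of n] bd(1)[of n] dc[of n] a v_closed[of n] bd(3)[of n]
        by (simp add: S.l_distr S.r_distr S.m_assoc S.a_ac)
    qed (use a in simp)
    have "\<exists>y\<in>carrier S. (s \<otimes>\<^bsub>S\<^esub> a \<oplus>\<^bsub>S\<^esub> t) \<ominus>\<^bsub>S\<^esub> psum g n = v n \<otimes>\<^bsub>S\<^esub> y" for n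
    proof -
      obtain y z where yz: "y \<in> carrier S" "s \<ominus>\<^bsub>S\<^esub> psum b n = v n \<otimes>\<^bsub>S\<^esub> y" "z \<in> carrier S" "t \<ominus>\<^bsub>S\<^esub> psum d n = v n \<otimes>\<^bsub>S\<^esub> z"
        using s(2) t(2) by metis
      have "(s \<otimes>\<^bsub>S\<^esub> a \<oplus>\<^bsub>S\<^esub> t) \<ominus>\<^bsub>S\<^esub> psum g n = (s \<ominus>\<^bsub>S\<^esub> psum b n) \<otimes>\<^bsub>S\<^esub> a \<oplus>\<^bsub>S\<^esub> (t \<ominus>\<^bsub>S\<^esub> psum d n)"
        unfolding p using s(1) Gc[OF t(1)] c[of n] a by (simp add: S.minus_eq S.l_distr S.l_minus S.minus_add S.a_ac)
      also have "\<dots> = v n \<otimes>\<^bsub>S\<^esub> (y \<otimes>\<^bsub>S\<^esub> a \<oplus>\<^bsub>S\<^esub> z)"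
        unfolding yz(2,4) using yz(1,3) a v_closed[of n] by (simp add: S.r_distr S.m_assoc)
      finally show ?thesis using yz(1,3) a by blast
    qed
    then show "\<exists>s\<in>gen_left_ideal S (insert a U). \<forall>n. \<exists>y\<in>carrier S. s \<ominus>\<^bsub>S\<^esub> psum g n = v n \<otimes>\<^bsub>S\<^esub> y"
      unfolding S.gen_left_ideal_insert[OF a U] using s(1) t(1) by blast
  qed
qed

text \<open>The corrections of a successive approximation form a series with a sum in the finitely generated
  left ideal, and separatedness identifies this sum with \<^term>\<open>y\<close>.\<close>

lemma gen_if_approximable:
  assumes U: "finite U" "U \<subseteq> carrier S" and Yc: "\<And>n. Y n \<subseteq> carrier S"
    and step: "\<And>n y. y \<in> Y n \<Longrightarrow> \<exists>g\<in>gen_left_ideal S U. \<exists>y'\<in>Y (Suc n). y = g \<oplus>\<^bsub>S\<^esub> h w \<otimes>\<^bsub>S\<^esub> y'"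
    and y: "y \<in> Y (0::nat)"
  shows "y \<in> gen_left_ideal S U"
proof -
  have "\<forall>n y. \<exists>g y'. y \<in> Y n \<longrightarrow> g \<in> gen_left_ideal S U \<and> y' \<in> Y (Suc n) \<and> y = g \<oplus>\<^bsub>S\<^esub> h w \<otimes>\<^bsub>S\<^esub> y'"
    using step by blast
  then obtain G F where GF: "\<And>n y. y \<in> Y n \<Longrightarrow> G n y \<in> gen_left_ideal S U \<and> F n y \<in> Y (Suc n) \<and> y = G n y \<oplus>\<^bsub>S\<^esub> h w \<otimes>\<^bsub>S\<^esub> F n y"
    by metis
  \<comment> \<open>The successive remainders. After n steps \<open>y\<close> differs from the
    partial sum of the corrections by h(w)^n times the current remainder.\<close>
  define ys where "ys = rec_nat y F"
  have ys: "ys n \<in> Y n" for n unfolding ys_def by (induction n) (use y GF in simp_all)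
  define g where "g n = G n (ys n)" for n :: nat
  have g: "g n \<in> gen_left_ideal S U" for n unfolding g_def using GF ys by blast
  have rec: "ys n = g n \<oplus>\<^bsub>S\<^esub> h w \<otimes>\<^bsub>S\<^esub> ys (Suc n)" for n
    using GF[OF ys[of n]] unfolding g_def ys_def by simp
  have gc: "g n \<in> carrier S" for n using left_ideal_inD(1)[OF S.left_ideal_in_gen[OF U(2)] g] .
  have yc: "ys n \<in> carrier S" for n using ys Yc by blast
  note c = psum_closed[of g, OF gc]
  have e: "y = psum g n \<oplus>\<^bsub>S\<^esub> v n \<otimes>\<^bsub>S\<^esub> ys n" for n
  proof (induction n)
    case 0 then show ?case using yc[of 0] unfolding ys_def by simp
  next
    case (Suc n)
    have "v n \<otimes>\<^bsub>S\<^esub> ys n = v n \<otimes>\<^bsub>S\<^esub> g n \<oplus>\<^bsub>S\<^esub> v (Suc n) \<otimes>\<^bsub>S\<^esub> ys (Suc n)"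
      unfolding v_Suc[OF yc] by (subst rec) (use gc yc v_closed w in \<open>simp add: S.r_distr\<close>)
    then show ?case using Suc c[of n] gc[of n] yc[of "Suc n"] v_closed[of n] v_closed[of "Suc n"]
      by (simp add: S.a_assoc)
  qed
  obtain s where s: "s \<in> gen_left_ideal S U" "\<And>n. \<exists>x\<in>carrier S. s \<ominus>\<^bsub>S\<^esub> psum g n = v n \<otimes>\<^bsub>S\<^esub> x"
    using series_closed_gen[OF U] g unfolding series_closed_def by blast
  have sc: "s \<in> carrier S" using left_ideal_inD(1)[OF S.left_ideal_in_gen[OF U(2)] s(1)] .
  have yS: "y \<in> carrier S" using y Yc by blast
  have "s \<ominus>\<^bsub>S\<^esub> y = \<zero>\<^bsub>S\<^esub>"
  proof (rule separated)
    show "s \<ominus>\<^bsub>S\<^esub> y \<in> carrier S" using sc yS by simp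
    fix n
    obtain x where x: "x \<in> carrier S" "s \<ominus>\<^bsub>S\<^esub> psum g n = v n \<otimes>\<^bsub>S\<^esub> x" using s(2) by blast
    have "s \<ominus>\<^bsub>S\<^esub> y = (s \<ominus>\<^bsub>S\<^esub> psum g n) \<ominus>\<^bsub>S\<^esub> v n \<otimes>\<^bsub>S\<^esub> ys n"
      by (subst e[of n]) (use sc c[of n] yc[of n] v_closed[of n] in \<open>simp add: S.minus_eq S.minus_add S.a_ac\<close>)
    also have "\<dots> = v n \<otimes>\<^bsub>S\<^esub> (x \<ominus>\<^bsub>S\<^esub> ys n)"
      unfolding x(2) using x(1) yc[of n] v_closed[of n] by (simp add: S.minus_eq S.r_distr S.r_minus)
    finally show "\<exists>x\<in>carrier S. s \<ominus>\<^bsub>S\<^esub> y = v n \<otimes>\<^bsub>S\<^esub> x" using x(1) yc[of n] by blast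
  qed
  then have "s = y" using sc yS by simp
  then show ?thesis using s(1) by simp
qed

text \<open>The part of degree \<open>n\<close> of the ideal of leading forms of \<open>I\<close>
  for the h(w)-adic filtration, pulled back to \<open>R\<close> where the chain condition is
  available. It is the counterpart of a leading coefficient ideal for polynomials.\<close>

definition residues :: "nat \<Rightarrow> 's set \<Rightarrow> 'c set" where
  "residues n I = {c \<in> carrier R. \<exists>x\<in>carrier S. v n \<otimes>\<^bsub>S\<^esub> (h c \<oplus>\<^bsub>S\<^esub> h w \<otimes>\<^bsub>S\<^esub> x) \<in> I}"

lemma residues_ideal:
  assumes I: "left_ideal_in S (carrier S) I" shows "left_ideal_in R (carrier R) (residues n I)"
proof (rule left_ideal_inI)
  show "residues n I \<subseteq> carrier R" unfolding residues_def by blast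
  have "v n \<otimes>\<^bsub>S\<^esub> (h \<zero>\<^bsub>R\<^esub> \<oplus>\<^bsub>S\<^esub> h w \<otimes>\<^bsub>S\<^esub> \<zero>\<^bsub>S\<^esub>) = \<zero>\<^bsub>S\<^esub>" using w v_closed by simp
  then have "\<exists>x\<in>carrier S. v n \<otimes>\<^bsub>S\<^esub> (h \<zero>\<^bsub>R\<^esub> \<oplus>\<^bsub>S\<^esub> h w \<otimes>\<^bsub>S\<^esub> x) \<in> I"
    using left_ideal_inD(2)[OF I] by (intro bexI[of _ "\<zero>\<^bsub>S\<^esub>"]) simp_all
  then show "\<zero>\<^bsub>R\<^esub> \<in> residues n I" unfolding residues_def by simp
next
  fix c d assume "c \<in> residues n I" "d \<in> residues n I"
  then obtain x y where x: "c \<in> carrier R" "x \<in> carrier S" "v n \<otimes>\<^bsub>S\<^esub> (h c \<oplus>\<^bsub>S\<^esub> h w \<otimes>\<^bsub>S\<^esub> x) \<in> I"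
    and y: "d \<in> carrier R" "y \<in> carrier S" "v n \<otimes>\<^bsub>S\<^esub> (h d \<oplus>\<^bsub>S\<^esub> h w \<otimes>\<^bsub>S\<^esub> y) \<in> I" unfolding residues_def by blast
  have "v n \<otimes>\<^bsub>S\<^esub> (h c \<oplus>\<^bsub>S\<^esub> h w \<otimes>\<^bsub>S\<^esub> x) \<oplus>\<^bsub>S\<^esub> v n \<otimes>\<^bsub>S\<^esub> (h d \<oplus>\<^bsub>S\<^esub> h w \<otimes>\<^bsub>S\<^esub> y)
    = v n \<otimes>\<^bsub>S\<^esub> (h (c \<oplus>\<^bsub>R\<^esub> d) \<oplus>\<^bsub>S\<^esub> h w \<otimes>\<^bsub>S\<^esub> (x \<oplus>\<^bsub>S\<^esub> y))"
    using x y w v_closed[of n] by (simp add: S.r_distr S.a_ac)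
  then have "v n \<otimes>\<^bsub>S\<^esub> (h (c \<oplus>\<^bsub>R\<^esub> d) \<oplus>\<^bsub>S\<^esub> h w \<otimes>\<^bsub>S\<^esub> (x \<oplus>\<^bsub>S\<^esub> y)) \<in> I" using left_ideal_inD(3)[OF I x(3) y(3)] by simp
  then show "c \<oplus>\<^bsub>R\<^esub> d \<in> residues n I" unfolding residues_def using x y S.a_closed[OF x(2) y(2)] by blast
next
  fix a c assume a: "a \<in> carrier R" and "c \<in> residues n I"
  then obtain x where x: "c \<in> carrier R" "x \<in> carrier S" "v n \<otimes>\<^bsub>S\<^esub> (h c \<oplus>\<^bsub>S\<^esub> h w \<otimes>\<^bsub>S\<^esub> x) \<in> I" unfolding residues_def by blast
  have ha: "h a \<in> carrier S" using a by simp
  have "h a \<otimes>\<^bsub>S\<^esub> (v n \<otimes>\<^bsub>S\<^esub> (h c \<oplus>\<^bsub>S\<^esub> h w \<otimes>\<^bsub>S\<^esub> x)) = v n \<otimes>\<^bsub>S\<^esub> (h a \<otimes>\<^bsub>S\<^esub> (h c \<oplus>\<^bsub>S\<^esub> h w \<otimes>\<^bsub>S\<^esub> x))"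
    using v_move[OF ha] x w by simp
  also have "h a \<otimes>\<^bsub>S\<^esub> (h c \<oplus>\<^bsub>S\<^esub> h w \<otimes>\<^bsub>S\<^esub> x) = h (a \<otimes>\<^bsub>R\<^esub> c) \<oplus>\<^bsub>S\<^esub> h w \<otimes>\<^bsub>S\<^esub> (h a \<otimes>\<^bsub>S\<^esub> x)"
    using v_move[OF ha x(2), of 1] x a w by (simp add: S.r_distr)
  finally have "v n \<otimes>\<^bsub>S\<^esub> (h (a \<otimes>\<^bsub>R\<^esub> c) \<oplus>\<^bsub>S\<^esub> h w \<otimes>\<^bsub>S\<^esub> (h a \<otimes>\<^bsub>S\<^esub> x)) \<in> I" using left_ideal_inD(4)[OF I ha x(3)] by simp
  then show "a \<otimes>\<^bsub>R\<^esub> c \<in> residues n I" unfolding residues_def using x a S.m_closed[OF ha x(2)] by blast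
qed

lemma residues_Suc:
  assumes I: "left_ideal_in S (carrier S) I" shows "residues n I \<subseteq> residues (Suc n) I"
proof
  fix c assume "c \<in> residues n I"
  then obtain x where x: "c \<in> carrier R" "x \<in> carrier S" "v n \<otimes>\<^bsub>S\<^esub> (h c \<oplus>\<^bsub>S\<^esub> h w \<otimes>\<^bsub>S\<^esub> x) \<in> I" unfolding residues_def by blast
  have "v (Suc n) \<otimes>\<^bsub>S\<^esub> (h c \<oplus>\<^bsub>S\<^esub> h w \<otimes>\<^bsub>S\<^esub> x) = h w \<otimes>\<^bsub>S\<^esub> (v n \<otimes>\<^bsub>S\<^esub> (h c \<oplus>\<^bsub>S\<^esub> h w \<otimes>\<^bsub>S\<^esub> x))"
    using x w by (intro v_Suc') simp
  also have "\<dots> \<in> I" using left_ideal_inD(4)[OF I _ x(3)] w by simp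
  finally show "c \<in> residues (Suc n) I" unfolding residues_def using x(1,2) by blast
qed

text \<open>The colon ideal of \<open>I\<close> by h(w)^n. These ideals increase with
  \<open>n\<close>, and their stabilisation is the form in which the Artin-Rees property is
  used.\<close>

definition quot :: "nat \<Rightarrow> 's set \<Rightarrow> 's set" where
  "quot n I = {y \<in> carrier S. v n \<otimes>\<^bsub>S\<^esub> y \<in> I}"

lemma quot_ideal:
  assumes I: "left_ideal_in S (carrier S) I" shows "left_ideal_in S (carrier S) (quot n I)"
proof (rule left_ideal_inI)
  show "\<zero>\<^bsub>S\<^esub> \<in> quot n I" using left_ideal_inD(2)[OF I] v_closed unfolding quot_def by simp
next
  fix x y assume "x \<in> quot n I" "y \<in> quot n I"
  then show "x \<oplus>\<^bsub>S\<^esub> y \<in> quot n I" unfolding quot_def using left_ideal_inD(3)[OF I, of "v n \<otimes>\<^bsub>S\<^esub> x" "v n \<otimes>\<^bsub>S\<^esub> y"] v_closed[of n]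
    by (simp add: S.r_distr)
next
  fix a x assume "a \<in> carrier S" "x \<in> quot n I"
  then show "a \<otimes>\<^bsub>S\<^esub> x \<in> quot n I" unfolding quot_def using left_ideal_inD(4)[OF I, of a "v n \<otimes>\<^bsub>S\<^esub> x"] v_move[of a x n] by simp
qed (auto simp: quot_def)

lemma quot_Suc:
  assumes I: "left_ideal_in S (carrier S) I" shows "quot n I \<subseteq> quot (Suc n) I"
  unfolding quot_def using left_ideal_inD(4)[OF I] v_Suc' w by auto

text \<open>One step of the approximation raises the degree: once a correction with the same residue
  has been subtracted, the difference divided by h(w) lies in the next colon ideal.\<close>

lemma quot_step:
  assumes I: "left_ideal_in S (carrier S) I" and y: "y \<in> quot n I"
    and g: "g \<in> quot n I" "y \<ominus>\<^bsub>S\<^esub> g = h w \<otimes>\<^bsub>S\<^esub> x" and x: "x \<in> carrier S"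
  shows "x \<in> quot (Suc n) I"
proof -
  have c: "y \<in> carrier S" "g \<in> carrier S" using y g unfolding quot_def by auto
  have "y \<ominus>\<^bsub>S\<^esub> g \<in> quot n I" using S.left_ideal_in_diff[OF S.subring_carrier quot_ideal[OF I] y g(1)] .
  then show ?thesis unfolding g(2) quot_def using x v_Suc by simp
qed

lemma residue_of:
  assumes I: "left_ideal_in S (carrier S) I" and y: "y \<in> quot n I"
  obtains c x where "c \<in> residues n I" "x \<in> carrier S" "y = h c \<oplus>\<^bsub>S\<^esub> h w \<otimes>\<^bsub>S\<^esub> x"
proof -
  have yc: "y \<in> carrier S" "v n \<otimes>\<^bsub>S\<^esub> y \<in> I" using y unfolding quot_def by auto
  obtain c x where c: "c \<in> carrier R" "x \<in> carrier S" "y = h c \<oplus>\<^bsub>S\<^esub> h w \<otimes>\<^bsub>S\<^esub> x" using dense[OF yc(1)] by blast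
  have "c \<in> residues n I" unfolding residues_def using c yc(2) by blast
  then show thesis using that c by blast
qed

lemma diff_residue:
  assumes "c \<in> carrier R" "x \<in> carrier S" "x' \<in> carrier S"
  shows "(h c \<oplus>\<^bsub>S\<^esub> h w \<otimes>\<^bsub>S\<^esub> x) \<ominus>\<^bsub>S\<^esub> (h c \<oplus>\<^bsub>S\<^esub> h w \<otimes>\<^bsub>S\<^esub> x') = h w \<otimes>\<^bsub>S\<^esub> (x \<ominus>\<^bsub>S\<^esub> x')"
  using assms w by (simp add: S.minus_eq S.minus_add S.r_distr S.r_minus S.a_ac S.r_neg1 S.r_neg2)

text \<open>The residue ideal has finitely many generators since \<open>R\<close> is Noetherian.
  These are lifted to the colon ideal, and left combinations of the lifts reach every
  residue.\<close>

lemma residues_lift: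
  assumes I: "left_ideal_in S (carrier S) I"
  obtains Q where "finite Q" "Q \<subseteq> quot n I"
    "\<And>c. c \<in> residues n I \<Longrightarrow> \<exists>g\<in>gen_left_ideal S Q. \<exists>x\<in>carrier S. g = h c \<oplus>\<^bsub>S\<^esub> h w \<otimes>\<^bsub>S\<^esub> x"
proof -
  interpret L: left_noetherian_ring R using noeth R.left_noetherian_iff_acc by blast
  note ri = residues_ideal[OF I, of n]
  obtain V where V: "V \<subseteq> carrier R" "finite V" "residues n I = gen_left_ideal R V"
    using L.left_ideal_fin_gen[of "residues n I"] ri R.left_ideal_iff by blast
  have "\<forall>c\<in>V. \<exists>x. x \<in> carrier S \<and> v n \<otimes>\<^bsub>S\<^esub> (h c \<oplus>\<^bsub>S\<^esub> h w \<otimes>\<^bsub>S\<^esub> x) \<in> I"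
    using R.gen_left_ideal_incl[of V] unfolding V(3)[symmetric] residues_def by blast
  then obtain x where x: "\<And>c. c \<in> V \<Longrightarrow> x c \<in> carrier S" "\<And>c. c \<in> V \<Longrightarrow> v n \<otimes>\<^bsub>S\<^esub> (h c \<oplus>\<^bsub>S\<^esub> h w \<otimes>\<^bsub>S\<^esub> x c) \<in> I"
    by metis
  define Q where "Q = (\<lambda>c. h c \<oplus>\<^bsub>S\<^esub> h w \<otimes>\<^bsub>S\<^esub> x c) ` V"
  have Q: "finite Q" "Q \<subseteq> quot n I" unfolding Q_def quot_def using V(1,2) x w by auto
  have Qc: "Q \<subseteq> carrier S" using Q(2) unfolding quot_def by blast
  note G = S.left_ideal_in_gen[OF Qc]
  let ?J = "{c \<in> carrier R. \<exists>g\<in>gen_left_ideal S Q. \<exists>x\<in>carrier S. g = h c \<oplus>\<^bsub>S\<^esub> h w \<otimes>\<^bsub>S\<^esub> x}"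
  have "left_ideal_in R (carrier R) ?J"
  proof (rule left_ideal_inI)
    have "\<zero>\<^bsub>S\<^esub> = h \<zero>\<^bsub>R\<^esub> \<oplus>\<^bsub>S\<^esub> h w \<otimes>\<^bsub>S\<^esub> \<zero>\<^bsub>S\<^esub>" using w by simp
    then show "\<zero>\<^bsub>R\<^esub> \<in> ?J" using left_ideal_inD(2)[OF G] by blast
  next
    fix c d assume "c \<in> ?J" "d \<in> ?J"
    then obtain x y where x: "c \<in> carrier R" "x \<in> carrier S" "h c \<oplus>\<^bsub>S\<^esub> h w \<otimes>\<^bsub>S\<^esub> x \<in> gen_left_ideal S Q"
      and y: "d \<in> carrier R" "y \<in> carrier S" "h d \<oplus>\<^bsub>S\<^esub> h w \<otimes>\<^bsub>S\<^esub> y \<in> gen_left_ideal S Q" by blast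
    have "(h c \<oplus>\<^bsub>S\<^esub> h w \<otimes>\<^bsub>S\<^esub> x) \<oplus>\<^bsub>S\<^esub> (h d \<oplus>\<^bsub>S\<^esub> h w \<otimes>\<^bsub>S\<^esub> y) = h (c \<oplus>\<^bsub>R\<^esub> d) \<oplus>\<^bsub>S\<^esub> h w \<otimes>\<^bsub>S\<^esub> (x \<oplus>\<^bsub>S\<^esub> y)"
      using x y w by (simp add: S.r_distr S.a_ac)
    then show "c \<oplus>\<^bsub>R\<^esub> d \<in> ?J" using left_ideal_inD(3)[OF G x(3) y(3)] x(1,2) y(1,2) S.a_closed R.a_closed by blast
  next
    fix a c assume a: "a \<in> carrier R" and "c \<in> ?J"
    then obtain x where x: "c \<in> carrier R" "x \<in> carrier S" "h c \<oplus>\<^bsub>S\<^esub> h w \<otimes>\<^bsub>S\<^esub> x \<in> gen_left_ideal S Q" by blast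
    have ha: "h a \<in> carrier S" using a by simp
    have "h a \<otimes>\<^bsub>S\<^esub> (h c \<oplus>\<^bsub>S\<^esub> h w \<otimes>\<^bsub>S\<^esub> x) = h (a \<otimes>\<^bsub>R\<^esub> c) \<oplus>\<^bsub>S\<^esub> h w \<otimes>\<^bsub>S\<^esub> (h a \<otimes>\<^bsub>S\<^esub> x)"
      using v_move[OF ha x(2), of 1] x a w by (simp add: S.r_distr)
    then show "a \<otimes>\<^bsub>R\<^esub> c \<in> ?J" using left_ideal_inD(4)[OF G ha x(3)] x(1,2) a ha S.m_closed R.m_closed by blast
  qed blast
  moreover have "V \<subseteq> ?J" using V(1) x(1) S.gen_left_ideal_incl[of Q] unfolding Q_def by blast
  ultimately have "residues n I \<subseteq> ?J" unfolding V(3) by (rule R.gen_left_ideal_minimal)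
  then have "\<exists>g\<in>gen_left_ideal S Q. \<exists>x\<in>carrier S. g = h c \<oplus>\<^bsub>S\<^esub> h w \<otimes>\<^bsub>S\<^esub> x" if "c \<in> residues n I" for c
    using that by blast
  with Q show thesis using that by blast
qed

text \<open>\<open>M\<close> makes the residue ideals constant along the chain in all degrees at
  once, and \<open>N\<close> makes those of \<open>I M\<close> constant in the degree. From degree
  \<open>N\<close> on, one finite set of lifts feeds an infinite approximation; the finitely many
  lower degrees are settled by one correction each.\<close>

theorem acc_in_S: "acc_in S (carrier S)"
  unfolding acc_in_def
proof (intro allI impI)
  fix I :: "nat \<Rightarrow> 's set"
  assume I: "\<forall>k. left_ideal_in S (carrier S) (I k)" and inc: "\<forall>k. I k \<subseteq> I (Suc k)"
  have mono: "I m \<subseteq> I n" if "m \<le> n" for m n using lift_Suc_mono_le[of I] inc that by blast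
  have "residues n (I k) \<subseteq> residues n (I (Suc k))" for n k using inc unfolding residues_def by blast
  then obtain M where M: "\<And>n k. k \<ge> M \<Longrightarrow> residues n (I k) = residues n (I M)"
    using acc_in_double[OF noeth, of "\<lambda>n k. residues n (I k)"] residues_ideal residues_Suc I by metis
  obtain N where N: "\<And>n. n \<ge> N \<Longrightarrow> residues n (I M) = residues N (I M)"
    using acc_inD[OF noeth, of "\<lambda>n. residues n (I M)"] residues_ideal residues_Suc I by metis
  have IM: "left_ideal_in S (carrier S) (I M)" using I by blast
  obtain Q where Q: "finite Q" "Q \<subseteq> quot N (I M)"
    "\<And>c. c \<in> residues N (I M) \<Longrightarrow> \<exists>g\<in>gen_left_ideal S Q. \<exists>x\<in>carrier S. g = h c \<oplus>\<^bsub>S\<^esub> h w \<otimes>\<^bsub>S\<^esub> x"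
  proof (rule residues_lift[OF IM, of N])
    fix Q assume a: "finite Q" "Q \<subseteq> quot N (I M)"
      "\<And>c. c \<in> residues N (I M) \<Longrightarrow> \<exists>g\<in>gen_left_ideal S Q. \<exists>x\<in>carrier S. g = h c \<oplus>\<^bsub>S\<^esub> h w \<otimes>\<^bsub>S\<^esub> x"
    show thesis by (rule that[OF a])
  qed
  have Qc: "Q \<subseteq> carrier S" using Q(2) unfolding quot_def by blast
  have genQ: "gen_left_ideal S Q \<subseteq> quot N (I M)" by (rule S.gen_left_ideal_minimal[OF quot_ideal[OF IM] Q(2)])
  have "I k \<subseteq> I M" if k: "k \<ge> M" for k
  proof -
    have Ik: "left_ideal_in S (carrier S) (I k)" using I by blast
    \<comment> \<open>From degree \<open>N\<close> on, the residues of \<open>I k\<close> are those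
      of \<open>I M\<close> in degree \<open>N\<close>. The lifts \<open>Q\<close> therefore serve
      at every stage, and the approximation converges within the ideal they generate.\<close>
    have top: "quot N (I k) \<subseteq> quot N (I M)"
    proof
      fix y assume y: "y \<in> quot N (I k)"
      have "y \<in> gen_left_ideal S Q"
      proof (rule gen_if_approximable[OF Q(1) Qc, of "\<lambda>n. quot (N + n) (I k)"])
        show "quot (N + n) (I k) \<subseteq> carrier S" for n unfolding quot_def by blast
        show "y \<in> quot (N + 0) (I k)" using y by simp
      next
        fix n z assume z: "z \<in> quot (N + n) (I k)"
        obtain c x where c: "c \<in> residues (N + n) (I k)" "x \<in> carrier S" "z = h c \<oplus>\<^bsub>S\<^esub> h w \<otimes>\<^bsub>S\<^esub> x"
          using residue_of[OF Ik z] .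
        have "residues (N + n) (I k) = residues N (I M)" using trans[OF M[OF k] N[of "N + n"]] by simp
        then have cN: "c \<in> residues N (I M)" using c(1) by simp
        then have cR: "c \<in> carrier R" unfolding residues_def by blast
        obtain g x' where g: "g \<in> gen_left_ideal S Q" "x' \<in> carrier S" "g = h c \<oplus>\<^bsub>S\<^esub> h w \<otimes>\<^bsub>S\<^esub> x'" using Q(3)[OF cN] by blast
        have "quot N (I k) \<subseteq> quot (N + n) (I k)"
          by (induction n) (use quot_Suc[OF Ik] in auto)
        moreover have "quot N (I M) \<subseteq> quot N (I k)" using mono[OF k] unfolding quot_def by blast
        ultimately have gq: "g \<in> quot (N + n) (I k)" using genQ g(1) by blast
        have d: "z \<ominus>\<^bsub>S\<^esub> g = h w \<otimes>\<^bsub>S\<^esub> (x \<ominus>\<^bsub>S\<^esub> x')" unfolding c(3) g(3) by (rule diff_residue[OF cR c(2) g(2)])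
        have "x \<ominus>\<^bsub>S\<^esub> x' \<in> quot (Suc (N + n)) (I k)"
          using quot_step[OF Ik z gq d] c(2) g(2) by simp
        moreover have "z = g \<oplus>\<^bsub>S\<^esub> h w \<otimes>\<^bsub>S\<^esub> (x \<ominus>\<^bsub>S\<^esub> x')"
          unfolding d[symmetric] using add_diff_cancel[of z g] z gq unfolding quot_def by simp
        ultimately show "\<exists>g\<in>gen_left_ideal S Q. \<exists>y'\<in>quot (N + Suc n) (I k). z = g \<oplus>\<^bsub>S\<^esub> h w \<otimes>\<^bsub>S\<^esub> y'"
          using g(1) by auto
      qed
      then show "y \<in> quot N (I M)" using genQ by blast
    qed
    \<comment> \<open>Descending induction from \<open>N\<close> to 0, where the colon ideal is the
      ideal itself.\<close>
    have "quot n (I k) \<subseteq> quot n (I M)" if "n \<le> N" for n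
      using that
    proof (induction rule: inc_induct)
      case base show ?case by (rule top)
    next
      case (step n)
      show ?case
      proof
        fix y assume y: "y \<in> quot n (I k)"
        obtain c x where c: "c \<in> residues n (I k)" "x \<in> carrier S" "y = h c \<oplus>\<^bsub>S\<^esub> h w \<otimes>\<^bsub>S\<^esub> x"
          using residue_of[OF Ik y] .
        have "c \<in> residues n (I M)" using c(1) M[OF k] by simp
        then obtain x' where x': "c \<in> carrier R" "x' \<in> carrier S" "v n \<otimes>\<^bsub>S\<^esub> (h c \<oplus>\<^bsub>S\<^esub> h w \<otimes>\<^bsub>S\<^esub> x') \<in> I M"
          unfolding residues_def by blast
        let ?g = "h c \<oplus>\<^bsub>S\<^esub> h w \<otimes>\<^bsub>S\<^esub> x'"
        have g: "?g \<in> quot n (I M)" "?g \<in> quot n (I k)" unfolding quot_def using x' w mono[OF k] by auto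
        have d: "y \<ominus>\<^bsub>S\<^esub> ?g = h w \<otimes>\<^bsub>S\<^esub> (x \<ominus>\<^bsub>S\<^esub> x')" unfolding c(3) by (rule diff_residue[OF x'(1) c(2) x'(2)])
        have "x \<ominus>\<^bsub>S\<^esub> x' \<in> quot (Suc n) (I k)" using quot_step[OF Ik y g(2) d] c(2) x'(2) by simp
        then have "x \<ominus>\<^bsub>S\<^esub> x' \<in> quot (Suc n) (I M)" using step.IH by blast
        then have "y \<ominus>\<^bsub>S\<^esub> ?g \<in> quot n (I M)"
          unfolding d quot_def mem_Collect_eq using v_Suc[of "x \<ominus>\<^bsub>S\<^esub> x'" n] w by (metis S.m_closed hom_closed)
        from left_ideal_inD(3)[OF quot_ideal[OF IM] g(1) this] show "y \<in> quot n (I M)"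
          using add_diff_cancel[of y ?g] y g(1) unfolding quot_def by simp
      qed
    qed
    from this[of 0] have q0: "quot 0 (I k) \<subseteq> quot 0 (I M)" by simp
    show "I k \<subseteq> I M"
    proof
      fix y assume y: "y \<in> I k"
      then have yc: "y \<in> carrier S" using left_ideal_inD(1)[OF Ik] by blast
      then show "y \<in> I M" using q0 y unfolding quot_def by auto
    qed
  qed
  then have "I k = I M" if "k \<ge> M" for k using mono[OF that] that by (intro subset_antisym)
  then show "\<exists>N. \<forall>n\<ge>N. I n = I N" by (intro exI[of _ M] allI impI)
qed

text \<open>Once the colon ideals are constant from \<open>N\<close> on, an element of the ideal
  that is divisible by h(w)^(N+i) is h(w)^i times an element of the ideal. So the differences of the
  approximations form a series with coefficients in the ideal, and \<open>series_closed_gen\<close>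
  applies.\<close>

lemma gen_closed:
  assumes U: "finite U" "U \<subseteq> carrier S" and x: "x \<in> carrier S"
    and app: "\<And>n. \<exists>g\<in>gen_left_ideal S U. \<exists>y\<in>carrier S. x = g \<oplus>\<^bsub>S\<^esub> v n \<otimes>\<^bsub>S\<^esub> y"
  shows "x \<in> gen_left_ideal S U"
proof -
  let ?G = "gen_left_ideal S U"
  note G = S.left_ideal_in_gen[OF U(2)]
  obtain N where N: "\<And>n. n \<ge> N \<Longrightarrow> quot n ?G = quot N ?G"
    using acc_inD[OF acc_in_S, of "\<lambda>n. quot n ?G"] quot_ideal[OF G] quot_Suc[OF G] by metis
  have "\<forall>n. \<exists>g y. g \<in> ?G \<and> y \<in> carrier S \<and> x = g \<oplus>\<^bsub>S\<^esub> v n \<otimes>\<^bsub>S\<^esub> y" using app by blast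
  then obtain g y where gy: "\<And>n. g n \<in> ?G" "\<And>n. y n \<in> carrier S" "\<And>n. x = g n \<oplus>\<^bsub>S\<^esub> v n \<otimes>\<^bsub>S\<^esub> y n" by metis
  have gc: "g n \<in> carrier S" for n using left_ideal_inD(1)[OF G gy(1)] .
  have "\<exists>e\<in>?G. g (Suc (N + i)) \<ominus>\<^bsub>S\<^esub> g (N + i) = v i \<otimes>\<^bsub>S\<^esub> e" for i
  proof -
    \<comment> \<open>\<open>?z\<close> is the difference of two consecutive approximations divided
      by h(w)^(N+i).\<close>
    let ?n = "N + i" and ?z = "y (N + i) \<ominus>\<^bsub>S\<^esub> h w \<otimes>\<^bsub>S\<^esub> y (Suc (N + i))"
    have c: "g ?n \<in> carrier S" "g (Suc ?n) \<in> carrier S" "v ?n \<otimes>\<^bsub>S\<^esub> y ?n \<in> carrier S"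
      "v (Suc ?n) \<otimes>\<^bsub>S\<^esub> y (Suc ?n) \<in> carrier S" "?z \<in> carrier S"
      using gc gy(2) v_closed w by auto
    have "g (Suc ?n) \<oplus>\<^bsub>S\<^esub> v (Suc ?n) \<otimes>\<^bsub>S\<^esub> y (Suc ?n) = g ?n \<oplus>\<^bsub>S\<^esub> v ?n \<otimes>\<^bsub>S\<^esub> y ?n"
      using gy(3)[of ?n] gy(3)[of "Suc ?n"] by simp
    then have "g (Suc ?n) \<ominus>\<^bsub>S\<^esub> g ?n = v ?n \<otimes>\<^bsub>S\<^esub> y ?n \<ominus>\<^bsub>S\<^esub> v (Suc ?n) \<otimes>\<^bsub>S\<^esub> y (Suc ?n)"
      by (rule add_eq_diff_eq[OF c(2,4,1,3)])
    also have "\<dots> = v ?n \<otimes>\<^bsub>S\<^esub> ?z" unfolding v_Suc[OF gy(2)] using gy(2) v_closed[of ?n] w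
      by (simp add: S.minus_eq S.r_distr S.r_minus)
    finally have d: "g (Suc ?n) \<ominus>\<^bsub>S\<^esub> g ?n = v ?n \<otimes>\<^bsub>S\<^esub> ?z" .
    have "g (Suc ?n) \<ominus>\<^bsub>S\<^esub> g ?n \<in> ?G" using S.left_ideal_in_diff[OF S.subring_carrier G gy(1) gy(1)] .
    then have "?z \<in> quot ?n ?G" unfolding d quot_def using c by simp
    then have "v N \<otimes>\<^bsub>S\<^esub> ?z \<in> ?G" using N[of ?n] unfolding quot_def by auto
    moreover have "v ?n \<otimes>\<^bsub>S\<^esub> ?z = v i \<otimes>\<^bsub>S\<^esub> (v N \<otimes>\<^bsub>S\<^esub> ?z)" using v_add[OF c(5), of i N] by (simp add: add.commute)
    ultimately show ?thesis using d by auto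
  qed
  then obtain e where e: "\<And>i. e i \<in> ?G" "\<And>i. g (Suc (N + i)) \<ominus>\<^bsub>S\<^esub> g (N + i) = v i \<otimes>\<^bsub>S\<^esub> e i" by metis
  have ec: "e i \<in> carrier S" for i using left_ideal_inD(1)[OF G e(1)] .
  note pc = psum_closed[of e, OF ec]
  have p: "g (N + i) = g N \<oplus>\<^bsub>S\<^esub> psum e i" for i
  proof (induction i)
    case 0 then show ?case using gc by simp
  next
    case (Suc i)
    have "g (N + Suc i) = g (N + i) \<oplus>\<^bsub>S\<^esub> v i \<otimes>\<^bsub>S\<^esub> e i"
      unfolding e(2)[of i, symmetric] using add_diff_cancel[OF gc gc] by simp
    then show ?case using Suc gc[of N] pc[of i] ec[of i] v_closed[of i] by (simp add: S.a_assoc)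
  qed
  obtain s where s: "s \<in> ?G" "\<And>n. \<exists>y\<in>carrier S. s \<ominus>\<^bsub>S\<^esub> psum e n = v n \<otimes>\<^bsub>S\<^esub> y"
    using series_closed_gen[OF U] e(1) unfolding series_closed_def by blast
  have sc: "s \<in> carrier S" using left_ideal_inD(1)[OF G s(1)] .
  have "x \<ominus>\<^bsub>S\<^esub> (s \<oplus>\<^bsub>S\<^esub> g N) = \<zero>\<^bsub>S\<^esub>"
  proof (rule separated)
    show "x \<ominus>\<^bsub>S\<^esub> (s \<oplus>\<^bsub>S\<^esub> g N) \<in> carrier S" using x sc gc by simp
    fix i
    obtain z where z: "z \<in> carrier S" "s \<ominus>\<^bsub>S\<^esub> psum e i = v i \<otimes>\<^bsub>S\<^esub> z" using s(2) by blast
    have c: "v (N + i) \<otimes>\<^bsub>S\<^esub> y (N + i) \<in> carrier S" using v_closed gy(2) by simp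
    have *: "(a \<oplus>\<^bsub>S\<^esub> b) \<oplus>\<^bsub>S\<^esub> d \<ominus>\<^bsub>S\<^esub> (s \<oplus>\<^bsub>S\<^esub> a) = d \<ominus>\<^bsub>S\<^esub> (s \<ominus>\<^bsub>S\<^esub> b)"
      if "a \<in> carrier S" "b \<in> carrier S" "d \<in> carrier S" for a b d using that sc by algebra
    have "x \<ominus>\<^bsub>S\<^esub> (s \<oplus>\<^bsub>S\<^esub> g N) = v (N + i) \<otimes>\<^bsub>S\<^esub> y (N + i) \<ominus>\<^bsub>S\<^esub> (s \<ominus>\<^bsub>S\<^esub> psum e i)"
      by (subst gy(3)[of "N + i"], subst p) (rule *[OF gc pc c])
    also have "\<dots> = v i \<otimes>\<^bsub>S\<^esub> (v N \<otimes>\<^bsub>S\<^esub> y (N + i)) \<ominus>\<^bsub>S\<^esub> v i \<otimes>\<^bsub>S\<^esub> z"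
      unfolding z(2) using v_add[OF gy(2), of i N] by (simp add: add.commute)
    also have "\<dots> = v i \<otimes>\<^bsub>S\<^esub> (v N \<otimes>\<^bsub>S\<^esub> y (N + i) \<ominus>\<^bsub>S\<^esub> z)"
      using z(1) gy(2) v_closed by (simp add: S.minus_eq S.r_distr S.r_minus)
    finally show "\<exists>z\<in>carrier S. x \<ominus>\<^bsub>S\<^esub> (s \<oplus>\<^bsub>S\<^esub> g N) = v i \<otimes>\<^bsub>S\<^esub> z"
      by (rule bexI) (use z(1) gy(2) v_closed in simp)
  qed
  then have "x = s \<oplus>\<^bsub>S\<^esub> g N" using x sc gc by simp
  then show ?thesis using left_ideal_inD(3)[OF G s(1) gy(1)] by simp
qed

text \<open>Approximate \<open>m\<close> by some c in \<open>R\<close> modulo h(w)^(k+N). Then c s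
  lies in RV + w^(k+N) R, and Artin-Rees for Rs + RV rewrites the error as w^k (a s + j') with j' in
  RV. Hence c - w^k a belongs to (RV : s). So \<open>m\<close> lies in S (RV : s) + h(w)^k S for
  every k, and \<open>gen_closed\<close> finishes the argument.\<close>

theorem colon_flat_approximation:
  assumes V: "V \<subseteq> carrier R" "finite V" and s: "s \<in> carrier R" and m: "m \<in> carrier S"
    and ms: "m \<otimes>\<^bsub>S\<^esub> h s \<in> gen_left_ideal S (h ` V)"
  shows "m \<in> gen_left_ideal S (h ` {c \<in> carrier R. c \<otimes>\<^bsub>R\<^esub> s \<in> gen_left_ideal R V})"
proof -
  let ?Q = "{c \<in> carrier R. c \<otimes>\<^bsub>R\<^esub> s \<in> gen_left_ideal R V}"
  note GV = R.left_ideal_in_gen[OF V(1)]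
  have Q: "left_ideal_in R (carrier R) ?Q"
    using s by (intro left_ideal_inI) (auto simp: R.l_distr R.m_assoc left_ideal_inD[OF GV])
  interpret L: left_noetherian_ring R using noeth R.left_noetherian_iff_acc by blast
  obtain W where W: "W \<subseteq> carrier R" "finite W" "?Q = gen_left_ideal R W"
    using L.left_ideal_fin_gen[of ?Q] Q R.left_ideal_iff by blast
  have hW: "h ` W \<subseteq> carrier S" using W(1) by auto
  have sV: "insert s V \<subseteq> carrier R" using s V by simp
  let ?I = "gen_left_ideal R (insert s V)"
  note I = R.left_ideal_in_gen[OF sV]
  \<comment> \<open>Artin-Rees is set up for Rs + RV and not for RV, since the error c s - j lies in
    the former.\<close>
  let ?q = "\<lambda>n. {c \<in> carrier R. u n \<otimes>\<^bsub>R\<^esub> c \<in> ?I}"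
  have qi: "left_ideal_in R (carrier R) (?q n)" for n
    using u_closed[of n] by (intro left_ideal_inI) (auto simp: R.r_distr u_move[symmetric] left_ideal_inD[OF I])
  have qs: "?q n \<subseteq> ?q (Suc n)" for n
    using left_ideal_inD(4)[OF I] u_Suc' w by auto
  obtain N where N: "\<And>n. n \<ge> N \<Longrightarrow> ?q n = ?q N" 
  proof (rule acc_inD[of R "carrier R" ?q, OF noeth qi qs])
    fix N assume a: "\<And>n. n \<ge> N \<Longrightarrow> ?q n = ?q N"
    show thesis by (rule that[OF a])
  qed
  \<comment> \<open>Modulo h(w)^n the ideal generated in \<open>S\<close> comes from the ideal
    generated in \<open>R\<close>: the coefficients are replaced by approximations from
    \<open>R\<close>.\<close>
  have gen: "\<exists>j\<in>gen_left_ideal R V. \<exists>y\<in>carrier S. x = h j \<oplus>\<^bsub>S\<^esub> v n \<otimes>\<^bsub>S\<^esub> y" if "x \<in> gen_left_ideal S (h ` V)" for x n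
  proof -
    let ?J = "{x. \<exists>j\<in>gen_left_ideal R V. \<exists>y\<in>carrier S. x = h j \<oplus>\<^bsub>S\<^esub> v n \<otimes>\<^bsub>S\<^esub> y}"
    have jc: "j \<in> carrier R" if "j \<in> gen_left_ideal R V" for j using left_ideal_inD(1)[OF GV that] .
    have "left_ideal_in S (carrier S) ?J"
    proof (rule left_ideal_inI)
      show "?J \<subseteq> carrier S" using jc v_closed by auto
      have "\<zero>\<^bsub>S\<^esub> = h \<zero>\<^bsub>R\<^esub> \<oplus>\<^bsub>S\<^esub> v n \<otimes>\<^bsub>S\<^esub> \<zero>\<^bsub>S\<^esub>" using v_closed by simp
      then show "\<zero>\<^bsub>S\<^esub> \<in> ?J" using left_ideal_inD(2)[OF GV] by blast
    next
      fix x x' assume "x \<in> ?J" "x' \<in> ?J"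
      then obtain j y j' y' where 1: "j \<in> gen_left_ideal R V" "y \<in> carrier S" "x = h j \<oplus>\<^bsub>S\<^esub> v n \<otimes>\<^bsub>S\<^esub> y"
        "j' \<in> gen_left_ideal R V" "y' \<in> carrier S" "x' = h j' \<oplus>\<^bsub>S\<^esub> v n \<otimes>\<^bsub>S\<^esub> y'" by blast
      have "x \<oplus>\<^bsub>S\<^esub> x' = h (j \<oplus>\<^bsub>R\<^esub> j') \<oplus>\<^bsub>S\<^esub> v n \<otimes>\<^bsub>S\<^esub> (y \<oplus>\<^bsub>S\<^esub> y')"
        unfolding 1(3,6) using 1 jc v_closed[of n] by (simp add: S.r_distr S.a_ac)
      then show "x \<oplus>\<^bsub>S\<^esub> x' \<in> ?J" using left_ideal_inD(3)[OF GV 1(1) 1(4)] S.a_closed[OF 1(2) 1(5)] by blast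
    next
      fix a x assume a: "a \<in> carrier S" and "x \<in> ?J"
      then obtain j y where 1: "j \<in> gen_left_ideal R V" "y \<in> carrier S" "x = h j \<oplus>\<^bsub>S\<^esub> v n \<otimes>\<^bsub>S\<^esub> y" by blast
      obtain b z where b: "b \<in> carrier R" "z \<in> carrier S" "a = h b \<oplus>\<^bsub>S\<^esub> v n \<otimes>\<^bsub>S\<^esub> z" using dense_pow[OF a] by blast
      have hj: "h j \<in> carrier S" using jc[OF 1(1)] by simp
      have "a \<otimes>\<^bsub>S\<^esub> x = a \<otimes>\<^bsub>S\<^esub> h j \<oplus>\<^bsub>S\<^esub> v n \<otimes>\<^bsub>S\<^esub> (a \<otimes>\<^bsub>S\<^esub> y)"
        unfolding 1(3) using a 1(2) hj v_closed[of n] v_move[OF a 1(2)] by (simp add: S.r_distr)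
      also have "a \<otimes>\<^bsub>S\<^esub> h j = h (b \<otimes>\<^bsub>R\<^esub> j) \<oplus>\<^bsub>S\<^esub> v n \<otimes>\<^bsub>S\<^esub> (z \<otimes>\<^bsub>S\<^esub> h j)"
        unfolding b(3) using b jc[OF 1(1)] v_closed[of n] by (simp add: S.l_distr S.m_assoc)
      also have "\<dots> \<oplus>\<^bsub>S\<^esub> v n \<otimes>\<^bsub>S\<^esub> (a \<otimes>\<^bsub>S\<^esub> y) = h (b \<otimes>\<^bsub>R\<^esub> j) \<oplus>\<^bsub>S\<^esub> v n \<otimes>\<^bsub>S\<^esub> (z \<otimes>\<^bsub>S\<^esub> h j \<oplus>\<^bsub>S\<^esub> a \<otimes>\<^bsub>S\<^esub> y)"
        using b(1,2) jc[OF 1(1)] v_closed[of n] a 1(2) by (simp add: S.r_distr S.a_assoc)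
      finally show "a \<otimes>\<^bsub>S\<^esub> x \<in> ?J"
        using left_ideal_inD(4)[OF GV b(1) 1(1)] a 1(2) b(2) hj by blast
    qed
    moreover have "h ` V \<subseteq> ?J"
    proof (rule image_subsetI)
      fix j assume j: "j \<in> V"
      then have "h j = h j \<oplus>\<^bsub>S\<^esub> v n \<otimes>\<^bsub>S\<^esub> \<zero>\<^bsub>S\<^esub>" using V v_closed by auto
      then show "h j \<in> ?J" using j R.gen_left_ideal_incl[of V] by blast
    qed
    ultimately have "gen_left_ideal S (h ` V) \<subseteq> ?J" by (rule S.gen_left_ideal_minimal)
    then show ?thesis using that by blast
  qed
  have "\<exists>g\<in>gen_left_ideal S (h ` W). \<exists>y\<in>carrier S. m = g \<oplus>\<^bsub>S\<^esub> v k \<otimes>\<^bsub>S\<^esub> y" for k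
  proof -
    \<comment> \<open>Artin-Rees costs \<open>N\<close> powers of \<open>w\<close>, so the precision
      k + N leaves precision \<open>k\<close>.\<close>
    let ?n = "k + N"
    obtain c y where c: "c \<in> carrier R" "y \<in> carrier S" "m = h c \<oplus>\<^bsub>S\<^esub> v ?n \<otimes>\<^bsub>S\<^esub> y" using dense_pow[OF m] by blast
    obtain j z where j: "j \<in> gen_left_ideal R V" "z \<in> carrier S" "m \<otimes>\<^bsub>S\<^esub> h s = h j \<oplus>\<^bsub>S\<^esub> v ?n \<otimes>\<^bsub>S\<^esub> z"
      using gen[OF ms] by blast
    have jc: "j \<in> carrier R" using left_ideal_inD(1)[OF GV j(1)] .
    have hs: "h s \<in> carrier S" "h c \<in> carrier S" "h j \<in> carrier S" "h c \<otimes>\<^bsub>S\<^esub> h s \<in> carrier S" using s c jc by auto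
    have vy: "v ?n \<otimes>\<^bsub>S\<^esub> (y \<otimes>\<^bsub>S\<^esub> h s) \<in> carrier S" "v ?n \<otimes>\<^bsub>S\<^esub> z \<in> carrier S" using v_closed c j hs by auto
    have "m \<otimes>\<^bsub>S\<^esub> h s = h c \<otimes>\<^bsub>S\<^esub> h s \<oplus>\<^bsub>S\<^esub> v ?n \<otimes>\<^bsub>S\<^esub> (y \<otimes>\<^bsub>S\<^esub> h s)"
      unfolding c(3) using c(2) hs v_closed[of ?n] by (simp add: S.l_distr S.m_assoc)
    with j(3) have e: "h j \<oplus>\<^bsub>S\<^esub> v ?n \<otimes>\<^bsub>S\<^esub> z = h c \<otimes>\<^bsub>S\<^esub> h s \<oplus>\<^bsub>S\<^esub> v ?n \<otimes>\<^bsub>S\<^esub> (y \<otimes>\<^bsub>S\<^esub> h s)" by simp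
    have "h c \<otimes>\<^bsub>S\<^esub> h s = (h c \<otimes>\<^bsub>S\<^esub> h s \<oplus>\<^bsub>S\<^esub> v ?n \<otimes>\<^bsub>S\<^esub> (y \<otimes>\<^bsub>S\<^esub> h s)) \<ominus>\<^bsub>S\<^esub> v ?n \<otimes>\<^bsub>S\<^esub> (y \<otimes>\<^bsub>S\<^esub> h s)"
      using hs vy by (simp add: S.minus_eq S.a_assoc S.r_neg)
    then have "h c \<otimes>\<^bsub>S\<^esub> h s \<ominus>\<^bsub>S\<^esub> h j = (h j \<oplus>\<^bsub>S\<^esub> v ?n \<otimes>\<^bsub>S\<^esub> z) \<ominus>\<^bsub>S\<^esub> v ?n \<otimes>\<^bsub>S\<^esub> (y \<otimes>\<^bsub>S\<^esub> h s) \<ominus>\<^bsub>S\<^esub> h j" unfolding e by simp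
    also have "\<dots> = v ?n \<otimes>\<^bsub>S\<^esub> z \<ominus>\<^bsub>S\<^esub> v ?n \<otimes>\<^bsub>S\<^esub> (y \<otimes>\<^bsub>S\<^esub> h s)"
      using hs vy by (simp add: S.minus_eq S.a_ac S.r_neg S.r_neg1 S.r_neg2)
    also have "\<dots> = v ?n \<otimes>\<^bsub>S\<^esub> (z \<ominus>\<^bsub>S\<^esub> y \<otimes>\<^bsub>S\<^esub> h s)"
      using c(2) j(2) hs v_closed[of ?n] by (simp add: S.minus_eq S.r_distr S.r_minus)
    finally have "h (c \<otimes>\<^bsub>R\<^esub> s \<ominus>\<^bsub>R\<^esub> j) = v ?n \<otimes>\<^bsub>S\<^esub> (z \<ominus>\<^bsub>S\<^esub> y \<otimes>\<^bsub>S\<^esub> h s)"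
      using c(1) s jc by (simp add: R.minus_eq S.minus_eq)
    from reflect_pow[OF _ _ this] obtain d where d: "d \<in> carrier R" "c \<otimes>\<^bsub>R\<^esub> s \<ominus>\<^bsub>R\<^esub> j = u ?n \<otimes>\<^bsub>R\<^esub> d"
      using c s jc j(2) hs by auto
    have cs: "c \<otimes>\<^bsub>R\<^esub> s \<in> ?I"
      using left_ideal_inD(4)[OF I c(1)] R.gen_left_ideal_incl[of "insert s V"] by blast
    have jI: "j \<in> ?I" using R.gen_left_ideal_mono[of V "insert s V"] j(1) by blast
    have "c \<otimes>\<^bsub>R\<^esub> s \<ominus>\<^bsub>R\<^esub> j \<in> ?I" using R.left_ideal_in_diff[OF R.subring_carrier I cs jI] .
    then have "d \<in> ?q ?n" using d by simp
    \<comment> \<open>\<open>d\<close> lies in the colon ideal of index k + N, which coincides with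
      the one of index \<open>N\<close>.\<close>
    then have "u N \<otimes>\<^bsub>R\<^esub> d \<in> ?I" using N[of ?n] by auto
    then obtain a j' where a: "a \<in> carrier R" "j' \<in> gen_left_ideal R V" "u N \<otimes>\<^bsub>R\<^esub> d = a \<otimes>\<^bsub>R\<^esub> s \<oplus>\<^bsub>R\<^esub> j'"
      unfolding R.gen_left_ideal_insert[OF s V(1)] by blast
    have j'c: "j' \<in> carrier R" using left_ideal_inD(1)[OF GV a(2)] .
    have uk: "u k \<in> carrier R" by (rule u_closed)
    have "c \<otimes>\<^bsub>R\<^esub> s \<ominus>\<^bsub>R\<^esub> j = u k \<otimes>\<^bsub>R\<^esub> (a \<otimes>\<^bsub>R\<^esub> s \<oplus>\<^bsub>R\<^esub> j')"
      using d u_add[OF d(1), of k N] a(3) by simp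
    then have "c \<otimes>\<^bsub>R\<^esub> s \<ominus>\<^bsub>R\<^esub> j \<oplus>\<^bsub>R\<^esub> j = (u k \<otimes>\<^bsub>R\<^esub> (a \<otimes>\<^bsub>R\<^esub> s) \<oplus>\<^bsub>R\<^esub> u k \<otimes>\<^bsub>R\<^esub> j') \<oplus>\<^bsub>R\<^esub> j"
      using uk a(1) s j'c by (simp add: R.r_distr)
    then have cs2: "c \<otimes>\<^bsub>R\<^esub> s = (u k \<otimes>\<^bsub>R\<^esub> a) \<otimes>\<^bsub>R\<^esub> s \<oplus>\<^bsub>R\<^esub> (u k \<otimes>\<^bsub>R\<^esub> j' \<oplus>\<^bsub>R\<^esub> j)"
      using c(1) s jc uk a(1) j'c by (simp add: R.minus_eq R.a_assoc R.l_neg R.m_assoc)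
    have "(c \<ominus>\<^bsub>R\<^esub> u k \<otimes>\<^bsub>R\<^esub> a) \<otimes>\<^bsub>R\<^esub> s = c \<otimes>\<^bsub>R\<^esub> s \<ominus>\<^bsub>R\<^esub> (u k \<otimes>\<^bsub>R\<^esub> a) \<otimes>\<^bsub>R\<^esub> s"
      using c(1) s uk a(1) by (simp add: R.minus_eq R.l_distr R.l_minus)
    also have "\<dots> = u k \<otimes>\<^bsub>R\<^esub> j' \<oplus>\<^bsub>R\<^esub> j"
      unfolding cs2 using s uk a(1) jc j'c by (simp add: R.minus_eq R.a_ac R.r_neg1 R.r_neg2 R.r_neg)
    also have "\<dots> \<in> gen_left_ideal R V"
      using left_ideal_inD(3)[OF GV left_ideal_inD(4)[OF GV uk a(2)] j(1)] .
    finally have q: "c \<ominus>\<^bsub>R\<^esub> u k \<otimes>\<^bsub>R\<^esub> a \<in> gen_left_ideal R W" unfolding W(3)[symmetric] using c(1) uk a(1) by simp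
    have "m = h (c \<ominus>\<^bsub>R\<^esub> u k \<otimes>\<^bsub>R\<^esub> a) \<oplus>\<^bsub>S\<^esub> v k \<otimes>\<^bsub>S\<^esub> (h a \<oplus>\<^bsub>S\<^esub> v N \<otimes>\<^bsub>S\<^esub> y)"
    proof -
      have x: "v k \<otimes>\<^bsub>S\<^esub> h a \<in> carrier S" "v k \<otimes>\<^bsub>S\<^esub> (v N \<otimes>\<^bsub>S\<^esub> y) \<in> carrier S" using a(1) c(2) v_closed by auto
      have "h (c \<ominus>\<^bsub>R\<^esub> u k \<otimes>\<^bsub>R\<^esub> a) = h c \<ominus>\<^bsub>S\<^esub> v k \<otimes>\<^bsub>S\<^esub> h a"
        using c(1) uk a(1) hu[of k] by (simp add: R.minus_eq S.minus_eq del: hom_nat_pow)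
      moreover have "v k \<otimes>\<^bsub>S\<^esub> (h a \<oplus>\<^bsub>S\<^esub> v N \<otimes>\<^bsub>S\<^esub> y) = v k \<otimes>\<^bsub>S\<^esub> h a \<oplus>\<^bsub>S\<^esub> v k \<otimes>\<^bsub>S\<^esub> (v N \<otimes>\<^bsub>S\<^esub> y)"
        using a(1) c(2) v_closed by (simp add: S.r_distr)
      ultimately show ?thesis unfolding c(3) v_add[OF c(2)] using x hs(2)
        by (simp add: S.minus_eq S.a_assoc S.r_neg1 S.r_neg2)
    qed
    then have "\<exists>y\<in>carrier S. m = h (c \<ominus>\<^bsub>R\<^esub> u k \<otimes>\<^bsub>R\<^esub> a) \<oplus>\<^bsub>S\<^esub> v k \<otimes>\<^bsub>S\<^esub> y"
      by (rule bexI) (use a(1) c(2) v_closed in simp)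
    then show ?thesis by (rule bexI) (rule hom_gen_left_ideal[OF W(1) q])
  qed
  then have "m \<in> gen_left_ideal S (h ` W)" using gen_closed[OF _ hW m] W(2) by blast
  moreover have "h ` W \<subseteq> h ` ?Q" using R.gen_left_ideal_incl[of W] unfolding W(3)[symmetric] by blast
  ultimately show ?thesis using S.gen_left_ideal_mono by blast
qed

end

section \<open>Filtered algebras and their associated graded algebras\<close>

locale filtered_algebra = assoc_algebra R B
  for R :: "('r, 'x) ring_scheme" (structure) and B :: "('r, 'b) module" +
  fixes F :: "nat \<Rightarrow> 'b set"
  assumes filt: "algebra_filtration R B F"
begin

abbreviation "Fp \<equiv> filt_pred B F"
abbreviation "Gr \<equiv> gr B F"

lemma F_sg: "additive_subgroup (F n) B" and F_Suc: "x \<in> F n \<Longrightarrow> x \<in> F (Suc n)"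
  and F_mult: "x \<in> F m \<Longrightarrow> y \<in> F n \<Longrightarrow> x \<otimes>\<^bsub>B\<^esub> y \<in> F (m + n)"
  using filt unfolding algebra_filtration_def R_submodule_def by auto

lemma F_carrier: "x \<in> F n \<Longrightarrow> x \<in> carrier B"
  using additive_subgroup.a_subset[OF F_sg] by blast

lemma F_zero: "\<zero>\<^bsub>B\<^esub> \<in> F n"
  using additive_subgroup.zero_closed[OF F_sg] .

lemma F_add: "x \<in> F n \<Longrightarrow> y \<in> F n \<Longrightarrow> x \<oplus>\<^bsub>B\<^esub> y \<in> F n"
  using additive_subgroup.a_closed[OF F_sg] .

lemma F_minus: "x \<in> F n \<Longrightarrow> \<ominus>\<^bsub>B\<^esub> x \<in> F n"
  using additive_subgroup.a_inv_closed[OF F_sg] .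

lemma F_mono: "m \<le> n \<Longrightarrow> x \<in> F m \<Longrightarrow> x \<in> F n"
  by (induction rule: dec_induct) (auto intro: F_Suc)

lemma Fp_simps: "Fp 0 = {\<zero>\<^bsub>B\<^esub>}" "Fp (Suc n) = F n"
  unfolding filt_pred_def by simp_all

lemma Fp_sub: "x \<in> Fp n \<Longrightarrow> x \<in> F n"
  by (cases n) (auto simp: Fp_simps F_zero F_Suc)

lemma Fp_zero: "\<zero>\<^bsub>B\<^esub> \<in> Fp n"
  by (cases n) (auto simp: Fp_simps F_zero)

lemma Fp_add: "x \<in> Fp n \<Longrightarrow> y \<in> Fp n \<Longrightarrow> x \<oplus>\<^bsub>B\<^esub> y \<in> Fp n"
  by (cases n) (auto simp: Fp_simps F_add)

lemma Fp_minus: "x \<in> Fp n \<Longrightarrow> \<ominus>\<^bsub>B\<^esub> x \<in> Fp n"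
  by (cases n) (auto simp: Fp_simps F_minus)

lemma Fp_carrier: "x \<in> Fp n \<Longrightarrow> x \<in> carrier B"
  using Fp_sub F_carrier by blast

lemma coset_mem: "z \<in> Fp n +>\<^bsub>B\<^esub> x \<longleftrightarrow> (\<exists>y\<in>Fp n. z = y \<oplus>\<^bsub>B\<^esub> x)"
  unfolding a_r_coset_def' by blast

lemma coset_zero: "x \<in> carrier B \<Longrightarrow> Fp 0 +>\<^bsub>B\<^esub> x = {x}"
  unfolding a_r_coset_def' Fp_simps by simp

lemma coset_self: "x \<in> carrier B \<Longrightarrow> x \<in> Fp n +>\<^bsub>B\<^esub> x"
  unfolding coset_mem using Fp_zero A.l_zero[of x] by force

lemma coset_trivial:
  assumes x: "x \<in> Fp n" shows "Fp n +>\<^bsub>B\<^esub> x = Fp n"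
proof
  show "Fp n +>\<^bsub>B\<^esub> x \<subseteq> Fp n" using x Fp_add by (auto simp: coset_mem)
  show "Fp n \<subseteq> Fp n +>\<^bsub>B\<^esub> x"
  proof
    fix z assume z: "z \<in> Fp n"
    then have "z \<oplus>\<^bsub>B\<^esub> \<ominus>\<^bsub>B\<^esub> x \<in> Fp n" using x Fp_add Fp_minus by blast
    moreover have "z = (z \<oplus>\<^bsub>B\<^esub> \<ominus>\<^bsub>B\<^esub> x) \<oplus>\<^bsub>B\<^esub> x" using Fp_carrier[OF z] Fp_carrier[OF x] by (simp add: A.a_assoc A.l_neg)
    ultimately show "z \<in> Fp n +>\<^bsub>B\<^esub> x" unfolding coset_mem by blast
  qed
qed

text \<open>The homogeneous element of degree \<open>n\<close> given by the class of
  \<open>x\<close>; it vanishes when \<open>x\<close> already lies in the preceding step of the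
  filtration.\<close>

definition symbol :: "nat \<Rightarrow> 'b \<Rightarrow> nat \<Rightarrow> 'b set" where
  "symbol n x = (\<lambda>m. if m = n then Fp n +>\<^bsub>B\<^esub> x else Fp m)"

lemma symbol_closed:
  assumes x: "x \<in> F n" shows "symbol n x \<in> carrier Gr"
proof -
  have "\<exists>y\<in>F m. symbol n x m = Fp m +>\<^bsub>B\<^esub> y" for m
    using x coset_trivial[OF Fp_zero, of m] F_zero[of m] unfolding symbol_def by (cases "m = n") auto
  moreover have "finite {m. symbol n x m \<noteq> Fp m}"
    by (rule finite_subset[of _ "{n}"]) (auto simp: symbol_def)
  ultimately show ?thesis unfolding gr_def by simp
qed

lemma GrE: assumes "s \<in> carrier Gr" obtains x where "\<And>n. x n \<in> F n" "\<And>n. s n = Fp n +>\<^bsub>B\<^esub> x n"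
proof -
  have "\<forall>n. \<exists>x. x \<in> F n \<and> s n = Fp n +>\<^bsub>B\<^esub> x" using assms unfolding gr_def by auto
  then show thesis using that by metis
qed

lemma Gr_sub: "s \<in> carrier Gr \<Longrightarrow> x \<in> s n \<Longrightarrow> x \<in> F n"
  by (erule GrE[of s]) (auto simp: coset_mem intro: F_add Fp_sub)

lemma finsum_atMost_closed:
  fixes N :: nat
  assumes "\<And>x. x \<in> H \<Longrightarrow> x \<in> carrier B" "\<zero>\<^bsub>B\<^esub> \<in> H" "\<And>x y. x \<in> H \<Longrightarrow> y \<in> H \<Longrightarrow> x \<oplus>\<^bsub>B\<^esub> y \<in> H"
    and "\<And>i. i \<le> N \<Longrightarrow> f i \<in> H"
  shows "(\<Oplus>\<^bsub>B\<^esub>i\<in>{..N}. f i) \<in> H"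
  using assms(4)
proof (induction N)
  case 0 then show ?case using assms(1) by simp
next
  case (Suc N)
  have "(\<Oplus>\<^bsub>B\<^esub>i\<in>{..Suc N}. f i) = f (Suc N) \<oplus>\<^bsub>B\<^esub> (\<Oplus>\<^bsub>B\<^esub>i\<in>{..N}. f i)"
    using Suc.prems assms(1) by (intro A.finsum_Suc) auto
  then show ?case using Suc assms(3) by simp
qed

lemma Gr_mult: "(s \<otimes>\<^bsub>Gr\<^esub> t) n
    = \<Union>{Fp n +>\<^bsub>B\<^esub> (\<Oplus>\<^bsub>B\<^esub>i\<in>{..n}. x i \<otimes>\<^bsub>B\<^esub> y (n - i)) | x y. \<forall>i. x i \<in> s i \<and> y i \<in> t i}"
  unfolding gr_def by simp

text \<open>The homogeneous left ideals of the associated graded algebra, lifted to the filtered algebra.\<close>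

definition graded_ideal :: "(nat \<Rightarrow> 'b set) \<Rightarrow> bool" where
  "graded_ideal G \<longleftrightarrow> (\<forall>n. Fp n \<subseteq> G n \<and> G n \<subseteq> F n \<and> (\<forall>x\<in>G n. \<forall>y\<in>G n. x \<oplus>\<^bsub>B\<^esub> y \<in> G n)) \<and>
     (\<forall>m n. \<forall>x\<in>F m. \<forall>y\<in>G n. x \<otimes>\<^bsub>B\<^esub> y \<in> G (m + n))"

lemma graded_ideal_left_ideal:
  assumes ring: "ring Gr" and G: "graded_ideal G"
  shows "left_ideal_in Gr (carrier Gr) {s \<in> carrier Gr. \<forall>n. s n \<subseteq> G n}"
proof (rule left_ideal_inI)
  interpret Gr: ring Gr by (rule ring)
  have G1: "x \<in> Fp n \<Longrightarrow> x \<in> G n" and G2: "x \<in> G n \<Longrightarrow> x \<in> F n" and G3: "x \<in> G n \<Longrightarrow> y \<in> G n \<Longrightarrow> x \<oplus>\<^bsub>B\<^esub> y \<in> G n"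
    and G4: "x \<in> F m \<Longrightarrow> y \<in> G n \<Longrightarrow> x \<otimes>\<^bsub>B\<^esub> y \<in> G (m + n)" for x y m n
    using G unfolding graded_ideal_def by blast+
  have z: "\<zero>\<^bsub>Gr\<^esub> = Fp" unfolding gr_def by simp
  show "\<zero>\<^bsub>Gr\<^esub> \<in> {s \<in> carrier Gr. \<forall>n. s n \<subseteq> G n}" using Gr.zero_closed G1 unfolding z by blast
  {
    fix s t assume s: "s \<in> {s \<in> carrier Gr. \<forall>n. s n \<subseteq> G n}" "t \<in> {s \<in> carrier Gr. \<forall>n. s n \<subseteq> G n}"
    have "(s \<oplus>\<^bsub>Gr\<^esub> t) n = s n <+>\<^bsub>B\<^esub> t n" for n unfolding gr_def by simp
    note e = this[unfolded set_add_def']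
    have "(s \<oplus>\<^bsub>Gr\<^esub> t) n \<subseteq> G n" for n unfolding e using s G3 by blast
    then show "s \<oplus>\<^bsub>Gr\<^esub> t \<in> {s \<in> carrier Gr. \<forall>n. s n \<subseteq> G n}" using s Gr.a_closed by simp
  next
    fix s t assume s: "s \<in> carrier Gr" "t \<in> {s \<in> carrier Gr. \<forall>n. s n \<subseteq> G n}"
    have "(s \<otimes>\<^bsub>Gr\<^esub> t) n \<subseteq> G n" for n
    proof
      fix z assume "z \<in> (s \<otimes>\<^bsub>Gr\<^esub> t) n"
      then obtain x y where xy: "\<forall>i. x i \<in> s i \<and> y i \<in> t i" and z: "z \<in> Fp n +>\<^bsub>B\<^esub> (\<Oplus>\<^bsub>B\<^esub>i\<in>{..n}. x i \<otimes>\<^bsub>B\<^esub> y (n - i))"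
        unfolding Gr_mult by blast
      have "x i \<otimes>\<^bsub>B\<^esub> y (n - i) \<in> G n" if "i \<le> n" for i
      proof -
        have "y (n - i) \<in> G (n - i)" using xy s(2) by blast
        from G4[OF Gr_sub[OF s(1), of "x i" i] this] show ?thesis using xy that by simp
      qed
      then have "(\<Oplus>\<^bsub>B\<^esub>i\<in>{..n}. x i \<otimes>\<^bsub>B\<^esub> y (n - i)) \<in> G n"
        using G1 G2 G3 F_carrier Fp_zero by (intro finsum_atMost_closed) blast+
      then show "z \<in> G n" using z G1 G3 unfolding coset_mem by blast
    qed
    then show "s \<otimes>\<^bsub>Gr\<^esub> t \<in> {s \<in> carrier Gr. \<forall>n. s n \<subseteq> G n}" using s Gr.m_closed by simp
  }
qed blast

text \<open>Each family \<open>G k\<close> is encoded in a single left ideal of the graded algebra,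
  so one \<open>N\<close> works in all degrees. Membership of \<open>x\<close> in a component is
  read off from its symbol.\<close>

lemma graded_ideals_stabilise:
  assumes ring: "ring Gr" and acc: "acc_in Gr (carrier Gr)"
    and G: "\<And>k. graded_ideal (G k)" and inc: "\<And>k n. G k n \<subseteq> G (Suc k) n"
  shows "\<exists>N::nat. \<forall>k\<ge>N. \<forall>n. G k n \<subseteq> G N n"
proof -
  let ?I = "\<lambda>k. {s \<in> carrier Gr. \<forall>n. s n \<subseteq> G k n}"
  have i1: "left_ideal_in Gr (carrier Gr) (?I k)" for k by (rule graded_ideal_left_ideal[OF ring G])
  have i2: "?I k \<subseteq> ?I (Suc k)" for k using inc[of k] by blast
  show ?thesis
  proof (rule acc_inD[of Gr "carrier Gr" ?I, OF acc i1 i2])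
    fix N assume N: "\<And>k. k \<ge> N \<Longrightarrow> ?I k = ?I N"
    have "G k n \<subseteq> G N n" if k: "k \<ge> N" for k n
    proof
      fix x assume x: "x \<in> G k n"
      have Gk: "Fp m \<subseteq> G k m" "G k m \<subseteq> F m" "\<And>x y. x \<in> G k m \<Longrightarrow> y \<in> G k m \<Longrightarrow> x \<oplus>\<^bsub>B\<^esub> y \<in> G k m" for m
        using G[of k] unfolding graded_ideal_def by blast+
      have xF: "x \<in> F n" using x Gk(2) by blast
      have "symbol n x m \<subseteq> G k m" for m
        unfolding symbol_def using x Gk(1)[of m] subsetD[OF Gk(1)[of n]] Gk(3)[of _ n x] by (auto simp: coset_mem)
      then have "symbol n x \<in> ?I k" using symbol_closed[OF xF] by simp
      then have "symbol n x \<in> ?I N" unfolding N[OF k] .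
      then have "symbol n x n \<subseteq> G N n" by blast
      then show "x \<in> G N n" unfolding symbol_def using coset_self[OF F_carrier[OF xF]] by auto
    qed
    then show "\<exists>N. \<forall>k\<ge>N. \<forall>n. G k n \<subseteq> G N n" by blast
  qed
qed

lemma symbol_zero_add:
  assumes "x \<in> F 0" "y \<in> F 0" shows "symbol 0 (x \<oplus>\<^bsub>B\<^esub> y) = symbol 0 x \<oplus>\<^bsub>Gr\<^esub> symbol 0 y"
proof
  fix n
  have e: "(symbol 0 x \<oplus>\<^bsub>Gr\<^esub> symbol 0 y) n = symbol 0 x n <+>\<^bsub>B\<^esub> symbol 0 y n" unfolding gr_def by simp
  show "symbol 0 (x \<oplus>\<^bsub>B\<^esub> y) n = (symbol 0 x \<oplus>\<^bsub>Gr\<^esub> symbol 0 y) n"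
  proof (cases n)
    case 0
    then show ?thesis unfolding e set_add_def' using assms F_carrier by (simp add: coset_zero symbol_def)
  next
    case (Suc m)
    have "Fp n <+>\<^bsub>B\<^esub> Fp n = Fp n" unfolding set_add_def'
    proof
      show "(\<Union>h\<in>Fp n. \<Union>k\<in>Fp n. {h \<oplus>\<^bsub>B\<^esub> k}) \<subseteq> Fp n" using Fp_add by blast
      show "Fp n \<subseteq> (\<Union>h\<in>Fp n. \<Union>k\<in>Fp n. {h \<oplus>\<^bsub>B\<^esub> k})"
      proof
        fix z assume z: "z \<in> Fp n"
        then have "z = z \<oplus>\<^bsub>B\<^esub> \<zero>\<^bsub>B\<^esub>" using Fp_carrier by simp
        then show "z \<in> (\<Union>h\<in>Fp n. \<Union>k\<in>Fp n. {h \<oplus>\<^bsub>B\<^esub> k})" using z Fp_zero by blast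
      qed
    qed
    then show ?thesis unfolding e using Suc by (simp add: symbol_def)
  qed
qed

text \<open>The product of the graded algebra is a union over all families of representatives. So
  every family has to give the same coset, and at least one family has to exist.\<close>

lemma symbol_zero_mult:
  assumes a: "a \<in> F 0" and b: "b \<in> F 0" shows "symbol 0 (a \<otimes>\<^bsub>B\<^esub> b) = symbol 0 a \<otimes>\<^bsub>Gr\<^esub> symbol 0 b"
proof
  fix n
  let ?S = "{Fp n +>\<^bsub>B\<^esub> (\<Oplus>\<^bsub>B\<^esub>i\<in>{..n}. x i \<otimes>\<^bsub>B\<^esub> y (n - i)) | x y. \<forall>i. x i \<in> symbol 0 a i \<and> y i \<in> symbol 0 b i}"
  have s0: "symbol 0 u 0 = {u}" if "u \<in> F 0" for u
    unfolding symbol_def using F_carrier[OF that] by (simp add: coset_zero)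
  have sS: "symbol 0 u (Suc m) = F m" for u m unfolding symbol_def by (simp add: Fp_simps)
  have "Fp n +>\<^bsub>B\<^esub> (\<Oplus>\<^bsub>B\<^esub>i\<in>{..n}. x i \<otimes>\<^bsub>B\<^esub> y (n - i)) = symbol 0 (a \<otimes>\<^bsub>B\<^esub> b) n"
    if xy: "\<forall>i. x i \<in> symbol 0 a i \<and> y i \<in> symbol 0 b i" for x y
  proof (cases n)
    case 0
    have "x 0 = a" "y 0 = b" using spec[OF xy, of 0] s0[OF a] s0[OF b] by auto
    then show ?thesis using 0 F_carrier[OF a] F_carrier[OF b] unfolding symbol_def by simp
  next
    case (Suc m)
    \<comment> \<open>A component of positive degree i represents zero and thus lies in F (i-1).
      Every summand of total degree m+1 falls into F m, also for i = 0, where the second factor has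
      positive degree.\<close>
    have "x i \<otimes>\<^bsub>B\<^esub> y (n - i) \<in> F m" if i: "i \<le> n" for i
    proof (cases i)
      case 0
      have "x 0 \<in> F 0" "y (Suc m) \<in> F m" using spec[OF xy, of 0] spec[OF xy, of "Suc m"] s0[OF a] a sS by auto
      from F_mult[OF this] show ?thesis using 0 Suc by simp
    next
      case (Suc k)
      have "x (Suc k) \<in> F k" using spec[OF xy, of "Suc k"] sS by auto
      moreover have "y (n - i) \<in> F (n - i)"
        using spec[OF xy, of "n - i"] s0[OF b] b sS F_Suc by (cases "n - i") auto
      ultimately have "x i \<otimes>\<^bsub>B\<^esub> y (n - i) \<in> F (k + (n - i))" using F_mult Suc by simp
      moreover have "k + (n - i) = m" using i Suc \<open>n = Suc m\<close> by simp
      ultimately show ?thesis by simp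
    qed
    then have "(\<Oplus>\<^bsub>B\<^esub>i\<in>{..n}. x i \<otimes>\<^bsub>B\<^esub> y (n - i)) \<in> F m"
      using F_carrier F_zero F_add by (intro finsum_atMost_closed) blast+
    then show ?thesis using coset_trivial[of _ n] Suc unfolding symbol_def by (simp add: Fp_simps)
  qed
  then have "V = symbol 0 (a \<otimes>\<^bsub>B\<^esub> b) n" if "V \<in> ?S" for V using that by blast
  moreover have "\<exists>V. V \<in> ?S"
  proof -
    \<comment> \<open>The family concentrated in degree zero shows that the union is not
      empty.\<close>
    let ?x = "\<lambda>i. if i = (0::nat) then a else \<zero>\<^bsub>B\<^esub>" and ?y = "\<lambda>i. if i = (0::nat) then b else \<zero>\<^bsub>B\<^esub>"
    have "\<forall>i. ?x i \<in> symbol 0 a i \<and> ?y i \<in> symbol 0 b i"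
    proof
      fix i show "?x i \<in> symbol 0 a i \<and> ?y i \<in> symbol 0 b i"
        using s0[OF a] s0[OF b] sS F_zero by (cases i) auto
    qed
    then show ?thesis by (intro exI CollectI conjI) (rule refl)
  qed
  ultimately have "?S = {symbol 0 (a \<otimes>\<^bsub>B\<^esub> b) n}" by blast
  then show "symbol 0 (a \<otimes>\<^bsub>B\<^esub> b) n = (symbol 0 a \<otimes>\<^bsub>Gr\<^esub> symbol 0 b) n" unfolding Gr_mult by simp
qed

lemma acc_in_gr_zero:
  assumes acc: "acc_in B (F 0)" shows "acc_in Gr (gr_zero B F)"
proof -
  have "acc_in Gr (symbol 0 ` F 0)"
  proof (rule acc_in_hom_image[OF acc])
    show "symbol 0 \<zero>\<^bsub>B\<^esub> = \<zero>\<^bsub>Gr\<^esub>"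
      unfolding symbol_def gr_def using coset_trivial[OF Fp_zero, of 0] by (auto simp: fun_eq_iff)
    show "\<zero>\<^bsub>B\<^esub> \<in> F 0" by (rule F_zero)
    show "x \<oplus>\<^bsub>B\<^esub> y \<in> F 0 \<and> x \<otimes>\<^bsub>B\<^esub> y \<in> F 0" if "x \<in> F 0" "y \<in> F 0" for x y
      using that F_add F_mult[of x 0 y 0] by simp
    show "symbol 0 (x \<oplus>\<^bsub>B\<^esub> y) = symbol 0 x \<oplus>\<^bsub>Gr\<^esub> symbol 0 y \<and> symbol 0 (x \<otimes>\<^bsub>B\<^esub> y) = symbol 0 x \<otimes>\<^bsub>Gr\<^esub> symbol 0 y"
      if "x \<in> F 0" "y \<in> F 0" for x y
      using that symbol_zero_add symbol_zero_mult by simp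
  qed
  moreover have "symbol 0 ` F 0 = gr_zero B F"
  proof
    show "symbol 0 ` F 0 \<subseteq> gr_zero B F"
      unfolding gr_zero_def using symbol_closed by (auto simp: symbol_def)
    show "gr_zero B F \<subseteq> symbol 0 ` F 0"
    proof
      fix s assume "s \<in> gr_zero B F"
      then have s: "s \<in> carrier Gr" "\<And>n. n > 0 \<Longrightarrow> s n = Fp n" unfolding gr_zero_def by auto
      obtain x where x: "\<And>n. x n \<in> F n" "\<And>n. s n = Fp n +>\<^bsub>B\<^esub> x n" using GrE[OF s(1)] by metis
      have "s = symbol 0 (x 0)" unfolding symbol_def using s(2) x(2) by (auto simp: fun_eq_iff)
      then show "s \<in> symbol 0 ` F 0" using x(1) by blast
    qed
  qed
  ultimately show ?thesis by simp
qed

end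

section \<open>Sums of a filtered algebra and a second ring inside a common overring\<close>

text \<open>In the application \<^term>\<open>E\<close> is the completion of \<^term>\<open>A\<close>, and \<^term>\<open>D\<close> is its base change.\<close>

locale filtered_sum = filtered_algebra R B F + D: ring D + E: ring E
  for R :: "('r, 'x) ring_scheme" (structure) and B :: "('r, 'b) module" and F
    and D :: "('d, 'y) ring_scheme" and E :: "('e, 'z) ring_scheme" +
  fixes j :: "'b \<Rightarrow> 'd" and i :: "'e \<Rightarrow> 'd"
  assumes j: "j \<in> ring_hom B D" and i: "i \<in> ring_hom E D"
    and exh: "exhaustive B F"
    and F0: "\<And>x. x \<in> F 0 \<Longrightarrow> j x \<in> i ` carrier E"
    and ji: "\<And>n x a. x \<in> F n \<Longrightarrow> a \<in> carrier E \<Longrightarrow> \<exists>y\<in>F n. \<exists>b\<in>carrier E. j x \<otimes>\<^bsub>D\<^esub> i a = j y \<oplus>\<^bsub>D\<^esub> i b"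
    and ij: "\<And>n x a. x \<in> F n \<Longrightarrow> a \<in> carrier E \<Longrightarrow> \<exists>y\<in>F n. \<exists>b\<in>carrier E. i a \<otimes>\<^bsub>D\<^esub> j x = j y \<oplus>\<^bsub>D\<^esub> i b"
begin

sublocale j: ring_hom_ring B D j by (rule ring_hom_ringI2[OF A.ring_axioms D.ring_axioms j])
sublocale i: ring_hom_ring E D i by (rule ring_hom_ringI2[OF E.ring_axioms D.ring_axioms i])

definition Cn :: "nat \<Rightarrow> 'd set" where
  "Cn n = {j x \<oplus>\<^bsub>D\<^esub> i a | x a. x \<in> F n \<and> a \<in> carrier E}"

definition C :: "'d set" where
  "C = {j x \<oplus>\<^bsub>D\<^esub> i a | x a. x \<in> carrier B \<and> a \<in> carrier E}"

lemma C_iff: "c \<in> C \<longleftrightarrow> (\<exists>n. c \<in> Cn n)"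
proof -
  have "x \<in> carrier B \<longleftrightarrow> (\<exists>n. x \<in> F n)" for x using exh unfolding exhaustive_def by blast
  then show ?thesis unfolding C_def Cn_def by auto
qed

lemma CnI: "x \<in> F n \<Longrightarrow> a \<in> carrier E \<Longrightarrow> j x \<oplus>\<^bsub>D\<^esub> i a \<in> Cn n"
  unfolding Cn_def by blast

lemma CnE: assumes "c \<in> Cn n" obtains x a where "x \<in> F n" "a \<in> carrier E" "c = j x \<oplus>\<^bsub>D\<^esub> i a"
  using assms unfolding Cn_def by blast

lemma Cn_carrier: "c \<in> Cn n \<Longrightarrow> c \<in> carrier D"
  by (erule CnE) (use F_carrier in auto)

lemma j_Cn: "x \<in> F n \<Longrightarrow> j x \<in> Cn n"
  using CnI[of x n "\<zero>\<^bsub>E\<^esub>"] F_carrier[of x n] by simp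

lemma i_Cn: "a \<in> carrier E \<Longrightarrow> i a \<in> Cn n"
  using CnI[OF F_zero[of n], of a] by simp

lemma Cn_mono: "m \<le> n \<Longrightarrow> c \<in> Cn m \<Longrightarrow> c \<in> Cn n"
  by (erule CnE) (auto intro: CnI F_mono)

lemma Cn_add: "c \<in> Cn n \<Longrightarrow> d \<in> Cn n \<Longrightarrow> c \<oplus>\<^bsub>D\<^esub> d \<in> Cn n"
proof -
  assume "c \<in> Cn n" "d \<in> Cn n"
  then obtain x a y b where 1: "x \<in> F n" "a \<in> carrier E" "c = j x \<oplus>\<^bsub>D\<^esub> i a" "y \<in> F n" "b \<in> carrier E" "d = j y \<oplus>\<^bsub>D\<^esub> i b"
    by (metis CnE)
  have "c \<oplus>\<^bsub>D\<^esub> d = j (x \<oplus>\<^bsub>B\<^esub> y) \<oplus>\<^bsub>D\<^esub> i (a \<oplus>\<^bsub>E\<^esub> b)"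
    unfolding 1(3,6) using 1 F_carrier by (simp add: D.a_ac)
  then show ?thesis using CnI[OF F_add[OF 1(1) 1(4)], of "a \<oplus>\<^bsub>E\<^esub> b"] 1(2,5) by simp
qed

text \<open>Only the mixed product is delicate; \<open>ji\<close> rewrites it without raising the
  filtration degree.\<close>

lemma j_mult_Cn:
  assumes x: "x \<in> F m" and c: "c \<in> Cn n" shows "j x \<otimes>\<^bsub>D\<^esub> c \<in> Cn (m + n)"
proof -
  obtain y a where c: "y \<in> F n" "a \<in> carrier E" "c = j y \<oplus>\<^bsub>D\<^esub> i a" using c by (rule CnE)
  obtain z b where z: "z \<in> F m" "b \<in> carrier E" "j x \<otimes>\<^bsub>D\<^esub> i a = j z \<oplus>\<^bsub>D\<^esub> i b" using ji[OF x c(2)] by blast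
  have "j x \<otimes>\<^bsub>D\<^esub> c = j (x \<otimes>\<^bsub>B\<^esub> y) \<oplus>\<^bsub>D\<^esub> (j z \<oplus>\<^bsub>D\<^esub> i b)"
    unfolding c(3) z(3)[symmetric] using x c F_carrier by (simp add: D.r_distr)
  moreover have "j z \<oplus>\<^bsub>D\<^esub> i b \<in> Cn (m + n)" using Cn_mono[of m "m + n"] CnI[OF z(1,2)] by simp
  ultimately show ?thesis using Cn_add[OF j_Cn[OF F_mult[OF x c(1)]]] by simp
qed

lemma i_mult_Cn:
  assumes a: "a \<in> carrier E" and c: "c \<in> Cn n" shows "i a \<otimes>\<^bsub>D\<^esub> c \<in> Cn n"
proof -
  obtain y b where c: "y \<in> F n" "b \<in> carrier E" "c = j y \<oplus>\<^bsub>D\<^esub> i b" using c by (rule CnE)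
  obtain z d where z: "z \<in> F n" "d \<in> carrier E" "i a \<otimes>\<^bsub>D\<^esub> j y = j z \<oplus>\<^bsub>D\<^esub> i d" using ij[OF c(1) a] by blast
  have "i a \<otimes>\<^bsub>D\<^esub> c = (j z \<oplus>\<^bsub>D\<^esub> i d) \<oplus>\<^bsub>D\<^esub> i (a \<otimes>\<^bsub>E\<^esub> b)"
    unfolding c(3) z(3)[symmetric] using a c F_carrier by (simp add: D.r_distr)
  then show ?thesis using Cn_add[OF CnI[OF z(1,2)] i_Cn[of "a \<otimes>\<^bsub>E\<^esub> b" n]] a c(2) by simp
qed

lemma C_subring: "subring C D"
proof (rule D.subringI)
  show "C \<subseteq> carrier D" using C_iff Cn_carrier by blast
  show "\<one>\<^bsub>D\<^esub> \<in> C" using i_Cn[of "\<one>\<^bsub>E\<^esub>" 0] C_iff by auto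
next
  fix c assume "c \<in> C"
  then obtain x a where c: "x \<in> carrier B" "a \<in> carrier E" "c = j x \<oplus>\<^bsub>D\<^esub> i a" unfolding C_def by blast
  then have "\<ominus>\<^bsub>D\<^esub> c = j (\<ominus>\<^bsub>B\<^esub> x) \<oplus>\<^bsub>D\<^esub> i (\<ominus>\<^bsub>E\<^esub> a)" by (simp add: D.minus_add D.a_comm)
  then show "\<ominus>\<^bsub>D\<^esub> c \<in> C" unfolding C_def using c A.a_inv_closed E.a_inv_closed by blast
next
  fix c d assume "c \<in> C" "d \<in> C"
  then obtain m n where mn: "c \<in> Cn m" "d \<in> Cn n" using C_iff by blast
  then have "c \<oplus>\<^bsub>D\<^esub> d \<in> Cn (max m n)" using Cn_add Cn_mono[of m "max m n"] Cn_mono[of n "max m n"] by simp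
  then show "c \<oplus>\<^bsub>D\<^esub> d \<in> C" using C_iff by blast
  obtain x a where c: "x \<in> F m" "a \<in> carrier E" "c = j x \<oplus>\<^bsub>D\<^esub> i a" using mn(1) by (rule CnE)
  have "c \<otimes>\<^bsub>D\<^esub> d = j x \<otimes>\<^bsub>D\<^esub> d \<oplus>\<^bsub>D\<^esub> i a \<otimes>\<^bsub>D\<^esub> d"
    unfolding c(3) using c F_carrier Cn_carrier[OF mn(2)] by (simp add: D.l_distr)
  also have "\<dots> \<in> Cn (m + n)"
    using j_mult_Cn[OF c(1) mn(2)] Cn_mono[OF le_add2 i_mult_Cn[OF c(2) mn(2)]] by (rule Cn_add)
  finally show "c \<otimes>\<^bsub>D\<^esub> d \<in> C" using C_iff by blast
qed

lemma j_C: "x \<in> F n \<Longrightarrow> j x \<in> C" and i_C: "a \<in> carrier E \<Longrightarrow> i a \<in> C"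
  using j_Cn i_Cn C_iff by blast+

text \<open>Leading terms are taken in positive degrees only: in degree zero, the left ideal \<^term>\<open>I\<close> is
  controlled by its preimage in \<^term>\<open>E\<close>.\<close>

definition symbols :: "'d set \<Rightarrow> nat \<Rightarrow> 'b set" where
  "symbols I n = (case n of 0 \<Rightarrow> {\<zero>\<^bsub>B\<^esub>} | Suc m \<Rightarrow> {x \<in> F n. \<exists>g\<in>Cn m. j x \<oplus>\<^bsub>D\<^esub> g \<in> I})"

text \<open>Taking 0 in degree zero is compatible with multiplication, because its multiples vanish
  and 0 belongs to every component.\<close>

lemma graded_ideal_symbols:
  assumes I: "left_ideal_in D C I" shows "graded_ideal (symbols I)"
  unfolding graded_ideal_def
proof (intro conjI allI ballI)
  have s0: "symbols I 0 = {\<zero>\<^bsub>B\<^esub>}" and sS: "symbols I (Suc m) = {x \<in> F (Suc m). \<exists>g\<in>Cn m. j x \<oplus>\<^bsub>D\<^esub> g \<in> I}" for m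
    unfolding symbols_def by simp_all
  fix n
  show sub: "symbols I n \<subseteq> F n" by (cases n) (auto simp: s0 sS F_zero)
  show Fp: "Fp n \<subseteq> symbols I n"
  proof (cases n)
    case (Suc m)
    show ?thesis
    proof
      fix x assume "x \<in> Fp n"
      then have x: "x \<in> F m" using Suc by (simp add: Fp_simps)
      have "j x \<oplus>\<^bsub>D\<^esub> j (\<ominus>\<^bsub>B\<^esub> x) = \<zero>\<^bsub>D\<^esub>" using F_carrier[OF x] by (simp add: D.r_neg)
      then have "j x \<oplus>\<^bsub>D\<^esub> j (\<ominus>\<^bsub>B\<^esub> x) \<in> I" using left_ideal_inD(2)[OF I] by simp
      then have "\<exists>g\<in>Cn m. j x \<oplus>\<^bsub>D\<^esub> g \<in> I" by (rule bexI[OF _ j_Cn[OF F_minus[OF x]]])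
      then show "x \<in> symbols I n" unfolding Suc sS using F_Suc[OF x] by simp
    qed
  qed (simp add: s0 Fp_simps)
  fix x y assume x: "x \<in> symbols I n" "y \<in> symbols I n"
  show "x \<oplus>\<^bsub>B\<^esub> y \<in> symbols I n"
  proof (cases n)
    case 0 then show ?thesis using x by (simp add: s0)
  next
    case (Suc m)
    obtain g h where g: "x \<in> F n" "g \<in> Cn m" "j x \<oplus>\<^bsub>D\<^esub> g \<in> I" "y \<in> F n" "h \<in> Cn m" "j y \<oplus>\<^bsub>D\<^esub> h \<in> I"
      using x unfolding Suc sS by blast
    have "(j x \<oplus>\<^bsub>D\<^esub> g) \<oplus>\<^bsub>D\<^esub> (j y \<oplus>\<^bsub>D\<^esub> h) = j (x \<oplus>\<^bsub>B\<^esub> y) \<oplus>\<^bsub>D\<^esub> (g \<oplus>\<^bsub>D\<^esub> h)"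
      using g F_carrier Cn_carrier by (simp add: D.a_ac)
    then have "j (x \<oplus>\<^bsub>B\<^esub> y) \<oplus>\<^bsub>D\<^esub> (g \<oplus>\<^bsub>D\<^esub> h) \<in> I" using left_ideal_inD(3)[OF I g(3) g(6)] by simp
    then show ?thesis unfolding Suc sS using F_add g(1,4) Cn_add[OF g(2,5)] Suc by blast
  qed
next
  have s0: "symbols I 0 = {\<zero>\<^bsub>B\<^esub>}" and sS: "symbols I (Suc m) = {x \<in> F (Suc m). \<exists>g\<in>Cn m. j x \<oplus>\<^bsub>D\<^esub> g \<in> I}" for m
    unfolding symbols_def by simp_all
  fix m n x y assume x: "x \<in> F m" and y: "y \<in> symbols I n"
  show "x \<otimes>\<^bsub>B\<^esub> y \<in> symbols I (m + n)"
  proof (cases n)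
    case 0
    have y0: "y = \<zero>\<^bsub>B\<^esub>" using y unfolding 0 s0 by simp
    have "x \<otimes>\<^bsub>B\<^esub> y = \<zero>\<^bsub>B\<^esub>" unfolding y0 using F_carrier[OF x] by simp
    moreover have "\<zero>\<^bsub>B\<^esub> \<in> symbols I (m + n)"
    proof (cases "m + n")
      case (Suc k)
      have "j \<zero>\<^bsub>B\<^esub> \<oplus>\<^bsub>D\<^esub> i \<zero>\<^bsub>E\<^esub> = \<zero>\<^bsub>D\<^esub>" by simp
      then have "\<exists>g\<in>Cn k. j \<zero>\<^bsub>B\<^esub> \<oplus>\<^bsub>D\<^esub> g \<in> I" using i_Cn[OF E.zero_closed, of k] left_ideal_inD(2)[OF I] by metis
      then show ?thesis unfolding Suc sS using F_zero by blast
    qed (simp add: s0)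
    ultimately show ?thesis by simp
  next
    case (Suc k)
    \<comment> \<open>The lower term \<open>g\<close> has degree k = n - 1, so its product with
      \<open>j x\<close> stays one degree below m + n and can again be treated as a lower
      term.\<close>
    obtain g where g: "y \<in> F n" "g \<in> Cn k" "j y \<oplus>\<^bsub>D\<^esub> g \<in> I" using y unfolding Suc sS by blast
    have "j x \<otimes>\<^bsub>D\<^esub> (j y \<oplus>\<^bsub>D\<^esub> g) = j (x \<otimes>\<^bsub>B\<^esub> y) \<oplus>\<^bsub>D\<^esub> j x \<otimes>\<^bsub>D\<^esub> g"
      using g x F_carrier Cn_carrier by (simp add: D.r_distr)
    then have "j (x \<otimes>\<^bsub>B\<^esub> y) \<oplus>\<^bsub>D\<^esub> j x \<otimes>\<^bsub>D\<^esub> g \<in> I" using left_ideal_inD(4)[OF I j_C[OF x] g(3)] by simp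
    then have "\<exists>g\<in>Cn (m + k). j (x \<otimes>\<^bsub>B\<^esub> y) \<oplus>\<^bsub>D\<^esub> g \<in> I" using j_mult_Cn[OF x g(2)] by blast
    moreover have "x \<otimes>\<^bsub>B\<^esub> y \<in> F (Suc (m + k))" using F_mult[OF x g(1)] Suc by simp
    moreover have "m + n = Suc (m + k)" using Suc by simp
    ultimately show ?thesis unfolding \<open>m + n = Suc (m + k)\<close> sS by blast
  qed
qed

text \<open>The leading term of an element of degree n+1 in the larger ideal is matched by an
  element of the smaller ideal, and the difference has lower degree. Degree zero is settled by the
  chain of preimages in \<open>E\<close>. \<open>?K\<close> dominates the bounds of both
  chains.\<close>

theorem acc_in_C:
  assumes ring: "ring Gr" and accG: "acc_in Gr (carrier Gr)" and accE: "acc_in E (carrier E)"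
  shows "acc_in D C"
  unfolding acc_in_def
proof (intro allI impI)
  fix I :: "nat \<Rightarrow> 'd set" assume I: "\<forall>k. left_ideal_in D C (I k)" and inc: "\<forall>k. I k \<subseteq> I (Suc k)"
  have mono: "I m \<subseteq> I n" if "m \<le> n" for m n using lift_Suc_mono_le[of I] inc that by blast
  have "symbols (I k) n \<subseteq> symbols (I (Suc k)) n" for k n using inc unfolding symbols_def by (cases n) auto
  with graded_ideals_stabilise[OF ring accG, of "\<lambda>k. symbols (I k)"] graded_ideal_symbols[OF I[rule_format]]
  obtain M where M: "\<And>k n. k \<ge> M \<Longrightarrow> symbols (I k) n \<subseteq> symbols (I M) n" by metis
  let ?J = "\<lambda>k. {a \<in> carrier E. i a \<in> I k}"
  have j1: "left_ideal_in E (carrier E) (?J k)" for k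
    using left_ideal_inD[OF I[rule_format, of k]] i_C by (intro left_ideal_inI) auto
  have j2: "?J k \<subseteq> ?J (Suc k)" for k using inc by blast
  obtain N where N: "\<And>k. k \<ge> N \<Longrightarrow> ?J k = ?J N"
  proof (rule acc_inD[of E "carrier E" ?J, OF accE j1 j2])
    fix N assume a: "\<And>k. k \<ge> N \<Longrightarrow> ?J k = ?J N"
    show thesis by (rule that[OF a])
  qed
  let ?K = "max M N"
  have IK: "left_ideal_in D C (I ?K)" using I by blast
  have "I k \<subseteq> I ?K" if k: "k \<ge> ?K" for k
  proof -
    have Ik: "left_ideal_in D C (I k)" using I by blast
    have sym: "symbols (I k) n \<subseteq> symbols (I ?K) n" for n
    proof -
      have "symbols (I M) n \<subseteq> symbols (I ?K) n"
        using mono[of M ?K] unfolding symbols_def by (cases n) auto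
      then show ?thesis using M[of k n] k by simp
    qed
    have "z \<in> I ?K" if "z \<in> Cn n" "z \<in> I k" for z n
      using that
    proof (induction n arbitrary: z)
      case 0
      obtain x a where 1: "x \<in> F 0" "a \<in> carrier E" "z = j x \<oplus>\<^bsub>D\<^esub> i a" using 0(1) by (rule CnE)
      \<comment> \<open>By \<open>F0\<close> the filtered part of degree zero already lies in the
        image of \<open>E\<close>.\<close>
      obtain b where b: "b \<in> carrier E" "j x = i b" using F0[OF 1(1)] by blast
      have z: "z = i (b \<oplus>\<^bsub>E\<^esub> a)" unfolding 1(3) b(2) using b(1) 1(2) by simp
      then have "b \<oplus>\<^bsub>E\<^esub> a \<in> ?J k" using 0(2) b(1) 1(2) by simp
      moreover have "?J k = ?J N" using N[of k] k by simp
      ultimately have "z \<in> I N" unfolding z by blast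
      then show ?case using mono[of N ?K] by auto
    next
      case (Suc n)
      obtain x a where 1: "x \<in> F (Suc n)" "a \<in> carrier E" "z = j x \<oplus>\<^bsub>D\<^esub> i a" using Suc.prems(1) by (rule CnE)
      have "x \<in> symbols (I k) (Suc n)" unfolding symbols_def using 1 i_Cn Suc.prems(2) by auto
      then have "x \<in> symbols (I ?K) (Suc n)" using sym by blast
      then obtain g where g: "g \<in> Cn n" "j x \<oplus>\<^bsub>D\<^esub> g \<in> I ?K" unfolding symbols_def by auto
      have cc: "j x \<in> carrier D" "i a \<in> carrier D" "g \<in> carrier D" using 1 g F_carrier Cn_carrier by auto
      \<comment> \<open>Elements of the image of \<open>E\<close> count as elements of every degree,
        so the difference has degree \<open>n\<close>.\<close>
      have e: "z \<ominus>\<^bsub>D\<^esub> (j x \<oplus>\<^bsub>D\<^esub> g) = i a \<ominus>\<^bsub>D\<^esub> g" unfolding 1(3) using cc by algebra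
      have "z \<ominus>\<^bsub>D\<^esub> (j x \<oplus>\<^bsub>D\<^esub> g) \<in> I k"
        using D.left_ideal_in_diff[OF C_subring Ik Suc.prems(2)] mono[OF k] g(2) by blast
      moreover have "i a \<ominus>\<^bsub>D\<^esub> g \<in> Cn n"
      proof -
        obtain y b where y: "y \<in> F n" "b \<in> carrier E" "g = j y \<oplus>\<^bsub>D\<^esub> i b" using g(1) by (rule CnE)
        have "\<ominus>\<^bsub>D\<^esub> g = j (\<ominus>\<^bsub>B\<^esub> y) \<oplus>\<^bsub>D\<^esub> i (\<ominus>\<^bsub>E\<^esub> b)" unfolding y(3) using y F_carrier by (simp add: D.minus_add D.a_comm)
        then have "\<ominus>\<^bsub>D\<^esub> g \<in> Cn n" using CnI[OF F_minus[OF y(1)], of "\<ominus>\<^bsub>E\<^esub> b"] y(2) by simp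
        then show ?thesis unfolding D.minus_eq by (rule Cn_add[OF i_Cn[OF 1(2)]])
      qed
      ultimately have "i a \<ominus>\<^bsub>D\<^esub> g \<in> I ?K" using Suc.IH unfolding e by blast
      from left_ideal_inD(3)[OF IK g(2) this] have "(j x \<oplus>\<^bsub>D\<^esub> g) \<oplus>\<^bsub>D\<^esub> (i a \<ominus>\<^bsub>D\<^esub> g) \<in> I ?K" .
      moreover have "(j x \<oplus>\<^bsub>D\<^esub> g) \<oplus>\<^bsub>D\<^esub> (i a \<ominus>\<^bsub>D\<^esub> g) = z" unfolding 1(3) using cc by algebra
      ultimately show ?case by simp
    qed
    then show ?thesis using left_ideal_inD(1)[OF Ik] C_iff by blast
  qed
  then have "I k = I ?K" if "k \<ge> ?K" for k using mono[OF that] that by (intro subset_antisym)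
  then show "\<exists>N. \<forall>n\<ge>N. I n = I N" by (intro exI[of _ ?K] allI impI)
qed

end

section \<open>Localisation\<close>

text \<open>\<open>D\<close> and \<open>E\<close> arise from \<open>C\<close> and \<open>H\<close>
  by inverting \<open>w\<close>, and \<open>f\<close> is the restriction of \<open>h\<close> to
  \<open>C\<close> with values in \<open>H\<close>. The colon condition for \<open>C\<close> and
  \<open>H\<close> is carried over to \<open>D\<close> and \<open>E\<close>.\<close>

locale flat_localisation = h: ring_hom_ring D E h + i: ring_hom_ring H E i
  for D :: "('d, 'x) ring_scheme" and E :: "('e, 'y) ring_scheme" and h
    and H :: "('h, 'z) ring_scheme" and i +
  fixes C :: "'d set" and f :: "'d \<Rightarrow> 'h" and w w' :: 'd
  assumes C: "subring C D" and w: "w \<in> C" and w': "w' \<in> carrier D" "w \<otimes>\<^bsub>D\<^esub> w' = \<one>\<^bsub>D\<^esub>" "w' \<otimes>\<^bsub>D\<^esub> w = \<one>\<^bsub>D\<^esub>"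
    and w_central: "\<And>d. d \<in> carrier D \<Longrightarrow> d \<otimes>\<^bsub>D\<^esub> w = w \<otimes>\<^bsub>D\<^esub> d"
    and hw_central: "\<And>e. e \<in> carrier E \<Longrightarrow> e \<otimes>\<^bsub>E\<^esub> h w = h w \<otimes>\<^bsub>E\<^esub> e"
    and denom_D: "\<And>d. d \<in> carrier D \<Longrightarrow> \<exists>n::nat. w [^]\<^bsub>D\<^esub> n \<otimes>\<^bsub>D\<^esub> d \<in> C"
    and denom_E: "\<And>e. e \<in> carrier E \<Longrightarrow> \<exists>n::nat. \<exists>y\<in>carrier H. h w [^]\<^bsub>E\<^esub> n \<otimes>\<^bsub>E\<^esub> e = i y"
    and f: "\<And>c. c \<in> C \<Longrightarrow> f c \<in> carrier H" "\<And>c. c \<in> C \<Longrightarrow> i (f c) = h c"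
    and inj: "inj_on i (carrier H)"
    and colon_C: "\<And>V s m. \<lbrakk>finite V; V \<subseteq> C; s \<in> C; m \<in> carrier H; m \<otimes>\<^bsub>H\<^esub> f s \<in> gen_left_ideal H (f ` V)\<rbrakk>
      \<Longrightarrow> m \<in> gen_left_ideal H (f ` {c \<in> C. c \<otimes>\<^bsub>D\<^esub> s \<in> gen_left_ideal (D\<lparr>carrier := C\<rparr>) V})"
begin

lemma C_carrier: "c \<in> C \<Longrightarrow> c \<in> carrier D"
  using subringE(1)[OF C] by blast

lemma wD: "w \<in> carrier D"
  by (rule C_carrier[OF w])

abbreviation "u n \<equiv> w [^]\<^bsub>D\<^esub> (n::nat)"
abbreviation "u' n \<equiv> w' [^]\<^bsub>D\<^esub> (n::nat)"
abbreviation "v n \<equiv> h w [^]\<^bsub>E\<^esub> (n::nat)"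

lemma u_C: "u n \<in> C"
  by (induction n) (use w C in \<open>auto simp: subringE\<close>)

lemma u_closed: "u n \<in> carrier D" "u' n \<in> carrier D" "v n \<in> carrier E"
  using wD w' by simp_all

lemma u_inv: "u' n \<otimes>\<^bsub>D\<^esub> u n = \<one>\<^bsub>D\<^esub>"
proof (induction n)
  case (Suc n)
  have "u' (Suc n) \<otimes>\<^bsub>D\<^esub> u (Suc n) = u' n \<otimes>\<^bsub>D\<^esub> w' \<otimes>\<^bsub>D\<^esub> (w \<otimes>\<^bsub>D\<^esub> u n)"
    using h.R.nat_pow_Suc2[OF wD] by simp
  also have "\<dots> = u' n \<otimes>\<^bsub>D\<^esub> (w' \<otimes>\<^bsub>D\<^esub> w) \<otimes>\<^bsub>D\<^esub> u n" using wD w'(1) by (simp add: h.R.m_assoc)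
  also have "\<dots> = \<one>\<^bsub>D\<^esub>" using w'(3) Suc u_closed by simp
  finally show ?case .
qed simp

lemma hu: "h (u n) = v n"
  by (rule h.hom_nat_pow[OF wD])

lemma v_central: "e \<in> carrier E \<Longrightarrow> e \<otimes>\<^bsub>E\<^esub> v n = v n \<otimes>\<^bsub>E\<^esub> e"
proof (induction n)
  case (Suc n)
  have "e \<otimes>\<^bsub>E\<^esub> v (Suc n) = (e \<otimes>\<^bsub>E\<^esub> v n) \<otimes>\<^bsub>E\<^esub> h w" using Suc.prems wD by (simp add: h.S.m_assoc)
  also have "\<dots> = v n \<otimes>\<^bsub>E\<^esub> (e \<otimes>\<^bsub>E\<^esub> h w)" unfolding Suc.IH[OF Suc.prems] using Suc.prems wD by (simp add: h.S.m_assoc)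
  also have "\<dots> = v (Suc n) \<otimes>\<^bsub>E\<^esub> e" unfolding hw_central[OF Suc.prems] using Suc.prems wD by (simp add: h.S.m_assoc)
  finally show ?case .
qed simp

lemma u_central: "e \<in> carrier D \<Longrightarrow> e \<otimes>\<^bsub>D\<^esub> u n = u n \<otimes>\<^bsub>D\<^esub> e"
proof (induction n)
  case (Suc n)
  have "e \<otimes>\<^bsub>D\<^esub> u (Suc n) = (e \<otimes>\<^bsub>D\<^esub> u n) \<otimes>\<^bsub>D\<^esub> w" using Suc.prems wD by (simp add: h.R.m_assoc)
  also have "\<dots> = u n \<otimes>\<^bsub>D\<^esub> (e \<otimes>\<^bsub>D\<^esub> w)" unfolding Suc.IH[OF Suc.prems] using Suc.prems wD by (simp add: h.R.m_assoc)
  also have "\<dots> = u (Suc n) \<otimes>\<^bsub>D\<^esub> e" unfolding w_central[OF Suc.prems] using Suc.prems wD by (simp add: h.R.m_assoc)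
  finally show ?case .
qed simp

lemma cancel_u: "d \<in> carrier D \<Longrightarrow> u' n \<otimes>\<^bsub>D\<^esub> (u n \<otimes>\<^bsub>D\<^esub> d) = d"
  using u_inv[of n] u_closed[of n] by (simp add: h.R.m_assoc[symmetric])

lemma cancel_v: "e \<in> carrier E \<Longrightarrow> h (u' n) \<otimes>\<^bsub>E\<^esub> (v n \<otimes>\<^bsub>E\<^esub> e) = e"
proof -
  assume e: "e \<in> carrier E"
  have "h (u' n) \<otimes>\<^bsub>E\<^esub> v n = h (u' n \<otimes>\<^bsub>D\<^esub> u n)" unfolding hu[symmetric] using u_closed by (intro h.hom_mult[symmetric])
  then have "h (u' n) \<otimes>\<^bsub>E\<^esub> v n = \<one>\<^bsub>E\<^esub>" unfolding u_inv by simp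
  then show ?thesis using e u_closed[of n] by (simp add: h.S.m_assoc[symmetric] del: h.hom_nat_pow)
qed

lemma f_w: "i (f w) = h w"
  using f(2)[OF w] .

lemma i_pow: "y \<in> carrier H \<Longrightarrow> i (f w [^]\<^bsub>H\<^esub> n \<otimes>\<^bsub>H\<^esub> y) = v n \<otimes>\<^bsub>E\<^esub> i y" for n :: nat
  using f(1)[OF w] f_w i.hom_nat_pow[OF f(1)[OF w], of n] by simp

lemma denom_add: "u n \<otimes>\<^bsub>D\<^esub> d \<in> C \<Longrightarrow> d \<in> carrier D \<Longrightarrow> u (m + n) \<otimes>\<^bsub>D\<^esub> d \<in> C"
proof -
  assume "u n \<otimes>\<^bsub>D\<^esub> d \<in> C" and d: "d \<in> carrier D"
  then have "u m \<otimes>\<^bsub>D\<^esub> (u n \<otimes>\<^bsub>D\<^esub> d) \<in> C" using subringE(6)[OF C u_C] by blast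
  then show ?thesis using wD d by (simp add: h.R.nat_pow_mult[symmetric] h.R.m_assoc)
qed

lemma denom_finite:
  assumes "finite V" "V \<subseteq> carrier D" shows "\<exists>n. \<forall>d\<in>V. u n \<otimes>\<^bsub>D\<^esub> d \<in> C"
  using assms
proof (induction V)
  case (insert d V)
  then obtain n where n: "\<forall>d\<in>V. u n \<otimes>\<^bsub>D\<^esub> d \<in> C" by auto
  obtain m where m: "u m \<otimes>\<^bsub>D\<^esub> d \<in> C" using denom_D[of d] insert.prems by auto
  have "u (m + n) \<otimes>\<^bsub>D\<^esub> x \<in> C" if "x \<in> insert d V" for x
    using that n m denom_add[of m d n] denom_add[of n x m] insert.prems by (auto simp: add.commute)
  then show ?case by blast
qed simp

text \<open>The elements that satisfy the conclusion form a left ideal: a power of the central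
  element h(w) can be distributed over a product, one part clearing the coefficient and the other
  part the ideal element.\<close>

lemma clear_gen:
  assumes V: "V \<subseteq> C" and z: "z \<in> gen_left_ideal E (h ` V)"
  shows "\<exists>k. \<exists>y\<in>gen_left_ideal H (f ` V). v k \<otimes>\<^bsub>E\<^esub> z = i y"
proof -
  have fV: "f ` V \<subseteq> carrier H" using V f(1) by blast
  note G = i.R.left_ideal_in_gen[OF fV]
  have Gc: "y \<in> carrier H" if "y \<in> gen_left_ideal H (f ` V)" for y using left_ideal_inD(1)[OF G that] .
  have v_add: "v (m + n) \<otimes>\<^bsub>E\<^esub> x = v m \<otimes>\<^bsub>E\<^esub> (v n \<otimes>\<^bsub>E\<^esub> x)" if "x \<in> carrier E" for m n x
    using that wD by (simp add: h.S.nat_pow_mult[symmetric] h.S.m_assoc)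
  have lift: "v m \<otimes>\<^bsub>E\<^esub> i y = i (f w [^]\<^bsub>H\<^esub> m \<otimes>\<^bsub>H\<^esub> y) \<and> f w [^]\<^bsub>H\<^esub> m \<otimes>\<^bsub>H\<^esub> y \<in> gen_left_ideal H (f ` V)"
    if "y \<in> gen_left_ideal H (f ` V)" for m :: nat and y
    using i_pow[OF Gc[OF that], of m] left_ideal_inD(4)[OF G _ that, of "f w [^]\<^bsub>H\<^esub> m"] f(1)[OF w] by simp
  let ?J = "{z \<in> carrier E. \<exists>k. \<exists>y\<in>gen_left_ideal H (f ` V). v k \<otimes>\<^bsub>E\<^esub> z = i y}"
  have "left_ideal_in E (carrier E) ?J"
  proof (rule left_ideal_inI)
    have "v 0 \<otimes>\<^bsub>E\<^esub> \<zero>\<^bsub>E\<^esub> = i \<zero>\<^bsub>H\<^esub>" by simp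
    then show "\<zero>\<^bsub>E\<^esub> \<in> ?J" using left_ideal_inD(2)[OF G] by blast
  next
    fix z z' assume "z \<in> ?J" "z' \<in> ?J"
    then obtain k y k' y' where 1: "z \<in> carrier E" "y \<in> gen_left_ideal H (f ` V)" "v k \<otimes>\<^bsub>E\<^esub> z = i y"
      "z' \<in> carrier E" "y' \<in> gen_left_ideal H (f ` V)" "v k' \<otimes>\<^bsub>E\<^esub> z' = i y'" by blast
    have "v (k' + k) \<otimes>\<^bsub>E\<^esub> z = i (f w [^]\<^bsub>H\<^esub> k' \<otimes>\<^bsub>H\<^esub> y)" "v (k + k') \<otimes>\<^bsub>E\<^esub> z' = i (f w [^]\<^bsub>H\<^esub> k \<otimes>\<^bsub>H\<^esub> y')"
      using v_add 1 lift by simp_all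
    then have "v (k + k') \<otimes>\<^bsub>E\<^esub> (z \<oplus>\<^bsub>E\<^esub> z') = i (f w [^]\<^bsub>H\<^esub> k' \<otimes>\<^bsub>H\<^esub> y \<oplus>\<^bsub>H\<^esub> f w [^]\<^bsub>H\<^esub> k \<otimes>\<^bsub>H\<^esub> y')"
      using 1 u_closed(3)[of "k + k'"] Gc lift[OF 1(2), of k'] lift[OF 1(5), of k]
      by (simp add: h.S.r_distr add.commute)
    moreover have "f w [^]\<^bsub>H\<^esub> k' \<otimes>\<^bsub>H\<^esub> y \<oplus>\<^bsub>H\<^esub> f w [^]\<^bsub>H\<^esub> k \<otimes>\<^bsub>H\<^esub> y' \<in> gen_left_ideal H (f ` V)"
      using lift[OF 1(2), of k'] lift[OF 1(5), of k] by (intro left_ideal_inD(3)[OF G]) simp_all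
    ultimately show "z \<oplus>\<^bsub>E\<^esub> z' \<in> ?J" using 1(1,4) h.S.a_closed by blast
  next
    fix e z assume e: "e \<in> carrier E" and "z \<in> ?J"
    then obtain k y where 1: "z \<in> carrier E" "y \<in> gen_left_ideal H (f ` V)" "v k \<otimes>\<^bsub>E\<^esub> z = i y" by blast
    obtain n x where x: "x \<in> carrier H" "v n \<otimes>\<^bsub>E\<^esub> e = i x" using denom_E[OF e] by blast
    have "v (n + k) \<otimes>\<^bsub>E\<^esub> (e \<otimes>\<^bsub>E\<^esub> z) = v n \<otimes>\<^bsub>E\<^esub> ((v k \<otimes>\<^bsub>E\<^esub> e) \<otimes>\<^bsub>E\<^esub> z)"
      using v_add[of "e \<otimes>\<^bsub>E\<^esub> z" n k] e 1(1) u_closed(3)[of k] by (simp add: h.S.m_assoc)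
    also have "\<dots> = v n \<otimes>\<^bsub>E\<^esub> (e \<otimes>\<^bsub>E\<^esub> (v k \<otimes>\<^bsub>E\<^esub> z))"
      unfolding v_central[OF e, symmetric] using e 1(1) u_closed(3)[of k] by (simp add: h.S.m_assoc)
    also have "\<dots> = i x \<otimes>\<^bsub>E\<^esub> i y"
      unfolding 1(3) x(2)[symmetric] using e Gc[OF 1(2)] u_closed(3)[of n] by (simp add: h.S.m_assoc)
    also have "\<dots> = i (x \<otimes>\<^bsub>H\<^esub> y)" using x(1) Gc[OF 1(2)] by simp
    finally have "v (n + k) \<otimes>\<^bsub>E\<^esub> (e \<otimes>\<^bsub>E\<^esub> z) = i (x \<otimes>\<^bsub>H\<^esub> y)" .
    then show "e \<otimes>\<^bsub>E\<^esub> z \<in> ?J" using left_ideal_inD(4)[OF G x(1) 1(2)] h.S.m_closed[OF e 1(1)] by blast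
  qed blast
  moreover have "h ` V \<subseteq> ?J"
  proof (rule image_subsetI)
    fix c assume c: "c \<in> V"
    have "v 0 \<otimes>\<^bsub>E\<^esub> h c = i (f c)" using f(2)[of c] c V C_carrier by auto
    moreover have "f c \<in> gen_left_ideal H (f ` V)" using i.R.gen_left_ideal_incl[of "f ` V"] c by blast
    moreover have "h c \<in> carrier E" using c V C_carrier by auto
    ultimately show "h c \<in> ?J" by blast
  qed
  ultimately have "gen_left_ideal E (h ` V) \<subseteq> ?J" by (rule h.S.gen_left_ideal_minimal)
  then show ?thesis using z by blast
qed

theorem colon_flat: "colon_flat D E h"
proof (rule colon_flat.intro[OF h.ring_hom_ring_axioms colon_flat_axioms.intro])
  fix V s m
  assume V: "finite V" "V \<subseteq> carrier D" and s: "s \<in> carrier D" and m: "m \<in> carrier E"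
    and ms: "m \<otimes>\<^bsub>E\<^esub> h s \<in> gen_left_ideal E (h ` V)"
  let ?Q = "{c \<in> carrier D. c \<otimes>\<^bsub>D\<^esub> s \<in> gen_left_ideal D V}"
  note GV = h.R.left_ideal_in_gen[OF V(2)]
  \<comment> \<open>A common power of \<open>w\<close> moves \<open>s\<close> and \<open>V\<close>
    into \<open>C\<close>. It is a central unit of \<open>D\<close>, so the colon condition for the
    scaled data is equivalent to the original one.\<close>
  obtain n where n: "\<forall>d\<in>insert s V. u n \<otimes>\<^bsub>D\<^esub> d \<in> C" using denom_finite[of "insert s V"] V s by auto
  let ?V = "(\<lambda>d. u n \<otimes>\<^bsub>D\<^esub> d) ` V" and ?s = "u n \<otimes>\<^bsub>D\<^esub> s"
  have V': "finite ?V" "?V \<subseteq> C" "h ` ?V \<subseteq> carrier E" "h ` V \<subseteq> carrier E" and s': "?s \<in> C"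
    using V n u_closed by auto
  note GE = h.S.left_ideal_in_gen[OF V'(3)]
  have "h ` V \<subseteq> gen_left_ideal E (h ` ?V)"
  proof (rule image_subsetI)
    fix d assume d: "d \<in> V"
    then have "h d = h (u' n) \<otimes>\<^bsub>E\<^esub> h (u n \<otimes>\<^bsub>D\<^esub> d)"
      using cancel_u[of d n] V(2) u_closed[of n] by (metis h.hom_mult h.R.m_closed subsetD)
    moreover have "h (u n \<otimes>\<^bsub>D\<^esub> d) \<in> gen_left_ideal E (h ` ?V)" using h.S.gen_left_ideal_incl[of "h ` ?V"] d by blast
    ultimately show "h d \<in> gen_left_ideal E (h ` ?V)"
      using left_ideal_inD(4)[OF GE, of "h (u' n)"] u_closed(2)[of n] h.hom_closed by metis
  qed
  then have "m \<otimes>\<^bsub>E\<^esub> h s \<in> gen_left_ideal E (h ` ?V)" using h.S.gen_left_ideal_minimal[OF GE] ms by blast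
  then have "v n \<otimes>\<^bsub>E\<^esub> (m \<otimes>\<^bsub>E\<^esub> h s) \<in> gen_left_ideal E (h ` ?V)" using left_ideal_inD(4)[OF GE u_closed(3)] by blast
  moreover have e1: "v n \<otimes>\<^bsub>E\<^esub> (m \<otimes>\<^bsub>E\<^esub> h s) = m \<otimes>\<^bsub>E\<^esub> h ?s"
  proof -
    have "v n \<otimes>\<^bsub>E\<^esub> (m \<otimes>\<^bsub>E\<^esub> h s) = (m \<otimes>\<^bsub>E\<^esub> v n) \<otimes>\<^bsub>E\<^esub> h s"
      unfolding v_central[OF m] using m s u_closed(3)[of n] by (simp add: h.S.m_assoc)
    also have "\<dots> = m \<otimes>\<^bsub>E\<^esub> h ?s"
      using m s u_closed hu[of n] by (simp add: h.S.m_assoc del: h.hom_nat_pow)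
    finally show ?thesis .
  qed
  ultimately have "m \<otimes>\<^bsub>E\<^esub> h ?s \<in> gen_left_ideal E (h ` ?V)" by simp
  from clear_gen[OF V'(2) this] obtain k y where y: "y \<in> gen_left_ideal H (f ` ?V)" "v k \<otimes>\<^bsub>E\<^esub> (m \<otimes>\<^bsub>E\<^esub> h ?s) = i y" by blast
  obtain t m0 where m0: "m0 \<in> carrier H" "v t \<otimes>\<^bsub>E\<^esub> m = i m0" using denom_E[OF m] by blast
  have fV: "f ` ?V \<subseteq> carrier H" using V' f(1) by blast
  note G = i.R.left_ideal_in_gen[OF fV]
  have yc: "y \<in> carrier H" using left_ideal_inD(1)[OF G y(1)] .
  have fw: "f w [^]\<^bsub>H\<^esub> (j::nat) \<in> carrier H" for j using f(1)[OF w] by simp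
  \<comment> \<open>\<open>v t\<close> clears the denominator of \<open>m\<close>, and
    \<open>v k\<close> the one in the membership of its product with the scaled \<open>s\<close>.
    \<open>?m\<close> is what corresponds in \<open>H\<close> to \<open>m\<close> multiplied by
    both.\<close>
  let ?m = "f w [^]\<^bsub>H\<^esub> k \<otimes>\<^bsub>H\<^esub> m0"
  have mc: "?m \<in> carrier H" using fw m0(1) by simp
  have hs: "h ?s \<in> carrier E" using s' C_carrier by auto
  have "i (?m \<otimes>\<^bsub>H\<^esub> f ?s) = i (f w [^]\<^bsub>H\<^esub> t \<otimes>\<^bsub>H\<^esub> y)"
  proof -
    have "i (?m \<otimes>\<^bsub>H\<^esub> f ?s) = i ?m \<otimes>\<^bsub>E\<^esub> h ?s" using mc f[OF s'] by simp
    also have "i ?m = v k \<otimes>\<^bsub>E\<^esub> (v t \<otimes>\<^bsub>E\<^esub> m)" unfolding m0(2) by (rule i_pow[OF m0(1)])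
    also have "\<dots> = v t \<otimes>\<^bsub>E\<^esub> (v k \<otimes>\<^bsub>E\<^esub> m)"
      using m u_closed(3)[of k] u_closed(3)[of t] v_central[OF u_closed(3)[of k], of t] by (simp add: h.S.m_assoc[symmetric])
    also have "\<dots> \<otimes>\<^bsub>E\<^esub> h ?s = v t \<otimes>\<^bsub>E\<^esub> (v k \<otimes>\<^bsub>E\<^esub> (m \<otimes>\<^bsub>E\<^esub> h ?s))"
      using m u_closed(3)[of k] u_closed(3)[of t] hs by (simp add: h.S.m_assoc del: h.hom_mult)
    also have "\<dots> = i (f w [^]\<^bsub>H\<^esub> t \<otimes>\<^bsub>H\<^esub> y)" unfolding y(2) by (rule i_pow[OF yc, symmetric])
    finally show ?thesis .
  qed
  then have "?m \<otimes>\<^bsub>H\<^esub> f ?s = f w [^]\<^bsub>H\<^esub> t \<otimes>\<^bsub>H\<^esub> y"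
    by (rule inj_onD[OF inj]) (use mc f(1)[OF s'] fw[of t] yc in auto)
  also have "\<dots> \<in> gen_left_ideal H (f ` ?V)" by (rule left_ideal_inD(4)[OF G fw y(1)])
  finally have mP: "?m \<in> gen_left_ideal H (f ` {c \<in> C. c \<otimes>\<^bsub>D\<^esub> ?s \<in> gen_left_ideal (D\<lparr>carrier := C\<rparr>) ?V})"
    (is "_ \<in> gen_left_ideal H (f ` ?P)") by (rule colon_C[OF V'(1,2) s' mc])
  \<comment> \<open>The colon ideal over \<open>C\<close> for the scaled data lies in the colon
    ideal over \<open>D\<close> for the original data, as the power of \<open>w\<close> can be
    divided out again.\<close>
  have hP: "h ` ?P \<subseteq> h ` ?Q"
  proof (rule image_mono, rule subsetI)
    interpret CR: ring "D\<lparr>carrier := C\<rparr>" by (rule h.R.subring_is_ring[OF C])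
    fix c assume "c \<in> ?P"
    then have c: "c \<in> C" "c \<otimes>\<^bsub>D\<^esub> ?s \<in> gen_left_ideal (D\<lparr>carrier := C\<rparr>) ?V" by auto
    have cD: "c \<in> carrier D" by (rule C_carrier[OF c(1)])
    have "left_ideal_in (D\<lparr>carrier := C\<rparr>) C (gen_left_ideal D V \<inter> C)"
      using left_ideal_inD[OF GV] subringE[OF C] C_carrier by (intro left_ideal_inI) auto
    then have l: "left_ideal_in (D\<lparr>carrier := C\<rparr>) (carrier (D\<lparr>carrier := C\<rparr>)) (gen_left_ideal D V \<inter> C)" by simp
    have "?V \<subseteq> gen_left_ideal D V \<inter> C"
      using V'(2) left_ideal_inD(4)[OF GV u_closed(1)] h.R.gen_left_ideal_incl[of V] by blast
    then have "c \<otimes>\<^bsub>D\<^esub> ?s \<in> gen_left_ideal D V" using CR.gen_left_ideal_minimal[OF l] c(2) by blast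
    from left_ideal_inD(4)[OF GV u_closed(2) this]
    have "u' n \<otimes>\<^bsub>D\<^esub> (c \<otimes>\<^bsub>D\<^esub> ?s) \<in> gen_left_ideal D V" .
    moreover have "c \<otimes>\<^bsub>D\<^esub> ?s = u n \<otimes>\<^bsub>D\<^esub> (c \<otimes>\<^bsub>D\<^esub> s)"
      using u_central[OF cD, of n] cD s u_closed(1)[of n] by (simp add: h.R.m_assoc[symmetric])
    ultimately show "c \<in> ?Q" using cancel_u[of "c \<otimes>\<^bsub>D\<^esub> s" n] cD s by simp
  qed
  have hQ: "h ` ?Q \<subseteq> carrier E" by auto
  note GQ = h.S.left_ideal_in_gen[OF hQ]
  have "left_ideal_in H (carrier H) {x \<in> carrier H. i x \<in> gen_left_ideal E (h ` ?Q)}"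
    using left_ideal_inD[OF GQ] by (intro left_ideal_inI) auto
  moreover have "f ` ?P \<subseteq> {x \<in> carrier H. i x \<in> gen_left_ideal E (h ` ?Q)}"
  proof (rule image_subsetI)
    fix c assume c: "c \<in> ?P"
    then have "h c \<in> gen_left_ideal E (h ` ?Q)"
      using subsetD[OF h.S.gen_left_ideal_incl subsetD[OF hP imageI[OF c]]] by simp
    then show "f c \<in> {x \<in> carrier H. i x \<in> gen_left_ideal E (h ` ?Q)}" using f[of c] c by simp
  qed
  ultimately have "gen_left_ideal H (f ` ?P) \<subseteq> {x \<in> carrier H. i x \<in> gen_left_ideal E (h ` ?Q)}"
    by (rule i.R.gen_left_ideal_minimal)
  with mP have im: "i ?m \<in> gen_left_ideal E (h ` ?Q)" by blast
  \<comment> \<open>\<open>m\<close> is recovered by means of the inverse powers, which are images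
    of elements of \<open>D\<close>.\<close>
  have me: "m = h (u' t) \<otimes>\<^bsub>E\<^esub> (h (u' k) \<otimes>\<^bsub>E\<^esub> i ?m)"
  proof -
    have "i ?m = v k \<otimes>\<^bsub>E\<^esub> (v t \<otimes>\<^bsub>E\<^esub> m)" unfolding m0(2) by (rule i_pow[OF m0(1)])
    then show ?thesis using cancel_v[of "v t \<otimes>\<^bsub>E\<^esub> m" k] cancel_v[OF m, of t] m u_closed(3)[of t] by simp
  qed
  show "m \<in> gen_left_ideal E (h ` ?Q)"
    by (subst me) (intro left_ideal_inD(4)[OF GQ] h.hom_closed u_closed(2) im)
qed

end

section \<open>The chain condition under base change\<close>

context base_change_algebra
begin

lemma fr_unit: "a \<in> carrier A \<Longrightarrow> fr \<one>\<^bsub>A\<^esub> n \<otimes>\<^bsub>BC\<^esub> fr a m = fr a (n + m)"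
  by (simp add: fr_mult)

lemma fr_clear: "a \<in> carrier A \<Longrightarrow> fr (p [^] (n::nat) \<odot>\<^bsub>A\<^esub> \<one>\<^bsub>A\<^esub>) 0 \<otimes>\<^bsub>BC\<^esub> fr a n = fr a 0"
  using smult_closed[OF p_pow_K[of n]] smult_mult_l[of "p [^] n" "\<one>\<^bsub>A\<^esub>" a] p_pow_K fr_shift[of a n 0]
  by (simp add: fr_mult)

text \<open>A left ideal of the base change is determined by its intersection with \<open>A\<close>,
  since powers of \<open>p\<close> are invertible there.\<close>

lemma acc_in_BC:
  assumes acc: "acc_in A (carrier A)" shows "acc_in BC (carrier BC)"
  unfolding acc_in_def
proof (intro allI impI)
  fix I :: "nat \<Rightarrow> ('b \<times> 'a \<Rightarrow>\<^sub>0 int) set set"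
  assume I: "\<forall>k. left_ideal_in BC (carrier BC) (I k)" and inc: "\<forall>k. I k \<subseteq> I (Suc k)"
  have mono: "I m \<subseteq> I n" if "m \<le> n" for m n using lift_Suc_mono_le[of I] inc that by blast
  let ?J = "\<lambda>k. {a \<in> carrier A. fr a 0 \<in> I k}"
  have j1: "left_ideal_in A (carrier A) (?J k)" for k
  proof (rule left_ideal_inI)
    note Ik = I[rule_format, of k]
    show "\<zero>\<^bsub>A\<^esub> \<in> ?J k" using left_ideal_inD(2)[OF Ik] BC_zero[of 0] by simp
    show "x \<oplus>\<^bsub>A\<^esub> y \<in> ?J k" if "x \<in> ?J k" "y \<in> ?J k" for x y
      using that left_ideal_inD(3)[OF Ik, of "fr x 0" "fr y 0"] by (simp add: fr_add)
    show "a \<otimes>\<^bsub>A\<^esub> x \<in> ?J k" if "a \<in> carrier A" "x \<in> ?J k" for a x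
      using that left_ideal_inD(4)[OF Ik, of "fr a 0" "fr x 0"] by (simp add: fr_mult fr_closed)
  qed blast
  have j2: "?J k \<subseteq> ?J (Suc k)" for k using inc by blast
  show "\<exists>N. \<forall>n\<ge>N. I n = I N"
  proof (rule acc_inD[of A "carrier A" ?J, OF acc j1 j2])
    fix N assume N: "\<And>k. k \<ge> N \<Longrightarrow> ?J k = ?J N"
    have "I k \<subseteq> I N" if k: "k \<ge> N" for k
    proof
      fix U assume U: "U \<in> I k"
      note Ik = I[rule_format, of k]
      obtain a n where a: "a \<in> carrier A" "U = fr a n" using left_ideal_inD(1)[OF Ik U] by (rule frE)
      have "fr a 0 \<in> I k"
        using left_ideal_inD(4)[OF Ik _ U, of "fr (p [^] n \<odot>\<^bsub>A\<^esub> \<one>\<^bsub>A\<^esub>) 0"] fr_clear[OF a(1), of n] a(2)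
          fr_closed smult_closed[OF p_pow_K] by simp
      then have "a \<in> ?J k" using a(1) by simp
      then have "fr a 0 \<in> I N" unfolding N[OF k] by simp
      from left_ideal_inD(4)[OF I[rule_format] fr_closed[OF A.one_closed, of n] this]
      show "U \<in> I N" using fr_unit[OF a(1), of n 0] a(2) by simp
    qed
    then have "I k = I N" if "k \<ge> N" for k using mono[OF that] that by (intro subset_antisym)
    then show "\<exists>N. \<forall>n\<ge>N. I n = I N" by (intro exI[of _ N] allI impI)
  qed
qed

end

text \<open>A dictionary: the completion is described by scalars p^n, the approximation argument by
  powers of a central ring element.\<close>

lemma (in assoc_algebra) smult_one_pow:
  assumes p: "p \<in> carrier R" and x: "x \<in> carrier A"
  shows "(p \<odot>\<^bsub>A\<^esub> \<one>\<^bsub>A\<^esub>) [^]\<^bsub>A\<^esub> (n::nat) \<otimes>\<^bsub>A\<^esub> x = (p [^]\<^bsub>R\<^esub> n) \<odot>\<^bsub>A\<^esub> x"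
    and "(p \<odot>\<^bsub>A\<^esub> \<one>\<^bsub>A\<^esub>) \<otimes>\<^bsub>A\<^esub> x = p \<odot>\<^bsub>A\<^esub> x" and "x \<otimes>\<^bsub>A\<^esub> (p \<odot>\<^bsub>A\<^esub> \<one>\<^bsub>A\<^esub>) = p \<odot>\<^bsub>A\<^esub> x"
proof -
  have w: "p \<odot>\<^bsub>A\<^esub> \<one>\<^bsub>A\<^esub> \<in> carrier A" using lsmult_closed[OF p] by simp
  have m: "(p \<odot>\<^bsub>A\<^esub> \<one>\<^bsub>A\<^esub>) \<otimes>\<^bsub>A\<^esub> y = p \<odot>\<^bsub>A\<^esub> y" if "y \<in> carrier A" for y
    using smult_mult_l[OF p _ that, of "\<one>\<^bsub>A\<^esub>"] that by simp
  show "(p \<odot>\<^bsub>A\<^esub> \<one>\<^bsub>A\<^esub>) \<otimes>\<^bsub>A\<^esub> x = p \<odot>\<^bsub>A\<^esub> x" by (rule m[OF x])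
  show "x \<otimes>\<^bsub>A\<^esub> (p \<odot>\<^bsub>A\<^esub> \<one>\<^bsub>A\<^esub>) = p \<odot>\<^bsub>A\<^esub> x" using smult_mult_r[OF p x, of "\<one>\<^bsub>A\<^esub>"] x by simp
  show "(p \<odot>\<^bsub>A\<^esub> \<one>\<^bsub>A\<^esub>) [^]\<^bsub>A\<^esub> n \<otimes>\<^bsub>A\<^esub> x = (p [^]\<^bsub>R\<^esub> n) \<odot>\<^bsub>A\<^esub> x"
  proof (induction n)
    case 0 then show ?case using x lsmult_one by simp
  next
    case (Suc n)
    have pn: "(p [^]\<^bsub>R\<^esub> n) \<in> carrier R" using p by simp
    have "(p \<odot>\<^bsub>A\<^esub> \<one>\<^bsub>A\<^esub>) [^]\<^bsub>A\<^esub> Suc n \<otimes>\<^bsub>A\<^esub> x = (p \<odot>\<^bsub>A\<^esub> \<one>\<^bsub>A\<^esub>) \<otimes>\<^bsub>A\<^esub> ((p \<odot>\<^bsub>A\<^esub> \<one>\<^bsub>A\<^esub>) [^]\<^bsub>A\<^esub> n \<otimes>\<^bsub>A\<^esub> x)"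
      unfolding A.nat_pow_Suc2[OF w] using w x by (simp add: A.m_assoc)
    also have "\<dots> = p \<odot>\<^bsub>A\<^esub> ((p [^]\<^bsub>R\<^esub> n) \<odot>\<^bsub>A\<^esub> x)" unfolding Suc using m lsmult_closed[OF pn x] by simp
    also have "\<dots> = (p [^]\<^bsub>R\<^esub> Suc n) \<odot>\<^bsub>A\<^esub> x" using lsmult_assoc[OF p pn x] p by (simp add: R.m_comm)
    finally show ?case .
  qed
qed

lemma subalgebra_assoc_algebra:
  assumes A: "assoc_algebra R A" and S: "R_subalgebra R A S" shows "assoc_algebra R (A\<lparr>carrier := S\<rparr>)"
proof -
  interpret assoc_algebra R A by (rule A)
  have S1: "subring S A" and S2: "\<And>r x. r \<in> carrier R \<Longrightarrow> x \<in> S \<Longrightarrow> r \<odot>\<^bsub>A\<^esub> x \<in> S"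
    using S unfolding R_subalgebra_def by blast+
  interpret S: ring "A\<lparr>carrier := S\<rparr>" by (rule A.subring_is_ring[OF S1])
  have Sc: "x \<in> S \<Longrightarrow> x \<in> carrier A" for x using subringE(1)[OF S1] by blast
  show ?thesis
    by (intro assoc_algebra.intro R.cring_axioms S.ring_axioms left_module.intro S.abelian_group_axioms
        left_module_axioms.intro assoc_algebra_axioms.intro R.ring_axioms)
      (simp_all add: S2 Sc lsmult_l_distr lsmult_r_distr lsmult_assoc lsmult_one smult_mult_l[symmetric] smult_mult_r[symmetric])
qed

text \<open>The axioms \<open>dense\<close> and \<open>reflect\<close> are \<open>kap_dense\<close>
  and \<open>kap_divisible\<close> with exponent 1; the remaining ones translate properties of the
  completion by \<open>smult_one_pow\<close>.\<close>

lemma (in adic_algebra) adic_approximation_completion: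
  assumes acc: "acc_in A (carrier A)"
  shows "adic_approximation A Ac kap (p \<odot>\<^bsub>A\<^esub> \<one>\<^bsub>A\<^esub>)"
proof -
  interpret Ah: assoc_algebra R Ac by (rule Ac_assoc_algebra)
  have w: "p \<odot>\<^bsub>A\<^esub> \<one>\<^bsub>A\<^esub> \<in> carrier A" using sm[OF p] by simp
  have kw: "kap (p \<odot>\<^bsub>A\<^esub> \<one>\<^bsub>A\<^esub>) = p \<odot>\<^bsub>Ac\<^esub> \<one>\<^bsub>Ac\<^esub>"
    using kap_smult[OF p, of "\<one>\<^bsub>A\<^esub>"] ring_hom_one[OF kap_hom] by simp
  have kc: "kap a \<in> carrier Ac" if "a \<in> carrier A" for a using ring_hom_closed[OF kap_hom that] .
  note pa = smult_one_pow[OF p] and ph = Ah.smult_one_pow[OF p]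
  show ?thesis
  proof (rule adic_approximation.intro[OF ring_hom_ringI2[OF A.ring_axioms Ac_ring kap_hom] adic_approximation_axioms.intro],
      unfold kw)
    show "x = \<zero>\<^bsub>Ac\<^esub>" if "x \<in> carrier Ac" "(p \<odot>\<^bsub>Ac\<^esub> \<one>\<^bsub>Ac\<^esub>) \<otimes>\<^bsub>Ac\<^esub> x = \<zero>\<^bsub>Ac\<^esub>" for x
      using Ac_torsion_free that ph(2)[OF that(1)] unfolding torsion_free_def by simp
    show "x = \<zero>\<^bsub>Ac\<^esub>" if "x \<in> carrier Ac" "\<And>n::nat. \<exists>y\<in>carrier Ac. x = (p \<odot>\<^bsub>Ac\<^esub> \<one>\<^bsub>Ac\<^esub>) [^]\<^bsub>Ac\<^esub> n \<otimes>\<^bsub>Ac\<^esub> y" for x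
      using Ac_separated[OF that(1)] that(2) ph(1) by metis
    show "\<exists>s\<in>carrier Ac. \<forall>n. \<exists>y\<in>carrier Ac. s \<ominus>\<^bsub>Ac\<^esub> t n = (p \<odot>\<^bsub>Ac\<^esub> \<one>\<^bsub>Ac\<^esub>) [^]\<^bsub>Ac\<^esub> n \<otimes>\<^bsub>Ac\<^esub> y"
      if t: "\<And>n. t n \<in> carrier Ac" "\<And>n::nat. \<exists>y\<in>carrier Ac. t (Suc n) \<ominus>\<^bsub>Ac\<^esub> t n = (p \<odot>\<^bsub>Ac\<^esub> \<one>\<^bsub>Ac\<^esub>) [^]\<^bsub>Ac\<^esub> n \<otimes>\<^bsub>Ac\<^esub> y" for t
    proof -
      have "\<exists>y\<in>carrier Ac. t (Suc n) \<ominus>\<^bsub>Ac\<^esub> t n = pw n \<odot>\<^bsub>Ac\<^esub> y" for n using t(2)[of n] ph(1) by metis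
      from Ac_complete[OF t(1) this] show ?thesis using ph(1) by metis
    qed
    show "\<exists>c\<in>carrier A. \<exists>y\<in>carrier Ac. x = kap c \<oplus>\<^bsub>Ac\<^esub> (p \<odot>\<^bsub>Ac\<^esub> \<one>\<^bsub>Ac\<^esub>) \<otimes>\<^bsub>Ac\<^esub> y" if x: "x \<in> carrier Ac" for x
    proof -
      obtain a y where a: "a \<in> carrier A" "y \<in> carrier Ac" "x \<ominus>\<^bsub>Ac\<^esub> kap a = pw 1 \<odot>\<^bsub>Ac\<^esub> y" using kap_dense[OF x] by blast
      have "x = kap a \<oplus>\<^bsub>Ac\<^esub> (x \<ominus>\<^bsub>Ac\<^esub> kap a)" using x kc[OF a(1)] by algebra
      then have "x = kap a \<oplus>\<^bsub>Ac\<^esub> (p \<odot>\<^bsub>Ac\<^esub> \<one>\<^bsub>Ac\<^esub>) \<otimes>\<^bsub>Ac\<^esub> y" unfolding a(3) using p ph(2)[OF a(2)] by simp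
      then show ?thesis using a(1,2) by blast
    qed
    show "\<exists>c'\<in>carrier A. c = (p \<odot>\<^bsub>A\<^esub> \<one>\<^bsub>A\<^esub>) \<otimes>\<^bsub>A\<^esub> c'"
      if "c \<in> carrier A" "y \<in> carrier Ac" "kap c = (p \<odot>\<^bsub>Ac\<^esub> \<one>\<^bsub>Ac\<^esub>) \<otimes>\<^bsub>Ac\<^esub> y" for c y
    proof -
      have "kap c = pw 1 \<odot>\<^bsub>Ac\<^esub> y" using that ph(2)[OF that(2)] p by simp
      from kap_divisible[OF that(1,2) this] obtain z where "z \<in> carrier A" "c = pw 1 \<odot>\<^bsub>A\<^esub> z" unfolding P_iff by blast
      then show ?thesis using pa(2) p by (intro bexI[of _ z]) simp_all
    qed
  qed (use w pa ph acc in simp_all)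
qed

section \<open>The valuation ring and its uniformizer\<close>

context complete_discrete_valuation_field
begin

lemma v_one: "v \<one> = 0"
  using v_mult[of \<one> \<one>] by simp

lemma v_minus: assumes "x \<in> carrier L" "x \<noteq> \<zero>" shows "v (\<ominus> x) = v x"
proof -
  have n: "\<ominus> \<one> \<noteq> \<zero>" using minus_minus[of \<one>] by (metis minus_zero one_closed one_not_zero)
  \<comment> \<open>The square of -1 is 1, so twice the valuation of -1 is 0.\<close>
  have "v (\<ominus> \<one> \<otimes> \<ominus> \<one>) = v (\<ominus> \<one>) + v (\<ominus> \<one>)" using n by (intro v_mult) auto
  then have "v (\<ominus> \<one>) = 0" using v_one by (simp add: l_minus r_minus)
  moreover have "v (\<ominus> \<one> \<otimes> x) = v (\<ominus> \<one>) + v x" using n assms by (intro v_mult) auto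
  ultimately show ?thesis using assms by (simp add: l_minus)
qed

lemma valuation_subring: "subring (val_ball L v 0) L"
proof (rule subringI)
  show "val_ball L v 0 \<subseteq> carrier L" "\<one> \<in> val_ball L v 0" unfolding val_ball_def using v_one by auto
  fix x assume x: "x \<in> val_ball L v 0"
  show "\<ominus> x \<in> val_ball L v 0" using x v_minus[of x] unfolding val_ball_def by auto
  fix y assume y: "y \<in> val_ball L v 0"
  have c: "x \<in> carrier L" "y \<in> carrier L" using x y unfolding val_ball_def by auto
  show "x \<otimes> y \<in> val_ball L v 0"
    using x y v_mult[of x y] unfolding val_ball_def by (cases "x = \<zero> \<or> y = \<zero>") auto
  show "x \<oplus> y \<in> val_ball L v 0"
  proof (cases "x = \<zero> \<or> y = \<zero> \<or> x \<oplus> y = \<zero>")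
    case True then show ?thesis using x y c unfolding val_ball_def by auto
  next
    case False
    then show ?thesis using x y c v_add[of x y] unfolding val_ball_def by auto
  qed
qed

end

lemma denominators_uniformizer:
  fixes L (structure)
  assumes L: "complete_discrete_valuation_field L v" and p: "uniformizer L v p"
  shows "denominators L (val_ball L v 0) p"
proof -
  interpret complete_discrete_valuation_field L v by (rule L)
  show ?thesis
  proof (rule denominators.intro[OF field_axioms denominators_axioms.intro])
    have p': "p \<in> carrier L" "p \<noteq> \<zero>" "v p = 1" using p unfolding uniformizer_def by auto
    show "p \<in> val_ball L v 0" "p \<noteq> \<zero>" using p' unfolding val_ball_def by auto
    fix l assume l: "l \<in> carrier L"
    show "\<exists>n::nat. p [^] n \<otimes> l \<in> val_ball L v 0"
    proof (cases "l = \<zero>")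
      case True then show ?thesis using p' unfolding val_ball_def by auto
    next
      case False
      have nz: "p [^] n \<noteq> \<zero>" for n :: nat by (induction n) (use p' in \<open>auto simp: integral_iff\<close>)
      have "v (p [^] n) = int n" for n :: nat
      proof (induction n)
        case (Suc n)
        then show ?case using v_mult[of "p [^] n" p] p' nz[of n] by simp
      qed (simp add: v_one)
      then have "v (p [^] n \<otimes> l) = int n + v l" for n :: nat
        using v_mult[of "p [^] n" l] p' nz[of n] l False by simp
      \<comment> \<open>As p^n has valuation n, the exponent -v(l), cut off at 0, suffices.\<close>
      then have "0 \<le> v (p [^] nat (- v l) \<otimes> l)" by simp
      then show ?thesis using p' l unfolding val_ball_def by auto
    qed
  qed (rule valuation_subring)
qed

lemma (in abelian_group) add_diff_cancel_left:
  assumes "a \<in> carrier G" "b \<in> carrier G" shows "b \<oplus> (a \<ominus> b) = a"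
  using assms a_lcomm[of b a "\<ominus> b"] by (simp add: minus_eq r_neg)

context base_change_algebra
begin

lemma fr0_hom: "(\<lambda>a. fr a 0) \<in> ring_hom A BC"
  by (rule ring_hom_memI) (simp_all add: fr_closed fr_mult fr_add BC_one)

lemma fr0_inj: "inj_on (\<lambda>a. fr a 0) (carrier A)"
  by (rule inj_onI) (simp add: fr_eq_iff)

text \<open>The image of \<open>p\<close>, a central unit of the base change whose inverse is the
  fraction 1/p.\<close>

abbreviation "p0 \<equiv> fr (p \<odot>\<^bsub>A\<^esub> \<one>\<^bsub>A\<^esub>) 0"

lemma p1_closed: "p \<odot>\<^bsub>A\<^esub> \<one>\<^bsub>A\<^esub> \<in> carrier A"
  using smult_closed[OF L.p(1)] by simp

lemma p0_closed: "p0 \<in> carrier BC"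
  by (rule fr_closed[OF p1_closed])

lemma p0_mult:
  assumes a: "a \<in> carrier A" shows "p0 \<otimes>\<^bsub>BC\<^esub> fr a n = fr (p \<odot>\<^bsub>A\<^esub> a) n" "fr a n \<otimes>\<^bsub>BC\<^esub> p0 = fr (p \<odot>\<^bsub>A\<^esub> a) n"
  using smult_mult_l[of p "\<one>\<^bsub>A\<^esub>" a] smult_mult_r[of p a "\<one>\<^bsub>A\<^esub>"] L.p(1) a p1_closed by (simp_all add: fr_mult)

lemma p0_central: "U \<in> carrier BC \<Longrightarrow> U \<otimes>\<^bsub>BC\<^esub> p0 = p0 \<otimes>\<^bsub>BC\<^esub> U"
  by (erule frE) (simp add: p0_mult)

lemma p0_pow_mult: "a \<in> carrier A \<Longrightarrow> p0 [^]\<^bsub>BC\<^esub> (n::nat) \<otimes>\<^bsub>BC\<^esub> fr a m = fr (p [^] n \<odot>\<^bsub>A\<^esub> a) m"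
proof (induction n)
  case 0 then show ?case using lsmult_one[of a] by (simp add: fr_closed)
next
  case (Suc n)
  have "p0 [^]\<^bsub>BC\<^esub> Suc n \<otimes>\<^bsub>BC\<^esub> fr a m = p0 \<otimes>\<^bsub>BC\<^esub> (p0 [^]\<^bsub>BC\<^esub> n \<otimes>\<^bsub>BC\<^esub> fr a m)"
    unfolding BC.nat_pow_Suc2[OF p0_closed] using p0_closed Suc.prems by (simp add: BC.m_assoc fr_closed)
  also have "\<dots> = fr (p \<odot>\<^bsub>A\<^esub> (p [^] n \<odot>\<^bsub>A\<^esub> a)) m"
    unfolding Suc.IH[OF Suc.prems] by (rule p0_mult[OF smult_closed[OF p_pow_K Suc.prems]])
  also have "p \<odot>\<^bsub>A\<^esub> (p [^] n \<odot>\<^bsub>A\<^esub> a) = p [^] Suc n \<odot>\<^bsub>A\<^esub> a"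
    using lsmult_assoc[of p "p [^] n" a] L.p(1) p_pow_K Suc.prems K_carrier by (simp add: L.m_comm)
  finally show ?case .
qed

lemma p0_unit_closed: "fr \<one>\<^bsub>A\<^esub> 1 \<in> carrier BC"
  by (simp add: fr_closed)

lemma p0_unit: "p0 \<otimes>\<^bsub>BC\<^esub> fr \<one>\<^bsub>A\<^esub> 1 = \<one>\<^bsub>BC\<^esub>" "fr \<one>\<^bsub>A\<^esub> 1 \<otimes>\<^bsub>BC\<^esub> p0 = \<one>\<^bsub>BC\<^esub>"
proof -
  have e: "fr (p \<odot>\<^bsub>A\<^esub> \<one>\<^bsub>A\<^esub>) 1 = \<one>\<^bsub>BC\<^esub>"
    using fr_shift[of "\<one>\<^bsub>A\<^esub>" 1 0] K_carrier[OF L.p(1)] unfolding BC_one by simp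
  show "p0 \<otimes>\<^bsub>BC\<^esub> fr \<one>\<^bsub>A\<^esub> 1 = \<one>\<^bsub>BC\<^esub>" by (rule trans[OF p0_mult(1)[OF A.one_closed] e])
  show "fr \<one>\<^bsub>A\<^esub> 1 \<otimes>\<^bsub>BC\<^esub> p0 = \<one>\<^bsub>BC\<^esub>" by (rule trans[OF p0_mult(2)[OF A.one_closed] e])
qed

lemma p0_clear:
  assumes "U \<in> carrier BC" shows "\<exists>n::nat. \<exists>a\<in>carrier A. p0 [^]\<^bsub>BC\<^esub> n \<otimes>\<^bsub>BC\<^esub> U = fr a 0"
proof -
  obtain a n where "a \<in> carrier A" "U = fr a n" using assms by (rule frE)
  then have "p0 [^]\<^bsub>BC\<^esub> n \<otimes>\<^bsub>BC\<^esub> U = fr a 0" using fr_shift[of a n 0] by (simp add: p0_pow_mult)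
  then show ?thesis using \<open>a \<in> carrier A\<close> by blast
qed

end

section \<open>Comparison of the completions\<close>

text \<open>The q-commutative structure enters through the chain condition on the graded algebra
  alone. \<open>B\<close> is kept as a subset of the base change, so that its elements remain
  fractions of elements of \<open>A\<close>.\<close>

locale completion_comparison = A: base_change_algebra L K p A
  for L :: "('l, 'x) ring_scheme" (structure) and K p and A :: "('l, 'a) module" +
  fixes BB :: "('a \<times> 'l \<Rightarrow>\<^sub>0 int) set set" and F :: "nat \<Rightarrow> ('a \<times> 'l \<Rightarrow>\<^sub>0 int) set set"
  assumes accA: "acc_in A (carrier A)"
    and BB: "R_subalgebra A.Rg A.BC BB"
    and A_BB: "\<And>a. a \<in> carrier A \<Longrightarrow> A.fr a 0 \<in> BB"
    and filt: "algebra_filtration A.Rg (A.BC\<lparr>carrier := BB\<rparr>) F"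
    and exh: "exhaustive (A.BC\<lparr>carrier := BB\<rparr>) F"
    and F0: "F 0 = (\<lambda>a. A.fr a 0) ` carrier A"
    and gr_ring: "ring (gr (A.BC\<lparr>carrier := BB\<rparr>) F)"
    and gr_acc: "acc_in (gr (A.BC\<lparr>carrier := BB\<rparr>) F) (carrier (gr (A.BC\<lparr>carrier := BB\<rparr>) F))"
begin

abbreviation "B \<equiv> A.BC\<lparr>carrier := BB\<rparr>"
abbreviation "iA \<equiv> \<lambda>a. A.fr a 0"

lemma BB_subring: "subring BB A.BC"
  using BB unfolding R_subalgebra_def by blast

lemma BB_carrier: "x \<in> BB \<Longrightarrow> x \<in> carrier A.BC"
  using subringE(1)[OF BB_subring] by blast

lemma B_assoc_algebra: "assoc_algebra A.Rg B"
  by (rule subalgebra_assoc_algebra[OF A.BC_assoc_algebra BB])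

lemma p_closed: "p \<in> carrier A.Rg"
  using A.L.p(1) by simp

lemma B_torsion_free: "torsion_free p B"
  unfolding torsion_free_def
proof (intro ballI impI)
  fix U assume "U \<in> carrier B" and z: "p \<odot>\<^bsub>B\<^esub> U = \<zero>\<^bsub>B\<^esub>"
  then have "U \<in> carrier A.BC" using BB_carrier by simp
  then obtain a n where a: "a \<in> carrier A" "U = A.fr a n" by (rule A.frE)
  have "A.fr (p \<odot>\<^bsub>A\<^esub> a) n = A.fr \<zero>\<^bsub>A\<^esub> n"
    using z a A.L.p(1) A.BC_zero[of n] by (simp add: A.fr_smult)
  then have "p \<odot>\<^bsub>A\<^esub> a = \<zero>\<^bsub>A\<^esub>" using a(1) A.smult_closed[OF A.L.p(1)] by (simp add: A.fr_eq_iff)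
  then have "a = \<zero>\<^bsub>A\<^esub>" using A.tf a(1) unfolding torsion_free_def by blast
  then show "U = \<zero>\<^bsub>B\<^esub>" using a(2) A.BC_zero[of n] by simp
qed

lemma adic_A: "adic_algebra A.Rg A p"
  by (intro adic_algebra.intro A.assoc_algebra_axioms adic_algebra_axioms.intro p_closed A.tf)

lemma adic_B: "adic_algebra A.Rg B p"
  by (intro adic_algebra.intro B_assoc_algebra adic_algebra_axioms.intro p_closed B_torsion_free)

interpretation a: adic_algebra A.Rg A p by (rule adic_A)
interpretation b: adic_algebra A.Rg B p by (rule adic_B)

lemma iA_hom: "iA \<in> ring_hom A B"
  by (rule ring_hom_memI) (simp_all add: A_BB A.fr_mult A.fr_add A.BC_one)

lemma adic_iA: "adic_hom A.Rg A B p iA"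
  by (intro adic_hom.intro adic_A adic_B adic_hom_axioms.intro iA_hom) (simp add: A.fr_smult)

interpretation ab: adic_hom A.Rg A B p iA by (rule adic_iA)

abbreviation "Ah \<equiv> completion A.Rg p A"
abbreviation "Bh \<equiv> completion A.Rg p B"

lemma denoms: "denominators L K p"
  by (rule A.L.denominators_axioms)

lemma Ah_base_change: "base_change_algebra L K p Ah"
  by (intro base_change_algebra.intro denoms a.Ac_assoc_algebra base_change_algebra_axioms.intro a.Ac_torsion_free)

lemma Bh_base_change: "base_change_algebra L K p Bh"
  by (intro base_change_algebra.intro denoms b.Ac_assoc_algebra base_change_algebra_axioms.intro b.Ac_torsion_free)

interpretation Ah: base_change_algebra L K p Ah by (rule Ah_base_change)
interpretation Bh: base_change_algebra L K p Bh by (rule Bh_base_change)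

lemma kap_base_change: "base_change_hom L K p A Ah a.kap"
  by (intro base_change_hom.intro A.base_change_algebra_axioms Ah_base_change base_change_hom_axioms.intro a.kap_hom)
    (simp add: a.kap_smult)

lemma cm_base_change: "base_change_hom L K p Ah Bh ab.cm"
  by (intro base_change_hom.intro Bh_base_change Ah_base_change base_change_hom_axioms.intro ab.cm_hom)
    (simp add: ab.cm_smult)

interpretation j: base_change_hom L K p A Ah a.kap by (rule kap_base_change)
interpretation h: base_change_hom L K p Ah Bh ab.cm by (rule cm_base_change)

abbreviation "D \<equiv> base_change A.Rg L Ah"
abbreviation "E \<equiv> base_change A.Rg L Bh"

lemma accAh: "acc_in Ah (carrier Ah)"
proof -
  interpret adic_approximation A Ah a.kap "p \<odot>\<^bsub>A\<^esub> \<one>\<^bsub>A\<^esub>" by (rule a.adic_approximation_completion[OF accA])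
  show ?thesis by (rule acc_in_S)
qed

lemma accD: "acc_in D (carrier D)"
  by (rule Ah.acc_in_BC[OF accAh])

lemma BBE:
  assumes "x \<in> BB"
  obtains c n where "c \<in> carrier A" "x = A.fr c n" "p [^] n \<odot>\<^bsub>B\<^esub> x = iA c"
proof -
  obtain c n where c: "c \<in> carrier A" "x = A.fr c n" using BB_carrier[OF assms] by (rule A.frE)
  have "p [^] n \<odot>\<^bsub>A.BC\<^esub> x = iA c"
    unfolding c(2) A.fr_smult[OF A.p_pow_K c(1)] using A.fr_shift[OF c(1), of n 0] by simp
  then show thesis using that c by simp
qed

text \<open>In the completion of \<open>B\<close> only the cleared identity p^n x = c is available;
  it is divided by p^n after base change.\<close>

lemma kap_B:
  assumes c: "c \<in> carrier A" and x: "A.fr c n \<in> BB"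
  shows "Bh.fr (b.kap (A.fr c n)) 0 = Bh.fr (b.kap (iA c)) n"
proof -
  have k: "b.kap (A.fr c n) \<in> carrier Bh" using ring_hom_closed[OF b.kap_hom, of "A.fr c n"] x by simp
  have "p [^] n \<odot>\<^bsub>A.BC\<^esub> A.fr c n = iA c"
    unfolding A.fr_smult[OF A.p_pow_K c] using A.fr_shift[OF c, of n 0] by simp
  then have "b.kap (iA c) = p [^] n \<odot>\<^bsub>Bh\<^esub> b.kap (A.fr c n)"
    using b.kap_smult[of "p [^] n" "A.fr c n"] A.p_pow_K x by simp
  then show ?thesis using Bh.fr_shift[OF k, of n 0] by simp
qed

text \<open>Two routes from \<open>B\<close> to the base change of its completion agree, although
  one of them passes through the completion of \<open>A\<close>. Both are determined by the
  numerator of x = c/p^n.\<close>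

lemma hj:
  assumes x: "x \<in> BB" shows "h.bcm (j.bcm x) = Bh.fr (b.kap x) 0"
proof -
  obtain c n where c: "c \<in> carrier A" "x = A.fr c n" using BBE[OF x] .
  have kc: "a.kap c \<in> carrier Ah" using ring_hom_closed[OF a.kap_hom c(1)] .
  have "h.bcm (j.bcm x) = Bh.fr (b.kap (iA c)) n"
    unfolding c(2) j.bcm_fr[OF c(1)] h.bcm_fr[OF kc] ab.cm_kap[OF c(1)] ..
  then show ?thesis using kap_B[OF c(1), of n] x unfolding c(2) by simp
qed

lemma filtered_B: "filtered_algebra A.Rg B F"
  by (intro filtered_algebra.intro B_assoc_algebra filtered_algebra_axioms.intro filt)

lemma Ah_approx:
  assumes "y \<in> carrier Ah"
  obtains c y' where "c \<in> carrier A" "y' \<in> carrier Ah" "y = a.kap c \<oplus>\<^bsub>Ah\<^esub> p [^] (n::nat) \<odot>\<^bsub>Ah\<^esub> y'"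
proof -
  obtain c y' where c: "c \<in> carrier A" "y' \<in> carrier Ah" "y \<ominus>\<^bsub>Ah\<^esub> a.kap c = a.pw n \<odot>\<^bsub>Ah\<^esub> y'"
    using a.kap_dense[OF assms] by blast
  have "y = a.kap c \<oplus>\<^bsub>Ah\<^esub> (y \<ominus>\<^bsub>Ah\<^esub> a.kap c)"
    using abelian_group.add_diff_cancel_left[OF a.Ac.abelian_group_axioms assms ring_hom_closed[OF a.kap_hom c(1)]] by simp
  then show thesis using that c A.K_pow by metis
qed

text \<open>With x = c/p^m in F n and y = e + p^m y', the product x y equals x e + c y'. Here x e
  lies in F n because e lies in F 0, and in the second summand the denominator has cancelled. The
  other order is symmetric.\<close>

lemma filtered_sum_comparison: "filtered_sum A.Rg B F D Ah j.bcm (\<lambda>a. Ah.fr a 0)"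
proof (rule filtered_sum.intro[OF filtered_B Ah.BC_ring a.Ac_ring filtered_sum_axioms.intro])
  interpret fB: filtered_algebra A.Rg B F by (rule filtered_B)
  show "j.bcm \<in> ring_hom B D"
    using j.bcm_ring_hom BB_carrier unfolding ring_hom_def by auto
  show "(\<lambda>a. Ah.fr a 0) \<in> ring_hom Ah D" by (rule Ah.fr0_hom)
  show "exhaustive B F" by (rule exh)
  show "j.bcm x \<in> (\<lambda>a. Ah.fr a 0) ` carrier Ah" if "x \<in> F 0" for x
    using that ring_hom_closed[OF a.kap_hom] unfolding F0 by (auto simp: j.bcm_fr)
  have kc: "a.kap c \<in> carrier Ah" if "c \<in> carrier A" for c using ring_hom_closed[OF a.kap_hom that] .
  have FB: "x \<in> BB" if "x \<in> F n" for x n using fB.F_carrier[OF that] by simp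
  fix n x y assume x: "x \<in> F n" and y: "y \<in> carrier Ah"
  obtain c m where c: "c \<in> carrier A" "x = A.fr c m" using BBE[OF FB[OF x]] .
  \<comment> \<open>The denominator p^m of \<open>x\<close> fixes the precision with which
    \<open>y\<close> is approximated from \<open>A\<close>.\<close>
  obtain e y' where e: "e \<in> carrier A" "y' \<in> carrier Ah" "y = a.kap e \<oplus>\<^bsub>Ah\<^esub> p [^] m \<odot>\<^bsub>Ah\<^esub> y'"
    using Ah_approx[OF y] .
  have ie: "iA e \<in> F 0" unfolding F0 using e(1) by blast
  have py: "p [^] m \<odot>\<^bsub>Ah\<^esub> y' \<in> carrier Ah" by (rule Ah.smult_closed[OF A.p_pow_K e(2)])
  have jx: "j.bcm x = Ah.fr (a.kap c) m" unfolding c(2) by (rule j.bcm_fr[OF c(1)])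
  have fry: "Ah.fr y 0 = Ah.fr (a.kap e) 0 \<oplus>\<^bsub>D\<^esub> Ah.fr (p [^] m \<odot>\<^bsub>Ah\<^esub> y') 0"
    unfolding e(3) by (rule Ah.fr_add[OF kc[OF e(1)] py, symmetric])
  note cl = Ah.fr_closed[OF kc[OF c(1)], of m] Ah.fr_closed[OF kc[OF e(1)], of 0] Ah.fr_closed[OF py, of 0]
  have r: "j.bcm x \<otimes>\<^bsub>D\<^esub> Ah.fr y 0 = j.bcm (x \<otimes>\<^bsub>B\<^esub> iA e) \<oplus>\<^bsub>D\<^esub> Ah.fr (a.kap c \<otimes>\<^bsub>Ah\<^esub> y') 0"
  proof -
    have "j.bcm x \<otimes>\<^bsub>D\<^esub> Ah.fr y 0 = Ah.fr (a.kap c) m \<otimes>\<^bsub>D\<^esub> Ah.fr (a.kap e) 0 \<oplus>\<^bsub>D\<^esub> Ah.fr (a.kap c) m \<otimes>\<^bsub>D\<^esub> Ah.fr (p [^] m \<odot>\<^bsub>Ah\<^esub> y') 0"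
      unfolding jx fry using cl by (rule Ah.BC.r_distr[rotated 2])
    also have "Ah.fr (a.kap c) m \<otimes>\<^bsub>D\<^esub> Ah.fr (a.kap e) 0 = j.bcm (x \<otimes>\<^bsub>B\<^esub> iA e)"
      using c e(1) ring_hom_mult[OF a.kap_hom c(1) e(1)] kc by (simp add: A.fr_mult j.bcm_fr Ah.fr_mult)
    also have "Ah.fr (a.kap c) m \<otimes>\<^bsub>D\<^esub> Ah.fr (p [^] m \<odot>\<^bsub>Ah\<^esub> y') 0 = Ah.fr (p [^] m \<odot>\<^bsub>Ah\<^esub> (a.kap c \<otimes>\<^bsub>Ah\<^esub> y')) (0 + m)"
      using kc[OF c(1)] e(2) py Ah.smult_mult_r[of "p [^] m" "a.kap c" y'] A.p_pow_K by (simp add: Ah.fr_mult)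
    also have "\<dots> = Ah.fr (a.kap c \<otimes>\<^bsub>Ah\<^esub> y') 0" using kc[OF c(1)] e(2) by (intro Ah.fr_shift) simp
    finally show ?thesis .
  qed
  show "\<exists>z\<in>F n. \<exists>t\<in>carrier Ah. j.bcm x \<otimes>\<^bsub>D\<^esub> Ah.fr y 0 = j.bcm z \<oplus>\<^bsub>D\<^esub> Ah.fr t 0"
    using r fB.F_mult[OF x ie] kc[OF c(1)] e(2) by (intro bexI[of _ "x \<otimes>\<^bsub>B\<^esub> iA e"] bexI[of _ "a.kap c \<otimes>\<^bsub>Ah\<^esub> y'"]) simp_all
  have l: "Ah.fr y 0 \<otimes>\<^bsub>D\<^esub> j.bcm x = j.bcm (iA e \<otimes>\<^bsub>B\<^esub> x) \<oplus>\<^bsub>D\<^esub> Ah.fr (y' \<otimes>\<^bsub>Ah\<^esub> a.kap c) 0"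
  proof -
    have "Ah.fr y 0 \<otimes>\<^bsub>D\<^esub> j.bcm x = Ah.fr (a.kap e) 0 \<otimes>\<^bsub>D\<^esub> Ah.fr (a.kap c) m \<oplus>\<^bsub>D\<^esub> Ah.fr (p [^] m \<odot>\<^bsub>Ah\<^esub> y') 0 \<otimes>\<^bsub>D\<^esub> Ah.fr (a.kap c) m"
      unfolding jx fry using cl(2,3,1) by (rule Ah.BC.l_distr)
    also have "Ah.fr (a.kap e) 0 \<otimes>\<^bsub>D\<^esub> Ah.fr (a.kap c) m = j.bcm (iA e \<otimes>\<^bsub>B\<^esub> x)"
      using c e(1) ring_hom_mult[OF a.kap_hom e(1) c(1)] kc by (simp add: A.fr_mult j.bcm_fr Ah.fr_mult)
    also have "Ah.fr (p [^] m \<odot>\<^bsub>Ah\<^esub> y') 0 \<otimes>\<^bsub>D\<^esub> Ah.fr (a.kap c) m = Ah.fr (p [^] m \<odot>\<^bsub>Ah\<^esub> (y' \<otimes>\<^bsub>Ah\<^esub> a.kap c)) (0 + m)"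
      using kc[OF c(1)] e(2) py Ah.smult_mult_l[of "p [^] m" y' "a.kap c"] A.p_pow_K by (simp add: Ah.fr_mult)
    also have "\<dots> = Ah.fr (y' \<otimes>\<^bsub>Ah\<^esub> a.kap c) 0" using kc[OF c(1)] e(2) by (intro Ah.fr_shift) simp
    finally show ?thesis .
  qed
  show "\<exists>z\<in>F n. \<exists>t\<in>carrier Ah. Ah.fr y 0 \<otimes>\<^bsub>D\<^esub> j.bcm x = j.bcm z \<oplus>\<^bsub>D\<^esub> Ah.fr t 0"
    using l fB.F_mult[OF ie x] kc[OF c(1)] e(2) by (intro bexI[of _ "iA e \<otimes>\<^bsub>B\<^esub> x"] bexI[of _ "y' \<otimes>\<^bsub>Ah\<^esub> a.kap c"]) simp_all
qed

interpretation S: filtered_sum A.Rg B F D Ah j.bcm "\<lambda>a. Ah.fr a 0"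
  by (rule filtered_sum_comparison)

section \<open>The ring \<open>C\<close> and its map to the completion of \<open>B\<close>\<close>

abbreviation "C \<equiv> S.C"

lemma accC: "acc_in D C"
  by (rule S.acc_in_C[OF gr_ring gr_acc accAh])

lemma CE:
  assumes "c \<in> C" obtains x y where "x \<in> BB" "y \<in> carrier Ah" "c = j.bcm x \<oplus>\<^bsub>D\<^esub> Ah.fr y 0"
  using assms unfolding S.C_def by auto

lemma CI: "x \<in> BB \<Longrightarrow> y \<in> carrier Ah \<Longrightarrow> j.bcm x \<oplus>\<^bsub>D\<^esub> Ah.fr y 0 \<in> C"
  unfolding S.C_def by auto

lemma kB: "x \<in> BB \<Longrightarrow> b.kap x \<in> carrier Bh"
  using ring_hom_closed[OF b.kap_hom, of x] by simp

lemma cmc: "y \<in> carrier Ah \<Longrightarrow> ab.cm y \<in> carrier Bh"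
  using ring_hom_closed[OF ab.cm_hom, of y] .

lemma jD: "x \<in> BB \<Longrightarrow> j.bcm x \<in> carrier D"
  using ring_hom_closed[OF j.bcm_ring_hom] BB_carrier by blast

lemma h_C:
  assumes x: "x \<in> BB" and y: "y \<in> carrier Ah"
  shows "h.bcm (j.bcm x \<oplus>\<^bsub>D\<^esub> Ah.fr y 0) = Bh.fr (b.kap x \<oplus>\<^bsub>Bh\<^esub> ab.cm y) 0"
  unfolding ring_hom_add[OF h.bcm_ring_hom jD[OF x] Ah.fr_closed[OF y]] hj[OF x] h.bcm_fr[OF y]
  by (rule Bh.fr_add[OF kB[OF x] cmc[OF y]])

text \<open>The restriction to \<^term>\<open>C\<close> of the map of base changes takes its values in \<^term>\<open>Bh\<close>.\<close>

definition f :: "(((nat \<Rightarrow> 'a set) \<times> 'l) \<Rightarrow>\<^sub>0 int) set \<Rightarrow> nat \<Rightarrow> ('a \<times> 'l \<Rightarrow>\<^sub>0 int) set set" where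
  "f c = inv_into (carrier Bh) (\<lambda>y. Bh.fr y 0) (h.bcm c)"

lemma f_eq:
  assumes x: "x \<in> BB" and y: "y \<in> carrier Ah"
  shows "f (j.bcm x \<oplus>\<^bsub>D\<^esub> Ah.fr y 0) = b.kap x \<oplus>\<^bsub>Bh\<^esub> ab.cm y"
  unfolding f_def h_C[OF x y] using kB[OF x] cmc[OF y] by (intro inv_into_f_f[OF Bh.fr0_inj]) simp

lemma f: "c \<in> C \<Longrightarrow> f c \<in> carrier Bh" "c \<in> C \<Longrightarrow> Bh.fr (f c) 0 = h.bcm c"
  by (auto elim!: CE simp: f_eq h_C kB cmc)

lemma C_carrier: "c \<in> C \<Longrightarrow> c \<in> carrier D"
  using subringE(1)[OF S.C_subring] by blast

text \<open>The identities are tested after the injection into the base change, where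
  \<open>f\<close> becomes the homomorphism \<open>h.bcm\<close>.\<close>

lemma f_hom: "f \<in> ring_hom (D\<lparr>carrier := C\<rparr>) Bh"
proof (rule ring_hom_memI)
  note inj = inj_onD[OF Bh.fr0_inj]
  show "f c \<in> carrier Bh" if "c \<in> carrier (D\<lparr>carrier := C\<rparr>)" for c using that f(1) by simp
  fix c d assume "c \<in> carrier (D\<lparr>carrier := C\<rparr>)" "d \<in> carrier (D\<lparr>carrier := C\<rparr>)"
  then have c: "c \<in> C" "d \<in> C" by auto
  note fc = f(1)[OF c(1)] f(1)[OF c(2)] and cD = C_carrier[OF c(1)] C_carrier[OF c(2)]
  have "Bh.fr (f (c \<otimes>\<^bsub>D\<^esub> d)) 0 = Bh.fr (f c \<otimes>\<^bsub>Bh\<^esub> f d) 0"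
    using f(2)[OF subringE(6)[OF S.C_subring c]] f(2)[OF c(1)] f(2)[OF c(2)] Bh.fr_mult[OF fc, of 0 0]
      ring_hom_mult[OF h.bcm_ring_hom cD] by simp
  then show "f (c \<otimes>\<^bsub>D\<lparr>carrier := C\<rparr>\<^esub> d) = f c \<otimes>\<^bsub>Bh\<^esub> f d"
    using f(1)[OF subringE(6)[OF S.C_subring c]] fc by (simp add: Bh.fr_eq_iff)
  have "Bh.fr (f (c \<oplus>\<^bsub>D\<^esub> d)) 0 = Bh.fr (f c \<oplus>\<^bsub>Bh\<^esub> f d) 0"
    using f(2)[OF subringE(7)[OF S.C_subring c]] f(2)[OF c(1)] f(2)[OF c(2)] Bh.fr_add[OF fc, of 0]
      ring_hom_add[OF h.bcm_ring_hom cD] by simp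
  then show "f (c \<oplus>\<^bsub>D\<lparr>carrier := C\<rparr>\<^esub> d) = f c \<oplus>\<^bsub>Bh\<^esub> f d"
    using f(1)[OF subringE(7)[OF S.C_subring c]] fc by (simp add: Bh.fr_eq_iff)
next
  have "Bh.fr (f \<one>\<^bsub>D\<^esub>) 0 = Bh.fr \<one>\<^bsub>Bh\<^esub> 0"
    using f(2)[OF subringE(3)[OF S.C_subring]] ring_hom_one[OF h.bcm_ring_hom] Bh.BC_one by simp
  then show "f \<one>\<^bsub>D\<lparr>carrier := C\<rparr>\<^esub> = \<one>\<^bsub>Bh\<^esub>"
    using f(1)[OF subringE(3)[OF S.C_subring]] by (simp add: Bh.fr_eq_iff)
qed

abbreviation "w \<equiv> Ah.p0"

lemma w_C: "w \<in> C"
  by (rule S.i_C[OF Ah.p1_closed])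

lemma h_w: "h.bcm w = Bh.p0"
  using h.bcm_fr[OF Ah.p1_closed, of 0] ab.cm_smult[of p "\<one>\<^bsub>Ah\<^esub>"] ring_hom_one[OF ab.cm_hom] A.L.p(1) by simp

lemma f_w: "f w = p \<odot>\<^bsub>Bh\<^esub> \<one>\<^bsub>Bh\<^esub>"
proof -
  have "Bh.fr (f w) 0 = Bh.p0" using f(2)[OF w_C] h_w by simp
  then show ?thesis using f(1)[OF w_C] Bh.p1_closed by (simp add: Bh.fr_eq_iff)
qed

lemma w_mult_C:
  assumes x: "x \<in> BB" and y: "y \<in> carrier Ah"
  shows "w \<otimes>\<^bsub>D\<^esub> (j.bcm x \<oplus>\<^bsub>D\<^esub> Ah.fr y 0) = j.bcm (p \<odot>\<^bsub>B\<^esub> x) \<oplus>\<^bsub>D\<^esub> Ah.fr (p \<odot>\<^bsub>Ah\<^esub> y) 0"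
proof -
  obtain c n where c: "c \<in> carrier A" "x = A.fr c n" using BBE[OF x] .
  have kc: "a.kap c \<in> carrier Ah" using ring_hom_closed[OF a.kap_hom c(1)] .
  have "w \<otimes>\<^bsub>D\<^esub> j.bcm x = j.bcm (p \<odot>\<^bsub>B\<^esub> x)"
    unfolding c(2) j.bcm_fr[OF c(1)] Ah.p0_mult(1)[OF kc]
    using A.L.p(1) c(1) a.kap_smult[of p c] A.smult_closed[OF A.L.p(1) c(1)] by (simp add: A.fr_smult j.bcm_fr)
  then show ?thesis
    using Ah.BC.r_distr[OF jD[OF x] Ah.fr_closed[OF y] Ah.p0_closed, of 0] Ah.p0_mult(1)[OF y, of 0] by simp
qed

text \<open>Density is provided by \<open>B\<close> alone. For \<open>reflect\<close>, an element x
  + z of \<open>C\<close> is rewritten as (x + e) + p z' with x + e in \<open>B\<close>;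
  divisibility of its image by \<open>p\<close> in the completion then descends to divisibility of x
  + e in \<open>B\<close>.\<close>

lemma approximation_C: "adic_approximation (D\<lparr>carrier := C\<rparr>) Bh f w"
proof -
  interpret CR: ring "D\<lparr>carrier := C\<rparr>" by (rule Ah.BC.subring_is_ring[OF S.C_subring])
  note ph = Bh.smult_one_pow[OF p_closed]
  have pB: "p [^]\<^bsub>A.Rg\<^esub> (1::nat) = p" using p_closed A.K_carrier by (simp add: A.K_pow)
  show ?thesis
  proof (rule adic_approximation.intro[OF ring_hom_ringI2[OF CR.ring_axioms b.Ac_ring f_hom] adic_approximation_axioms.intro],
      unfold f_w)
    show "w \<in> carrier (D\<lparr>carrier := C\<rparr>)" using w_C by simp
    show "c \<otimes>\<^bsub>D\<lparr>carrier := C\<rparr>\<^esub> w = w \<otimes>\<^bsub>D\<lparr>carrier := C\<rparr>\<^esub> c" if "c \<in> carrier (D\<lparr>carrier := C\<rparr>)" for c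
      using Ah.p0_central[OF C_carrier] that by simp
    show "x \<otimes>\<^bsub>Bh\<^esub> (p \<odot>\<^bsub>Bh\<^esub> \<one>\<^bsub>Bh\<^esub>) = p \<odot>\<^bsub>Bh\<^esub> \<one>\<^bsub>Bh\<^esub> \<otimes>\<^bsub>Bh\<^esub> x" if "x \<in> carrier Bh" for x
      using ph(2,3)[OF that] by simp
    show "x = \<zero>\<^bsub>Bh\<^esub>" if "x \<in> carrier Bh" "(p \<odot>\<^bsub>Bh\<^esub> \<one>\<^bsub>Bh\<^esub>) \<otimes>\<^bsub>Bh\<^esub> x = \<zero>\<^bsub>Bh\<^esub>" for x
      using b.Ac_torsion_free that ph(2)[OF that(1)] unfolding torsion_free_def by simp
    show "x = \<zero>\<^bsub>Bh\<^esub>" if "x \<in> carrier Bh" "\<And>n::nat. \<exists>y\<in>carrier Bh. x = (p \<odot>\<^bsub>Bh\<^esub> \<one>\<^bsub>Bh\<^esub>) [^]\<^bsub>Bh\<^esub> n \<otimes>\<^bsub>Bh\<^esub> y" for x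
      using b.Ac_separated[OF that(1)] that(2) ph(1) by metis
    show "\<exists>s\<in>carrier Bh. \<forall>n. \<exists>y\<in>carrier Bh. s \<ominus>\<^bsub>Bh\<^esub> t n = (p \<odot>\<^bsub>Bh\<^esub> \<one>\<^bsub>Bh\<^esub>) [^]\<^bsub>Bh\<^esub> n \<otimes>\<^bsub>Bh\<^esub> y"
      if t: "\<And>n. t n \<in> carrier Bh" "\<And>n::nat. \<exists>y\<in>carrier Bh. t (Suc n) \<ominus>\<^bsub>Bh\<^esub> t n = (p \<odot>\<^bsub>Bh\<^esub> \<one>\<^bsub>Bh\<^esub>) [^]\<^bsub>Bh\<^esub> n \<otimes>\<^bsub>Bh\<^esub> y" for t
    proof -
      have "\<exists>y\<in>carrier Bh. t (Suc n) \<ominus>\<^bsub>Bh\<^esub> t n = b.pw n \<odot>\<^bsub>Bh\<^esub> y" for n using t(2)[of n] ph(1) by metis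
      from b.Ac_complete[OF t(1) this] show ?thesis using ph(1) by metis
    qed
    show "\<exists>c\<in>carrier (D\<lparr>carrier := C\<rparr>). \<exists>y\<in>carrier Bh. x = f c \<oplus>\<^bsub>Bh\<^esub> (p \<odot>\<^bsub>Bh\<^esub> \<one>\<^bsub>Bh\<^esub>) \<otimes>\<^bsub>Bh\<^esub> y" if x: "x \<in> carrier Bh" for x
    proof -
      obtain c y where c: "c \<in> carrier B" "y \<in> carrier Bh" "x \<ominus>\<^bsub>Bh\<^esub> b.kap c = b.pw 1 \<odot>\<^bsub>Bh\<^esub> y" using b.kap_dense[OF x] by blast
      have cB: "c \<in> BB" using c(1) by simp
      \<comment> \<open>With the zero element of the completion of \<open>A\<close> as second
        summand, \<open>f\<close> restricts to the canonical map on \<open>B\<close>.\<close>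
      have fc: "f (j.bcm c \<oplus>\<^bsub>D\<^esub> Ah.fr \<zero>\<^bsub>Ah\<^esub> 0) = b.kap c"
        using f_eq[OF cB, of "\<zero>\<^bsub>Ah\<^esub>"] kB[OF cB] ring_hom_zero[OF ab.cm_hom a.Ac_ring b.Ac_ring] by simp
      have "x = b.kap c \<oplus>\<^bsub>Bh\<^esub> (x \<ominus>\<^bsub>Bh\<^esub> b.kap c)" 
        using abelian_group.add_diff_cancel_left[OF b.Ac.abelian_group_axioms x kB[OF cB]] by simp
      then have "x = f (j.bcm c \<oplus>\<^bsub>D\<^esub> Ah.fr \<zero>\<^bsub>Ah\<^esub> 0) \<oplus>\<^bsub>Bh\<^esub> (p \<odot>\<^bsub>Bh\<^esub> \<one>\<^bsub>Bh\<^esub>) \<otimes>\<^bsub>Bh\<^esub> y"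
        unfolding fc c(3) pB ph(2)[OF c(2)] .
      moreover have "j.bcm c \<oplus>\<^bsub>D\<^esub> Ah.fr \<zero>\<^bsub>Ah\<^esub> 0 \<in> carrier (D\<lparr>carrier := C\<rparr>)" using CI[OF cB a.Ac.zero_closed] by simp
      ultimately show ?thesis using c(2) by blast
    qed
    show "\<exists>c'\<in>carrier (D\<lparr>carrier := C\<rparr>). c = w \<otimes>\<^bsub>D\<lparr>carrier := C\<rparr>\<^esub> c'"
      if c: "c \<in> carrier (D\<lparr>carrier := C\<rparr>)" and y: "y \<in> carrier Bh" and fc: "f c = (p \<odot>\<^bsub>Bh\<^esub> \<one>\<^bsub>Bh\<^esub>) \<otimes>\<^bsub>Bh\<^esub> y" for c y
    proof -
      have cC: "c \<in> C" using c by simp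
      obtain x z where xz: "x \<in> BB" "z \<in> carrier Ah" "c = j.bcm x \<oplus>\<^bsub>D\<^esub> Ah.fr z 0" using cC by (rule CE)
      obtain e z' where e: "e \<in> carrier A" "z' \<in> carrier Ah" "z = a.kap e \<oplus>\<^bsub>Ah\<^esub> p [^] (1::nat) \<odot>\<^bsub>Ah\<^esub> z'"
        using Ah_approx[OF xz(2)] .
      have p1: "p [^] (1::nat) = p" using A.K_carrier[OF A.L.p(1)] by simp
      have pz: "p \<odot>\<^bsub>Ah\<^esub> z' \<in> carrier Ah" by (rule Ah.smult_closed[OF A.L.p(1) e(2)])
      have ke: "a.kap e \<in> carrier Ah" using ring_hom_closed[OF a.kap_hom e(1)] .
      have ie: "iA e \<in> BB" by (rule A_BB[OF e(1)])
      have xe: "x \<oplus>\<^bsub>A.BC\<^esub> iA e \<in> BB" using subringE(7)[OF BB_subring xz(1) ie] .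
      have cz: "ab.cm z = b.kap (iA e) \<oplus>\<^bsub>Bh\<^esub> p \<odot>\<^bsub>Bh\<^esub> ab.cm z'"
        unfolding e(3) p1 ring_hom_add[OF ab.cm_hom ke pz] ab.cm_kap[OF e(1)]
        using ab.cm_smult[OF p_closed e(2)] by simp
      have kx: "b.kap (x \<oplus>\<^bsub>A.BC\<^esub> iA e) = b.kap x \<oplus>\<^bsub>Bh\<^esub> b.kap (iA e)"
        using ring_hom_add[OF b.kap_hom, of x "iA e"] xz(1) ie by simp
      have cl: "b.kap x \<in> carrier Bh" "b.kap (iA e) \<in> carrier Bh" "p \<odot>\<^bsub>Bh\<^esub> ab.cm z' \<in> carrier Bh" "p \<odot>\<^bsub>Bh\<^esub> y \<in> carrier Bh"
        using kB xz(1) ie Bh.smult_closed[OF A.L.p(1)] cmc[OF e(2)] y by auto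
      have "b.kap x \<oplus>\<^bsub>Bh\<^esub> (b.kap (iA e) \<oplus>\<^bsub>Bh\<^esub> p \<odot>\<^bsub>Bh\<^esub> ab.cm z') = p \<odot>\<^bsub>Bh\<^esub> y"
        using f_eq[OF xz(1,2)] fc ph(2)[OF y] unfolding xz(3) cz by simp
      then have "b.kap (x \<oplus>\<^bsub>A.BC\<^esub> iA e) \<oplus>\<^bsub>Bh\<^esub> p \<odot>\<^bsub>Bh\<^esub> ab.cm z' = p \<odot>\<^bsub>Bh\<^esub> y"
        unfolding kx using cl by (simp add: b.Ac.a_assoc)
      then have "b.kap (x \<oplus>\<^bsub>A.BC\<^esub> iA e) = p \<odot>\<^bsub>Bh\<^esub> y \<ominus>\<^bsub>Bh\<^esub> p \<odot>\<^bsub>Bh\<^esub> ab.cm z'"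
        using cl kB[OF xe] by (metis b.Ac.add.inv_solve_right b.Ac.minus_eq)
      also have "\<dots> = b.pw 1 \<odot>\<^bsub>Bh\<^esub> (y \<ominus>\<^bsub>Bh\<^esub> ab.cm z')"
        unfolding pB using Bh.smult_diff[OF A.L.p(1) y cmc[OF e(2)]] by simp
      finally have "b.kap (x \<oplus>\<^bsub>A.BC\<^esub> iA e) = b.pw 1 \<odot>\<^bsub>Bh\<^esub> (y \<ominus>\<^bsub>Bh\<^esub> ab.cm z')" .
      \<comment> \<open>An element of \<open>B\<close> that becomes a multiple of \<open>p\<close>
        in the completion is one already in \<open>B\<close>.\<close>
      from b.kap_divisible[OF _ _ this] have "x \<oplus>\<^bsub>A.BC\<^esub> iA e \<in> b.P 1" using xe y cmc[OF e(2)] by simp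
      then obtain x' where x': "x' \<in> BB" "x \<oplus>\<^bsub>A.BC\<^esub> iA e = p \<odot>\<^bsub>B\<^esub> x'" unfolding b.P_iff pB by auto
      have "c = j.bcm x \<oplus>\<^bsub>D\<^esub> (j.bcm (iA e) \<oplus>\<^bsub>D\<^esub> Ah.fr (p \<odot>\<^bsub>Ah\<^esub> z') 0)"
        unfolding xz(3) e(3) p1 j.bcm_fr[OF e(1)] using Ah.fr_add[OF ke pz, of 0] by simp
      also have "\<dots> = j.bcm (x \<oplus>\<^bsub>A.BC\<^esub> iA e) \<oplus>\<^bsub>D\<^esub> Ah.fr (p \<odot>\<^bsub>Ah\<^esub> z') 0"
        unfolding ring_hom_add[OF j.bcm_ring_hom BB_carrier[OF xz(1)] BB_carrier[OF ie]]
        using jD[OF xz(1)] jD[OF ie] Ah.fr_closed[OF pz, of 0] by (simp add: Ah.BC.a_assoc)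
      also have "\<dots> = w \<otimes>\<^bsub>D\<^esub> (j.bcm x' \<oplus>\<^bsub>D\<^esub> Ah.fr z' 0)" unfolding x'(2) by (rule w_mult_C[OF x'(1) e(2), symmetric])
      finally show ?thesis using CI[OF x'(1) e(2)] by auto
    qed
    \<comment> \<open>The chain condition refers to a ring through its operations only, and these
      are the same for \<open>D\<close> and its restriction to \<open>C\<close>.\<close>
    show "acc_in (D\<lparr>carrier := C\<rparr>) (carrier (D\<lparr>carrier := C\<rparr>))"
      using accC by (simp add: acc_in_def left_ideal_in_def)
  qed
qed

lemma accE: "acc_in E (carrier E)"
proof -
  interpret adic_approximation "D\<lparr>carrier := C\<rparr>" Bh f w by (rule approximation_C)
  show ?thesis by (rule Bh.acc_in_BC[OF acc_in_S])
qed

lemma colon_flat_E: "colon_flat D E h.bcm"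
proof -
  interpret approx: adic_approximation "D\<lparr>carrier := C\<rparr>" Bh f w by (rule approximation_C)
  interpret flat_localisation D E h.bcm Bh "\<lambda>y. Bh.fr y 0" C f w "Ah.fr \<one>\<^bsub>Ah\<^esub> 1"
  proof (rule flat_localisation.intro[OF ring_hom_ringI2[OF Ah.BC_ring Bh.BC_ring h.bcm_ring_hom]
        ring_hom_ringI2[OF b.Ac_ring Bh.BC_ring Bh.fr0_hom] flat_localisation_axioms.intro], unfold h_w)
    \<comment> \<open>A power of \<open>w\<close> moves an element of \<open>D\<close> into the
      completion of \<open>A\<close>, which is contained in \<open>C\<close>.\<close>
    show "\<exists>n::nat. w [^]\<^bsub>D\<^esub> n \<otimes>\<^bsub>D\<^esub> d \<in> C" if "d \<in> carrier D" for d
      using Ah.p0_clear[OF that] S.i_C by metis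
    show "\<exists>n::nat. \<exists>y\<in>carrier Bh. Bh.p0 [^]\<^bsub>E\<^esub> n \<otimes>\<^bsub>E\<^esub> e = Bh.fr y 0" if "e \<in> carrier E" for e
      using Bh.p0_clear[OF that] .
    fix V s m assume "finite V" "V \<subseteq> C" "s \<in> C" "m \<in> carrier Bh" "m \<otimes>\<^bsub>Bh\<^esub> f s \<in> gen_left_ideal Bh (f ` V)"
    then show "m \<in> gen_left_ideal Bh (f ` {c \<in> C. c \<otimes>\<^bsub>D\<^esub> s \<in> gen_left_ideal (D\<lparr>carrier := C\<rparr>) V})"
      using approx.colon_flat_approximation[of V s m] by simp
  qed (rule S.C_subring w_C Ah.p0_unit Ah.p0_unit_closed Ah.p0_central Bh.p0_central f Bh.fr0_inj; assumption?)+
  show ?thesis by (rule colon_flat)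
qed

theorem comparison:
  "left_noetherian_ring D" "left_noetherian_ring E"
  "flat_right_module TYPE('n) D (right_module_via h.bcm E)"
proof -
  show "left_noetherian_ring D" unfolding Ah.BC.left_noetherian_iff_acc by (rule accD)
  show "left_noetherian_ring E" unfolding Bh.BC.left_noetherian_iff_acc by (rule accE)
  interpret colon_flat D E h.bcm by (rule colon_flat_E)
  show "flat_right_module TYPE('n) D (right_module_via h.bcm E)" by (rule flat)
qed

end

theorem proposition4p4:
  fixes L R :: "'l ring" and v :: "'l \<Rightarrow> int" and p q qd :: 'l and d :: nat
    and A :: "('l, 'a) module"
    and AL B :: "('l, ('a \<times> 'l \<Rightarrow>\<^sub>0 int) set) module"
    and BB :: "('a \<times> 'l \<Rightarrow>\<^sub>0 int) set set"
    and F :: "nat \<Rightarrow> ('a \<times> 'l \<Rightarrow>\<^sub>0 int) set set"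
  assumes "complete_discrete_valuation_field L v"
    and "R = val_ring L v"
    and "uniformizer L v p"
    and "d \<ge> 1" and "q \<in> Units R" and "\<forall>n::nat. n \<ge> 1 \<longrightarrow> q [^]\<^bsub>R\<^esub> n \<noteq> \<one>\<^bsub>R\<^esub>"
    and "qd \<in> carrier R" and "qd [^]\<^bsub>R\<^esub> d = q" and "qd \<ominus>\<^bsub>R\<^esub> \<one>\<^bsub>R\<^esub> \<in> PIdl\<^bsub>R\<^esub> p"
    and "assoc_algebra R A" and "left_noetherian_ring A"
    and "adically_separated R p A" and "torsion_free p A"
    and "AL = base_change R L A"
    and "R_subalgebra R AL BB" and "to_base_change R L A ` carrier A \<subseteq> BB"
    and "B = AL\<lparr>carrier := BB\<rparr>"
    and "algebra_filtration R B F" and "exhaustive B F"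
    and "F 0 = to_base_change R L A ` carrier A"
    and "q_commutative_algebra R qd (gr_zero B F) (gr B F)"
  shows "left_noetherian_ring (base_change R L (completion R p A)) \<and>
         left_noetherian_ring (base_change R L (completion R p B)) \<and>
         flat_right_module TYPE('n)
           (base_change R L (completion R p A))
           (right_module_via
              (base_change_map R L (completion R p B)
                 (completion_map R p B (to_base_change R L A)))
              (base_change R L (completion R p B)))"
proof -
  note L = assms(1) and R = assms(2)
  let ?K = "val_ball L v 0"
  have RK: "R = L\<lparr>carrier := ?K\<rparr>" unfolding R val_ring_def ..
  have den: "denominators L ?K p" by (rule denominators_uniformizer[OF L assms(3)])
  have bc: "base_change_algebra L ?K p A"
    using assms(10) den assms(13) unfolding RK
    by (intro base_change_algebra.intro base_change_algebra_axioms.intro)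
  interpret A: base_change_algebra L ?K p A by (rule bc)
  have iA: "to_base_change R L A = (\<lambda>a. A.fr a 0)"
    unfolding RK by (rule ext) (rule A.to_base_change_eq)
  have B: "B = A.BC\<lparr>carrier := BB\<rparr>" unfolding assms(17,14) RK ..
  have accA: "acc_in A (carrier A)" using assms(11) unfolding A.A.left_noetherian_iff_acc .
  have q: "q_commutative_algebra R qd (gr_zero B F) (gr B F)" by (rule assms(21))
  have gr: "assoc_algebra R (gr B F)" using q unfolding q_commutative_algebra_def by blast
  interpret gr: assoc_algebra R "gr B F" by (rule gr)
  \<comment> \<open>Since d >= 1, \<open>qd\<close> is a factor of the unit q = qd^d.\<close>
  have qd: "qd \<in> Units R"
  proof -
    obtain e where e: "d = Suc e" using assms(4) by (cases d) auto
    have "qd [^]\<^bsub>R\<^esub> e \<otimes>\<^bsub>R\<^esub> qd \<in> Units R" using assms(5,8) unfolding e by simp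
    then show ?thesis using gr.R.unit_factor[of qd "qd [^]\<^bsub>R\<^esub> e"] assms(7) by (simp add: gr.R.m_comm)
  qed
  have sub: "R_subalgebra A.Rg A.BC BB" using assms(15) unfolding assms(14) RK .
  have filt: "algebra_filtration A.Rg (A.BC\<lparr>carrier := BB\<rparr>) F" using assms(18) unfolding B RK .
  interpret F: filtered_algebra A.Rg "A.BC\<lparr>carrier := BB\<rparr>" F
    by (intro filtered_algebra.intro filtered_algebra_axioms.intro filt
        subalgebra_assoc_algebra[OF A.BC_assoc_algebra sub])
  have F0: "F 0 = (\<lambda>a. A.fr a 0) ` carrier A" using assms(20) unfolding iA .
  \<comment> \<open>F 0 is the image of \<open>A\<close> and inherits its chain condition, which
    passes on to the degree zero part of the graded algebra.\<close>
  have "acc_in (A.BC\<lparr>carrier := BB\<rparr>) (F 0)"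
    unfolding F0 by (rule acc_in_hom_image[OF accA]) (simp_all add: A.fr_add A.fr_mult A.BC_zero[of 0])
  from F.acc_in_gr_zero[OF this] have "acc_in (gr B F) (gr_zero B F)" unfolding B .
  from q_commutative_algebra_acc[OF q qd this] have grB: "acc_in (gr B F) (carrier (gr B F))" .
  interpret completion_comparison L ?K p A BB F
  proof (intro completion_comparison.intro bc completion_comparison_axioms.intro accA sub filt F0)
    show "A.fr a 0 \<in> BB" if "a \<in> carrier A" for a using assms(16) that unfolding iA by blast
    show "exhaustive (A.BC\<lparr>carrier := BB\<rparr>) F" using assms(19) unfolding B .
    show "ring (gr (A.BC\<lparr>carrier := BB\<rparr>) F)" using gr.A.ring_axioms unfolding B .
    show "acc_in (gr (A.BC\<lparr>carrier := BB\<rparr>) F) (carrier (gr (A.BC\<lparr>carrier := BB\<rparr>) F))"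
      using grB unfolding B .
  qed
  show ?thesis unfolding B iA using comparison unfolding RK by blast
qed

end
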